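(* Let $\Omega\subset\mathbb{R}^N$ be a smooth bounded domain with $0\in\Omega$, let $p\in(1,N)$, $q\in(p-1,p)$, and let $A$ and $B$ satisfy the structural assumptions listed in the context. Let $f\in L^1(\Omega)$ with $f\ge 0$. Then for every $\vartheta>0$ there exists a weak solution $u\in W_0^{1,p}(\Omega)$ of the problem $$-\operatorname{div}\left(A(|\nabla u|)\nabla u\right)+B(|\nabla u|)=\vartheta\frac{u^q}{|x|^p}+f \ \text{ in }\Omega,\qquad u\ge 0\ \text{ in }\Omega,\qquad u=0\ \text{ on }\partial\Omega,$$ that is, there is $u\in W_0^{1,p}(\Omega)$ with $u\ge 0$ a.e. in $\Omega$ such that $$\int_\Omega A(|\nabla u|)(\nabla u,\nabla\varphi)\,dx+\int_\Omega B(|\nabla u|)\varphi\,dx=\vartheta\int_\Omega\frac{u^q}{|x|^p}\varphi\,dx+\int_\Omega f\varphi\,dx\qquad\forall\varphi\in W_0^{1,p}(\Omega)\cap L^\infty(\Omega).$$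
   Context: Notation: $\mathbb{R}^+=(0,+\infty)$, $\overline{\mathbb{R}}^+=[0,+\infty)$; $(\cdot,\cdot)$ is the Euclidean scalar product. Assumptions on $A$: $A:\mathbb{R}^+\to\mathbb{R}^+$ is of class $C^1(\mathbb{R}^+)$ (with the convention that $A(|\eta|)\eta=0$ when $\eta=0$), and there are constants $K\ge 1$, $c_1,c_2>0$ such that: (i) $t\mapsto tA(t)$ is increasing; (ii) $|A(|\eta|)\eta|\le c_1|\eta|^{p-1}$ for all $\eta\in\mathbb{R}^N$ with $|\eta|\ge K$; (iii) $[A(|\eta|)\eta-A(|\eta'|)\eta']\cdot[\eta-\eta']\ge c_2(|\eta|+|\eta'|)^{p-2}|\eta-\eta'|^2$ for all $\eta,\eta'\in\mathbb{R}^N$ (not both zero). Assumptions on $B$: $B:\overline{\mathbb{R}}^+\to\overline{\mathbb{R}}^+$ is of class $C^1(\overline{\mathbb{R}}^+)$, $B(0)=0$, $B(t)\ge\sigma t^p$ for all $t\geq 0$ for some $\sigma>0$, and $B'(t)\le\hat C\,tA(t)$ for all $t>0$ for some $\hat C>0$.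
   Formalization: The convention A(|η|)η=0 at η=0 is read as a continuous extension, i.e. tA(t)→0 as t→0+ is assumed; without it existence fails, e.g. p=2, A(t)=1+1/t, B(t)=t², f a small positive constant and ϑ small. *)

theory Defs
  imports "HOL-Analysis.Analysis"
begin

definition partial_deriv :: "'n::finite \<Rightarrow> (real^'n \<Rightarrow> real) \<Rightarrow> real^'n \<Rightarrow> real" where
  "partial_deriv i f x = frechet_derivative f (at x) (axis i 1)"

definition grad :: "(real^'n::finite \<Rightarrow> real) \<Rightarrow> real^'n \<Rightarrow> real^'n" where
  "grad f x = (\<chi> i. partial_deriv i f x)"

primrec Ck :: "nat \<Rightarrow> (real^'n::finite \<Rightarrow> real) \<Rightarrow> bool" where
  "Ck 0 f \<longleftrightarrow> continuous_on UNIV f"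
| "Ck (Suc k) f \<longleftrightarrow> (\<forall>x. f differentiable (at x)) \<and> (\<forall>i. Ck k (partial_deriv i f))"

definition smooth :: "(real^'n::finite \<Rightarrow> real) \<Rightarrow> bool" where
  "smooth f \<longleftrightarrow> (\<forall>k. Ck k f)"

text \<open>
  The boundary is locally a smooth graph over the hyperplane orthogonal to some coordinate axis
  \<open>i\<close>, with the domain on one side of it. The graph function of the remaining
  coordinates is encoded as a function on the whole space that is constant along \<open>axis i 1\<close>;
  the sign \<open>s\<close> is the orientation of the axis.
\<close>

definition smooth_boundary :: "(real^'n::finite) set \<Rightarrow> bool" where
  "smooth_boundary \<Omega> \<longleftrightarrow>
    (\<forall>x0 \<in> frontier \<Omega>. \<exists>r > 0. \<exists>i. \<exists>s \<in> {-1, 1}. \<exists>\<gamma>.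
      smooth \<gamma> \<and> (\<forall>x t. \<gamma> (x + t *\<^sub>R axis i 1) = \<gamma> x) \<and>
      \<Omega> \<inter> ball x0 r = {x \<in> ball x0 r. s * x $ i > \<gamma> x})"

definition smooth_bounded_domain :: "(real^'n::finite) set \<Rightarrow> bool" where
  "smooth_bounded_domain \<Omega> \<longleftrightarrow>
    open \<Omega> \<and> connected \<Omega> \<and> \<Omega> \<noteq> {} \<and> bounded \<Omega> \<and> smooth_boundary \<Omega>"

definition test_functions :: "(real^'n::finite) set \<Rightarrow> (real^'n \<Rightarrow> real) set" where
  "test_functions \<Omega> = {\<phi>. smooth \<phi> \<and> compact (closure {x. \<phi> x \<noteq> 0}) \<and> closure {x. \<phi> x \<noteq> 0} \<subseteq> \<Omega>}"

text \<open>
  Functions on \<open>\<Omega>\<close> are represented by total functions whose values outside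
  \<open>\<Omega>\<close> are irrelevant; classes modulo null sets are not formed.
\<close>

definition Lp :: "real \<Rightarrow> (real^'n::finite) set \<Rightarrow> (real^'n \<Rightarrow> 'b::euclidean_space) set" where
  "Lp p \<Omega> = {f \<in> borel_measurable (lebesgue_on \<Omega>).
               integrable (lebesgue_on \<Omega>) (\<lambda>x. norm (f x) powr p)}"

definition Linfty :: "(real^'n::finite) set \<Rightarrow> (real^'n \<Rightarrow> real) set" where
  "Linfty \<Omega> = {f \<in> borel_measurable (lebesgue_on \<Omega>). \<exists>C. AE x in lebesgue_on \<Omega>. \<bar>f x\<bar> \<le> C}"

definition locally_integrable :: "(real^'n::finite) set \<Rightarrow> (real^'n \<Rightarrow> 'b::euclidean_space) \<Rightarrow> bool" where
  "locally_integrable \<Omega> f \<longleftrightarrow> (\<forall>K. compact K \<and> K \<subseteq> \<Omega> \<longrightarrow> integrable (lebesgue_on K) f)"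

definition has_weak_gradient ::
    "(real^'n::finite) set \<Rightarrow> (real^'n \<Rightarrow> real) \<Rightarrow> (real^'n \<Rightarrow> real^'n) \<Rightarrow> bool" where
  "has_weak_gradient \<Omega> u Du \<longleftrightarrow>
    locally_integrable \<Omega> u \<and> locally_integrable \<Omega> Du \<and>
    (\<forall>\<phi> \<in> test_functions \<Omega>. \<forall>i.
      (LINT x|lebesgue_on \<Omega>. u x * partial_deriv i \<phi> x) = - (LINT x|lebesgue_on \<Omega>. Du x $ i * \<phi> x))"

definition W1p :: "real \<Rightarrow> (real^'n::finite) set \<Rightarrow> (real^'n \<Rightarrow> real) set" where
  "W1p p \<Omega> = {u \<in> Lp p \<Omega>. \<exists>Du \<in> Lp p \<Omega>. has_weak_gradient \<Omega> u Du}"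

text \<open>The closure of the test functions in the norm of \<open>W1p p \<Omega>\<close>.\<close>

definition W01p :: "real \<Rightarrow> (real^'n::finite) set \<Rightarrow> (real^'n \<Rightarrow> real) set" where
  "W01p p \<Omega> = {u \<in> W1p p \<Omega>. \<exists>Du \<in> Lp p \<Omega>. has_weak_gradient \<Omega> u Du \<and>
     (\<exists>\<phi> :: nat \<Rightarrow> real^'n \<Rightarrow> real. (\<forall>k. \<phi> k \<in> test_functions \<Omega>) \<and>
        (\<lambda>k. LINT x|lebesgue_on \<Omega>. \<bar>\<phi> k x - u x\<bar> powr p) \<longlonglongrightarrow> 0 \<and>
        (\<lambda>k. LINT x|lebesgue_on \<Omega>. norm (grad (\<phi> k) x - Du x) powr p) \<longlonglongrightarrow> 0)}"

text \<open>
  \<open>A\<close> is only given on the positive reals; the vector field is set to \<open>0\<close> at the origin.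
  This convention is meant as a continuous extension, so the theorem assumes \<open>isCont (flux A) 0\<close>,
  i.e. that \<open>t * A t\<close> tends to \<open>0\<close> as \<open>t\<close> tends to \<open>0\<close> from the right. Existence fails without it:
  take \<open>p = 2\<close>, \<open>A t = 1 + 1 / t\<close>, \<open>B t = t\<^sup>2\<close>, \<open>f\<close> a small positive constant and \<open>\<theta>\<close> small.
\<close>

definition flux :: "(real \<Rightarrow> real) \<Rightarrow> real^'n::finite \<Rightarrow> real^'n" where
  "flux A \<eta> = (if \<eta> = 0 then 0 else A (norm \<eta>) *\<^sub>R \<eta>)"

text \<open>
  Weak gradients are unique up to null sets, so the choice of \<open>Du\<close> and \<open>D\<phi>\<close> below is immaterial.
  The integrability conditions are stated because the Bochner integral of a
  non-integrable function is \<open>0\<close> by convention.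
\<close>

definition weak_solution ::
    "real \<Rightarrow> real \<Rightarrow> real \<Rightarrow> (real^'n::finite) set \<Rightarrow> (real \<Rightarrow> real) \<Rightarrow> (real \<Rightarrow> real) \<Rightarrow>
     (real^'n \<Rightarrow> real) \<Rightarrow> (real^'n \<Rightarrow> real) \<Rightarrow> bool" where
  "weak_solution p q \<theta> \<Omega> A B f u \<longleftrightarrow>
    u \<in> W01p p \<Omega> \<and> (AE x in lebesgue_on \<Omega>. u x \<ge> 0) \<and>
    (\<exists>Du. has_weak_gradient \<Omega> u Du \<and>
      (\<forall>\<phi> \<in> W01p p \<Omega> \<inter> Linfty \<Omega>. \<forall>D\<phi>. has_weak_gradient \<Omega> \<phi> D\<phi> \<longrightarrow>
        integrable (lebesgue_on \<Omega>) (\<lambda>x. flux A (Du x) \<bullet> D\<phi> x) \<and>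
        integrable (lebesgue_on \<Omega>) (\<lambda>x. B (norm (Du x)) * \<phi> x) \<and>
        integrable (lebesgue_on \<Omega>) (\<lambda>x. u x powr q / norm x powr p * \<phi> x) \<and>
        integrable (lebesgue_on \<Omega>) (\<lambda>x. f x * \<phi> x) \<and>
        (LINT x|lebesgue_on \<Omega>. flux A (Du x) \<bullet> D\<phi> x) +
        (LINT x|lebesgue_on \<Omega>. B (norm (Du x)) * \<phi> x) =
        \<theta> * (LINT x|lebesgue_on \<Omega>. u x powr q / norm x powr p * \<phi> x) +
        (LINT x|lebesgue_on \<Omega>. f x * \<phi> x)))"

end

theory Submission
 imports Defs "HOL-Complex_Analysis.Great_Picard"
begin

(* The problem is regularised twice. With the right-hand side truncated at height n and the
gradient term truncated at height m, the problem is a fixed point of the solution map of the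
strictly monotone operator, which exists by minimisation of its convex potential and Schauder's
argument. As m tends to infinity the energy stays bounded because the gradient term has a good
sign. As n tends to infinity, the test function arctan u yields the a priori estimate: the
gradient term B(|Du|) >= sigma |Du|^p absorbs u^q / |x|^p by Hardy's inequality, because q < p.
In both limits gradients converge almost everywhere (Boccardo and Murat), and the limit equation
follows from Fatou's lemma applied with exponential weights that use B(|Du|) <= C A(|Du|) |Du|^2. *)

text \<open>The two truncations cannot be removed together. Testing with arctan u needs the full
  lower bound sigma |Du|^p of the gradient term, which is lost once that term is cut at height m. So
  m goes first, while the right-hand side is bounded by n and testing with u bounds the energy. The
  main obstacle is that the gradient term grows like the energy density: it is bounded in L^1, but
  weak convergence of gradients does not determine its limit. Almost everywhere convergence does,
  and the exponential weights give the inequality that plain Fatou misses. The size of theta is free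
  because s^q <= d s^p + K for every d > 0, so Hardy's constant is multiplied by a number as small
  as needed. Weak limits do not come from reflexivity: ellipticity makes the potential uniformly
  convex, and minimising it over decreasing convex sets yields strongly convergent sequences.
  Sobolev functions are pairs (u, D) in the closure of test functions with their gradients, and
  Hoelder's inequality is replaced by the splitting y^(p-1) z <= d y^p + d^(1-p) z^p.\<close>

text \<open>The Henstock--Kurzweil versions of these facts would otherwise take precedence.\<close>

lemmas integrable_add = Bochner_Integration.integrable_add
  and integrable_bound = Bochner_Integration.integrable_bound
  and integrable_diff = Bochner_Integration.integrable_diff
  and integrable_minus = Bochner_Integration.integrable_minus
  and integrable_sum = Bochner_Integration.integrable_sum
  and integral_add = Bochner_Integration.integral_add
  and integral_cong = Bochner_Integration.integral_cong
  and integral_diff = Bochner_Integration.integral_diff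
  and integral_nonneg = Bochner_Integration.integral_nonneg
  and integral_norm_bound_integral = Bochner_Integration.integral_norm_bound_integral
  and integral_sum = Bochner_Integration.integral_sum

section \<open>Smooth functions\<close>

lemma partial_deriv_eq:
 assumes "(f has_derivative f') (at x)"
 shows "partial_deriv i f x = f' (axis i 1)"
 using frechet_derivative_at[OF assms] by (simp add: partial_deriv_def)

lemma grad_inner:
 fixes f :: "real^'n::finite => real"
 assumes "(f has_derivative f') (at x)"
 shows "f' h = grad f x \<bullet> h"
proof -
 interpret bounded_linear f' using assms by (rule has_derivative_bounded_linear)
 have "f' h = f' (\<Sum>i\<in>UNIV. h $ i *\<^sub>R axis i 1)"
  using basis_expansion[of h] by (simp add: scalar_mult_eq_scaleR)
 also have "... = (\<Sum>i\<in>UNIV. h $ i * f' (axis i 1))"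
  by (simp add: sum scaleR)
 also have "... = grad f x \<bullet> h"
  by (simp add: grad_def inner_vec_def partial_deriv_eq[OF assms] mult.commute)
 finally show ?thesis .
qed

lemma grad_eqI:
 fixes f :: "real^'n::finite => real"
 assumes "(f has_derivative (%h. v \<bullet> h)) (at x)"
 shows "grad f x = v"
 by (simp add: vec_eq_iff grad_def partial_deriv_eq[OF assms] inner_axis)

lemma has_derivative_grad:
 fixes f :: "real^'n::finite => real"
 assumes "f differentiable (at x)"
 shows "(f has_derivative (%h. grad f x \<bullet> h)) (at x)"
proof -
 obtain f' where f': "(f has_derivative f') (at x)"
  using assms by (auto simp: differentiable_def)
 moreover have "f' = (%h. grad f x \<bullet> h)"
  using grad_inner[OF f'] by blast
 ultimately show ?thesis by simp
qed

lemma partial_deriv_grad: "partial_deriv i f x = grad f x $ i"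
 by (simp add: grad_def)

lemma Ck_Suc_imp: "Ck (Suc k) f ==> Ck k f"
proof (induction k arbitrary: f)
 case 0
 then show ?case
  by (auto intro!: continuous_at_imp_continuous_on differentiable_imp_continuous_within)
qed auto

lemma Ck_const: "Ck k (%x. c)"
proof (induction k arbitrary: c)
 case (Suc k)
 have "partial_deriv i (%x. c) = (%x. 0)" for i :: 'a
  by (rule ext, subst partial_deriv_eq[of _ "%_. 0"]) auto
 then show ?case using Suc[of 0] by auto
qed auto

lemma partial_deriv_add:
 assumes "f differentiable (at x)" "g differentiable (at x)"
 shows "partial_deriv i (%x. f x + g x) x = partial_deriv i f x + partial_deriv i g x"
proof -
 have "((%x. f x + g x) has_derivative (%h. grad f x \<bullet> h + grad g x \<bullet> h)) (at x)"
  by (intro has_derivative_add has_derivative_grad assms)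
 from partial_deriv_eq[OF this] show ?thesis by (simp add: grad_def inner_axis)
qed
lemma Ck_add: "Ck k f ==> Ck k g ==> Ck k (%x. f x + g x)"
proof (induction k arbitrary: f g)
 case 0 then show ?case by (simp add: continuous_on_add)
next
 case (Suc k)
 have d: "f differentiable (at x)" "g differentiable (at x)" for x
  using Suc.prems by simp_all
 have e: "partial_deriv i (%x. f x + g x) = (%x. partial_deriv i f x + partial_deriv i g x)" for i
  by (rule ext) (simp add: partial_deriv_add d)
 have "Ck k (%x. partial_deriv i f x + partial_deriv i g x)" for i
  by (rule Suc.IH) (use Suc.prems in simp_all)
 then show ?case using d by (simp add: e)
qed

lemma partial_deriv_mult:
 assumes "f differentiable (at x)" "g differentiable (at x)"
 shows "partial_deriv i (%x. f x * g x) x = f x * partial_deriv i g x + partial_deriv i f x * g x"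
proof -
 have "((%x. f x * g x) has_derivative (%h. f x * (grad g x \<bullet> h) + (grad f x \<bullet> h) * g x)) (at x)"
  by (intro has_derivative_mult has_derivative_grad assms)
 from partial_deriv_eq[OF this] show ?thesis by (simp add: grad_def inner_axis)
qed
lemma Ck_mult: "Ck k f ==> Ck k g ==> Ck k (%x. f x * g x)"
proof (induction k arbitrary: f g)
 case 0 then show ?case by (simp add: continuous_on_mult)
next
 case (Suc k)
 have d: "f differentiable (at x)" "g differentiable (at x)" for x
  using Suc.prems by simp_all
 have e: "partial_deriv i (%x. f x * g x) = (%x. f x * partial_deriv i g x + partial_deriv i f x * g x)" for i
  by (rule ext) (simp add: partial_deriv_mult d)
 have "Ck k (%x. f x * partial_deriv i g x + partial_deriv i f x * g x)" for i
  using Suc.prems Suc.prems[THEN Ck_Suc_imp] by (intro Ck_add Suc.IH) simp_all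
 then show ?case using d by (simp add: e)
qed

lemma smooth_const: "smooth (%x. c)"
 and smooth_add: "smooth f ==> smooth g ==> smooth (%x. f x + g x)"
 and smooth_mult: "smooth f ==> smooth g ==> smooth (%x. f x * g x)"
 by (simp_all add: smooth_def Ck_const Ck_add Ck_mult)

lemma smooth_power: "smooth f ==> smooth (%x. f x ^ n)"
 by (induction n) (auto intro: smooth_const smooth_mult)

lemma smooth_sum: "finite S ==> (!!i. i \<in> S ==> smooth (f i)) ==> smooth (%x. \<Sum>i\<in>S. f i x)"
 by (induction S rule: finite_induct) (auto intro: smooth_const smooth_add)

lemma smooth_prod: "finite S ==> (!!i. i \<in> S ==> smooth (f i)) ==> smooth (%x. \<Prod>i\<in>S. f i x)"
 by (induction S rule: finite_induct) (auto intro: smooth_const smooth_mult)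

lemma smooth_Ck: "smooth f ==> Ck k f"
 by (simp add: smooth_def)

lemma smooth_differentiable: "smooth f ==> f differentiable (at x)"
 using smooth_Ck[of f "Suc 0"] by simp

lemma smooth_continuous: "smooth f ==> continuous_on S f"
 using smooth_Ck[of f 0] by (auto intro: continuous_on_subset)

lemma smooth_partial_deriv:
 assumes "smooth f" shows "smooth (partial_deriv i f)"
 unfolding smooth_def
proof
 show "Ck k (partial_deriv i f)" for k
  using smooth_Ck[OF assms, of "Suc k"] by simp
qed

lemma smooth_grad_continuous: "smooth f ==> continuous_on S (grad f)"
 unfolding grad_def
 by (intro continuous_on_vec_lambda smooth_continuous smooth_partial_deriv)

lemma smooth_has_derivative:
 "smooth f ==> (f has_derivative (%h. grad f x \<bullet> h)) (at x)"
 by (intro has_derivative_grad smooth_differentiable)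

lemma tendsto_poly_exp_minus: "((%y. poly p y * exp (- y :: real)) \<longlongrightarrow> 0) at_top"
proof -
 have "((%y. \<Sum>i\<le>degree p. coeff p i * (y ^ i / exp y)) \<longlongrightarrow> (\<Sum>i\<le>degree p. coeff p i * 0)) at_top"
  by (intro tendsto_sum tendsto_mult tendsto_const tendsto_power_div_exp_0)
 moreover have "(%y. \<Sum>i\<le>degree p. coeff p i * (y ^ i / exp y)) = (%y. poly p y * exp (- y))"
  by (simp add: poly_altdef sum_distrib_right exp_minus divide_inverse mult.assoc)
 ultimately show ?thesis by simp
qed

text \<open>The functions p(1/t) exp(-1/t), extended by 0, are closed under differentiation: the
  derivative belongs to the polynomial X^2 (p - p'). Carrying an arbitrary \<open>p\<close> turns
  smoothness of exp(-1/t) into an induction on the order in \<open>Ck_flat_bump\<close>.\<close>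

definition flat_bump :: "real poly => real => real" where
 "flat_bump p t = (if t > 0 then poly p (1 / t) * exp (- (1 / t)) else 0)"

lemma has_derivative_flat_bump:
 "(flat_bump p has_real_derivative flat_bump ([:0, 0, 1:] * (p - pderiv p)) t) (at t)"
proof -
 consider "t < 0" | "t = 0" | "t > 0" by linarith
 then show ?thesis
 proof cases
  case 1
  have "((%_. 0) has_real_derivative 0) (at t)" by simp
  moreover have "\<forall>\<^sub>F x in nhds t. 0 = flat_bump p x"
   using eventually_nhds_in_open[of "{..<0}" t] 1
   by (auto elim!: eventually_mono simp: flat_bump_def)
  ultimately have "(flat_bump p has_real_derivative 0) (at t)"
   using DERIV_cong_ev[of t t "%_. 0" "flat_bump p" 0 0] by auto
  then show ?thesis using 1 by (simp add: flat_bump_def)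
 next
  case 2
  \<comment> \<open>The right difference quotient at 0 is p(1/h) (1/h) exp(-1/h), so with y = 1/h
    the polynomial X p, written \<open>pCons 0 p\<close>, appears.\<close>
  have "((%y. poly (pCons 0 p) y * exp (- y)) \<longlongrightarrow> 0) at_top"
   by (rule tendsto_poly_exp_minus)
  then have "((%x. poly (pCons 0 p) (inverse x) * exp (- (inverse x))) \<longlongrightarrow> 0) (at_right 0)"
   by (rule filterlim_compose[OF _ filterlim_inverse_at_top_right])
  moreover have "\<forall>\<^sub>F x in at_right (0::real). x > 0"
   by (simp add: eventually_at_filter)
  ultimately have r: "((%x. flat_bump p x / x) \<longlongrightarrow> 0) (at_right 0)"
   by (elim Lim_transform_eventually, auto elim!: eventually_mono simp: flat_bump_def field_simps)
  have "\<forall>\<^sub>F x in at_left (0::real). 0 = flat_bump p x / x"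
   by (auto simp: eventually_at_filter flat_bump_def)
  then have l: "((%x. flat_bump p x / x) \<longlongrightarrow> 0) (at_left 0)"
   by (rule Lim_transform_eventually[rotated]) simp
  have "((%x. flat_bump p x / x) \<longlongrightarrow> 0) (at 0)"
   using l r by (simp add: filterlim_split_at)
  then show ?thesis using 2
   by (simp add: has_field_derivative_iff flat_bump_def)
 next
  case 3
  have "((%x. poly p (1 / x) * exp (- (1 / x))) has_real_derivative
    flat_bump ([:0, 0, 1:] * (p - pderiv p)) t) (at t)"
  proof (rule DERIV_cong)
   have "((%x. 1 / x) has_real_derivative - (1 / t\<^sup>2)) (at t)"
    using 3 by (auto intro!: derivative_eq_intros simp: power2_eq_square)
   then show "((%x. poly p (1 / x) * exp (- (1 / x))) has_real_derivative
     poly (pderiv p) (1 / t) * (- (1 / t\<^sup>2)) * exp (- (1 / t)) +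
     (exp (- (1 / t)) * - (- (1 / t\<^sup>2))) * poly p (1 / t)) (at t)"
    by (intro DERIV_mult DERIV_chain2[OF poly_DERIV] DERIV_chain2[OF DERIV_exp] DERIV_minus)
  qed (use 3 in \<open>simp add: flat_bump_def algebra_simps power2_eq_square\<close>)
  moreover have "\<forall>\<^sub>F x in nhds t. poly p (1 / x) * exp (- (1 / x)) = flat_bump p x"
   using eventually_nhds_in_open[of "{0<..}" t] 3
   by (auto elim!: eventually_mono simp: flat_bump_def)
  ultimately show ?thesis
   using DERIV_cong_ev[of t t "%x. poly p (1 / x) * exp (- (1 / x))" "flat_bump p"
    "flat_bump ([:0, 0, 1:] * (p - pderiv p)) t"  "flat_bump ([:0, 0, 1:] * (p - pderiv p)) t"] by auto
 qed
qed

lemma Ck_flat_bump: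
 fixes i :: "'n::finite"
 shows "Ck k (%x::real^'n. flat_bump p (c * x $ i + d))"
proof (induction k arbitrary: p)
 case 0
 have "continuous_on UNIV (flat_bump p)"
  using has_derivative_flat_bump DERIV_isCont by (blast intro: continuous_at_imp_continuous_on)
 then show ?case
  by (auto intro!: continuous_intros continuous_on_compose2[of UNIV "flat_bump p"])
next
 case (Suc k)
 let ?q = "[:0, 0, 1:] * (p - pderiv p)"
 have D: "((%x::real^'n. flat_bump p (c * x $ i + d)) has_derivative
   (%h. (flat_bump ?q (c * x $ i + d)) * (c * h $ i))) (at x)" for x
  by (rule has_derivative_compose[where g="flat_bump p" and g'="%h. flat_bump ?q (c * x $ i + d) * h",
     unfolded o_def])
   (auto intro!: derivative_eq_intros has_derivative_flat_bump[unfolded has_field_derivative_def, simplified]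
     bounded_linear.has_derivative[OF bounded_linear_vec_nth])
 have "partial_deriv j (%x::real^'n. flat_bump p (c * x $ i + d))
   = (%x. (if i = j then c else 0) * flat_bump ?q (c * x $ i + d))" for j
  by (rule ext, subst partial_deriv_eq[OF D]) (auto simp: axis_def)
 moreover have "Ck k (%x::real^'n. (if i = j then c else 0) * flat_bump ?q (c * x $ i + d))" for j
  by (intro Ck_mult Ck_const Suc)
 ultimately show ?case using D by (auto simp: differentiable_def)
qed

section \<open>Test functions\<close>

lemma test_functionsI:
 fixes \<Omega> :: "(real^'n::finite) set"
 assumes "smooth \<phi>" "compact K" "K \<subseteq> \<Omega>" "!!x. x \<notin> K ==> \<phi> x = 0"
 shows "\<phi> \<in> test_functions \<Omega>"
proof -
 have "closure {x. \<phi> x \<noteq> 0} \<subseteq> K"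
  using assms by (intro closure_minimal) (auto intro: compact_imp_closed)
 moreover from this have "compact (closure {x. \<phi> x \<noteq> 0})"
  using compact_Int_closed[OF assms(2), of "closure {x. \<phi> x \<noteq> 0}"] by (simp add: Int_absorb1)
 ultimately show ?thesis
  using assms(1,3) unfolding test_functions_def by blast
qed

lemma test_functions_support:
 fixes \<Omega> :: "(real^'n::finite) set"
 assumes "\<phi> \<in> test_functions \<Omega>"
 shows "\<exists>K. compact K \<and> K \<subseteq> \<Omega> \<and> (\<forall>x. x \<notin> K \<longrightarrow> \<phi> x = 0 \<and> grad \<phi> x = 0)"
proof -
 define K where "K = closure {x. \<phi> x \<noteq> 0}"
 have "grad \<phi> x = 0" if "x \<notin> K" for x
 proof -
  have "((%_. 0) has_derivative (%h. 0 \<bullet> h)) (at x)" by simp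
  moreover have "open (- K)" by (auto simp: K_def intro: open_Compl)
  ultimately have "(\<phi> has_derivative (%h. 0 \<bullet> h)) (at x)"
   using that by (elim has_derivative_transform_within_open[of _ _ _ _ "-K"])
    (use closure_subset[of "{x. \<phi> x \<noteq> 0}"] in \<open>auto simp: K_def\<close>)
  then show ?thesis by (rule grad_eqI)
 qed
 moreover have "\<phi> x = 0" if "x \<notin> K" for x
  using that closure_subset[of "{x. \<phi> x \<noteq> 0}"] by (auto simp: K_def)
 moreover have "compact K" "K \<subseteq> \<Omega>"
  using assms by (simp_all add: test_functions_def K_def)
 ultimately show ?thesis by blast
qed

lemma test_functions_smooth: "\<phi> \<in> test_functions \<Omega> ==> smooth \<phi>"
 by (simp add: test_functions_def)

lemma test_functions_0: "(%_. 0) \<in> test_functions \<Omega>"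
 by (rule test_functionsI[of _ "{}"]) (simp_all add: smooth_const)

lemma test_functions_add:
 fixes \<Omega> :: "(real^'n::finite) set"
 assumes "\<phi> \<in> test_functions \<Omega>" "\<psi> \<in> test_functions \<Omega>"
 shows "(%x. \<phi> x + \<psi> x) \<in> test_functions \<Omega>"
proof -
 obtain K where K: "compact K" "K \<subseteq> \<Omega>" "!!x. x \<notin> K ==> \<phi> x = 0 \<and> grad \<phi> x = 0"
  using test_functions_support[OF assms(1)] by blast
 obtain L where L: "compact L" "L \<subseteq> \<Omega>" "!!x. x \<notin> L ==> \<psi> x = 0 \<and> grad \<psi> x = 0"
  using test_functions_support[OF assms(2)] by blast
 show ?thesis
  by (rule test_functionsI[of _ "K \<union> L"])
   (use K L assms[THEN test_functions_smooth] in \<open>simp_all add: smooth_add compact_Un\<close>)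
qed

lemma test_functions_mult:
 fixes \<Omega> :: "(real^'n::finite) set"
 assumes "\<phi> \<in> test_functions \<Omega>" "smooth \<psi>"
 shows "(%x. \<phi> x * \<psi> x) \<in> test_functions \<Omega>"
proof -
 obtain K where K: "compact K" "K \<subseteq> \<Omega>" "!!x. x \<notin> K ==> \<phi> x = 0 \<and> grad \<phi> x = 0"
  using test_functions_support[OF assms(1)] by blast
 show ?thesis
  by (rule test_functionsI[of _ K])
   (use K assms(2) test_functions_smooth[OF assms(1)] in \<open>simp_all add: smooth_mult\<close>)
qed

lemma grad_add:
 assumes "smooth f" "smooth g"
 shows "grad (%x. f x + g x) x = grad f x + grad g x"
 by (rule grad_eqI)
  (use has_derivative_add[OF assms[THEN smooth_has_derivative]] in \<open>simp add: inner_add_left\<close>)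

lemma grad_mult:
 assumes "smooth f" "smooth g"
 shows "grad (%x. f x * g x) x = f x *\<^sub>R grad g x + g x *\<^sub>R grad f x"
 by (rule grad_eqI)
  (use has_derivative_mult[OF assms[THEN smooth_has_derivative]] in
   \<open>simp add: inner_add_left mult.commute\<close>)

lemma grad_cmult:
 assumes "smooth f"
 shows "grad (%x. c * f x) x = c *\<^sub>R grad f x"
 by (rule grad_eqI)
  (use has_derivative_mult_right[OF smooth_has_derivative[OF assms]] in simp)

lemma grad_compose:
 fixes f :: "real^'n::finite => real"
 assumes "smooth f" "(g has_real_derivative d) (at (f x))"
 shows "grad (%x. g (f x)) x = d *\<^sub>R grad f x"
 by (rule grad_eqI)
  (use has_derivative_compose[OF smooth_has_derivative[OF assms(1)]
    assms(2)[THEN has_field_derivative_imp_has_derivative]] in simp)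

lemma bounded_by_on_compact_support:
 fixes f :: "real^'n::finite => 'b::real_normed_vector"
 assumes "continuous_on UNIV f" "compact K" "!!x. x \<notin> K ==> f x = 0"
 obtains C where "C > 0" "!!x. norm (f x) <= C"
proof -
 have "compact (f ` K)"
  using assms by (intro compact_continuous_image) (auto intro: continuous_on_subset)
 then obtain C where "C > 0" "!!y. y \<in> f ` K ==> norm y <= C"
  using compact_imp_bounded bounded_pos by metis
 then have "norm (f x) <= C" for x using assms(3)[of x] by (cases "x \<in> K") auto
 then show ?thesis using that[OF \<open>C > 0\<close>] by blast
qed

lemma test_functions_bounded:
 fixes \<Omega> :: "(real^'n::finite) set"
 assumes "\<phi> \<in> test_functions \<Omega>"
 obtains C where "C > 0" "!!x. \<bar>\<phi> x\<bar> <= C" "!!x. norm (grad \<phi> x) <= C"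
proof -
 obtain K where K: "compact K" "K \<subseteq> \<Omega>" "!!x. x \<notin> K ==> \<phi> x = 0 \<and> grad \<phi> x = 0"
  using test_functions_support[OF assms] by blast
 obtain C where C: "C > 0" "!!x. norm (\<phi> x) <= C"
  using bounded_by_on_compact_support[OF smooth_continuous[OF test_functions_smooth[OF assms]] K(1)] K(3) by blast
 obtain D where D: "D > 0" "!!x. norm (grad \<phi> x) <= D"
  using bounded_by_on_compact_support[OF smooth_grad_continuous[OF test_functions_smooth[OF assms]] K(1)] K(3) by blast
 have "\<bar>\<phi> x\<bar> <= C + D" "norm (grad \<phi> x) <= C + D" for x
  using C(1) D(1) C(2)[of x] D(2)[of x] by auto
 then show ?thesis using C(1) D(1) by (intro that[of "C + D"]) auto
qed

text \<open>Tensor products of \<open>exp (- 1 / t)\<close> exhaust every open box.\<close>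

lemma box_bump:
 fixes a b :: "real^'n::finite"
 assumes "cbox a b \<subseteq> \<Omega>"
 obtains \<phi> where "!!k. \<phi> k \<in> test_functions \<Omega>" "!!k x. \<bar>\<phi> k x\<bar> <= indicator (cbox a b) x"
  "!!x. (%k. \<phi> k x) \<longlonglongrightarrow> indicator (box a b) x"
proof -
 define \<beta> where "\<beta> t = flat_bump 1 t" for t
 \<comment> \<open>The factors are exp(-1/t) at t = (k+1)(x_i - a_i) and t = (k+1)(b_i - x_i). The
   dilation by k+1 drives each factor to 1 inside the box, and one nonpositive argument makes the
   product vanish outside.\<close>
 define \<phi> where "\<phi> k x = (\<Prod>i\<in>UNIV. \<beta> (real (Suc k) * x $ i + - (Suc k) * a $ i) *
   \<beta> (- real (Suc k) * x $ i + Suc k * b $ i))" for k and x :: "real^'n"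
 have b01: "0 <= \<beta> t" "\<beta> t <= 1" "t <= 0 ==> \<beta> t = 0" for t
  by (auto simp: \<beta>_def flat_bump_def)
 have sm: "smooth (\<phi> k)" for k
  unfolding \<phi>_def \<beta>_def
  by (rule smooth_prod, simp, unfold smooth_def, intro allI Ck_mult Ck_flat_bump)
 have z: "\<phi> k x = 0" if x: "x \<notin> box a b" for k x
 proof -
  obtain i where "x $ i <= a $ i \<or> x $ i \<ge> b $ i"
   using x unfolding mem_box_cart by (meson not_less)
  then have "real (Suc k) * x $ i + - (Suc k) * a $ i <= 0 \<or> - real (Suc k) * x $ i + Suc k * b $ i <= 0"
   by (auto simp: mult_left_mono simp del: of_nat_Suc)
  then have "\<beta> (real (Suc k) * x $ i + - (Suc k) * a $ i) * \<beta> (- real (Suc k) * x $ i + Suc k * b $ i) = 0"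
   using b01(3) by (metis mult_eq_0_iff)
  then show ?thesis unfolding \<phi>_def by (meson UNIV_I finite prod_zero)
 qed
 have bd: "\<bar>\<phi> k x\<bar> <= 1" for k x
 proof -
  have "0 <= \<phi> k x" "\<phi> k x <= 1" unfolding \<phi>_def
   by (auto intro!: prod_nonneg prod_le_1 mult_nonneg_nonneg mult_le_one b01 simp del: of_nat_Suc)
  then show ?thesis by simp
 qed
 have lim1: "(%k. \<beta> (real (Suc k) * t)) \<longlonglongrightarrow> 1" if "t > 0" for t
 proof -
  have "(%k. exp (- (1 / t * inverse (real (Suc k))))) \<longlonglongrightarrow> exp (- (1 / t * 0))"
   by (intro tendsto_intros LIMSEQ_inverse_real_of_nat)
  moreover have "\<beta> (real (Suc k) * t) = exp (- (1 / t * inverse (real (Suc k))))" for k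
   using that by (simp add: \<beta>_def flat_bump_def field_simps add_pos_nonneg)
  ultimately show ?thesis by simp
 qed
 have lim: "(%k. \<phi> k x) \<longlonglongrightarrow> indicator (box a b) x" for x
 proof (cases "x \<in> box a b")
  case True
  have "(%k. \<Prod>i\<in>UNIV. \<beta> (real (Suc k) * (x $ i - a $ i)) * \<beta> (real (Suc k) * (b $ i - x $ i)))
    \<longlonglongrightarrow> (\<Prod>i\<in>(UNIV::'n set). 1 * 1)"
   using True by (intro tendsto_prod tendsto_mult lim1) (auto simp: mem_box_cart)
  then show ?thesis using True
   by (simp add: \<phi>_def algebra_simps)
 qed (auto simp: z)
 show ?thesis
 proof (rule that[of \<phi>])
  show "\<phi> k \<in> test_functions \<Omega>" for k
   by (rule test_functionsI[OF sm, of "cbox a b"])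
    (use assms z[of _ k] box_subset_cbox[of a b] in \<open>simp, simp, blast\<close>)
  show "\<bar>\<phi> k x\<bar> <= indicator (cbox a b) x" for k x
   using bd[of k x] z[of x k] box_subset_cbox[of a b] by (auto simp: indicator_def)
 qed (rule lim)
qed

section \<open>Integration lemmas\<close>

lemma integrable_Fatou:
 fixes f :: "'a => real"
 assumes "!!n. integrable M (X n)" "!!n. AE x in M. 0 <= X n x"
  and "!!n. integral\<^sup>L M (X n) <= C" and [measurable]: "f \<in> borel_measurable M"
  and lim: "AE x in M. (%n. X n x) \<longlonglongrightarrow> f x"
 shows "integrable M f" "integral\<^sup>L M f <= C"
proof -
 have [measurable]: "X n \<in> borel_measurable M" for n using assms(1) by auto
 have AE0: "AE x in M. 0 <= f x"
 proof -
  have "AE x in M. \<forall>n. 0 <= X n x" using assms(2) by (simp add: AE_all_countable)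
  then show ?thesis using lim by eventually_elim (auto intro: LIMSEQ_le_const)
 qed
 have C: "0 <= C"
  using integral_nonneg_AE[OF assms(2)] assms(3) order_trans by blast
 have "(\<integral>\<^sup>+x. ennreal (f x) \<partial>M) = (\<integral>\<^sup>+x. liminf (%n. ennreal (X n x)) \<partial>M)"
 proof (rule nn_integral_cong_AE)
  show "AE x in M. ennreal (f x) = liminf (%n. ennreal (X n x))"
   using lim
  proof eventually_elim
   case (elim x)
   then have "(%n. ennreal (X n x)) \<longlonglongrightarrow> ennreal (f x)" by (rule tendsto_ennrealI)
   then show ?case using lim_imp_Liminf[of sequentially] by force
  qed
 qed
 also have "... <= liminf (%n. \<integral>\<^sup>+x. ennreal (X n x) \<partial>M)"
  by (rule nn_integral_liminf) simp
 also have "... <= liminf (%n::nat. ennreal C)"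
  using assms(1-3) by (intro Liminf_mono always_eventually) (auto simp: nn_integral_eq_integral intro: ennreal_leI)
 also have "... = ennreal C" by (simp add: Liminf_const)
 finally have le: "(\<integral>\<^sup>+x. ennreal (f x) \<partial>M) <= ennreal C" .
 show int: "integrable M f"
  using le AE0 by (intro integrableI_nonneg) (auto simp: top.not_eq_extremum intro: le_less_trans)
 show "integral\<^sup>L M f <= C"
  using le nn_integral_eq_integral[OF int AE0] C by simp
qed

text \<open>A form of Vitali's theorem: equi-integrability is expressed by a Young-type splitting.\<close>

lemma tendsto_integral_Vitali:
 fixes X Y :: "nat => 'a => real"
 assumes [measurable]: "!!n. X n \<in> borel_measurable M"
  and X0: "!!n x. 0 <= X n x"
  and Y: "!!n. integrable M (Y n)" "!!n x. 0 <= Y n x" "!!n. integral\<^sup>L M (Y n) <= C"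
  and split: "!!d. d > 0 ==> \<exists>G. integrable M G \<and> (\<forall>x. 0 <= G x) \<and> (\<forall>n. AE x in M. X n x <= d * Y n x + G x)"
  and lim: "AE x in M. (%n. X n x) \<longlonglongrightarrow> 0"
 shows "!!n. integrable M (X n)" "(%n. integral\<^sup>L M (X n)) \<longlonglongrightarrow> 0"
proof -
 show int: "integrable M (X n)" for n
 proof -
  obtain G where "integrable M G" "AE x in M. X n x <= 1 * Y n x + G x"
   using split[of 1] by auto
  then show ?thesis
   using Y(1)[of n] X0 by (intro integrable_bound[of M "%x. 1 * Y n x + G x" "X n"]) auto
 qed
 have C: "0 <= C" using integral_nonneg_AE[OF AE_I2, of M "Y 0"] Y(2)[of 0] Y(3)[of 0] by (metis order_trans)
 show "(%n. integral\<^sup>L M (X n)) \<longlonglongrightarrow> 0"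
 proof (rule LIMSEQ_I)
  fix e :: real assume e: "e > 0"
  define d where "d = e / (2 * (C + 1))"
  have d: "d > 0" "d * C < e / 2" using C e by (auto simp: d_def field_simps add_pos_nonneg)
  obtain G where G: "integrable M G" "!!x. 0 <= G x" "!!n. AE x in M. X n x <= d * Y n x + G x"
   using split[OF d(1)] by blast
  have [measurable]: "G \<in> borel_measurable M" using G(1) by auto
  \<comment> \<open>Cutting \<open>X n\<close> at \<open>G\<close> leaves a dominated sequence. By
    the splitting, the part above \<open>G\<close> is at most \<open>d * Y n\<close>, whose integral
    is at most \<open>d * C\<close>.\<close>
  have "(%n. \<integral>x. min (X n x) (G x) \<partial>M) \<longlonglongrightarrow> (\<integral>x. 0 \<partial>M)"
  proof (rule integral_dominated_convergence[where w=G])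
   show "AE x in M. (%n. min (X n x) (G x)) \<longlonglongrightarrow> 0"
    using lim
   proof eventually_elim
    case (elim x)
    have "(%n. min (X n x) (G x)) \<longlonglongrightarrow> min 0 (G x)"
     by (intro tendsto_min elim tendsto_const)
    then show ?case using G(2)[of x] by simp
   qed
   show "AE x in M. norm (min (X n x) (G x)) <= G x" for n
    using X0 G(2) by (auto intro!: AE_I2)
  qed (use G(1) in auto)
  then have lim0: "(%n. \<integral>x. min (X n x) (G x) \<partial>M) \<longlonglongrightarrow> 0" by simp
  obtain N where N: "!!n. n \<ge> N ==> norm (\<integral>x. min (X n x) (G x) \<partial>M) < e / 2"
   using LIMSEQ_D[OF lim0, of "e/2"] e by auto
  have "norm (integral\<^sup>L M (X n) - 0) < e" if "n \<ge> N" for n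
  proof -
   have imin: "integrable M (%x. min (X n x) (G x))"
    by (rule integrable_bound[OF G(1)]) (use X0 G(2) in \<open>auto intro!: AE_I2\<close>)
   have "integral\<^sup>L M (X n) <= (\<integral>x. d * Y n x + min (X n x) (G x) \<partial>M)"
    using G(3)[of n] Y(1) Y(2)[of n] d(1)
    by (intro integral_mono_AE int integrable_add imin)
     (auto elim!: eventually_mono simp: min_def)
   also have "... = d * integral\<^sup>L M (Y n) + (\<integral>x. min (X n x) (G x) \<partial>M)"
    using Y(1) imin by (subst integral_add) auto
   also have "... < e"
   proof -
    have "d * integral\<^sup>L M (Y n) <= d * C" by (rule mult_left_mono[OF Y(3)]) (use d in simp)
    then show ?thesis using N[OF that] d(2) unfolding real_norm_def by linarith
   qed
   finally show ?thesis using X0[of n] by (simp add: integral_nonneg)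
  qed
  then show "\<exists>N. \<forall>n\<ge>N. norm (integral\<^sup>L M (X n) - 0) < e" by blast
 qed
qed

text \<open>A two-case substitute for Young's inequality: if z <= d y the first term dominates the
  product, otherwise y < z / d and the second does. The free parameter \<open>d\<close> is what
  permits absorption later.\<close>

lemma young_split:
 fixes y z d p :: real
 assumes "p > 1" "d > 0" "y \<ge> 0" "z \<ge> 0"
 shows "y powr (p - 1) * z <= d * y powr p + d powr (1 - p) * z powr p"
proof (cases "z <= d * y")
 case True
 have "y powr (p - 1) * z <= y powr (p - 1) * (d * y)"
  using True by (intro mult_left_mono) auto
 also have "... = d * y powr p"
  using assms by (cases "y = 0") (auto simp: powr_diff field_simps)
 finally show ?thesis using assms by (auto intro: add_increasing2)
next
 case False
 then have y: "y <= z / d" "z > 0" using assms by (auto simp: field_simps mult_le_0_iff)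
   (metis assms(2,3) less_eq_real_def linorder_not_less mult_nonneg_nonneg order_le_less_trans)
 have "y powr (p - 1) * z <= (z / d) powr (p - 1) * z"
  using assms y by (intro mult_right_mono powr_mono2) auto
 also have "... = d powr (1 - p) * z powr p"
  using assms y by (simp add: powr_divide powr_diff field_simps)
 finally show ?thesis using assms by (auto intro: add_increasing)
qed

text \<open>Bounding the sum by twice the maximum produces the factor 2^p, which becomes the
  constant in the quasi-triangle inequality for \<open>nrm\<close>.\<close>

lemma powr_add_le:
 fixes a b p :: real
 assumes "p > 0" "a \<ge> 0" "b \<ge> 0"
 shows "(a + b) powr p <= 2 powr p * (a powr p + b powr p)"
proof -
 have "(a + b) powr p <= (2 * max a b) powr p"
  using assms by (intro powr_mono2) auto
 also have "... = 2 powr p * max a b powr p" using assms by (simp add: powr_mult)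
 also have "... <= 2 powr p * (a powr p + b powr p)"
  by (intro mult_left_mono) (auto simp: max_def)
 finally show ?thesis .
qed

lemma DERIV_abs_powr:
 assumes "p > 1"
 shows "((%s::real. \<bar>s\<bar> powr p) has_real_derivative p * \<bar>s\<bar> powr (p - 1) * sgn s) (at s)"
proof (cases "s = 0")
 case True
 have "((%h. \<bar>h\<bar> powr (p - 1)) \<longlongrightarrow> \<bar>0\<bar> powr (p - 1)) (at 0)"
  using assms by (intro tendsto_powr' tendsto_intros) auto
 then have "((%h. \<bar>h\<bar> powr (p - 1)) \<longlongrightarrow> 0) (at 0)" using assms by simp
 then have "((%h. \<bar>h\<bar> powr p / h) \<longlongrightarrow> 0) (at 0)"
 proof (rule Lim_null_comparison[rotated])
  show "\<forall>\<^sub>F h in at 0. norm (\<bar>h\<bar> powr p / h) <= \<bar>h\<bar> powr (p - 1)"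
   by (auto simp: eventually_at_filter powr_diff)
 qed
 then show ?thesis using True assms by (simp add: has_field_derivative_iff)
next
 case False
 consider "s > 0" | "s < 0" using False by linarith
 then show ?thesis
 proof cases
  case 1
  have "((%s. s powr p) has_real_derivative p * \<bar>s\<bar> powr (p - 1) * sgn s) (at s)"
   using 1 by (auto intro!: derivative_eq_intros)
  then show ?thesis
   by (rule has_field_derivative_transform_within_open[of _ _ _ "{0<..}"]) (use 1 in auto)
 next
  case 2
  have "((%s. (- s) powr p) has_real_derivative p * \<bar>s\<bar> powr (p - 1) * sgn s) (at s)"
   using 2 by (auto intro!: derivative_eq_intros simp: powr_diff)
  then show ?thesis
   by (rule has_field_derivative_transform_within_open[of _ _ _ "{..<0}"]) (use 2 in auto)
 qed
qed

lemma continuous_on_abs_powr: "p > 0 ==> continuous_on S (%s::real. \<bar>s\<bar> powr p)"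
 by (intro continuous_on_powr' continuous_intros) auto

lemma continuous_on_abs_powr_sgn:
 assumes "r > 0"
 shows "continuous_on UNIV (%s::real. \<bar>s\<bar> powr r * sgn s)"
proof (rule continuous_at_imp_continuous_on, rule ballI)
 fix s :: real
 show "isCont (%s. \<bar>s\<bar> powr r * sgn s) s"
 proof (cases "s = 0")
  case True
  have "((%h. \<bar>h\<bar> powr r) \<longlongrightarrow> \<bar>0\<bar> powr r) (at (0::real))"
   using assms by (intro tendsto_powr' tendsto_intros) auto
  then have "((%h. \<bar>h\<bar> powr r) \<longlongrightarrow> 0) (at (0::real))" using assms by simp
  then have "((%h. \<bar>h\<bar> powr r * sgn h) \<longlongrightarrow> 0) (at (0::real))"
   by (rule Lim_null_comparison[rotated]) (auto simp: eventually_at_filter abs_mult abs_sgn_eq)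
  then show ?thesis using True assms by (simp add: isCont_def)
 next
  case False
  then show ?thesis by (intro continuous_intros) auto
 qed
qed

section \<open>Integration by parts\<close>

lemma integral_lborel_translate:
 fixes f :: "'a::euclidean_space => 'b::{banach, second_countable_topology}"
 assumes [measurable]: "f \<in> borel_measurable borel"
 shows "(\<integral>x. f (x + c) \<partial>lborel) = (\<integral>x. f x \<partial>lborel)"
proof -
 have "(\<integral>x. f x \<partial>lborel) = (\<integral>x. f x \<partial>distr lborel borel ((+) c))"
  by (simp add: lborel_distr_plus)
 also have "... = (\<integral>x. f (x + c) \<partial>lborel)"
  by (subst integral_distr) (auto simp: add.commute)
 finally show ?thesis by simp
qed

lemma integrable_lborel_translate:
 fixes f :: "'a::euclidean_space => 'b::{banach, second_countable_topology}"
 assumes "integrable lborel f"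
 shows "integrable lborel (%x. f (x + c))"
proof -
 have [measurable]: "f \<in> borel_measurable borel" using borel_measurable_integrable[OF assms] by simp
 have "integrable (distr lborel borel ((+) c)) f" using assms by (simp add: lborel_distr_plus)
 then show ?thesis
  by (subst (asm) integrable_distr_eq) (auto simp: add.commute)
qed

lemma integrable_compact_support:
 fixes f :: "'a::euclidean_space => 'b::{banach, second_countable_topology}"
 assumes "continuous_on UNIV f" "bounded K" "!!x. x \<notin> K ==> f x = 0"
 shows "integrable lborel f"
proof -
 obtain R where R: "K \<subseteq> cball 0 R" using assms(2) by (auto simp: bounded_iff subset_eq)
 have "integrable lborel (%x. indicator (cball 0 R) x *\<^sub>R f x)"
  by (rule borel_integrable_compact) (auto intro: continuous_on_subset[OF assms(1)])
 moreover have "(%x. indicator (cball 0 R) x *\<^sub>R f x) = f"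
 proof
  show "indicator (cball 0 R) x *\<^sub>R f x = f x" for x
   using R assms(3)[of x] by (cases "x \<in> K") (auto simp: indicator_def)
 qed
 ultimately show ?thesis by simp
qed

text \<open>\<open>K\<close> is any compact set outside which \<open>f\<close> and \<open>Df\<close>
  vanish, not necessarily the support. Hardy's inequality is obtained from |phi|^p times a weight,
  which is only C^1, so integration by parts is set up for this class and not only for test
  functions.\<close>

definition C1_compact :: "('a::euclidean_space => real) => ('a => 'a) => 'a set => bool" where
 "C1_compact f Df K \<longleftrightarrow> compact K \<and> continuous_on UNIV Df \<and>
  (\<forall>x. (f has_derivative (%h. Df x \<bullet> h)) (at x)) \<and> (\<forall>x. x \<notin> K \<longrightarrow> f x = 0 \<and> Df x = 0)"

lemma C1_compact_continuous: "C1_compact f Df K ==> continuous_on UNIV f"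
 unfolding C1_compact_def
 by (meson continuous_at_imp_continuous_on has_derivative_continuous)

lemma C1_compact_Lipschitz:
 assumes "C1_compact f Df K"
 obtains L where "L > 0" "!!x y. \<bar>f x - f y\<bar> <= L * norm (x - y)"
proof -
 have "compact (Df ` K)"
  using assms by (intro compact_continuous_image) (auto simp: C1_compact_def intro: continuous_on_subset)
 then obtain L where L: "L > 0" "!!y. y \<in> Df ` K ==> norm y <= L"
  using compact_imp_bounded bounded_pos by metis
 have DL: "norm (Df x) <= L" for x
  using L assms by (cases "x \<in> K") (auto simp: C1_compact_def)
 have "norm (f x - f y) <= L * norm (x - y)" for x y
 proof (rule differentiable_bound[of UNIV f "%x h. Df x \<bullet> h"])
  show "onorm (%h. Df x \<bullet> h) <= L" for x
  proof (rule onorm_bound)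
   show "norm (Df x \<bullet> h) <= L * norm h" for h
    using Cauchy_Schwarz_ineq2[of "Df x" h] mult_right_mono[OF DL[of x], of "norm h"] by auto
  qed (use L(1) in simp)
 qed (use assms in \<open>auto simp: C1_compact_def\<close>)
 then show ?thesis using that[OF L(1)] by auto
qed

lemma C1_compact_quotient_limit:
 assumes "C1_compact f Df K"
 shows "(%m. real (Suc m) * (f (x + h /\<^sub>R real (Suc m)) - f x)) \<longlonglongrightarrow> Df x \<bullet> h"
proof -
 have "((%t. f (x + t *\<^sub>R h)) has_real_derivative (Df x \<bullet> h)) (at 0)"
 proof -
  have "(f has_derivative (%h. Df x \<bullet> h)) (at (x + 0 *\<^sub>R h))"
   using assms by (simp add: C1_compact_def)
  then have "((%t. f (x + t *\<^sub>R h)) has_derivative (%t. Df x \<bullet> (t *\<^sub>R h))) (at 0)"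
   by (rule has_derivative_compose[rotated]) (auto intro!: derivative_eq_intros)
  then show ?thesis
   unfolding has_field_derivative_def by (rule has_derivative_eq_rhs) (auto simp: mult.commute)
 qed
 then have "((%t. (f (x + t *\<^sub>R h) - f x) / t) \<longlongrightarrow> Df x \<bullet> h) (at 0)"
  by (simp add: has_field_derivative_iff)
 then have "(%m. (f (x + inverse (real (Suc m)) *\<^sub>R h) - f x) / inverse (real (Suc m))) \<longlonglongrightarrow> Df x \<bullet> h"
  using LIMSEQ_inverse_real_of_nat unfolding tendsto_at_iff_sequentially o_def by (auto simp del: of_nat_Suc)
 then show ?thesis by (simp add: divide_inverse mult.commute del: of_nat_Suc)
qed

text \<open>The Lipschitz bound and the compact support give one dominating function for all
  quotients. The nonlinearity \<open>g\<close> lets one proof serve the integral of the derivative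
  (\<open>g\<close> the identity) and its L^1 norm (\<open>g\<close> the absolute value).\<close>

lemma C1_compact_quotient_integral:
 fixes f :: "'a::euclidean_space => real"
 assumes "C1_compact f Df K" "continuous_on UNIV (g :: real => real)" "!!s. \<bar>g s\<bar> <= \<bar>s\<bar>"
 shows "(%m. \<integral>x. g (real (Suc m) * (f (x + h /\<^sub>R real (Suc m)) - f x)) \<partial>lborel)
   \<longlonglongrightarrow> (\<integral>x. g (Df x \<bullet> h) \<partial>lborel)"
proof -
 have contf: "continuous_on UNIV f" using C1_compact_continuous[OF assms(1)] .
 obtain L where L: "L > 0" "!!x y. \<bar>f x - f y\<bar> <= L * norm (x - y)"
  using C1_compact_Lipschitz[OF assms(1)] by blast
 obtain R where R: "K \<subseteq> cball 0 R"
 proof -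
  have "bounded K" using assms(1) compact_imp_bounded by (auto simp: C1_compact_def)
  then show thesis using that by (auto simp: bounded_iff subset_eq)
 qed
 have [measurable]: "f \<in> borel_measurable borel" "Df \<in> borel_measurable borel" "g \<in> borel_measurable borel"
  using assms contf by (auto simp: C1_compact_def intro: borel_measurable_continuous_onI)
 show ?thesis
 proof (rule integral_dominated_convergence[where w="%x. indicator (cball 0 (R + norm h)) x *\<^sub>R (L * norm h)"])
  show "integrable lborel (%x::'a. indicator (cball 0 (R + norm h)) x *\<^sub>R (L * norm h))"
   by (rule integrable_scaleR_left)
    (use emeasure_bounded_finite[of "cball (0::'a) (R + norm h)"] in \<open>auto simp: integrable_indicator_iff\<close>)
  show "AE x in lborel. (%m. g (real (Suc m) * (f (x + h /\<^sub>R real (Suc m)) - f x))) \<longlonglongrightarrow> g (Df x \<bullet> h)"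
   using assms(2) C1_compact_quotient_limit[OF assms(1)]
   by (intro AE_I2 continuous_on_tendsto_compose[of UNIV g]) auto
  show "AE x in lborel. norm (g (real (Suc m) * (f (x + h /\<^sub>R real (Suc m)) - f x)))
    <= indicator (cball 0 (R + norm h)) x *\<^sub>R (L * norm h)" for m
  proof (rule AE_I2)
   fix x :: 'a
   have hm: "norm (h /\<^sub>R real (Suc m)) <= norm h"
    by (simp add: field_simps mult_left_le_one_le) 
   show "norm (g (real (Suc m) * (f (x + h /\<^sub>R real (Suc m)) - f x)))
    <= indicator (cball 0 (R + norm h)) x *\<^sub>R (L * norm h)"
   proof (cases "x \<in> cball 0 (R + norm h)")
    case True
    have "\<bar>g (real (Suc m) * (f (x + h /\<^sub>R real (Suc m)) - f x))\<bar>
      <= real (Suc m) * \<bar>f (x + h /\<^sub>R real (Suc m)) - f x\<bar>"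
     using assms(3)[of "real (Suc m) * (f (x + h /\<^sub>R real (Suc m)) - f x)"] by (simp add: abs_mult)
    also have "... <= real (Suc m) * (L * norm (h /\<^sub>R real (Suc m)))"
     using L(2)[of "x + h /\<^sub>R real (Suc m)" x] by (intro mult_left_mono) auto
    also have "... = L * norm h" by (simp add: field_simps)
    finally show ?thesis using True by simp
   next
    case False
    have "norm x <= norm (x + h /\<^sub>R real (Suc m)) + norm (h /\<^sub>R real (Suc m))"
     using norm_triangle_ineq4[of "x + h /\<^sub>R real (Suc m)" "h /\<^sub>R real (Suc m)"] by simp
    then have "norm (x + h /\<^sub>R real (Suc m)) > R" "norm x > R"
     using False hm norm_ge_zero[of h] unfolding mem_cball_0 by linarith+
    then have "f (x + h /\<^sub>R real (Suc m)) = 0" "f x = 0"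
     using R assms(1) by (force simp: C1_compact_def)+
    then show ?thesis using False assms(3)[of 0] by simp
   qed
  qed
 qed auto
qed

text \<open>Every difference quotient has integral zero by translation invariance of Lebesgue
  measure, hence so does their limit. This takes the place of the divergence theorem.\<close>

lemma C1_compact_integral_derivative:
 fixes f :: "'a::euclidean_space => real"
 assumes "C1_compact f Df K"
 shows "(\<integral>x. Df x \<bullet> h \<partial>lborel) = 0"
proof -
 have [measurable]: "f \<in> borel_measurable borel"
  using C1_compact_continuous[OF assms] by (rule borel_measurable_continuous_onI)
 have "integrable lborel f"
  using C1_compact_continuous[OF assms] assms
  by (intro integrable_compact_support[of f K]) (auto simp: C1_compact_def intro: compact_imp_bounded)
 then have "(\<integral>x. real (Suc m) * (f (x + h /\<^sub>R real (Suc m)) - f x) \<partial>lborel) = 0" for m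
  by (simp add: integrable_lborel_translate integral_lborel_translate del: of_nat_Suc)
 then show ?thesis
  using C1_compact_quotient_integral[OF assms, of "%x. x" h] LIMSEQ_unique
  by (simp add: continuous_on_id LIMSEQ_const_iff del: of_nat_Suc)
qed

text \<open>The L^1 distance to a translate is subadditive in the shift, so its value at h is at
  most m+1 times its value at h/(m+1), for every m. The latter tends to the integral of |Df .
  h|.\<close>

lemma C1_compact_translation_estimate:
 fixes f :: "'a::euclidean_space => real"
 assumes f: "C1_compact f Df K"
 shows "(\<integral>x. \<bar>f (x + h) - f x\<bar> \<partial>lborel) <= norm h * (\<integral>x. norm (Df x) \<partial>lborel)"
proof -
 have [measurable]: "f \<in> borel_measurable borel"
  using C1_compact_continuous[OF f] by (rule borel_measurable_continuous_onI)
 have int: "integrable lborel f"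
  using C1_compact_continuous[OF f] f
  by (intro integrable_compact_support[of f K]) (auto simp: C1_compact_def intro: compact_imp_bounded)
 define g where "g v = (\<integral>x. \<bar>f (x + v) - f x\<bar> \<partial>lborel)" for v
 have inth: "integrable lborel (%x. \<bar>f (x + v) - f (x + w)\<bar>)" for v w
  by (intro integrable_abs integrable_diff integrable_lborel_translate int)
 have sub: "g (real m *\<^sub>R v) <= real m * g v" for m v
 proof (induction m)
  case (Suc m)
  have "g (real (Suc m) *\<^sub>R v) <= (\<integral>x. \<bar>f (x + real m *\<^sub>R v + v) - f (x + real m *\<^sub>R v)\<bar> + \<bar>f (x + real m *\<^sub>R v) - f (x + 0)\<bar> \<partial>lborel)"
   unfolding g_def using inth[of "real (Suc m) *\<^sub>R v" 0] inth[of "real m *\<^sub>R v + v" "real m *\<^sub>R v"] inth[of "real m *\<^sub>R v" 0]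
   by (intro integral_mono integrable_add) (auto simp: algebra_simps)
  also have "... = (\<integral>x. \<bar>f (x + real m *\<^sub>R v + v) - f (x + real m *\<^sub>R v)\<bar> \<partial>lborel) + g (real m *\<^sub>R v)"
   using inth[of "real m *\<^sub>R v + v" "real m *\<^sub>R v"] inth[of "real m *\<^sub>R v" 0]
   by (simp add: g_def add.assoc)
  also have "(\<integral>x. \<bar>f (x + real m *\<^sub>R v + v) - f (x + real m *\<^sub>R v)\<bar> \<partial>lborel) = g v"
   unfolding g_def by (rule integral_lborel_translate[of "%x. \<bar>f (x + v) - f x\<bar>"]) simp
  finally show ?case using Suc by (simp add: algebra_simps)
 qed (simp add: g_def)
 have "g h <= (\<integral>x. \<bar>real (Suc m) * (f (x + h /\<^sub>R real (Suc m)) - f x)\<bar> \<partial>lborel)" for m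
  using sub[of "Suc m" "h /\<^sub>R real (Suc m)"] by (simp add: g_def abs_mult del: of_nat_Suc)
 moreover have "(%m. \<integral>x. \<bar>real (Suc m) * (f (x + h /\<^sub>R real (Suc m)) - f x)\<bar> \<partial>lborel)
   \<longlonglongrightarrow> (\<integral>x. \<bar>Df x \<bullet> h\<bar> \<partial>lborel)"
  by (rule C1_compact_quotient_integral[OF f]) (auto intro!: continuous_intros)
 ultimately have "g h <= (\<integral>x. \<bar>Df x \<bullet> h\<bar> \<partial>lborel)"
  by (intro LIMSEQ_le_const) auto
 also have "... <= (\<integral>x. norm h * norm (Df x) \<partial>lborel)"
 proof (rule integral_mono)
  have "continuous_on UNIV Df" "bounded K" "!!x. x \<notin> K ==> Df x = 0"
   using f compact_imp_bounded by (auto simp: C1_compact_def)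
  then have "integrable lborel Df" by (rule integrable_compact_support)
  then show "integrable lborel (%x. \<bar>Df x \<bullet> h\<bar>)" "integrable lborel (%x. norm h * norm (Df x))"
   by auto
  show "\<bar>Df x \<bullet> h\<bar> <= norm h * norm (Df x)" for x
   using Cauchy_Schwarz_ineq2[of "Df x" h] by (simp add: mult.commute)
 qed
 finally show ?thesis by (simp add: g_def)
qed

lemma integral_lebesgue_on_support:
 fixes f :: "'a::euclidean_space => 'b::{banach, second_countable_topology}"
 assumes [measurable]: "f \<in> borel_measurable borel" and "S \<in> sets lebesgue" "!!x. x \<notin> S ==> f x = 0"
 shows "(LINT x|lebesgue_on S. f x) = (LINT x|lborel. f x)"
  "integrable (lebesgue_on S) f \<longleftrightarrow> integrable lborel f"
proof -
 have e: "(%x. indicator S x *\<^sub>R f x) = f"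
  using assms(3) by (auto simp: indicator_def fun_eq_iff)
 show "(LINT x|lebesgue_on S. f x) = (LINT x|lborel. f x)"
  using assms(2) by (subst integral_restrict_space) (simp_all add: e integral_completion)
 show "integrable (lebesgue_on S) f \<longleftrightarrow> integrable lborel f"
  using assms(2) by (subst integrable_restrict_space) (simp_all add: e integrable_completion)
qed

lemma test_functions_C1_compact:
 fixes \<Omega> :: "(real^'n::finite) set"
 assumes "\<phi> \<in> test_functions \<Omega>"
 obtains K where "C1_compact \<phi> (grad \<phi>) K" "K \<subseteq> \<Omega>"
proof -
 obtain K where "compact K" "K \<subseteq> \<Omega>" "\<forall>x. x \<notin> K \<longrightarrow> \<phi> x = 0 \<and> grad \<phi> x = 0"
  using test_functions_support[OF assms] by blast
 then show ?thesis
  using test_functions_smooth[OF assms]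
  by (intro that[of K]) (simp_all add: C1_compact_def smooth_grad_continuous smooth_has_derivative)
qed

section \<open>The Hardy inequality\<close>

text \<open>Coordinatewise integration by parts for the field g(x) x, whose divergence is x . Dg + N
  g. This is how the dimension enters Hardy's inequality.\<close>

lemma C1_compact_dilation:
 fixes g :: "real^'n::finite => real"
 assumes "C1_compact g Dg K"
 shows "(\<integral>x. x \<bullet> Dg x + real CARD('n) * g x \<partial>lborel) = 0"
  "integrable lborel (%x. x \<bullet> Dg x + real CARD('n) * g x)"
proof -
 have cont: "continuous_on UNIV g" "continuous_on UNIV Dg" and der: "!!x. (g has_derivative (%h. Dg x \<bullet> h)) (at x)"
  and K: "compact K" "!!x. x \<notin> K ==> g x = 0 \<and> Dg x = 0"
  using assms C1_compact_continuous[OF assms] by (auto simp: C1_compact_def)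
 define F where "F i x = x $ i * Dg x $ i + g x" for i x
 have F: "(\<integral>x. F i x \<partial>lborel) = 0" "integrable lborel (F i)" for i
 proof -
  have "C1_compact (%x. x $ i * g x) (%x. x $ i *\<^sub>R Dg x + g x *\<^sub>R axis i 1) K"
   unfolding C1_compact_def
  proof (intro conjI allI impI)
   show "((%x. x $ i * g x) has_derivative (%h. (x $ i *\<^sub>R Dg x + g x *\<^sub>R axis i 1) \<bullet> h)) (at x)" for x
    by (rule has_derivative_eq_rhs[OF has_derivative_mult[OF bounded_linear.has_derivative[OF bounded_linear_vec_nth] der]],
      rule has_derivative_ident)
     (auto simp: fun_eq_iff inner_add_left inner_axis' mult.commute)
   show "continuous_on UNIV (%x. x $ i *\<^sub>R Dg x + g x *\<^sub>R axis i 1)"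
    using cont by (intro continuous_intros)
  qed (use K in auto)
  then have "(\<integral>x. (x $ i *\<^sub>R Dg x + g x *\<^sub>R axis i 1) \<bullet> axis i 1 \<partial>lborel) = 0"
   by (rule C1_compact_integral_derivative)
  then show "(\<integral>x. F i x \<partial>lborel) = 0"
   by (simp add: F_def inner_add_left inner_axis)
  show "integrable lborel (F i)"
   unfolding F_def using K cont
   by (intro integrable_compact_support[of _ K] continuous_intros) (auto intro: compact_imp_bounded)
 qed
 have e: "x \<bullet> Dg x + real CARD('n) * g x = (\<Sum>i\<in>UNIV. F i x)" for x
  by (simp add: F_def inner_vec_def sum.distrib)
 show "(\<integral>x. x \<bullet> Dg x + real CARD('n) * g x \<partial>lborel) = 0"
  unfolding e by (subst integral_sum) (simp_all add: F)
 show "integrable lborel (%x. x \<bullet> Dg x + real CARD('n) * g x)"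
  unfolding e by (intro integrable_sum F)
qed

text \<open>The weight \<open>1 / norm x powr p\<close> is regularised to \<open>(norm x ^ 2 + e) powr (- p / 2)\<close>.\<close>

lemma Hardy_regularised:
 fixes \<phi> :: "real^'n::finite => real"
 assumes \<phi>: "C1_compact \<phi> D\<phi> K" and p: "1 < p" "p < real CARD('n)" and e: "e > 0"
 defines "d \<equiv> (real CARD('n) - p) / (2 * p)"
 shows "integrable lborel (%x. \<bar>\<phi> x\<bar> powr p * (x \<bullet> x + e) powr (- p / 2))"
  "(\<integral>x. \<bar>\<phi> x\<bar> powr p * (x \<bullet> x + e) powr (- p / 2) \<partial>lborel) <= d powr (- p) * (\<integral>x. norm (D\<phi> x) powr p \<partial>lborel)"
proof -
 have cont: "continuous_on UNIV \<phi>" "continuous_on UNIV D\<phi>" and der: "!!x. (\<phi> has_derivative (%h. D\<phi> x \<bullet> h)) (at x)"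
  and K: "compact K" "bounded K" "!!x. x \<notin> K ==> \<phi> x = 0 \<and> D\<phi> x = 0"
  using \<phi> C1_compact_continuous[OF \<phi>] by (auto simp: C1_compact_def intro: compact_imp_bounded)
 have d: "d > 0" "p * d = (real CARD('n) - p) / 2" using p by (auto simp: d_def)
 have p0: "0 <= p" using p by simp
 define s where "s x = x \<bullet> x + e" for x :: "real^'n"
 have s: "s x > 0" for x using e by (simp add: s_def add_nonneg_pos)
 define y where "y x = \<bar>\<phi> x\<bar> powr p * s x powr (- p / 2)" for x
 define z where "z x = norm (D\<phi> x) powr p" for x
 define Dy where "Dy x = (s x powr (- p / 2) * (p * (\<bar>\<phi> x\<bar> powr (p - 1) * sgn (\<phi> x)))) *\<^sub>R D\<phi> x
   + (\<bar>\<phi> x\<bar> powr p * (- p * s x powr (- p / 2 - 1))) *\<^sub>R x" for x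
 have conts: "continuous_on UNIV s" by (auto simp: s_def intro!: continuous_intros)
 have contsp: "continuous_on UNIV (%x. s x powr r)" for r
  using conts s by (intro continuous_intros) (metis less_irrefl)+
 have contp: "continuous_on UNIV (%x. \<bar>\<phi> x\<bar> powr p)"
  using continuous_on_compose2[OF continuous_on_abs_powr[of p UNIV] cont(1)] p by auto
 have contq: "continuous_on UNIV (%x. \<bar>\<phi> x\<bar> powr (p - 1) * sgn (\<phi> x))"
  using continuous_on_compose2[OF continuous_on_abs_powr_sgn[of "p - 1"] cont(1)] p by auto
 have ders: "((%x. s x powr (- p / 2)) has_derivative (%h. (- p * s x powr (- p / 2 - 1)) * (x \<bullet> h))) (at x)" for x
 proof -
  have "((%t. t powr (- p / 2)) has_real_derivative (- p / 2 * s x powr (- p / 2 - 1))) (at (s x))"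
   using s[of x] by (auto intro!: derivative_eq_intros)
  then have "((%t. t powr (- p / 2)) has_derivative (%h. h * (- p / 2 * s x powr (- p / 2 - 1)))) (at (s x))"
   unfolding has_field_derivative_def by (rule has_derivative_eq_rhs) (auto simp: mult.commute)
  moreover have "(s has_derivative (%h. 2 * (x \<bullet> h))) (at x)"
   unfolding s_def by (auto intro!: derivative_eq_intros simp: inner_commute)
  ultimately have "((%x. s x powr (- p / 2)) has_derivative (%h. (2 * (x \<bullet> h)) * (- p / 2 * s x powr (- p / 2 - 1)))) (at x)"
   by (rule has_derivative_compose[rotated])
  then show ?thesis by (rule has_derivative_eq_rhs) (auto simp: fun_eq_iff)
 qed
 have derp: "((%x. \<bar>\<phi> x\<bar> powr p) has_derivative (%h. p * (\<bar>\<phi> x\<bar> powr (p - 1) * sgn (\<phi> x)) * (D\<phi> x \<bullet> h))) (at x)" for x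
 proof -
  have "((%s. \<bar>s\<bar> powr p) has_derivative (%h. p * (\<bar>\<phi> x\<bar> powr (p - 1) * sgn (\<phi> x)) * h)) (at (\<phi> x))"
   using DERIV_abs_powr[OF p(1), of "\<phi> x"] unfolding has_field_derivative_def
   by (rule has_derivative_eq_rhs) (simp add: fun_eq_iff)
  from has_derivative_compose[OF der this] show ?thesis .
 qed
 have y: "C1_compact y Dy K"
  unfolding C1_compact_def
 proof (intro conjI allI impI)
  show "continuous_on UNIV Dy"
   unfolding Dy_def
   by (intro continuous_on_add continuous_on_scaleR continuous_on_mult[OF contsp] continuous_on_mult[OF contp]
     continuous_on_mult_const continuous_on_const contsp contp contq cont continuous_on_id continuous_on_mult)
  show "(y has_derivative (%h. Dy x \<bullet> h)) (at x)" for x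
   unfolding y_def
   by (rule has_derivative_eq_rhs[OF has_derivative_mult[OF derp ders]])
    (auto simp: Dy_def fun_eq_iff inner_add_left algebra_simps)
 qed (use K p in \<open>auto simp: y_def Dy_def\<close>)
 have zi: "integrable lborel z"
  unfolding z_def
  by (rule integrable_compact_support[of _ K])
   (use K p continuous_on_compose2[OF continuous_on_abs_powr[of p UNIV] continuous_on_norm[OF cont(2)]] in auto)
 have yi: "integrable lborel y"
  using C1_compact_continuous[OF y] K p by (intro integrable_compact_support[of _ K]) (auto simp: y_def)
 then show "integrable lborel (%x. \<bar>\<phi> x\<bar> powr p * (x \<bullet> x + e) powr (- p / 2))"
  by (simp add: y_def[abs_def] s_def)
 \<comment> \<open>In x . Dy + N y the derivative of the weight costs at most p y, leaving (N - p)
   y. The term with the gradient of phi is split by \<open>young_split\<close> with \<open>d\<close>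
   chosen so that p d = (N - p) / 2; half of (N - p) y survives.\<close>
 have key: "(real CARD('n) - p) / 2 * y x - p * d powr (1 - p) * z x <= x \<bullet> Dy x + real CARD('n) * y x" for x
 proof -
  define t where "t = \<bar>\<phi> x\<bar> * s x powr (- 1 / 2)"
  have t: "t \<ge> 0" by (simp add: t_def)
  have yt: "y x = t powr p"
   using s[of x] by (simp add: y_def t_def powr_mult powr_powr)
  have nx: "norm x <= s x powr (1 / 2)"
   using e by (simp add: s_def powr_half_sqrt norm_eq_sqrt_inner)
  have xs: "(x \<bullet> x) <= s x" using e by (simp add: s_def)
  have 1: "s x powr (- p / 2 - 1) * (x \<bullet> x) <= s x powr (- p / 2)"
   using mult_left_mono[OF xs, of "s x powr (- p / 2 - 1)"] s[of x] by (simp add: powr_diff)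
  have 2: "s x powr (- p / 2) * (\<bar>\<phi> x\<bar> powr (p - 1) * (norm x * norm (D\<phi> x))) <= t powr (p - 1) * norm (D\<phi> x)"
  proof -
   have "s x powr (- p / 2) * norm x <= s x powr (- p / 2) * s x powr (1 / 2)"
    using nx by (intro mult_left_mono) auto
   also have "... = s x powr (- 1 / 2 * (p - 1))"
    unfolding powr_add[symmetric] by (rule arg_cong) argo
   finally have "s x powr (- p / 2) * norm x * (\<bar>\<phi> x\<bar> powr (p - 1) * norm (D\<phi> x))
     <= s x powr (- 1 / 2 * (p - 1)) * (\<bar>\<phi> x\<bar> powr (p - 1) * norm (D\<phi> x))"
    by (intro mult_right_mono) auto
   also have "... = t powr (p - 1) * norm (D\<phi> x)"
    using s[of x] by (simp add: t_def powr_mult powr_powr)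
   finally show ?thesis by (simp add: mult_ac)
  qed
  have 3: "t powr (p - 1) * norm (D\<phi> x) <= d * y x + d powr (1 - p) * z x"
   using young_split[OF p(1) d(1) t, of "norm (D\<phi> x)"] by (simp add: yt z_def)
  have "x \<bullet> Dy x = p * (s x powr (- p / 2) * (\<bar>\<phi> x\<bar> powr (p - 1) * (sgn (\<phi> x) * (x \<bullet> D\<phi> x))))
    - p * (\<bar>\<phi> x\<bar> powr p * (s x powr (- p / 2 - 1) * (x \<bullet> x)))"
   by (simp add: Dy_def inner_add_right algebra_simps)
  also have "... \<ge> - (p * (t powr (p - 1) * norm (D\<phi> x))) - p * y x"
  proof -
   have "sgn (\<phi> x) * (x \<bullet> D\<phi> x) \<ge> - (norm x * norm (D\<phi> x))"
    using Cauchy_Schwarz_ineq2[of x "D\<phi> x"] by (auto simp: sgn_if)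
   then have "s x powr (- p / 2) * (\<bar>\<phi> x\<bar> powr (p - 1) * - (norm x * norm (D\<phi> x)))
     <= s x powr (- p / 2) * (\<bar>\<phi> x\<bar> powr (p - 1) * (sgn (\<phi> x) * (x \<bullet> D\<phi> x)))"
    by (intro mult_left_mono) auto
   with 2 have a: "- (t powr (p - 1) * norm (D\<phi> x)) <= s x powr (- p / 2) * (\<bar>\<phi> x\<bar> powr (p - 1) * (sgn (\<phi> x) * (x \<bullet> D\<phi> x)))"
    by simp
   have b: "\<bar>\<phi> x\<bar> powr p * (s x powr (- p / 2 - 1) * (x \<bullet> x)) <= y x"
    unfolding y_def by (intro mult_left_mono 1) auto
   show ?thesis using mult_left_mono[OF a p0] mult_left_mono[OF b p0] unfolding mult_minus_right by linarith
  qed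
  finally have 4: "x \<bullet> Dy x \<ge> - (p * (d * y x + d powr (1 - p) * z x)) - p * y x"
   using mult_left_mono[OF 3 p0] by linarith
  have 5: "p * (d * y x + d powr (1 - p) * z x) = (real CARD('n) - p) / 2 * y x + p * d powr (1 - p) * z x"
   unfolding d(2)[symmetric] by (simp add: algebra_simps)
  have 6: "real CARD('n) * y x - p * y x = (real CARD('n) - p) / 2 * y x + (real CARD('n) - p) / 2 * y x"
   by (simp add: field_simps)
  show ?thesis using 4 5 6 by linarith
 qed
 have "(real CARD('n) - p) / 2 * integral\<^sup>L lborel y - p * d powr (1 - p) * integral\<^sup>L lborel z
   = (\<integral>x. (real CARD('n) - p) / 2 * y x - p * d powr (1 - p) * z x \<partial>lborel)"
  using yi zi by simp
 also have "... <= (\<integral>x. x \<bullet> Dy x + real CARD('n) * y x \<partial>lborel)"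
  using yi zi C1_compact_dilation(2)[OF y] by (intro integral_mono key) auto
 also have "... = 0" by (rule C1_compact_dilation(1)[OF y])
 finally have "p * d * integral\<^sup>L lborel y <= p * d powr (1 - p) * integral\<^sup>L lborel z"
  by (simp add: d(2))
 then have "integral\<^sup>L lborel y <= d powr (- p) * integral\<^sup>L lborel z"
  using p d(1) by (simp add: powr_diff powr_minus field_simps)
 then show "(\<integral>x. \<bar>\<phi> x\<bar> powr p * (x \<bullet> x + e) powr (- p / 2) \<partial>lborel) <= d powr (- p) * (\<integral>x. norm (D\<phi> x) powr p \<partial>lborel)"
  by (simp add: y_def[abs_def] s_def z_def[abs_def])
qed

text \<open>The regularised weights converge off the origin, which is a null set, and the bound does
  not depend on the regularisation. Fatou's lemma therefore gives integrability and the inequality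
  at once.\<close>

lemma Hardy_C1:
 fixes \<phi> :: "real^'n::finite => real"
 assumes \<phi>: "C1_compact \<phi> D\<phi> K" and p: "1 < p" "p < real CARD('n)"
 defines "d \<equiv> (real CARD('n) - p) / (2 * p)"
 shows "integrable lborel (%x. \<bar>\<phi> x\<bar> powr p / norm x powr p)"
  "(\<integral>x. \<bar>\<phi> x\<bar> powr p / norm x powr p \<partial>lborel) <= d powr (- p) * (\<integral>x. norm (D\<phi> x) powr p \<partial>lborel)"
proof -
 have [measurable]: "\<phi> \<in> borel_measurable borel"
  using C1_compact_continuous[OF \<phi>] by (rule borel_measurable_continuous_onI)
 define X where "X n x = \<bar>\<phi> x\<bar> powr p * (x \<bullet> x + inverse (real (Suc n))) powr (- p / 2)" for n and x :: "real^'n"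
 have X: "integrable lborel (X n)" "(\<integral>x. X n x \<partial>lborel) <= d powr (- p) * (\<integral>x. norm (D\<phi> x) powr p \<partial>lborel)" for n
  unfolding X_def[abs_def] d_def by (rule Hardy_regularised[OF \<phi> p], simp)+
 have lim: "AE x in lborel. (%n. X n x) \<longlonglongrightarrow> \<bar>\<phi> x\<bar> powr p / norm x powr p"
 proof -
  have "AE x in lborel. x \<noteq> (0 :: real^'n)" by (rule AE_lborel_singleton)
  then show ?thesis
  proof eventually_elim
   case (elim x)
   have "(%n. (x \<bullet> x + inverse (real (Suc n))) powr (- p / 2)) \<longlonglongrightarrow> (x \<bullet> x + 0) powr (- p / 2)"
    using elim by (intro tendsto_powr tendsto_intros LIMSEQ_inverse_real_of_nat) auto
   moreover have "(x \<bullet> x + 0) powr (- p / 2) = inverse (norm x powr p)"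
   proof -
    have "x \<bullet> x + 0 = norm x powr 2" using elim by (simp add: dot_square_norm)
    then show ?thesis by (simp only: powr_powr) (simp add: powr_minus)
   qed
   ultimately have "(%n. (x \<bullet> x + inverse (real (Suc n))) powr (- p / 2)) \<longlonglongrightarrow> inverse (norm x powr p)"
    by simp
   from tendsto_mult[OF tendsto_const[of "\<bar>\<phi> x\<bar> powr p"] this]
   show ?case unfolding X_def divide_inverse .
  qed
 qed
 show "integrable lborel (%x. \<bar>\<phi> x\<bar> powr p / norm x powr p)"
  "(\<integral>x. \<bar>\<phi> x\<bar> powr p / norm x powr p \<partial>lborel) <= d powr (- p) * (\<integral>x. norm (D\<phi> x) powr p \<partial>lborel)"
  by (rule integrable_Fatou[of lborel X, OF X(1) _ X(2) _ lim]; simp add: X_def)+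
qed

section \<open>The fundamental lemma of the calculus of variations\<close>

text \<open>Bumps exhausting a box show that h integrates to zero over every box whose
  \<open>cbox\<close> lies in the domain. Boxes are stable under intersection and generate the Borel
  sets, so h integrates to zero over all Borel subsets of such a box and vanishes there almost
  everywhere.\<close>

lemma fundamental_lemma:
 fixes \<Omega> :: "(real^'n::finite) set" and h :: "real^'n => real"
 assumes \<Omega>: "open \<Omega>" and loc: "!!K. compact K ==> K \<subseteq> \<Omega> ==> integrable (lebesgue_on K) h"
  and zero: "!!\<phi>. \<phi> \<in> test_functions \<Omega> ==> (LINT x|lebesgue_on \<Omega>. h x * \<phi> x) = 0"
 shows "AE x in lebesgue_on \<Omega>. h x = 0"
proof -
 have setsO[measurable]: "\<Omega> \<in> sets lebesgue" using \<Omega> by (simp add: borel_open)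
 have intC: "integrable lebesgue (%x. indicator (cbox a b) x * h x)" if "cbox a b \<subseteq> \<Omega>" for a b
  using loc[OF compact_cbox that] by (subst (asm) integrable_restrict_space) auto
 have box0: "(LINT x|lebesgue. indicator (box a b) x * h x) = 0" if ab: "cbox a b \<subseteq> \<Omega>" for a b
 proof -
  obtain \<phi> where \<phi>: "!!k. \<phi> k \<in> test_functions \<Omega>" "!!k x. \<bar>\<phi> k x\<bar> <= indicator (cbox a b) x"
   "!!x. (%k. \<phi> k x) \<longlonglongrightarrow> indicator (box a b) x"
   using box_bump[OF ab] by blast
  have [measurable]: "\<phi> k \<in> borel_measurable borel" for k
   using smooth_continuous[OF test_functions_smooth[OF \<phi>(1)]] by (rule borel_measurable_continuous_onI)
  have \<phi>0: "\<phi> k x = 0" if "x \<notin> cbox a b" for k x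
   using \<phi>(2)[of k x] that by simp
  have m1: "(%x. indicator (cbox a b) x * h x) \<in> borel_measurable lebesgue" using intC[OF ab] by auto
  have "(%k. LINT x|lebesgue. (indicator (cbox a b) x * h x) * \<phi> k x)
    \<longlonglongrightarrow> (LINT x|lebesgue. (indicator (cbox a b) x * h x) * indicator (box a b) x)"
  proof (rule integral_dominated_convergence[where w="%x. \<bar>indicator (cbox a b) x * h x\<bar>"])
   show "(%x. (indicator (cbox a b) x * h x) * \<phi> k x) \<in> borel_measurable lebesgue" for k
    by (intro borel_measurable_times[OF m1] measurable_completion) simp
   show "(%x. (indicator (cbox a b) x * h x) * indicator (box a b) x) \<in> borel_measurable lebesgue"
    by (intro borel_measurable_times[OF m1] measurable_completion) simp
   show "integrable lebesgue (%x. \<bar>indicator (cbox a b) x * h x\<bar>)" using intC[OF ab] by simp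
   show "AE x in lebesgue. (%k. (indicator (cbox a b) x * h x) * \<phi> k x)
     \<longlonglongrightarrow> (indicator (cbox a b) x * h x) * indicator (box a b) x"
    using \<phi>(3) by (auto intro!: AE_I2 tendsto_intros)
   show "AE x in lebesgue. norm ((indicator (cbox a b) x * h x) * \<phi> k x) <= \<bar>indicator (cbox a b) x * h x\<bar>" for k
   proof (rule AE_I2)
    fix x
    have "\<bar>\<phi> k x\<bar> <= 1" using order_trans[OF \<phi>(2)[of k x] indicator_le_1] .
    then show "norm ((indicator (cbox a b) x * h x) * \<phi> k x) <= \<bar>indicator (cbox a b) x * h x\<bar>"
     by (simp add: abs_mult mult_left_le)
   qed
  qed
  moreover have "(LINT x|lebesgue. (indicator (cbox a b) x * h x) * \<phi> k x) = 0" for k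
  proof -
   have "0 = (LINT x|lebesgue. indicator \<Omega> x *\<^sub>R (h x * \<phi> k x))"
    using zero[OF \<phi>(1)[of k]] by (subst (asm) integral_restrict_space) auto
   also have "... = (LINT x|lebesgue. (indicator (cbox a b) x * h x) * \<phi> k x)"
   proof (rule integral_cong)
    show "indicator \<Omega> x *\<^sub>R (h x * \<phi> k x) = (indicator (cbox a b) x * h x) * \<phi> k x" for x
     using ab \<phi>0[of x k] by (cases "x \<in> cbox a b") (auto simp: indicator_def)
   qed simp
   finally show ?thesis by simp
  qed
  ultimately have "(LINT x|lebesgue. (indicator (cbox a b) x * h x) * indicator (box a b) x) = 0"
   by (simp add: LIMSEQ_const_iff)
  moreover have "(%x. (indicator (cbox a b) x * h x) * indicator (box a b) x) = (%x. indicator (box a b) x * h x)"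
   using box_subset_cbox[of a b] by (auto simp: indicator_def fun_eq_iff)
  ultimately show ?thesis by simp
 qed
 have local0: "AE x in lebesgue. x \<in> box a b \<longrightarrow> h x = 0" if ab: "cbox a b \<subseteq> \<Omega>" for a b
 proof -
  have intB: "integrable lebesgue (%x. indicator (box a b) x * h x)"
  proof -
   have "integrable lebesgue (%x. indicator (box a b) x *\<^sub>R (indicator (cbox a b) x * h x))"
    by (rule integrable_mult_indicator[OF _ intC[OF ab]]) simp
   moreover have "(%x. indicator (box a b) x *\<^sub>R (indicator (cbox a b) x * h x)) = (%x. indicator (box a b) x * h x)"
    using box_subset_cbox[of a b] by (auto simp: indicator_def fun_eq_iff)
   ultimately show ?thesis by simp
  qed
  \<comment> \<open>The induction over generated sets speaks of Borel sets only, so h on the box is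
    replaced by a Borel function that agrees with it almost everywhere.\<close>
  then obtain g where g[measurable]: "g \<in> borel_measurable lborel"
   and gh: "AE x in lborel. indicator (box a b) x * h x = g x"
   using completion_ex_borel_measurable_real[of "%x. indicator (box a b) x * h x" lborel] by auto
  have gh': "AE x in lebesgue. indicator (box a b) x * h x = g x"
   using gh by (rule AE_completion)
  have "integrable lebesgue g"
   using intB measurable_completion[OF g] gh' by (rule integrable_cong_AE_imp)
  then have gi: "integrable lborel g" by (simp add: integrable_completion)
  have gA: "(LINT x|lborel. indicator A x *\<^sub>R g x) = (LINT x|lebesgue. indicator A x * (indicator (box a b) x * h x))"
   if [measurable]: "A \<in> sets borel" for A
  proof -
   have "(LINT x|lborel. indicator A x *\<^sub>R g x) = (LINT x|lebesgue. indicator A x *\<^sub>R g x)"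
    by (subst integral_completion) auto
   also have "... = (LINT x|lebesgue. indicator A x * (indicator (box a b) x * h x))"
   proof (rule integral_cong_AE)
    show "(%x. indicator A x *\<^sub>R g x) \<in> borel_measurable lebesgue" by (intro measurable_completion) simp
    show "(%x. indicator A x * (indicator (box a b) x * h x)) \<in> borel_measurable lebesgue"
     by (intro borel_measurable_times[OF _ borel_measurable_integrable[OF intB]] borel_measurable_indicator) simp
    show "AE x in lebesgue. indicator A x *\<^sub>R g x = indicator A x * (indicator (box a b) x * h x)"
     using gh' by eventually_elim simp
   qed
   finally show ?thesis .
  qed
  have is_box: "Int_stable (range (%(a, b). box a b :: (real^'n) set))"
   by (auto simp: Int_stable_def box_Int_box)
  have sub_box: "range (%(a, b). box a b :: (real^'n) set) \<subseteq> Pow UNIV" by simp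
  have "(LINT x|lborel. indicator A x *\<^sub>R g x) = 0" if "A \<in> sigma_sets UNIV (range (%(a, b). box a b))" for A
   using is_box sub_box that
  proof (induction rule: sigma_sets_induct_disjoint)
   case (basic A)
   then obtain c d where A: "A = box c d" by auto
   obtain u v where uv: "box c d \<inter> box a b = box u v" by (auto simp: box_Int_box)
   have "(LINT x|lborel. indicator A x *\<^sub>R g x) = (LINT x|lebesgue. indicator (box u v) x * h x)"
    unfolding A uv[symmetric] by (subst gA) (auto simp: indicator_inter_arith mult.assoc)
   also have "... = 0"
   proof (cases "box u v = {}")
    case False
    have "closure (box u v) \<subseteq> cbox a b"
     using uv box_subset_cbox[of a b] by (intro closure_minimal) auto
    then have "cbox u v \<subseteq> \<Omega>" using ab False by (auto simp: closure_box)
    then show ?thesis by (rule box0)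
   qed simp
   finally show ?case .
  next
   case empty then show ?case by simp
  next
   case (compl A)
   have [measurable]: "A \<in> sets borel" using compl(1) by (simp add: borel_eq_box)
   have "(LINT x|lborel. g x) = 0"
    using gA[of UNIV] box0[OF ab] by simp
   moreover have "(LINT x|lborel. indicator (UNIV - A) x *\<^sub>R g x) = (LINT x|lborel. g x - indicator A x *\<^sub>R g x)"
    by (intro integral_cong) (auto simp: indicator_def)
   moreover have "... = (LINT x|lborel. g x) - (LINT x|lborel. indicator A x *\<^sub>R g x)"
    by (intro integral_diff gi integrable_mult_indicator) auto
   ultimately show ?case using compl(2) by simp
  next
   case (union A)
   have [measurable]: "A i \<in> sets borel" for i using union(2) by (auto simp: borel_eq_box)
   have "(%n. LINT x|lborel. indicator (\<Union>i<n. A i) x *\<^sub>R g x) \<longlonglongrightarrow> (LINT x|lborel. indicator (\<Union>i. A i) x *\<^sub>R g x)"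
   proof (rule integral_dominated_convergence[where w="%x. norm (g x)"])
    show "AE x in lborel. (%n. indicator (\<Union>i<n. A i) x *\<^sub>R g x) \<longlonglongrightarrow> indicator (\<Union>i. A i) x *\<^sub>R g x"
     by (intro AE_I2 tendsto_scaleR tendsto_const) (rule LIMSEQ_indicator_UN)
   qed (use gi in \<open>auto intro!: AE_I2 simp: indicator_def\<close>)
   moreover have "(LINT x|lborel. indicator (\<Union>i<n. A i) x *\<^sub>R g x) = 0" for n
   proof -
    have eq: "indicator (\<Union>i<n. A i) x *\<^sub>R g x = (\<Sum>i<n. indicator (A i) x *\<^sub>R g x)" for x
     using union(1) by (subst indicator_UN_disjoint) (auto simp: disjoint_family_on_def scaleR_sum_left sum_distrib_right)
    have "(LINT x|lborel. indicator (\<Union>i<n. A i) x *\<^sub>R g x) = (\<Sum>i<n. LINT x|lborel. indicator (A i) x *\<^sub>R g x)"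
     unfolding eq by (rule integral_sum) (intro integrable_mult_indicator gi, simp)
    then show ?thesis using union(3) by simp
   qed
   ultimately show ?case by (simp add: LIMSEQ_const_iff)
  qed
  then have "AE x in lborel. g x = 0"
   using gi by (intro density_unique_real[of lborel g "%_. 0"])
    (auto simp: set_lebesgue_integral_def borel_eq_box)
  then have "AE x in lebesgue. g x = 0" by (rule AE_completion)
  with gh' show ?thesis by eventually_elim (auto simp: indicator_def)
 qed
 \<comment> \<open>Only countably many null sets may be united; Lindelof's theorem reduces the cover
   by boxes to a countable one.\<close>
 define F where "F = {box a b |a b. cbox a b \<subseteq> \<Omega>}"
 have "!!S. S \<in> F ==> open S" by (auto simp: F_def)
 then obtain F' where F': "F' \<subseteq> F" "countable F'" "\<Union>F' = \<Union>F" using Lindelof by metis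
 have "\<Omega> \<subseteq> \<Union>F"
 proof
  fix x assume "x \<in> \<Omega>"
  then obtain a b where "cbox a b \<subseteq> \<Omega>" "x \<in> box a b"
   using open_contains_cbox[OF \<Omega>] by metis
  then show "x \<in> \<Union>F" by (auto simp: F_def)
 qed
 moreover have "AE x in lebesgue. \<forall>S\<in>F'. x \<in> S \<longrightarrow> h x = 0"
  using F'(1,2) local0 by (subst AE_ball_countable) (auto simp: F_def)
 ultimately have "AE x in lebesgue. x \<in> \<Omega> \<longrightarrow> h x = 0"
  using F'(3) by (auto elim!: eventually_mono)
 then show ?thesis by (subst AE_restrict_space_iff) auto
qed

section \<open>Compactness in the space of integrable functions\<close>

lemma ball_measure_pos:
 fixes d :: real assumes "d > 0"
 shows "measure lborel (ball (0::'a::euclidean_space) d) > 0"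
 using assms by (simp add: content_ball_pos)

text \<open>Mollification with the normalised indicator of a ball as kernel. The kernel is
  discontinuous, but for C^1 functions the averages are Lipschitz with a constant controlled by the
  L^1 norm of the gradient, which is enough for compactness.\<close>

definition ball_average :: "real => ('a::euclidean_space => real) => 'a => real" where
 "ball_average d f x = (\<integral>h. indicator (ball 0 d) h * f (x + h) \<partial>lborel) / measure lborel (ball (0::'a) d)"

context
 fixes f :: "'a::euclidean_space => real" and Df K and d :: real
 assumes f: "C1_compact f Df K" and d: "d > 0"
begin

private lemma fm[measurable]: "f \<in> borel_measurable borel"
 using C1_compact_continuous[OF f] by (rule borel_measurable_continuous_onI)

private lemma fi: "integrable lborel f"
 using C1_compact_continuous[OF f] f
 by (intro integrable_compact_support[of f K]) (auto simp: C1_compact_def intro: compact_imp_bounded)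

private lemma fti: "integrable lborel (%h. f (x + h))"
 using integrable_lborel_translate[OF fi, of x] by (simp add: add.commute)

private lemma fbi: "integrable lborel (%h. indicator (ball 0 d) h * f (x + h))"
 using integrable_mult_indicator[OF _ fti, of "ball 0 d" x] by simp

private lemma c: "measure lborel (ball (0::'a) d) > 0"
 by (rule ball_measure_pos[OF d])

private lemma wi: "integrable lborel (indicator (ball (0::'a) d) :: 'a => real)"
 using emeasure_bounded_finite[of "ball (0::'a) d"] by (auto simp: integrable_indicator_iff)

private lemma pair_measurable:
 "(%q::'a \<times> 'a. f (fst q + snd q)) \<in> borel_measurable borel"
 "(%q::'a \<times> 'a. f (snd q + fst q)) \<in> borel_measurable borel"
 "(%q::'a \<times> 'a. f (snd q)) \<in> borel_measurable borel"
 "(%q::'a \<times> 'a. indicator (ball 0 d) (fst q) :: real) \<in> borel_measurable borel"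
 "(%q::'a \<times> 'a. indicator (ball 0 d) (snd q) :: real) \<in> borel_measurable borel"
proof -
 have fs: "fst \<in> borel_measurable (borel :: ('a \<times> 'a) measure)" "snd \<in> borel_measurable (borel :: ('a \<times> 'a) measure)"
  by (auto intro!: borel_measurable_continuous_onI continuous_intros)
 show "(%q::'a \<times> 'a. f (fst q + snd q)) \<in> borel_measurable borel"
  "(%q::'a \<times> 'a. f (snd q + fst q)) \<in> borel_measurable borel"
  "(%q::'a \<times> 'a. f (snd q)) \<in> borel_measurable borel"
  by (intro measurable_compose[OF _ fm] borel_measurable_add fs)+
 show "(%q::'a \<times> 'a. indicator (ball 0 d) (fst q) :: real) \<in> borel_measurable borel"
  "(%q::'a \<times> 'a. indicator (ball 0 d) (snd q) :: real) \<in> borel_measurable borel"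
  by (rule measurable_compose[OF fs(1) borel_measurable_indicator] measurable_compose[OF fs(2) borel_measurable_indicator], simp)+
qed

lemma ball_average_measurable: "ball_average d f \<in> borel_measurable borel"
proof -
 have "(%x. \<integral>h. indicator (ball 0 d) h * f (x + h) \<partial>lborel) \<in> borel_measurable borel"
 proof -
  have "(%x. \<integral>h. indicator (ball 0 d) h * f (x + h) \<partial>lborel) \<in> borel_measurable lborel"
   by (rule lborel.borel_measurable_lebesgue_integral)
    (simp only: lborel_prod split_beta', intro borel_measurable_times, simp_all add: pair_measurable)
  then show ?thesis by simp
 qed
 then show ?thesis unfolding ball_average_def by simp
qed

text \<open>Two averages differ by at most the L^1 distance between f and its translate by x - y.
  The constant depends on f only through the L^1 norm of the gradient, so a bounded family becomes
  equi-Lipschitz at each radius.\<close>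

lemma ball_average_Lipschitz:
 "\<bar>ball_average d f x - ball_average d f y\<bar>
  <= (\<integral>z. norm (Df z) \<partial>lborel) / measure lborel (ball (0::'a) d) * norm (x - y)"
proof -
 let ?c = "measure lborel (ball (0::'a) d)"
 have di: "integrable lborel (%h. f (x + h) - f (y + h))"
  by (intro integrable_diff fti)
 have "\<bar>(\<integral>h. indicator (ball 0 d) h * f (x + h) \<partial>lborel) - (\<integral>h. indicator (ball 0 d) h * f (y + h) \<partial>lborel)\<bar>
   = norm (\<integral>h. indicator (ball 0 d) h * f (x + h) - indicator (ball 0 d) h * f (y + h) \<partial>lborel)"
  using fbi by (subst integral_diff) auto
 also have "... <= (\<integral>h. \<bar>f (x + h) - f (y + h)\<bar> \<partial>lborel)"
  by (rule integral_norm_bound_integral)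
   (use fbi[of x] fbi[of y] di in \<open>auto simp: indicator_def\<close>)
 also have "... = (\<integral>z. \<bar>f (z + (x - y)) - f z\<bar> \<partial>lborel)"
  using integral_lborel_translate[of "%z. \<bar>f (z + (x - y)) - f z\<bar>" y] by (simp add: add.commute add.left_commute)
 also have "... <= norm (x - y) * (\<integral>z. norm (Df z) \<partial>lborel)"
  by (rule C1_compact_translation_estimate[OF f])
 finally show ?thesis
  using c by (simp add: ball_average_def diff_divide_distrib[symmetric] field_simps)
qed

lemma ball_average_bound:
 "\<bar>ball_average d f x\<bar> <= (\<integral>z. \<bar>f z\<bar> \<partial>lborel) / measure lborel (ball (0::'a) d)"
proof -
 have "norm (\<integral>h. indicator (ball 0 d) h * f (x + h) \<partial>lborel) <= (\<integral>h. \<bar>f (x + h)\<bar> \<partial>lborel)"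
  by (rule integral_norm_bound_integral) (use fbi[of x] fti[of x] in \<open>auto simp: indicator_def\<close>)
 also have "... = (\<integral>z. \<bar>f z\<bar> \<partial>lborel)"
  using integral_lborel_translate[of "%z. \<bar>f z\<bar>" x] by (simp add: add.commute)
 finally show ?thesis using c by (simp add: ball_average_def divide_right_mono)
qed

lemma ball_average_support:
 assumes "K \<subseteq> cball 0 R" "norm x > R + d"
 shows "ball_average d f x = 0"
proof -
 have z: "indicator (ball 0 d) h * f (x + h) = 0" for h
 proof (cases "h \<in> ball 0 d")
  case True
  have "norm x <= norm (x + h) + norm h" using norm_triangle_ineq4[of "x + h" h] by simp
  then have "x + h \<notin> K" using assms True by auto
  then show ?thesis using f by (simp add: C1_compact_def)
 qed simp
 show ?thesis by (simp only: ball_average_def z) simp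
qed

lemma ball_average_integrable: "integrable lborel (ball_average d f)"
proof -
 obtain R where R: "K \<subseteq> cball 0 R"
  using f compact_imp_bounded[of K] by (auto simp: C1_compact_def bounded_iff subset_eq)
 let ?B = "(\<integral>z. \<bar>f z\<bar> \<partial>lborel) / measure lborel (ball (0::'a) d)"
 have "integrable lborel (%x::'a. indicator (cball 0 (R + d)) x *\<^sub>R ?B)"
  using emeasure_bounded_finite[of "cball (0::'a) (R + d)"]
  by (intro integrable_scaleR_left) (auto simp: integrable_indicator_iff)
 then show ?thesis
 proof (rule integrable_bound)
  show "ball_average d f \<in> borel_measurable lborel" using ball_average_measurable by simp
  show "AE x in lborel. norm (ball_average d f x) <= norm (indicator (cball 0 (R + d)) x *\<^sub>R ?B)"
   using ball_average_bound ball_average_support[OF R] c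
   by (intro AE_I2) (auto simp: indicator_def)
 qed
qed

text \<open>By Tonelli the distance is at most the mean over |h| < d of the L^1 distances to the
  translates by h, and each of these is at most d times the L^1 norm of the gradient.\<close>

lemma ball_average_approx:
 "(\<integral>x. \<bar>ball_average d f x - f x\<bar> \<partial>lborel) <= d * (\<integral>z. norm (Df z) \<partial>lborel)"
proof -
 let ?c = "measure lborel (ball (0::'a) d)"
 let ?w = "%h. indicator (ball (0::'a) d) h / ?c"
 let ?I = "\<integral>z. norm (Df z) \<partial>lborel"
 have I0: "0 <= ?I" by simp
 have w: "(\<integral>\<^sup>+h. ennreal (?w h) \<partial>lborel) = 1"
 proof -
  have "(\<integral>h. ?w h \<partial>lborel) = 1" using c by simp
  then show ?thesis using wi c by (subst nn_integral_eq_integral) auto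
 qed
 have pt: "\<bar>ball_average d f x - f x\<bar> <= (\<integral>h. ?w h * \<bar>f (x + h) - f x\<bar> \<partial>lborel)"
  and pti: "integrable lborel (%h. ?w h * \<bar>f (x + h) - f x\<bar>)" for x
 proof -
  have i1: "integrable lborel (%h. ?w h * (f (x + h) - f x))"
   using fbi[of x] wi by (simp add: right_diff_distrib)
  have "integrable lborel (%h. \<bar>?w h * (f (x + h) - f x)\<bar>)"
   using i1 by (rule integrable_abs)
  then show i2: "integrable lborel (%h. ?w h * \<bar>f (x + h) - f x\<bar>)" using c by (simp add: abs_mult)
  have "ball_average d f x - f x = (\<integral>h. ?w h * (f (x + h) - f x) \<partial>lborel)"
   using fbi[of x] wi c by (simp add: right_diff_distrib ball_average_def)
  also have "\<bar>...\<bar> <= (\<integral>h. ?w h * \<bar>f (x + h) - f x\<bar> \<partial>lborel)"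
   using integral_norm_bound_integral[OF i1 i2] c by (simp add: abs_mult)
  finally show "\<bar>ball_average d f x - f x\<bar> <= (\<integral>h. ?w h * \<bar>f (x + h) - f x\<bar> \<partial>lborel)" .
 qed
 have "(\<integral>\<^sup>+x. ennreal \<bar>ball_average d f x - f x\<bar> \<partial>lborel)
   <= (\<integral>\<^sup>+x. \<integral>\<^sup>+h. ennreal (?w h * \<bar>f (x + h) - f x\<bar>) \<partial>lborel \<partial>lborel)"
  using pt pti c by (intro nn_integral_mono) (subst nn_integral_eq_integral, auto intro!: ennreal_leI)
 also have "... = (\<integral>\<^sup>+h. \<integral>\<^sup>+x. ennreal (?w h * \<bar>f (x + h) - f x\<bar>) \<partial>lborel \<partial>lborel)"
  by (rule lborel_pair.Fubini')
   (simp only: lborel_prod split_beta', intro measurable_compose[OF _ measurable_ennreal] borel_measurable_times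
    borel_measurable_divide borel_measurable_abs borel_measurable_diff, simp_all add: pair_measurable)
 also have "... <= (\<integral>\<^sup>+h. ennreal (d * ?I) * ennreal (?w h) \<partial>lborel)"
 proof (rule nn_integral_mono)
  fix h :: 'a
  show "(\<integral>\<^sup>+x. ennreal (?w h * \<bar>f (x + h) - f x\<bar>) \<partial>lborel) <= ennreal (d * ?I) * ennreal (?w h)"
  proof (cases "h \<in> ball 0 d")
   case True
   have "integrable lborel (%x. \<bar>f (x + h) - f x\<bar>)"
    by (intro integrable_abs integrable_diff fi integrable_lborel_translate)
   then have "(\<integral>\<^sup>+x. ennreal (?w h * \<bar>f (x + h) - f x\<bar>) \<partial>lborel) = ennreal (?w h * (\<integral>x. \<bar>f (x + h) - f x\<bar> \<partial>lborel))"
    using c by (subst nn_integral_eq_integral) auto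
   also have "... <= ennreal (?w h * (d * ?I))"
   proof (intro ennreal_leI mult_left_mono)
    have "(\<integral>x. \<bar>f (x + h) - f x\<bar> \<partial>lborel) <= norm h * ?I"
     by (rule C1_compact_translation_estimate[OF f])
    also have "... <= d * ?I" using True I0 by (intro mult_right_mono) auto
    finally show "(\<integral>x. \<bar>f (x + h) - f x\<bar> \<partial>lborel) <= d * ?I" .
   qed (use c in auto)
   finally show ?thesis using d I0 c by (simp add: ennreal_mult'[symmetric] mult.commute)
  qed simp
 qed
 also have "... = ennreal (d * ?I)" 
 proof -
  have "(%h. ennreal (?w h)) \<in> borel_measurable lborel"
   by (intro measurable_compose[OF _ measurable_ennreal] borel_measurable_divide
     borel_measurable_integrable[OF wi] borel_measurable_const)
  then show ?thesis by (subst nn_integral_cmult) (simp_all only: w mult_1_right)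
 qed
 finally have "(\<integral>\<^sup>+x. ennreal \<bar>ball_average d f x - f x\<bar> \<partial>lborel) <= ennreal (d * ?I)" .
 moreover have "integrable lborel (%x. \<bar>ball_average d f x - f x\<bar>)"
  by (intro integrable_abs integrable_diff fi ball_average_integrable)
 ultimately show ?thesis
  using d I0 by (subst (asm) nn_integral_eq_integral) auto
qed

end

text \<open>At a fixed radius the ball averages are uniformly bounded and equi-Lipschitz, so
  convergence on a countable dense set gives convergence everywhere and, the supports lying in one
  ball, in L^1. Averages of small radius are L^1-close to the functions uniformly in n, which makes
  the subsequence Cauchy.\<close>

lemma L1_compactness:
 fixes f :: "nat => 'a::euclidean_space => real"
 assumes f: "!!n. C1_compact (f n) (Df n) (K n)" and K: "!!n. K n \<subseteq> cball 0 R"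
  and C: "!!n. (\<integral>x. norm (Df n x) \<partial>lborel) <= C" "!!n. (\<integral>x. \<bar>f n x\<bar> \<partial>lborel) <= C"
 obtains r :: "nat => nat" where "strict_mono r"
  "!!e. e > 0 ==> \<exists>N. \<forall>m\<ge>N. \<forall>n\<ge>N. (\<integral>x. \<bar>f (r m) x - f (r n) x\<bar> \<partial>lborel) < e"
proof -
 define d where "d j = inverse (real (Suc j))" for j
 have d: "d j > 0" "d j <= 1" for j by (simp_all add: d_def field_simps)
 define c where "c j = measure lborel (ball (0::'a) (d j))" for j
 have c: "c j > 0" for j unfolding c_def by (rule ball_measure_pos[OF d(1)])
 define A where "A j n x = ball_average (d j) (f n) x" for j n x
 have C0: "0 <= C" 
 proof -
  have "0 <= (\<integral>x. \<bar>f 0 x\<bar> \<partial>lborel)" by (rule integral_nonneg_AE) simp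
  then show ?thesis using C(2)[of 0] by linarith
 qed
 have A_Lip: "\<bar>A j n x - A j n y\<bar> <= C / c j * norm (x - y)" for j n x y
 proof -
  have "\<bar>A j n x - A j n y\<bar> <= (\<integral>z. norm (Df n z) \<partial>lborel) / c j * norm (x - y)"
   unfolding A_def c_def by (rule ball_average_Lipschitz[OF f d(1)])
  also have "... <= C / c j * norm (x - y)"
   using C(1)[of n] c[of j] by (intro mult_right_mono divide_right_mono) auto
  finally show ?thesis .
 qed
 have A_bd: "\<bar>A j n x\<bar> <= C / c j" for j n x
 proof -
  have "\<bar>A j n x\<bar> <= (\<integral>z. \<bar>f n z\<bar> \<partial>lborel) / c j"
   unfolding A_def c_def by (rule ball_average_bound[OF f d(1)])
  also have "... <= C / c j" using C(2)[of n] c[of j] by (intro divide_right_mono) auto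
  finally show ?thesis .
 qed
 have A_int: "integrable lborel (A j n)" for j n
  unfolding A_def[abs_def] by (rule ball_average_integrable[OF f d(1)])
 have A_supp: "A j n x = 0" if "norm x > R + 1" for j n x
  unfolding A_def using that d(2)[of j] by (intro ball_average_support[OF f d(1) K]) auto
 have fi: "integrable lborel (f n)" for n
  using C1_compact_continuous[OF f] f[of n]
  by (intro integrable_compact_support[of "f n" "K n"]) (auto simp: C1_compact_def intro: compact_imp_bounded)
 obtain S :: "'a set" where S: "countable S" "!!X. open X ==> X \<noteq> {} ==> \<exists>d\<in>S. d \<in> X"
  using countable_dense_setE by blast
 \<comment> \<open>The bounds C / c j blow up as the radius shrinks. Multiplying by
   \<open>c j\<close> makes them uniform, so a single diagonal extraction treats all radii and all
   dense points.\<close>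
 have "norm (case q of (j, x) => c j * A j n x) <= C" if "q \<in> UNIV \<times> S" for n q
  using A_bd c by (auto simp: abs_mult abs_of_pos[OF c] field_simps split: prod.split)
 then obtain r where r: "strict_mono r"
  "!!q. q \<in> UNIV \<times> S ==> \<exists>l. (%n. case q of (j, x) => c j * A j (r n) x) \<longlonglongrightarrow> l"
  using function_convergent_subsequence[of "UNIV \<times> S" "%n q. case q of (j, x) => c j * A j n x" C]
   countable_SIGMA[OF countableI_type[of "UNIV :: nat set"] S(1)] by blast
 have conv: "convergent (%n. A j (r n) x)" for j x
 proof -
  have "Cauchy (%n. A j (r n) x)"
  proof (rule CauchyI)
   fix e :: real assume e: "e > 0"
   define L where "L = C / c j"
   have L: "L \<ge> 0" using C0 c[of j] by (simp add: L_def)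
   obtain y where y: "y \<in> S" "y \<in> ball x (e / (4 * (L + 1)))"
   proof -
    have "ball x (e / (4 * (L + 1))) \<noteq> {}" using e L by (simp add: divide_le_0_iff)
    then show thesis using S(2)[OF open_ball] that by blast
   qed
   have Ly: "L * norm (x - y) < e / 4"
   proof -
    have "L * norm (x - y) <= (L + 1) * norm (x - y)" by (simp add: mult_right_mono)
    also have "... < (L + 1) * (e / (4 * (L + 1)))"
     using y(2) L by (intro mult_strict_left_mono) (auto simp: dist_norm)
    also have "(L + 1) * (e / (4 * (L + 1))) = e / 4" using L by (simp add: field_simps)
    finally show ?thesis .
   qed
   obtain l where "(%n. c j * A j (r n) y) \<longlonglongrightarrow> l" using r(2)[of "(j, y)"] y(1) by auto
   then have "(%n. c j * A j (r n) y / c j) \<longlonglongrightarrow> l / c j"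
    using c[of j] by (intro tendsto_divide tendsto_const) auto
   then have Cy: "Cauchy (%n. A j (r n) y)" using c[of j] by (simp add: LIMSEQ_imp_Cauchy)
   then obtain N where N: "!!m n. m \<ge> N ==> n \<ge> N ==> norm (A j (r m) y - A j (r n) y) < e / 4"
    using CauchyD[OF Cy, of "e / 4"] e by auto
   have "norm (A j (r m) x - A j (r n) x) < e" if "m \<ge> N" "n \<ge> N" for m n
    using N[OF that] A_Lip[of j "r m" x y] A_Lip[of j "r n" x y] Ly e
    unfolding L_def[symmetric] real_norm_def by linarith
   then show "\<exists>N. \<forall>m\<ge>N. \<forall>n\<ge>N. norm (A j (r m) x - A j (r n) x) < e" by blast
  qed
  then show ?thesis by (simp add: Cauchy_convergent_iff)
 qed
 define B where "B j x = lim (%n. A j (r n) x)" for j x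
 have AB: "(%n. A j (r n) x) \<longlonglongrightarrow> B j x" for j x
  using conv[of j x] by (simp add: B_def convergent_LIMSEQ_iff)
 have [measurable]: "A j n \<in> borel_measurable borel" for j n
  using borel_measurable_integrable[OF A_int[of j n]] by simp
 have [measurable]: "B j \<in> borel_measurable borel" for j
  by (rule borel_measurable_LIMSEQ_real[OF AB]) simp
 have B_bd: "\<bar>B j x\<bar> <= C / c j" for j x
  using tendsto_rabs[OF AB[of j x]] by (rule LIMSEQ_le_const2) (use A_bd in auto)
 have B_supp: "B j x = 0" if "norm x > R + 1" for j x
  using AB[of j x] A_supp[OF that] by (simp add: LIMSEQ_const_iff)
 have wint: "integrable lborel (%x::'a. indicator (cball 0 (R + 1)) x *\<^sub>R (2 * C / c j))" for j
  using emeasure_bounded_finite[of "cball (0::'a) (R + 1)"]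
  by (intro integrable_scaleR_left) (auto simp: integrable_indicator_iff)
 have AB_bd: "norm \<bar>A j n x - B j x\<bar> <= indicator (cball 0 (R + 1)) x *\<^sub>R (2 * C / c j)" for j n x
  using A_bd[of j n x] B_bd[of j x] A_supp[of x j n] B_supp[of x j] by (auto simp: indicator_def)
 have ABi: "integrable lborel (%x. \<bar>A j n x - B j x\<bar>)" for j n
 proof (rule integrable_bound[OF wint[of j]])
  show "AE x in lborel. norm \<bar>A j n x - B j x\<bar> <= norm (indicator (cball 0 (R + 1)) x *\<^sub>R (2 * C / c j))"
   using order_trans[OF AB_bd abs_ge_self] by (intro AE_I2) (simp only: real_norm_def)
 qed simp
 have AB0: "(%n. \<integral>x. \<bar>A j (r n) x - B j x\<bar> \<partial>lborel) \<longlonglongrightarrow> 0" for j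
 proof -
  have "(%n. \<integral>x. \<bar>A j (r n) x - B j x\<bar> \<partial>lborel) \<longlonglongrightarrow> (\<integral>x. 0 \<partial>(lborel::'a measure))"
  proof (rule integral_dominated_convergence[where w="%x. indicator (cball 0 (R + 1)) x *\<^sub>R (2 * C / c j)"])
   show "AE x in lborel. (%n. \<bar>A j (r n) x - B j x\<bar>) \<longlonglongrightarrow> 0"
    using AB[of j] by (intro AE_I2) (simp add: LIM_zero tendsto_rabs_zero)
   show "AE x in lborel. norm \<bar>A j (r n) x - B j x\<bar> <= indicator (cball 0 (R + 1)) x *\<^sub>R (2 * C / c j)" for n
    by (rule AE_I2) (rule AB_bd)
  qed (use wint in simp_all)
  then show ?thesis by simp
 qed
 show thesis
 proof (rule that[OF r(1)])
  fix e :: real assume e: "e > 0"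
  have "(%j. d j * C) \<longlonglongrightarrow> 0 * C"
   unfolding d_def by (intro tendsto_mult LIMSEQ_inverse_real_of_nat tendsto_const)
  then have "(%j. d j * C) \<longlonglongrightarrow> 0" by simp
  then have "\<forall>\<^sub>F j in sequentially. d j * C < e / 4"
   using e by (intro order_tendstoD(2)[of _ 0]) auto
  then obtain j where j: "d j * C < e / 4" by (metis eventually_happens' sequentially_bot)
  obtain N where N: "!!n. n \<ge> N ==> (\<integral>x. \<bar>A j (r n) x - B j x\<bar> \<partial>lborel) < e / 4"
   using order_tendstoD(2)[OF AB0[of j], of "e / 4"] e by (auto simp: eventually_sequentially)
  have appr: "(\<integral>x. \<bar>A j n x - f n x\<bar> \<partial>lborel) < e / 4" for n
  proof -
   have "(\<integral>x. \<bar>A j n x - f n x\<bar> \<partial>lborel) <= d j * (\<integral>z. norm (Df n z) \<partial>lborel)"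
    unfolding A_def by (rule ball_average_approx[OF f d(1)])
   also have "... <= d j * C" using C(1)[of n] d(1)[of j] by (intro mult_left_mono) auto
   finally show ?thesis using j by linarith
  qed
  have Afi: "integrable lborel (%x. \<bar>A j n x - f n x\<bar>)" for n
   by (intro integrable_abs integrable_diff fi A_int)
  have "(\<integral>x. \<bar>f (r m) x - f (r n) x\<bar> \<partial>lborel) < e" if "m \<ge> N" "n \<ge> N" for m n
  proof -
   have "(\<integral>x. \<bar>f (r m) x - f (r n) x\<bar> \<partial>lborel) <= (\<integral>x. \<bar>A j (r m) x - f (r m) x\<bar> + \<bar>A j (r n) x - f (r n) x\<bar>
     + (\<bar>A j (r m) x - B j x\<bar> + \<bar>A j (r n) x - B j x\<bar>) \<partial>lborel)"
    by (intro integral_mono integrable_abs integrable_diff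
      integrable_add fi Afi ABi) linarith
   also have "... = (\<integral>x. \<bar>A j (r m) x - f (r m) x\<bar> \<partial>lborel) + (\<integral>x. \<bar>A j (r n) x - f (r n) x\<bar> \<partial>lborel)
     + ((\<integral>x. \<bar>A j (r m) x - B j x\<bar> \<partial>lborel) + (\<integral>x. \<bar>A j (r n) x - B j x\<bar> \<partial>lborel))"
    using Afi ABi by (simp add: integrable_add)
   also have "... < e" using appr[of "r m"] appr[of "r n"] N[OF that(1)] N[OF that(2)] by linarith
   finally show ?thesis .
  qed
  then show "\<exists>N. \<forall>m\<ge>N. \<forall>n\<ge>N. (\<integral>x. \<bar>f (r m) x - f (r n) x\<bar> \<partial>lborel) < e" by blast
 qed
qed

text \<open>Along a subsequence whose consecutive L^1 distances are below 2^(-k), the increments are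
  summable almost everywhere, so the pointwise limit exists.\<close>

lemma Cauchy_L1_AE_subseq:
 fixes f :: "nat => 'a => 'b::{banach, second_countable_topology}"
 assumes int: "!!n. integrable M (f n)"
  and Cau: "!!e. e > 0 ==> \<exists>N. \<forall>m\<ge>N. \<forall>n\<ge>N. (\<integral>x. norm (f m x - f n x) \<partial>M) < e"
 obtains r :: "nat => nat" and g where "strict_mono r" "g \<in> borel_measurable M" "AE x in M. (%n. f (r n) x) \<longlonglongrightarrow> g x"
proof -
 have [measurable]: "f n \<in> borel_measurable M" for n using int by auto
 have "\<exists>N. \<forall>m\<ge>N. \<forall>n\<ge>N. (\<integral>x. norm (f m x - f n x) \<partial>M) < (1 / 2) ^ k" for k :: nat
  by (rule Cau) simp
 then obtain N where N: "!!k m n. m \<ge> N k ==> n \<ge> N k ==> (\<integral>x. norm (f m x - f n x) \<partial>M) < (1 / 2) ^ k" by metis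
 define r where "r = rec_nat (N 0) (%k m. max (Suc m) (N (Suc k)))"
 have r: "strict_mono r" by (auto simp: strict_mono_Suc_iff r_def)
 have rN: "r k \<ge> N k" for k by (cases k) (auto simp: r_def)
 have rS: "r (Suc k) \<ge> N k" for k
  using rN[of k] strict_monoD[OF r, of k "Suc k"] by simp
 define u where "u k x = norm (f (r (Suc k)) x - f (r k) x)" for k x
 have [measurable]: "u k \<in> borel_measurable M" for k unfolding u_def by simp
 have ui: "integrable M (u k)" for k unfolding u_def using int by auto
 have "(\<integral>\<^sup>+x. (\<Sum>k. ennreal (u k x)) \<partial>M) = (\<Sum>k. \<integral>\<^sup>+x. ennreal (u k x) \<partial>M)"
  by (rule nn_integral_suminf) simp
 also have "... <= (\<Sum>k. ennreal ((1 / 2) ^ k))"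
 proof (rule suminf_le)
  show "(\<integral>\<^sup>+x. ennreal (u k x) \<partial>M) <= ennreal ((1 / 2) ^ k)" for k
  proof -
   have "integral\<^sup>L M (u k) <= (1 / 2) ^ k"
    unfolding u_def[abs_def] using N[OF rS[of k] rN[of k]] by (rule less_imp_le)
   then show ?thesis using ui[of k] by (subst nn_integral_eq_integral) (auto simp: u_def intro!: ennreal_leI)
  qed
 qed auto
 also have "(\<Sum>k. ennreal ((1 / 2) ^ k)) = ennreal (\<Sum>k. (1 / 2) ^ k)"
  by (rule suminf_ennreal2) (simp_all add: summable_geometric)
 also have "... < \<infinity>" by (simp only: infinity_ennreal_def ennreal_less_top)
 finally have "AE x in M. (\<Sum>k. ennreal (u k x)) \<noteq> \<infinity>"
  by (intro nn_integral_noteq_infinite) auto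
 then have "AE x in M. convergent (%n. f (r n) x)"
 proof eventually_elim
  case (elim x)
  then have "summable (%k. u k x)"
   by (intro summable_suminf_not_top) (auto simp: u_def)
  then have "summable (%k. f (r (Suc k)) x - f (r k) x)"
   unfolding u_def by (rule summable_norm_cancel)
  then have "convergent (%n. \<Sum>k<n. f (r (Suc k)) x - f (r k) x)"
   by (simp add: summable_iff_convergent)
  then have "convergent (%n. f (r n) x - f (r 0) x)" 
   using sum_lessThan_telescope[of "%k. f (r k) x"] by simp
  from convergent_add[OF this convergent_const[of "f (r 0) x"]] show ?case by simp
 qed
 then have "AE x in M. (%n. f (r n) x) \<longlonglongrightarrow> lim (%n. f (r n) x)"
  by (simp add: convergent_LIMSEQ_iff)
 then show thesis
  using that[OF r borel_measurable_lim_metric[of "%n. f (r n)" M]] by simp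
qed

section \<open>Sobolev functions with zero boundary values\<close>

text \<open>The squared positive part is a convenient C^1 cutoff. It builds the bump in
  \<open>integrable_inverse_norm_powr\<close> and the linearly continued square in
  \<open>W0_mult_bounded\<close>.\<close>

lemma DERIV_pos_part_square:
 "((%s::real. (max 0 s)\<^sup>2) has_real_derivative 2 * max 0 s) (at s)"
proof -
 consider "s > 0" | "s < 0" | "s = 0" by linarith
 then show ?thesis
 proof cases
  case 1
  have "((%s. s\<^sup>2) has_real_derivative 2 * max 0 s) (at s)"
   using 1 by (auto intro!: derivative_eq_intros)
  then show ?thesis
   by (rule has_field_derivative_transform_within_open[of _ _ _ "{0<..}"]) (use 1 in auto)
 next
  case 2
  have "((%s. 0) has_real_derivative 2 * max 0 s) (at s)"
   using 2 by simp
  then show ?thesis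
   by (rule has_field_derivative_transform_within_open[of _ _ _ "{..<0}"]) (use 2 in auto)
 next
  case 3
  have "((%h::real. (max 0 h)\<^sup>2 / h) \<longlongrightarrow> 0) (at 0)"
  proof (rule Lim_null_comparison)
   show "\<forall>\<^sub>F h in at 0. norm ((max 0 h)\<^sup>2 / h) <= \<bar>h :: real\<bar>"
    by (rule always_eventually) (auto simp: max_def power2_eq_square)
   show "((%h::real. \<bar>h\<bar>) \<longlongrightarrow> 0) (at 0)" by (rule tendsto_rabs_zero) simp
  qed
  then show ?thesis using 3 by (simp add: has_field_derivative_iff)
 qed
qed

locale sobolev_domain =
 fixes \<Omega> :: "(real^'n::finite) set" and p :: real
 assumes open_domain: "open \<Omega>" and bounded_domain: "bounded \<Omega>"
  and p_gt_1: "1 < p" and p_less: "p < real CARD('n)"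
begin

abbreviation M :: "(real^'n) measure" where "M \<equiv> lebesgue_on \<Omega>"

lemma sets_domain: "\<Omega> \<in> sets lebesgue"
 using open_domain by (simp add: borel_open)

lemma lmeasurable_domain: "\<Omega> \<in> lmeasurable"
 using open_domain bounded_domain by (simp add: lmeasurable_open)

sublocale fin: finite_measure M
 using lmeasurable_domain by (rule finite_measure_lebesgue_on)

lemma AE_M_I: "AE x in lebesgue. x \<in> \<Omega> \<longrightarrow> P x ==> AE x in M. P x"
 using sets_domain by (subst AE_restrict_space_iff) auto

lemma AE_M_domain: "AE x in M. x \<in> \<Omega>"
 by (rule AE_M_I) simp

lemma AE_M_nonzero: "AE x in M. x \<noteq> 0"
 by (rule AE_M_I) (use AE_completion[OF AE_lborel_singleton[of "0::real^'n"]] in \<open>auto elim: eventually_mono\<close>)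

lemma borel_M: "f \<in> borel_measurable borel ==> f \<in> borel_measurable M"
 by (intro measurable_restrict_space1 measurable_completion) simp

lemma p_pos: "0 < p" "0 <= p" using p_gt_1 by auto

text \<open>This is the p-th power of the L^p norm. Without the root it is a plain integral that can
  be compared with energies directly; the price is a triangle inequality with the factor
  2^p.\<close>

definition nrm :: "(real^'n => 'b::euclidean_space) => real" where
 "nrm f = (LINT x|M. norm (f x) powr p)"

lemma nrm_nonneg: "0 <= nrm f"
 unfolding nrm_def by (rule integral_nonneg_AE) simp

lemma Lp_iff: "f \<in> Lp p \<Omega> \<longleftrightarrow> f \<in> borel_measurable M \<and> integrable M (%x. norm (f x) powr p)"
 by (simp add: Lp_def)

lemma Lp_measurable: "f \<in> Lp p \<Omega> ==> f \<in> borel_measurable M"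
 and Lp_integrable_powr: "f \<in> Lp p \<Omega> ==> integrable M (%x. norm (f x) powr p)"
 by (simp_all add: Lp_def)

lemma norm_powr_measurable:
 fixes f :: "real^'n => 'b::euclidean_space"
 assumes [measurable]: "f \<in> borel_measurable M"
 shows "(%x. norm (f x) powr p) \<in> borel_measurable M"
 by measurable

lemma Lp_bound:
 assumes "f \<in> borel_measurable M" "integrable M g" "AE x in M. norm (f x) powr p <= g x"
 shows "f \<in> Lp p \<Omega>"
proof -
 have "integrable M (%x. norm (f x) powr p)"
 proof (rule integrable_bound[OF assms(2) norm_powr_measurable[OF assms(1)]])
  show "AE x in M. norm (norm (f x) powr p) <= norm (g x)"
   using assms(3) by eventually_elim auto
 qed
 then show ?thesis using assms(1) by (simp add: Lp_iff)
qed

lemma Lp_dominated: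
 assumes "f \<in> borel_measurable M" "g \<in> Lp p \<Omega>" "AE x in M. norm (f x) <= C * norm (g x)" "C \<ge> 0"
 shows "f \<in> Lp p \<Omega>" "nrm f <= C powr p * nrm g"
proof -
 have le: "AE x in M. norm (f x) powr p <= C powr p * norm (g x) powr p"
  using assms(3)
 proof eventually_elim
  case (elim x)
  have "norm (f x) powr p <= (C * norm (g x)) powr p"
   using elim p_pos by (intro powr_mono2) auto
  then show ?case using assms(4) by (simp add: powr_mult)
 qed
 have int: "integrable M (%x. C powr p * norm (g x) powr p)"
  using Lp_integrable_powr[OF assms(2)] by simp
 show f: "f \<in> Lp p \<Omega>" by (rule Lp_bound[OF assms(1) int le])
 have "nrm f <= (LINT x|M. C powr p * norm (g x) powr p)"
  unfolding nrm_def by (rule integral_mono_AE[OF Lp_integrable_powr[OF f] int le])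
 then show "nrm f <= C powr p * nrm g" by (simp add: nrm_def)
qed

lemma Lp_bounded:
 assumes "f \<in> borel_measurable M" "AE x in M. norm (f x) <= C"
 shows "f \<in> Lp p \<Omega>" "nrm f <= C powr p * measure M \<Omega>"
proof -
 have le: "AE x in M. norm (f x) powr p <= C powr p"
  using assms(2)
 proof eventually_elim
  case (elim x)
  show ?case using elim p_pos by (intro powr_mono2) auto
 qed
 show f: "f \<in> Lp p \<Omega>" by (rule Lp_bound[OF assms(1) _ le]) simp
 have "nrm f <= (LINT x|M. C powr p)"
  unfolding nrm_def by (rule integral_mono_AE[OF Lp_integrable_powr[OF f] _ le]) simp
 then show "nrm f <= C powr p * measure M \<Omega>" by (simp add: space_restrict_space mult.commute)
qed

lemma Lp_add:
 assumes "f \<in> Lp p \<Omega>" "g \<in> Lp p \<Omega>"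
 shows "(%x. f x + g x) \<in> Lp p \<Omega>" "nrm (%x. f x + g x) <= 2 powr p * (nrm f + nrm g)"
proof -
 note fi = Lp_integrable_powr[OF assms(1)] and gi = Lp_integrable_powr[OF assms(2)]
 have le: "norm (f x + g x) powr p <= 2 powr p * (norm (f x) powr p + norm (g x) powr p)" for x
 proof -
  have "norm (f x + g x) powr p <= (norm (f x) + norm (g x)) powr p"
   using p_pos by (intro powr_mono2 norm_triangle_ineq) auto
  also have "... <= 2 powr p * (norm (f x) powr p + norm (g x) powr p)"
   by (rule powr_add_le) (use p_pos in auto)
  finally show ?thesis .
 qed
 have int: "integrable M (%x. 2 powr p * (norm (f x) powr p + norm (g x) powr p))"
  using fi gi by (intro integrable_mult_right integrable_add)
 show fg: "(%x. f x + g x) \<in> Lp p \<Omega>"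
  by (rule Lp_bound[OF _ int]) (use le assms in \<open>auto intro: borel_measurable_add Lp_measurable\<close>)
 have "nrm (%x. f x + g x) <= (LINT x|M. 2 powr p * (norm (f x) powr p + norm (g x) powr p))"
  unfolding nrm_def by (rule integral_mono[OF Lp_integrable_powr[OF fg] int le])
 also have "... = 2 powr p * (nrm f + nrm g)"
  unfolding nrm_def using fi gi by simp
 finally show "nrm (%x. f x + g x) <= 2 powr p * (nrm f + nrm g)" .
qed

lemma Lp_scaleR:
 assumes "f \<in> Lp p \<Omega>"
 shows "(%x. c *\<^sub>R f x) \<in> Lp p \<Omega>" "nrm (%x. c *\<^sub>R f x) = \<bar>c\<bar> powr p * nrm f"
proof -
 have m: "(%x. c *\<^sub>R f x) \<in> borel_measurable M"
  using Lp_measurable[OF assms] by (intro borel_measurable_scaleR borel_measurable_const)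
 show "(%x. c *\<^sub>R f x) \<in> Lp p \<Omega>"
  by (rule Lp_dominated(1)[OF m assms, of "\<bar>c\<bar>"]) auto
 show "nrm (%x. c *\<^sub>R f x) = \<bar>c\<bar> powr p * nrm f"
  by (simp add: nrm_def powr_mult)
qed

lemma Lp_cmult: "f \<in> Lp p \<Omega> ==> (%x. c * f x :: real) \<in> Lp p \<Omega>"
 using Lp_scaleR(1)[of f c] by simp

lemma Lp_diff:
 assumes "f \<in> Lp p \<Omega>" "g \<in> Lp p \<Omega>"
 shows "(%x. f x - g x) \<in> Lp p \<Omega>" "nrm (%x. f x - g x) <= 2 powr p * (nrm f + nrm g)"
 using Lp_add[OF assms(1) Lp_scaleR(1)[OF assms(2), of "-1"]] Lp_scaleR(2)[OF assms(2), of "-1"] by simp_all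

lemma nrm_commute: "nrm (%x. f x - g x) = nrm (%x. g x - f x)"
 by (simp add: nrm_def norm_minus_commute)

lemma nrm_triangle:
 assumes "f \<in> Lp p \<Omega>" "g \<in> Lp p \<Omega>" "h \<in> Lp p \<Omega>"
 shows "nrm (%x. f x - h x) <= 2 powr p * (nrm (%x. f x - g x) + nrm (%x. g x - h x))"
 using Lp_add(2)[OF Lp_diff(1)[OF assms(1,2)] Lp_diff(1)[OF assms(2,3)]] by simp

lemma le_one_plus_powr:
 assumes "d > 0" "z \<ge> 0" shows "z <= d + d powr (1 - p) * z powr p"
 using young_split[OF p_gt_1 assms(1), of 1 z] assms(2) by simp

lemma Lp_integrable: "f \<in> Lp p \<Omega> ==> integrable M f"
proof (rule integrable_bound[of M "%x. 1 + norm (f x) powr p"])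
 assume f: "f \<in> Lp p \<Omega>"
 show "integrable M (%x. 1 + norm (f x) powr p)" using Lp_integrable_powr[OF f] by simp
 show "f \<in> borel_measurable M" by (rule Lp_measurable[OF f])
 show "AE x in M. norm (f x) <= norm (1 + norm (f x) powr p)"
  using le_one_plus_powr[of 1 "norm (f _)"] by (intro AE_I2) auto
qed

text \<open>\<open>young_split\<close> against the constant 1 on a domain of finite measure stands
  in for Hoelder's inequality. Choosing \<open>d\<close> small first and then \<open>nrm f\<close>
  small gives L^1 convergence.\<close>

lemma L1_le_nrm:
 assumes "f \<in> Lp p \<Omega>" "d > 0"
 shows "(LINT x|M. norm (f x)) <= d * measure M \<Omega> + d powr (1 - p) * nrm f"
proof -
 have "(LINT x|M. norm (f x)) <= (LINT x|M. d + d powr (1 - p) * norm (f x) powr p)"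
  using Lp_integrable[OF assms(1)] Lp_integrable_powr[OF assms(1)] le_one_plus_powr[OF assms(2)]
  by (intro integral_mono) auto
 also have "... = d * measure M \<Omega> + d powr (1 - p) * nrm f"
  using Lp_integrable_powr[OF assms(1)] by (simp add: nrm_def space_restrict_space mult.commute)
 finally show ?thesis .
qed

lemma L1_tendsto:
 assumes "!!n. f n \<in> Lp p \<Omega>" "(%n. nrm (f n)) \<longlonglongrightarrow> 0"
 shows "(%n. LINT x|M. norm (f n x)) \<longlonglongrightarrow> 0"
proof (rule LIMSEQ_I)
 fix e :: real assume e: "e > 0"
 define m where "m = measure M \<Omega> + 1"
 have m: "m > 0" "measure M \<Omega> <= m" by (auto simp: m_def add_nonneg_pos)
 define d where "d = e / (2 * m)"
 have d: "d > 0" "d * m = e / 2" using e m by (auto simp: d_def)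
 have "(%n. d powr (1 - p) * nrm (f n)) \<longlonglongrightarrow> d powr (1 - p) * 0"
  by (intro tendsto_mult tendsto_const assms(2))
 then have "\<forall>\<^sub>F n in sequentially. d powr (1 - p) * nrm (f n) < e / 2"
  using e by (intro order_tendstoD(2)) auto
 then obtain N where N: "!!n. n \<ge> N ==> d powr (1 - p) * nrm (f n) < e / 2"
  by (auto simp: eventually_sequentially)
 have "norm ((LINT x|M. norm (f n x)) - 0) < e" if "n \<ge> N" for n
 proof -
  have "0 <= (LINT x|M. norm (f n x))" by (rule integral_nonneg_AE) simp
  moreover have "d * measure M \<Omega> <= e / 2" using mult_left_mono[OF m(2), of d] d by simp
  ultimately show ?thesis using L1_le_nrm[OF assms(1) d(1), of n] N[OF that] by simp
 qed
 then show "\<exists>N. \<forall>n\<ge>N. norm ((LINT x|M. norm (f n x)) - 0) < e" by blast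
qed

lemma nrm_AE_subseq:
 assumes "!!n. f n \<in> Lp p \<Omega>" "g \<in> Lp p \<Omega>" "(%n. nrm (%x. f n x - g x)) \<longlonglongrightarrow> 0"
 obtains r :: "nat => nat" where "strict_mono r" "AE x in M. (%n. f (r n) x) \<longlonglongrightarrow> g x"
proof -
 have L: "(%x. f n x - g x) \<in> Lp p \<Omega>" for n by (rule Lp_diff(1)[OF assms(1,2)])
 obtain r :: "nat => nat" where r: "strict_mono r" "AE x in M. (%n. f (r n) x - g x) \<longlonglongrightarrow> 0"
  using tendsto_L1_AE_subseq[of M "%n x. f n x - g x"] Lp_integrable[OF L] L1_tendsto[OF L assms(3)] by blast
 have "AE x in M. (%n. f (r n) x) \<longlonglongrightarrow> g x"
  using r(2) by eventually_elim (simp add: LIM_zero_iff)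
 then show thesis using that r(1) by blast
qed

text \<open>A Cauchy sequence for \<open>nrm\<close> is Cauchy in L^1 and so has a subsequence
  converging almost everywhere. Fatou's lemma applied to the p-th powers of the differences then
  controls the whole sequence.\<close>

lemma Lp_complete:
 assumes f: "!!n. f n \<in> Lp p \<Omega>"
  and Cau: "!!e. e > 0 ==> \<exists>N. \<forall>m\<ge>N. \<forall>n\<ge>N. nrm (%x. f m x - f n x) < e"
 obtains g where "g \<in> Lp p \<Omega>" "(%n. nrm (%x. f n x - g x)) \<longlonglongrightarrow> 0"
proof -
 have fd: "(%x. f m x - f n x) \<in> Lp p \<Omega>" for m n by (rule Lp_diff(1)[OF f f])
 have "\<exists>N. \<forall>m\<ge>N. \<forall>n\<ge>N. (LINT x|M. norm (f m x - f n x)) < e" if e: "e > 0" for e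
 proof -
  define mm where "mm = measure M \<Omega> + 1"
  have mm: "mm > 0" "measure M \<Omega> <= mm" by (auto simp: mm_def add_nonneg_pos)
  define d where "d = e / (2 * mm)"
  have d: "d > 0" "d * mm = e / 2" using e mm by (auto simp: d_def)
  have dp: "d powr (1 - p) > 0" using d by simp
  obtain N where N: "!!m n. m \<ge> N ==> n \<ge> N ==> nrm (%x. f m x - f n x) < e / (2 * d powr (1 - p))"
   using Cau[of "e / (2 * d powr (1 - p))"] e dp by auto
  have "(LINT x|M. norm (f m x - f n x)) < e" if "m \<ge> N" "n \<ge> N" for m n
  proof -
   have "d powr (1 - p) * nrm (%x. f m x - f n x) < e / 2"
    using mult_strict_left_mono[OF N[OF that] dp] dp by simp
   moreover have "d * measure M \<Omega> <= e / 2" using mult_left_mono[OF mm(2), of d] d by simp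
   ultimately show ?thesis using L1_le_nrm[OF fd d(1), of m n] by linarith
  qed
  then show ?thesis by blast
 qed
 then obtain r g where r: "strict_mono (r :: nat => nat)" and g: "g \<in> borel_measurable M"
  and lim: "AE x in M. (%n. f (r n) x) \<longlonglongrightarrow> g x"
  using Cauchy_L1_AE_subseq[of M f] Lp_integrable[OF f] by blast
 have key: "integrable M (%x. norm (f n x - g x) powr p) \<and> nrm (%x. f n x - g x) <= e"
  if N: "!!m n. m \<ge> N ==> n \<ge> N ==> nrm (%x. f m x - f n x) < e" "n \<ge> N" for n N e
 proof -
  have lim': "AE x in M. (%k. norm (f n x - f (r (k + N)) x) powr p) \<longlonglongrightarrow> norm (f n x - g x) powr p"
   using lim
  proof eventually_elim
   case (elim x)
   have "(%k. f (r (k + N)) x) \<longlonglongrightarrow> g x"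
    using LIMSEQ_ignore_initial_segment[OF elim, of N] .
   then have "(%k. norm (f n x - f (r (k + N)) x)) \<longlonglongrightarrow> norm (f n x - g x)"
    by (intro tendsto_intros)
   then show ?case using p_pos by (intro tendsto_powr' tendsto_const) auto
  qed
  have m: "(%x. norm (f n x - g x) powr p) \<in> borel_measurable M"
   by (intro norm_powr_measurable borel_measurable_diff Lp_measurable[OF f] g)
  have le: "(LINT x|M. norm (f n x - f (r (k + N)) x) powr p) <= e" for k
   using N(1)[of n "r (k + N)"] N(2) seq_suble[OF r, of "k + N"] by (simp add: nrm_def)
  show ?thesis
   unfolding nrm_def
   using integrable_Fatou[of M "%k x. norm (f n x - f (r (k + N)) x) powr p", OF _ _ le m lim']
    Lp_integrable_powr[OF fd] by simp
 qed
 obtain N1 where N1: "!!m n. m \<ge> N1 ==> n \<ge> N1 ==> nrm (%x. f m x - f n x) < 1" using Cau[of 1] by auto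
 have "(%x. f N1 x - g x) \<in> Lp p \<Omega>"
  using key[OF N1, of N1] by (auto simp: Lp_iff intro!: borel_measurable_diff g Lp_measurable[OF f])
 from Lp_diff(1)[OF f[of N1] this] have gL: "g \<in> Lp p \<Omega>" by simp
 have "(%n. nrm (%x. f n x - g x)) \<longlonglongrightarrow> 0"
 proof (rule LIMSEQ_I)
  fix e :: real assume e: "e > 0"
  obtain N where N: "!!m n. m \<ge> N ==> n \<ge> N ==> nrm (%x. f m x - f n x) < e / 2" using Cau[of "e / 2"] e by auto
  have "norm (nrm (%x. f n x - g x) - 0) < e" if "n \<ge> N" for n
   using key[OF N that] e nrm_nonneg[of "%x. f n x - g x"] by simp
  then show "\<exists>N. \<forall>n\<ge>N. norm (nrm (%x. f n x - g x) - 0) < e" by blast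
 qed
 with gL show thesis by (rule that)
qed

lemma nrm_tendsto_dominated:
 fixes D :: "real^'n => 'b::euclidean_space"
 assumes D: "D \<in> Lp p \<Omega>" and c: "!!k. c k \<in> borel_measurable M" "!!k. AE x in M. \<bar>c k x\<bar> <= L"
  and lim: "AE x in M. (%k. c k x) \<longlonglongrightarrow> 0"
 shows "(%k. nrm (%x. c k x *\<^sub>R D x)) \<longlonglongrightarrow> 0"
proof -
 have m: "(%x. norm (c k x *\<^sub>R D x) powr p) \<in> borel_measurable M" for k
  by (intro norm_powr_measurable borel_measurable_scaleR c Lp_measurable[OF D])
 have "(%k. LINT x|M. norm (c k x *\<^sub>R D x) powr p) \<longlonglongrightarrow> (LINT x|M. 0)"
 proof (rule integral_dominated_convergence[where w="%x. \<bar>L\<bar> powr p * norm (D x) powr p"])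
  show "AE x in M. (%k. norm (c k x *\<^sub>R D x) powr p) \<longlonglongrightarrow> 0"
   using lim
  proof eventually_elim
   case (elim x)
   have "(%k. norm (c k x *\<^sub>R D x)) \<longlonglongrightarrow> norm (0 *\<^sub>R D x)" by (intro tendsto_intros elim)
   then have "(%k. norm (c k x *\<^sub>R D x) powr p) \<longlonglongrightarrow> norm (0 *\<^sub>R D x) powr p"
    using p_pos by (intro tendsto_powr' tendsto_const) auto
   then show ?case using p_pos by simp
  qed
  show "AE x in M. norm (norm (c k x *\<^sub>R D x) powr p) <= \<bar>L\<bar> powr p * norm (D x) powr p" for k
   using c(2)[of k]
  proof eventually_elim
   case (elim x)
   have "norm (c k x *\<^sub>R D x) powr p <= (\<bar>L\<bar> * norm (D x)) powr p"
    using elim p_pos by (intro powr_mono2) (auto intro!: mult_right_mono)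
   then show ?case by (simp add: powr_mult)
  qed
 qed (use m Lp_integrable_powr[OF D] in simp_all)
 then show ?thesis by (simp add: nrm_def)
qed

lemma test_Lp:
 assumes "\<phi> \<in> test_functions \<Omega>"
 shows "\<phi> \<in> Lp p \<Omega>" "grad \<phi> \<in> Lp p \<Omega>"
proof -
 obtain C where C: "!!x. \<bar>\<phi> x\<bar> <= C" "!!x. norm (grad \<phi> x) <= C"
  using test_functions_bounded[OF assms] by metis
 note sm = test_functions_smooth[OF assms]
 have "\<phi> \<in> borel_measurable M" "grad \<phi> \<in> borel_measurable M"
  by (rule borel_M[OF borel_measurable_continuous_onI], rule smooth_continuous smooth_grad_continuous, rule sm)+
 then show "\<phi> \<in> Lp p \<Omega>" "grad \<phi> \<in> Lp p \<Omega>"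
  using C by (auto intro!: Lp_bounded(1)[of _ C] AE_I2)
qed

text \<open>The gradient is carried along as a second argument, so that (u, D) lies in the closure
  of the graph of \<open>grad\<close> and no representative has to be chosen.
  \<open>W01p_iff\<close> shows that the projection to \<open>u\<close> is exactly
  \<open>W01p\<close>.\<close>

definition W0 :: "(real^'n => real) => (real^'n => real^'n) => bool" where
 "W0 u D \<longleftrightarrow> u \<in> Lp p \<Omega> \<and> D \<in> Lp p \<Omega> \<and>
  (\<forall>e>0. \<exists>\<phi>\<in>test_functions \<Omega>. nrm (%x. \<phi> x - u x) < e \<and> nrm (%x. grad \<phi> x - D x) < e)"

lemma W0_Lp: "W0 u D ==> u \<in> Lp p \<Omega>" "W0 u D ==> D \<in> Lp p \<Omega>"
 by (simp_all add: W0_def)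

lemma W0_measurable: "W0 u D ==> u \<in> borel_measurable M" "W0 u D ==> D \<in> borel_measurable M"
 by (simp_all add: W0_def Lp_iff)

lemma nrm_zero: "nrm (%x. 0) = 0"
 using p_pos by (simp add: nrm_def)

lemma W0_test: "\<phi> \<in> test_functions \<Omega> ==> W0 \<phi> (grad \<phi>)"
 unfolding W0_def using test_Lp[of \<phi>] by (auto intro!: bexI[of _ \<phi>] simp: nrm_zero)

lemma W0_approxI:
 assumes "u \<in> Lp p \<Omega>" "D \<in> Lp p \<Omega>"
  and appr: "!!e. e > 0 ==> \<exists>v E. W0 v E \<and> nrm (%x. v x - u x) < e \<and> nrm (%x. E x - D x) < e"
 shows "W0 u D"
 unfolding W0_def
proof (intro conjI assms(1,2) allI impI)
 fix e :: real assume e: "e > 0"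
 \<comment> \<open>Two errors below \<open>e'\<close>, added and multiplied by the quasi-triangle
   constant 2^p, stay below \<open>e\<close>.\<close>
 define e' where "e' = e / (2 powr p * 2)"
 have e': "e' > 0" "2 powr p * (e' + e') = e" using e by (auto simp: e'_def field_simps)
 obtain v E where v: "W0 v E" "nrm (%x. v x - u x) < e'" "nrm (%x. E x - D x) < e'"
  using appr[OF e'(1)] by blast
 obtain \<phi> where \<phi>: "\<phi> \<in> test_functions \<Omega>" "nrm (%x. \<phi> x - v x) < e'" "nrm (%x. grad \<phi> x - E x) < e'"
  using v(1) e'(1) unfolding W0_def by blast
 have pos: "(2::real) powr p > 0" by simp
 have "nrm (%x. \<phi> x - u x) < e"
 proof -
  have "nrm (%x. \<phi> x - u x) <= 2 powr p * (nrm (%x. \<phi> x - v x) + nrm (%x. v x - u x))"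
   by (rule nrm_triangle[OF test_Lp(1)[OF \<phi>(1)] W0_Lp(1)[OF v(1)] assms(1)])
  also have "... < 2 powr p * (e' + e')" using \<phi>(2) v(2) pos by (intro mult_strict_left_mono) auto
  finally show ?thesis using e'(2) by simp
 qed
 moreover have "nrm (%x. grad \<phi> x - D x) < e"
 proof -
  have "nrm (%x. grad \<phi> x - D x) <= 2 powr p * (nrm (%x. grad \<phi> x - E x) + nrm (%x. E x - D x))"
   by (rule nrm_triangle[OF test_Lp(2)[OF \<phi>(1)] W0_Lp(2)[OF v(1)] assms(2)])
  also have "... < 2 powr p * (e' + e')" using \<phi>(3) v(3) pos by (intro mult_strict_left_mono) auto
  finally show ?thesis using e'(2) by simp
 qed
 ultimately show "\<exists>\<phi>\<in>test_functions \<Omega>. nrm (%x. \<phi> x - u x) < e \<and> nrm (%x. grad \<phi> x - D x) < e"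
  using \<phi>(1) by blast
qed

lemma W0_limit:
 assumes "u \<in> Lp p \<Omega>" "D \<in> Lp p \<Omega>" "!!k. W0 (v k) (E k)"
  and "(%k. nrm (%x. v k x - u x)) \<longlonglongrightarrow> 0" "(%k. nrm (%x. E k x - D x)) \<longlonglongrightarrow> 0"
 shows "W0 u D"
proof (rule W0_approxI[OF assms(1,2)])
 fix e :: real assume "e > 0"
 then have "\<forall>\<^sub>F k in sequentially. nrm (%x. v k x - u x) < e \<and> nrm (%x. E k x - D x) < e"
  using order_tendstoD(2)[OF assms(4)] order_tendstoD(2)[OF assms(5)] by (simp add: eventually_conj)
 then obtain k where "nrm (%x. v k x - u x) < e \<and> nrm (%x. E k x - D x) < e"
  by (auto dest!: eventually_happens)
 then show "\<exists>v E. W0 v E \<and> nrm (%x. v x - u x) < e \<and> nrm (%x. E x - D x) < e"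
  using assms(3) by blast
qed

lemma W0_cong_AE:
 assumes "W0 u D" "v \<in> borel_measurable M" "E \<in> borel_measurable M" "AE x in M. v x = u x" "AE x in M. E x = D x"
 shows "W0 v E"
proof (rule W0_limit[of v E "%_. u" "%_. D"])
 show "v \<in> Lp p \<Omega>"
  by (rule Lp_dominated(1)[OF assms(2) W0_Lp(1)[OF assms(1)], of 1]) (use assms(4) in \<open>auto elim: eventually_mono\<close>)
 show "E \<in> Lp p \<Omega>"
  by (rule Lp_dominated(1)[OF assms(3) W0_Lp(2)[OF assms(1)], of 1]) (use assms(5) in \<open>auto elim: eventually_mono\<close>)
 have "nrm (%x. u x - v x) = (LINT x|M. 0)" unfolding nrm_def
 proof (intro integral_cong_AE norm_powr_measurable borel_measurable_diff W0_measurable[OF assms(1)] assms(2,3) borel_measurable_const)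
  show "AE x in M. norm (u x - v x) powr p = 0" using assms(4) by eventually_elim (use p_pos in simp)
 qed
 then show "(%k. nrm (%x. u x - v x)) \<longlonglongrightarrow> 0" by simp
 have "nrm (%x. D x - E x) = (LINT x|M. 0)" unfolding nrm_def
 proof (intro integral_cong_AE norm_powr_measurable borel_measurable_diff W0_measurable[OF assms(1)] assms(2,3) borel_measurable_const)
  show "AE x in M. norm (D x - E x) powr p = 0" using assms(5) by eventually_elim (use p_pos in simp)
 qed
 then show "(%k. nrm (%x. D x - E x)) \<longlonglongrightarrow> 0" by simp
qed (rule assms(1))

lemma W0_add:
 assumes "W0 u D" "W0 v E"
 shows "W0 (%x. u x + v x) (%x. D x + E x)"
 unfolding W0_def
proof (intro conjI allI impI)
 fix e :: real assume e: "e > 0"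
 define e' where "e' = e / (2 powr p * 2)"
 have e': "e' > 0" "2 powr p * (e' + e') = e" using e by (auto simp: e'_def field_simps)
 obtain \<phi> where \<phi>: "\<phi> \<in> test_functions \<Omega>" "nrm (%x. \<phi> x - u x) < e'" "nrm (%x. grad \<phi> x - D x) < e'"
  using assms(1) e'(1) unfolding W0_def by blast
 obtain \<psi> where \<psi>: "\<psi> \<in> test_functions \<Omega>" "nrm (%x. \<psi> x - v x) < e'" "nrm (%x. grad \<psi> x - E x) < e'"
  using assms(2) e'(1) unfolding W0_def by blast
 have pos: "(2::real) powr p > 0" by simp
 have "nrm (%x. (\<phi> x + \<psi> x) - (u x + v x)) < e"
 proof -
  have "nrm (%x. (\<phi> x - u x) + (\<psi> x - v x)) <= 2 powr p * (nrm (%x. \<phi> x - u x) + nrm (%x. \<psi> x - v x))"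
   by (intro Lp_add(2) Lp_diff(1) test_Lp \<phi> \<psi> W0_Lp(1)[OF assms(1)] W0_Lp(1)[OF assms(2)])
  also have "... < 2 powr p * (e' + e')" using \<phi>(2) \<psi>(2) pos by (intro mult_strict_left_mono) auto
  finally show ?thesis using e'(2) by (simp add: algebra_simps)
 qed
 moreover have "nrm (%x. grad (%x. \<phi> x + \<psi> x) x - (D x + E x)) < e"
 proof -
  have "nrm (%x. (grad \<phi> x - D x) + (grad \<psi> x - E x)) <= 2 powr p * (nrm (%x. grad \<phi> x - D x) + nrm (%x. grad \<psi> x - E x))"
   by (intro Lp_add(2) Lp_diff(1) test_Lp \<phi> \<psi> W0_Lp(2)[OF assms(1)] W0_Lp(2)[OF assms(2)])
  also have "... < 2 powr p * (e' + e')" using \<phi>(3) \<psi>(3) pos by (intro mult_strict_left_mono) auto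
  finally show ?thesis
   using e'(2) by (simp add: grad_add test_functions_smooth[OF \<phi>(1)] test_functions_smooth[OF \<psi>(1)] algebra_simps)
 qed
 ultimately show "\<exists>\<phi>\<in>test_functions \<Omega>. nrm (%x. \<phi> x - (u x + v x)) < e \<and> nrm (%x. grad \<phi> x - (D x + E x)) < e"
  using test_functions_add[OF \<phi>(1) \<psi>(1)] by (intro bexI[of _ "%x. \<phi> x + \<psi> x"] conjI)
qed (use assms in \<open>auto intro: Lp_add(1) W0_Lp\<close>)

lemma W0_scale:
 assumes "W0 u D"
 shows "W0 (%x. c * u x) (%x. c *\<^sub>R D x)"
 unfolding W0_def
proof (intro conjI allI impI)
 fix e :: real assume e: "e > 0"
 define k where "k = \<bar>c\<bar> powr p + 1"
 have k: "k > 0" "\<bar>c\<bar> powr p <= k" by (auto simp: k_def add_nonneg_pos)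
 obtain \<phi> where \<phi>: "\<phi> \<in> test_functions \<Omega>" "nrm (%x. \<phi> x - u x) < e / k" "nrm (%x. grad \<phi> x - D x) < e / k"
  using assms divide_pos_pos[OF e k(1)] unfolding W0_def by blast
 have le: "\<bar>c\<bar> powr p * t < e" if "t < e / k" "0 <= t" for t
 proof -
  have "\<bar>c\<bar> powr p * t <= k * t" using k that by (intro mult_right_mono) auto
  also have "... < e" using that k by (simp add: field_simps)
  finally show ?thesis .
 qed
 have "nrm (%x. c *\<^sub>R (\<phi> x - u x)) < e" "nrm (%x. c *\<^sub>R (grad \<phi> x - D x)) < e"
  using \<phi> Lp_scaleR(2)[OF Lp_diff(1)[OF test_Lp(1)[OF \<phi>(1)] W0_Lp(1)[OF assms]]]
   Lp_scaleR(2)[OF Lp_diff(1)[OF test_Lp(2)[OF \<phi>(1)] W0_Lp(2)[OF assms]]]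
  by (simp_all add: le nrm_nonneg)
 then show "\<exists>\<phi>\<in>test_functions \<Omega>. nrm (%x. \<phi> x - c * u x) < e \<and> nrm (%x. grad \<phi> x - c *\<^sub>R D x) < e"
  using test_functions_mult[OF \<phi>(1) smooth_const[of c]]
  by (intro bexI[of _ "%x. \<phi> x * c"])
   (simp_all add: grad_cmult test_functions_smooth[OF \<phi>(1)] mult.commute[of _ c] right_diff_distrib scaleR_right_diff_distrib)
qed (use assms in \<open>auto intro: Lp_cmult Lp_scaleR(1) W0_Lp\<close>)

lemma W0_diff:
 assumes "W0 u D" "W0 v E"
 shows "W0 (%x. u x - v x) (%x. D x - E x)"
 using W0_add[OF assms(1) W0_scale[OF assms(2), of "-1"]] by simp

lemma W0_zero: "W0 (%x. 0) (%x. 0)"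
proof -
 have "grad (%x::real^'n. 0) = (%x. 0)"
  by (rule ext, rule grad_eqI) simp
 then show ?thesis using W0_test[OF test_functions_0] by simp
qed

text \<open>Besides converging in norm, the sequence converges almost everywhere, and its gradient
  errors stay below the prescribed \<open>e\<close> for every k. This uniform bound is what the
  Fatou argument in \<open>W0_Hardy\<close> uses.\<close>

lemma W0_seq:
 assumes "W0 u D" "e > 0"
 shows "\<exists>\<phi>. (\<forall>k. \<phi> k \<in> test_functions \<Omega> \<and> nrm (%x. grad (\<phi> k) x - D x) < e) \<and>
  (%k. nrm (%x. \<phi> k x - u x)) \<longlonglongrightarrow> 0 \<and> (%k. nrm (%x. grad (\<phi> k) x - D x)) \<longlonglongrightarrow> 0 \<and>
  (AE x in M. (%k. \<phi> k x) \<longlonglongrightarrow> u x)"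
proof -
 have "\<forall>k. \<exists>\<phi>. \<phi> \<in> test_functions \<Omega> \<and> nrm (%x. \<phi> x - u x) < e * inverse (real (Suc k)) \<and>
   nrm (%x. grad \<phi> x - D x) < e * inverse (real (Suc k))"
 proof
  fix k
  have "e * inverse (real (Suc k)) > 0" using assms(2) by simp
  then show "\<exists>\<phi>. \<phi> \<in> test_functions \<Omega> \<and> nrm (%x. \<phi> x - u x) < e * inverse (real (Suc k)) \<and>
   nrm (%x. grad \<phi> x - D x) < e * inverse (real (Suc k))"
   using assms(1) unfolding W0_def by blast
 qed
 then obtain \<phi> where \<phi>: "\<forall>k. \<phi> k \<in> test_functions \<Omega> \<and> nrm (%x. \<phi> k x - u x) < e * inverse (real (Suc k)) \<and>
   nrm (%x. grad (\<phi> k) x - D x) < e * inverse (real (Suc k))"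
  by (rule choice[THEN exE])
 have lim0: "(%k. e * inverse (real (Suc k))) \<longlonglongrightarrow> 0"
  using tendsto_mult[OF tendsto_const[of e] LIMSEQ_inverse_real_of_nat] by simp
 have l1: "(%k. nrm (%x. \<phi> k x - u x)) \<longlonglongrightarrow> 0" and l2: "(%k. nrm (%x. grad (\<phi> k) x - D x)) \<longlonglongrightarrow> 0"
 proof -
  have b: "nrm (%x. \<phi> k x - u x) <= e * inverse (real (Suc k))" "nrm (%x. grad (\<phi> k) x - D x) <= e * inverse (real (Suc k))" for k
   using \<phi> less_imp_le by blast+
  show "(%k. nrm (%x. \<phi> k x - u x)) \<longlonglongrightarrow> 0"
   by (rule tendsto_sandwich[OF _ _ tendsto_const lim0]) (simp_all only: nrm_nonneg b eventually_True)
  show "(%k. nrm (%x. grad (\<phi> k) x - D x)) \<longlonglongrightarrow> 0"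
   by (rule tendsto_sandwich[OF _ _ tendsto_const lim0]) (simp_all only: nrm_nonneg b eventually_True)
 qed
 obtain r :: "nat => nat" where r: "strict_mono r" "AE x in M. (%n. \<phi> (r n) x) \<longlonglongrightarrow> u x"
  using nrm_AE_subseq[OF test_Lp(1) W0_Lp(1)[OF assms(1)] l1] \<phi> by blast
 show ?thesis
 proof (intro exI[of _ "%k. \<phi> (r k)"] conjI allI)
  show "nrm (%x. grad (\<phi> (r k)) x - D x) < e" for k
  proof -
   have "inverse (real (Suc (r k))) <= 1" by (simp add: field_simps)
   then have "e * inverse (real (Suc (r k))) <= e" using assms(2) by (simp add: mult_left_le)
   moreover have "nrm (%x. grad (\<phi> (r k)) x - D x) < e * inverse (real (Suc (r k)))" using \<phi> by blast
   ultimately show ?thesis by linarith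
  qed
  show "(%k. nrm (%x. \<phi> (r k) x - u x)) \<longlonglongrightarrow> 0" "(%k. nrm (%x. grad (\<phi> (r k)) x - D x)) \<longlonglongrightarrow> 0"
   using LIMSEQ_subseq_LIMSEQ[OF l1 r(1)] LIMSEQ_subseq_LIMSEQ[OF l2 r(1)] by (simp_all add: o_def)
 qed (use \<phi> r(2) in blast)+
qed

end

section \<open>Weak gradients, the Hardy and Poincare inequalities, completeness and Rellich
  compactness\<close>

context sobolev_domain
begin

lemma integral_M_support:
 fixes f :: "real^'n => 'b::{banach, second_countable_topology}"
 assumes "continuous_on UNIV f" "compact K" "K \<subseteq> \<Omega>" "!!x. x \<notin> K ==> f x = 0"
 shows "(LINT x|M. f x) = (LINT x|lborel. f x)" "integrable M f" "integrable lborel f"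
proof -
 have m: "f \<in> borel_measurable borel" using assms(1) by (rule borel_measurable_continuous_onI)
 have z: "f x = 0" if "x \<notin> \<Omega>" for x using that assms(3,4) by blast
 show i: "integrable lborel f"
  by (rule integrable_compact_support[OF assms(1) compact_imp_bounded[OF assms(2)] assms(4)])
 show "(LINT x|M. f x) = (LINT x|lborel. f x)"
  by (rule integral_lebesgue_on_support(1)[OF m sets_domain z])
 show "integrable M f"
  using integral_lebesgue_on_support(2)[OF m sets_domain z] i by blast
qed

lemma locally_integrable_mult_test:
 fixes f :: "real^'n => real"
 assumes "!!K. compact K ==> K \<subseteq> \<Omega> ==> integrable (lebesgue_on K) f" "\<phi> \<in> test_functions \<Omega>"
 shows "integrable M (%x. f x * \<phi> x)"
proof -
 obtain K where K: "compact K" "K \<subseteq> \<Omega>" "\<forall>x. x \<notin> K \<longrightarrow> \<phi> x = 0 \<and> grad \<phi> x = 0"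
  using test_functions_support[OF assms(2)] by blast
 obtain C where C: "!!x. \<bar>\<phi> x\<bar> <= C" using test_functions_bounded[OF assms(2)] by metis
 have Kl: "K \<in> sets lebesgue" using K(1) by (simp add: borel_compact)
 have i: "integrable lebesgue (%x. indicator K x *\<^sub>R f x)"
  using assms(1)[OF K(1,2)] Kl by (subst (asm) integrable_restrict_space) auto
 have \<phi>m: "\<phi> \<in> borel_measurable lebesgue"
  using smooth_continuous[OF test_functions_smooth[OF assms(2)], of UNIV]
  by (intro measurable_completion) (simp add: borel_measurable_continuous_onI)
 have "integrable lebesgue (%x. (indicator K x *\<^sub>R f x) * \<phi> x)"
 proof (rule integrable_bound)
  show "integrable lebesgue (%x. C * (indicator K x *\<^sub>R f x))" using i by simp
  show "(%x. (indicator K x *\<^sub>R f x) * \<phi> x) \<in> borel_measurable lebesgue"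
   by (intro borel_measurable_times[OF borel_measurable_integrable[OF i] \<phi>m])
  show "AE x in lebesgue. norm ((indicator K x *\<^sub>R f x) * \<phi> x) <= norm (C * (indicator K x *\<^sub>R f x))"
  proof (rule AE_I2)
   fix x
   have "\<bar>\<phi> x\<bar> <= \<bar>C\<bar>" using C[of x] by linarith
   then show "norm ((indicator K x *\<^sub>R f x) * \<phi> x) <= norm (C * (indicator K x *\<^sub>R f x))"
    using mult_left_mono[of "\<bar>\<phi> x\<bar>" "\<bar>C\<bar>" "\<bar>indicator K x *\<^sub>R f x\<bar>"]
    by (simp only: real_norm_def abs_mult mult.commute[of "\<bar>C\<bar>"] abs_ge_zero)
  qed
 qed
 moreover have "(%x. (indicator K x *\<^sub>R f x) * \<phi> x) = (%x. indicator \<Omega> x *\<^sub>R (f x * \<phi> x))"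
  using K(2,3) by (auto simp: fun_eq_iff indicator_def)
 ultimately show ?thesis
  using sets_domain by (subst integrable_restrict_space) auto
qed

lemma integrable_imp_locally:
 fixes f :: "real^'n => 'b::euclidean_space"
 assumes "integrable M f"
 shows "locally_integrable \<Omega> f"
 unfolding locally_integrable_def
proof (intro allI impI)
 fix K assume K: "compact K \<and> K \<subseteq> \<Omega>"
 then have Kl: "K \<in> sets lebesgue" by (simp add: borel_compact)
 have "integrable lebesgue (%x. indicator \<Omega> x *\<^sub>R f x)"
  using assms sets_domain by (subst (asm) integrable_restrict_space) auto
 then have "integrable lebesgue (%x. indicator K x *\<^sub>R (indicator \<Omega> x *\<^sub>R f x))"
  by (rule integrable_mult_indicator[OF Kl])
 moreover have "(%x. indicator K x *\<^sub>R (indicator \<Omega> x *\<^sub>R f x)) = (%x. indicator K x *\<^sub>R f x)"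
  using K by (auto simp: fun_eq_iff indicator_def)
 ultimately show "integrable (lebesgue_on K) f"
  using Kl by (subst integrable_restrict_space) auto
qed

lemma test_integral_by_parts:
 assumes \<phi>: "\<phi> \<in> test_functions \<Omega>" and \<psi>: "\<psi> \<in> test_functions \<Omega>"
 shows "(LINT x|M. \<phi> x * partial_deriv i \<psi> x + grad \<phi> x $ i * \<psi> x) = 0"
proof -
 have P: "(%x. \<phi> x * \<psi> x) \<in> test_functions \<Omega>"
  by (rule test_functions_mult[OF \<phi> test_functions_smooth[OF \<psi>]])
 obtain K where K: "C1_compact (%x. \<phi> x * \<psi> x) (grad (%x. \<phi> x * \<psi> x)) K" "K \<subseteq> \<Omega>"
  using test_functions_C1_compact[OF P] by blast
 have g: "grad (%x. \<phi> x * \<psi> x) x \<bullet> axis i 1 = \<phi> x * partial_deriv i \<psi> x + grad \<phi> x $ i * \<psi> x" for x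
  by (simp add: grad_mult[OF test_functions_smooth[OF \<phi>] test_functions_smooth[OF \<psi>]] inner_axis partial_deriv_grad[symmetric] mult.commute)
 have "(LINT x|M. grad (%x. \<phi> x * \<psi> x) x \<bullet> axis i 1) = (LINT x|lborel. grad (%x. \<phi> x * \<psi> x) x \<bullet> axis i 1)"
  using K by (intro integral_M_support(1)[of _ K] continuous_on_inner continuous_on_const) (auto simp: C1_compact_def)
 also have "... = 0" by (rule C1_compact_integral_derivative[OF K(1)])
 finally show ?thesis unfolding g .
qed

lemma W0_has_weak_gradient:
 assumes "W0 u D"
 shows "has_weak_gradient \<Omega> u D"
 unfolding has_weak_gradient_def
proof (intro conjI ballI allI)
 note ui = Lp_integrable[OF W0_Lp(1)[OF assms]] and Di = Lp_integrable[OF W0_Lp(2)[OF assms]]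
 show "locally_integrable \<Omega> u" by (rule integrable_imp_locally[OF ui])
 show "locally_integrable \<Omega> D" by (rule integrable_imp_locally[OF Di])
 fix \<psi> i assume \<psi>: "\<psi> \<in> test_functions \<Omega>"
 obtain C where C: "C > 0" "!!x. \<bar>\<psi> x\<bar> <= C" "!!x. norm (grad \<psi> x) <= C"
  using test_functions_bounded[OF \<psi>] by metis
 have C': "\<bar>partial_deriv i \<psi> x\<bar> <= C" for x
  using component_le_norm_cart[of "grad \<psi> x" i] C(3)[of x] by (simp add: partial_deriv_grad)
 obtain \<phi> where \<phi>: "!!k. \<phi> k \<in> test_functions \<Omega>"
  "(%k. nrm (%x. \<phi> k x - u x)) \<longlonglongrightarrow> 0" "(%k. nrm (%x. grad (\<phi> k) x - D x)) \<longlonglongrightarrow> 0"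
  using W0_seq[OF assms zero_less_one] by blast
 have \<psi>m: "\<psi> \<in> borel_measurable M" "partial_deriv i \<psi> \<in> borel_measurable M"
  by (rule borel_M[OF borel_measurable_continuous_onI[OF smooth_continuous]];
    simp add: test_functions_smooth[OF \<psi>] smooth_partial_deriv)+
 have mult_int: "integrable M (%x. a x * \<psi> x)" "integrable M (%x. a x * partial_deriv i \<psi> x)"
  if a: "integrable M a" for a :: "real^'n => real"
 proof -
  have Ca: "integrable M (%x. C * a x)" using a by simp
  have 1: "norm (a x * \<psi> x) <= norm (C * a x)" for x
   using mult_mono[OF C(2)[of x] order_refl[of "\<bar>a x\<bar>"]] C(1) by (simp add: abs_mult mult.commute)
  have 2: "norm (a x * partial_deriv i \<psi> x) <= norm (C * a x)" for x
   using mult_mono[OF C'[of x] order_refl[of "\<bar>a x\<bar>"]] C(1) by (simp add: abs_mult mult.commute)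
  show "integrable M (%x. a x * \<psi> x)"
   by (rule integrable_bound[OF Ca])
    (use 1 in \<open>auto intro!: AE_I2 borel_measurable_times \<psi>m borel_measurable_integrable[OF a] simp del: real_norm_def\<close>)
  show "integrable M (%x. a x * partial_deriv i \<psi> x)"
   by (rule integrable_bound[OF Ca])
    (use 2 in \<open>auto intro!: AE_I2 borel_measurable_times \<psi>m borel_measurable_integrable[OF a] simp del: real_norm_def\<close>)
 qed
 have Dii: "integrable M (%x. D x $ i)"
  using Di integrable_inner_left[of "axis i 1" M D] by (simp add: inner_axis)
 note u1 = mult_int(2)[OF ui] and D1 = mult_int(1)[OF Dii]
 \<comment> \<open>\<open>S\<close> is the defect in the integration by parts formula. The same
   expression vanishes for each \<open>\<phi> k\<close>, so \<open>S\<close> is bounded by the L^1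
   errors of the approximation.\<close>
 define S where "S = (LINT x|M. u x * partial_deriv i \<psi> x + D x $ i * \<psi> x)"
 have bd: "\<bar>S\<bar> <= C * (LINT x|M. norm (\<phi> k x - u x)) + C * (LINT x|M. norm (grad (\<phi> k) x - D x))" for k
 proof -
  note pk = Lp_integrable[OF test_Lp(1)[OF \<phi>(1)[of k]]] and gk = Lp_integrable[OF test_Lp(2)[OF \<phi>(1)[of k]]]
  have gki: "integrable M (%x. grad (\<phi> k) x $ i)"
   using gk integrable_inner_left[of "axis i 1" M "grad (\<phi> k)"] by (simp add: inner_axis)
  have "S = S - (LINT x|M. \<phi> k x * partial_deriv i \<psi> x + grad (\<phi> k) x $ i * \<psi> x)"
   using test_integral_by_parts[OF \<phi>(1) \<psi>] by simp
  also have "... = (LINT x|M. (u x * partial_deriv i \<psi> x + D x $ i * \<psi> x) - (\<phi> k x * partial_deriv i \<psi> x + grad (\<phi> k) x $ i * \<psi> x))"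
   unfolding S_def using u1 D1 mult_int(2)[OF pk] mult_int(1)[OF gki]
   by (intro integral_diff[symmetric] integrable_add)
  finally have "\<bar>S\<bar> = norm (LINT x|M. (u x * partial_deriv i \<psi> x + D x $ i * \<psi> x) - (\<phi> k x * partial_deriv i \<psi> x + grad (\<phi> k) x $ i * \<psi> x))"
   by simp
  also have "... <= (LINT x|M. C * norm (\<phi> k x - u x) + C * norm (grad (\<phi> k) x - D x))"
  proof (rule integral_norm_bound_integral)
   show "integrable M (%x. (u x * partial_deriv i \<psi> x + D x $ i * \<psi> x) - (\<phi> k x * partial_deriv i \<psi> x + grad (\<phi> k) x $ i * \<psi> x))"
    using u1 D1 mult_int(2)[OF pk] mult_int(1)[OF gki]
    by (intro integrable_diff integrable_add)
   show "integrable M (%x. C * norm (\<phi> k x - u x) + C * norm (grad (\<phi> k) x - D x))"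
    using pk gk ui Di by auto
   fix x
   have "norm ((u x * partial_deriv i \<psi> x + D x $ i * \<psi> x) - (\<phi> k x * partial_deriv i \<psi> x + grad (\<phi> k) x $ i * \<psi> x))
     = \<bar>- ((\<phi> k x - u x) * partial_deriv i \<psi> x) - (grad (\<phi> k) x - D x) $ i * \<psi> x\<bar>"
    by (simp add: algebra_simps)
   also have "... <= \<bar>(\<phi> k x - u x) * partial_deriv i \<psi> x\<bar> + \<bar>(grad (\<phi> k) x - D x) $ i * \<psi> x\<bar>"
    by linarith
   also have "... <= \<bar>\<phi> k x - u x\<bar> * C + norm (grad (\<phi> k) x - D x) * C"
    unfolding abs_mult using C' C(1,2) component_le_norm_cart[of "grad (\<phi> k) x - D x" i]
    by (intro add_mono mult_mono) auto
   finally show "norm ((u x * partial_deriv i \<psi> x + D x $ i * \<psi> x) - (\<phi> k x * partial_deriv i \<psi> x + grad (\<phi> k) x $ i * \<psi> x))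
     <= C * norm (\<phi> k x - u x) + C * norm (grad (\<phi> k) x - D x)" by (simp add: mult.commute)
  qed
  also have "... = C * (LINT x|M. norm (\<phi> k x - u x)) + C * (LINT x|M. norm (grad (\<phi> k) x - D x))"
   using pk gk ui Di by simp
  finally show ?thesis .
 qed
 have "(%k. C * (LINT x|M. norm (\<phi> k x - u x)) + C * (LINT x|M. norm (grad (\<phi> k) x - D x))) \<longlonglongrightarrow> C * 0 + C * 0"
  by (intro tendsto_add tendsto_mult tendsto_const L1_tendsto \<phi>(2,3) Lp_diff(1) test_Lp \<phi>(1) W0_Lp[OF assms])
 then have "\<bar>S\<bar> <= 0" using bd by (intro LIMSEQ_le_const) auto
 then have "(LINT x|M. u x * partial_deriv i \<psi> x) + (LINT x|M. D x $ i * \<psi> x) = 0"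
  unfolding S_def using u1 D1 by simp
 then show "(LINT x|M. u x * partial_deriv i \<psi> x) = - (LINT x|M. D x $ i * \<psi> x)" by linarith
qed

lemma weak_gradient_unique:
 assumes "has_weak_gradient \<Omega> u D" "has_weak_gradient \<Omega> u E"
 shows "AE x in M. D x = E x"
proof -
 have "AE x in M. D x $ i - E x $ i = 0" for i
 proof (rule fundamental_lemma[OF open_domain])
  have int: "integrable (lebesgue_on K) (%x. D x $ i)" "integrable (lebesgue_on K) (%x. E x $ i)"
   if "compact K" "K \<subseteq> \<Omega>" for K
   using assms that integrable_inner_left[of "axis i 1" "lebesgue_on K" D]
    integrable_inner_left[of "axis i 1" "lebesgue_on K" E]
   by (simp_all add: has_weak_gradient_def locally_integrable_def inner_axis)
  show "integrable (lebesgue_on K) (%x. D x $ i - E x $ i)" if "compact K" "K \<subseteq> \<Omega>" for K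
   using int[OF that] by (rule integrable_diff)
  fix \<phi> assume \<phi>: "\<phi> \<in> test_functions \<Omega>"
  have "(LINT x|M. (D x $ i - E x $ i) * \<phi> x) = (LINT x|M. D x $ i * \<phi> x) - (LINT x|M. E x $ i * \<phi> x)"
   unfolding left_diff_distrib
   by (intro integral_diff locally_integrable_mult_test int \<phi>)
  also have "... = 0" 
  proof -
   have "(LINT x|M. u x * partial_deriv i \<phi> x) = - (LINT x|M. D x $ i * \<phi> x)"
    "(LINT x|M. u x * partial_deriv i \<phi> x) = - (LINT x|M. E x $ i * \<phi> x)"
    using assms \<phi> by (simp_all add: has_weak_gradient_def)
   then show ?thesis by linarith
  qed
  finally show "(LINT x|M. (D x $ i - E x $ i) * \<phi> x) = 0" .
 qed
 then have "AE x in M. \<forall>i. D x $ i - E x $ i = 0" by (simp add: AE_all_countable)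
 then show ?thesis by eventually_elim (simp add: vec_eq_iff)
qed

lemma W0_unique: "W0 u D ==> W0 u E ==> AE x in M. D x = E x"
 by (rule weak_gradient_unique) (rule W0_has_weak_gradient, assumption)+

lemma W01p_iff: "u \<in> W01p p \<Omega> \<longleftrightarrow> (\<exists>D. W0 u D)"
proof
 assume "u \<in> W01p p \<Omega>"
 then obtain D and \<phi> :: "nat => real^'n => real" where u: "u \<in> Lp p \<Omega>" and D: "D \<in> Lp p \<Omega>"
  and \<phi>: "!!k. \<phi> k \<in> test_functions \<Omega>" "(%k. LINT x|M. \<bar>\<phi> k x - u x\<bar> powr p) \<longlonglongrightarrow> 0"
   "(%k. LINT x|M. norm (grad (\<phi> k) x - D x) powr p) \<longlonglongrightarrow> 0"
  unfolding W01p_def W1p_def by auto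
 have "W0 u D"
  by (rule W0_limit[OF u D W0_test[OF \<phi>(1)]]) (use \<phi>(2,3) in \<open>simp_all add: nrm_def\<close>)
 then show "\<exists>D. W0 u D" by blast
next
 assume "\<exists>D. W0 u D"
 then obtain D where W: "W0 u D" by blast
 obtain \<phi> where \<phi>: "!!k. \<phi> k \<in> test_functions \<Omega>"
  "(%k. nrm (%x. \<phi> k x - u x)) \<longlonglongrightarrow> 0" "(%k. nrm (%x. grad (\<phi> k) x - D x)) \<longlonglongrightarrow> 0"
  using W0_seq[OF W zero_less_one] by blast
 show "u \<in> W01p p \<Omega>"
  unfolding W01p_def W1p_def mem_Collect_eq
  using W0_has_weak_gradient[OF W] W0_Lp[OF W] \<phi>[unfolded nrm_def real_norm_def] by blast
qed

text \<open>The factor 2^p is lost when the gradient energy of an approximating test function is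
  compared with that of its limit by the quasi-triangle inequality.\<close>

definition hardy_const :: real where
 "hardy_const = ((real CARD('n) - p) / (2 * p)) powr (- p) * 2 powr p"

lemma hardy_const_nonneg: "0 <= hardy_const"
 by (simp add: hardy_const_def)

lemma W0_Hardy:
 assumes "W0 u D"
 shows "integrable M (%x. \<bar>u x\<bar> powr p / norm x powr p)"
  "(LINT x|M. \<bar>u x\<bar> powr p / norm x powr p) <= hardy_const * nrm D"
proof -
 have um: "u \<in> borel_measurable M" by (rule W0_measurable[OF assms])
 have nm: "(%x. norm x powr p) \<in> borel_measurable M" by (rule borel_M) simp
 have m: "(%x. \<bar>u x\<bar> powr p / norm x powr p) \<in> borel_measurable M"
  using norm_powr_measurable[OF um] nm by (simp add: borel_measurable_divide)
 have main: "integrable M (%x. \<bar>u x\<bar> powr p / norm x powr p) \<and>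
   (LINT x|M. \<bar>u x\<bar> powr p / norm x powr p) <= hardy_const * (e + nrm D)" if e: "e > 0" for e
 proof -
  obtain \<phi> where \<phi>: "!!k. \<phi> k \<in> test_functions \<Omega>" "!!k. nrm (%x. grad (\<phi> k) x - D x) < e"
   "AE x in M. (%k. \<phi> k x) \<longlonglongrightarrow> u x"
   using W0_seq[OF assms e] by blast
  define X where "X k x = \<bar>\<phi> k x\<bar> powr p / norm x powr p" for k x
  have X: "integrable M (X k) \<and> (LINT x|M. X k x) <= hardy_const * (e + nrm D)" for k
  proof -
   obtain K where K: "C1_compact (\<phi> k) (grad (\<phi> k)) K" "K \<subseteq> \<Omega>"
    using test_functions_C1_compact[OF \<phi>(1)] by blast
   then have K': "compact K" "continuous_on UNIV (grad (\<phi> k))" "!!x. x \<notin> K ==> \<phi> k x = 0 \<and> grad (\<phi> k) x = 0"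
    by (auto simp: C1_compact_def)
   have Xm: "X k \<in> borel_measurable borel"
    unfolding X_def using borel_measurable_continuous_onI[OF C1_compact_continuous[OF K(1)]] by simp
   have z: "X k x = 0" if "x \<notin> \<Omega>" for x
    using K'(3)[of x] K(2) that p_pos by (auto simp: X_def)
   have "(LINT x|M. X k x) = (LINT x|lborel. X k x)"
    by (rule integral_lebesgue_on_support(1)[OF Xm sets_domain z])
   also have "... <= ((real CARD('n) - p) / (2 * p)) powr (- p) * (LINT x|lborel. norm (grad (\<phi> k) x) powr p)"
    unfolding X_def by (rule Hardy_C1(2)[OF K(1) p_gt_1 p_less])
   also have "(LINT x|lborel. norm (grad (\<phi> k) x) powr p) = nrm (grad (\<phi> k))"
    unfolding nrm_def
    by (rule integral_M_support(1)[of _ K, symmetric])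
     (use K' K(2) p_pos continuous_on_compose2[OF continuous_on_abs_powr[of p UNIV] continuous_on_norm[OF K'(2)]] in auto)
   also have "((real CARD('n) - p) / (2 * p)) powr (- p) * nrm (grad (\<phi> k))
     <= ((real CARD('n) - p) / (2 * p)) powr (- p) * (2 powr p * (e + nrm D))"
   proof (rule mult_left_mono)
    have "nrm (grad (\<phi> k)) <= 2 powr p * (nrm (%x. grad (\<phi> k) x - D x) + nrm D)"
     using Lp_add(2)[OF Lp_diff(1)[OF test_Lp(2)[OF \<phi>(1)[of k]] W0_Lp(2)[OF assms]] W0_Lp(2)[OF assms]] by simp
    also have "... <= 2 powr p * (e + nrm D)"
     using less_imp_le[OF \<phi>(2)[of k]] by (intro mult_left_mono add_right_mono) auto
    finally show "nrm (grad (\<phi> k)) <= 2 powr p * (e + nrm D)" .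
   qed simp
   finally have "(LINT x|M. X k x) <= hardy_const * (e + nrm D)"
    by (simp add: hardy_const_def mult.assoc)
   moreover have "integrable M (X k)"
    using integral_lebesgue_on_support(2)[OF Xm sets_domain z] Hardy_C1(1)[OF K(1) p_gt_1 p_less]
    unfolding X_def[abs_def] by blast
   ultimately show ?thesis by blast
  qed
  have lim: "AE x in M. (%k. X k x) \<longlonglongrightarrow> \<bar>u x\<bar> powr p / norm x powr p"
   using \<phi>(3) AE_M_nonzero
  proof eventually_elim
   case (elim x)
   have "(%k. \<bar>\<phi> k x\<bar> powr p) \<longlonglongrightarrow> \<bar>u x\<bar> powr p"
    using p_pos elim by (intro tendsto_powr' tendsto_rabs tendsto_const) auto
   then show ?case unfolding X_def using elim by (intro tendsto_divide tendsto_const) auto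
  qed
  have X0: "AE x in M. 0 <= X k x" for k by (rule AE_I2) (simp add: X_def)
  show ?thesis
   using integrable_Fatou[of M X, OF _ X0 _ m lim] X by blast
 qed
 show "integrable M (%x. \<bar>u x\<bar> powr p / norm x powr p)" using main[of 1] by simp
 show "(LINT x|M. \<bar>u x\<bar> powr p / norm x powr p) <= hardy_const * nrm D"
 proof (rule field_le_epsilon)
  fix e :: real assume e: "e > 0"
  have "hardy_const * (e / (hardy_const + 1) + nrm D) <= hardy_const * nrm D + e"
  proof -
   have "hardy_const * (e / (hardy_const + 1)) <= (hardy_const + 1) * (e / (hardy_const + 1))"
    using e hardy_const_nonneg by (intro mult_right_mono) auto
   also have "... = e" using hardy_const_nonneg by simp
   finally show ?thesis by (simp add: distrib_left)
  qed
  moreover have "e / (hardy_const + 1) > 0" using e hardy_const_nonneg by (simp add: add_nonneg_pos)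
  ultimately show "(LINT x|M. \<bar>u x\<bar> powr p / norm x powr p) <= hardy_const * nrm D + e"
   using main[of "e / (hardy_const + 1)"] by linarith
 qed
qed

lemma domain_radius: "\<exists>R. R > 0 \<and> (\<forall>x\<in>\<Omega>. norm x <= R)"
 using bounded_domain by (simp add: bounded_pos)

text \<open>With |x| <= R on the domain one has |u|^p <= R^p |u|^p / |x|^p, so Poincare's inequality
  follows from Hardy's.\<close>

definition poincare_const :: real where
 "poincare_const = (SOME R. R > 0 \<and> (\<forall>x\<in>\<Omega>. norm x <= R)) powr p * hardy_const"

lemma W0_Poincare:
 assumes "W0 u D" shows "nrm u <= poincare_const * nrm D"
proof -
 define R where "R = (SOME R. R > 0 \<and> (\<forall>x\<in>\<Omega>. norm x <= R))"
 have "R > 0 \<and> (\<forall>x\<in>\<Omega>. norm x <= R)"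
  unfolding R_def by (rule someI_ex[OF domain_radius])
 then have R: "R > 0" "!!x. x \<in> \<Omega> ==> norm x <= R" by auto
 note h = W0_Hardy[OF assms]
 have "nrm u <= (LINT x|M. R powr p * (\<bar>u x\<bar> powr p / norm x powr p))"
  unfolding nrm_def
 proof (rule integral_mono_AE)
  show "integrable M (%x. norm (u x) powr p)" by (rule Lp_integrable_powr[OF W0_Lp(1)[OF assms]])
  show "integrable M (%x. R powr p * (\<bar>u x\<bar> powr p / norm x powr p))" by (rule integrable_mult_right[OF h(1)])
  show "AE x in M. norm (u x) powr p <= R powr p * (\<bar>u x\<bar> powr p / norm x powr p)"
   using AE_M_domain AE_M_nonzero
  proof eventually_elim
   case (elim x)
   have "norm x powr p <= R powr p" using R elim p_pos by (intro powr_mono2) auto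
   then have "\<bar>u x\<bar> powr p * norm x powr p <= \<bar>u x\<bar> powr p * R powr p" by (intro mult_left_mono) auto
   then show ?case using elim by (simp add: field_simps)
  qed
 qed
 also have "... = R powr p * (LINT x|M. \<bar>u x\<bar> powr p / norm x powr p)" by (rule integral_mult_right_zero)
 also have "... <= R powr p * (hardy_const * nrm D)" using h(2) by (intro mult_left_mono) auto
 finally show ?thesis by (simp add: poincare_const_def R_def[symmetric] mult.assoc)
qed

lemma poincare_const_nonneg: "0 <= poincare_const"
 by (simp add: poincare_const_def hardy_const_nonneg)

text \<open>Hardy's inequality for a compactly supported C^1 function that is at least 1 on the
  domain; this replaces a computation in polar coordinates.\<close>

lemma integrable_inverse_norm_powr: "integrable M (%x. 1 / norm x powr p)"
proof -
 obtain R where R: "R > 0" "!!x. x \<in> \<Omega> ==> norm x <= R" using domain_radius by blast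
 define s where "s x = R\<^sup>2 + 1 - x \<bullet> x" for x :: "real^'n"
 define g where "g x = (max 0 (s x))\<^sup>2" for x :: "real^'n"
 have "C1_compact g (%x. (- 4 * max 0 (s x)) *\<^sub>R x) (cball 0 (R + 1))"
  unfolding C1_compact_def
 proof (intro conjI allI impI)
  show "continuous_on UNIV (%x. (- 4 * max 0 (s x)) *\<^sub>R x)"
   unfolding s_def by (intro continuous_intros)
  show "(g has_derivative (%h. ((- 4 * max 0 (s x)) *\<^sub>R x) \<bullet> h)) (at x)" for x
  proof -
   have "(s has_derivative (%h. - (2 * (x \<bullet> h)))) (at x)"
    unfolding s_def by (auto intro!: derivative_eq_intros simp: inner_commute)
   moreover have "((%s. (max 0 s)\<^sup>2) has_derivative (%h. 2 * max 0 (s x) * h)) (at (s x))"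
    using DERIV_pos_part_square[of "s x"] by (simp add: has_field_derivative_def)
   ultimately have "(g has_derivative (%h. 2 * max 0 (s x) * - (2 * (x \<bullet> h)))) (at x)"
    unfolding g_def by (rule has_derivative_compose)
   then show ?thesis by (rule has_derivative_eq_rhs) (simp add: fun_eq_iff)
  qed
  fix x :: "real^'n" assume "x \<notin> cball 0 (R + 1)"
  then have "norm x > R + 1" by simp
  then have "(R + 1)\<^sup>2 < (norm x)\<^sup>2" using R(1) by (intro power_strict_mono) auto
  then have "s x <= 0" using R(1) by (simp add: s_def dot_square_norm power2_eq_square algebra_simps)
  then show "g x = 0" "(- 4 * max 0 (s x)) *\<^sub>R x = 0" by (simp_all add: g_def max_def)
 qed simp
 then have i: "integrable lborel (%x. \<bar>g x\<bar> powr p / norm x powr p)"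
  by (rule Hardy_C1(1)[OF _ p_gt_1 p_less])
 have gm: "g \<in> borel_measurable borel"
  unfolding g_def s_def by (intro borel_measurable_continuous_onI continuous_intros)
 have m: "(%x. \<bar>g x\<bar> powr p / norm x powr p) \<in> borel_measurable borel"
  using gm by measurable
 have "integrable lebesgue (%x. \<bar>g x\<bar> powr p / norm x powr p)"
 proof -
  have m': "(%x. \<bar>g x\<bar> powr p / norm x powr p) \<in> borel_measurable lborel" using m by (simp only: measurable_lborel2)
  show ?thesis by (rule iffD2[OF integrable_completion[OF m'] i])
 qed
 from integrable_mult_indicator[OF sets_domain this]
 have iM: "integrable M (%x. \<bar>g x\<bar> powr p / norm x powr p)"
  using sets_domain by (subst integrable_restrict_space) (simp_all only: space_completion space_lborel space_borel Int_UNIV_right)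
 show ?thesis
 proof (rule integrable_bound[OF iM])
  show "(%x. 1 / norm x powr p) \<in> borel_measurable M" by (rule borel_M) simp
  show "AE x in M. norm (1 / norm x powr p) <= norm (\<bar>g x\<bar> powr p / norm x powr p)"
   using AE_M_domain
  proof eventually_elim
   case (elim x)
   have "(norm x)\<^sup>2 <= R\<^sup>2" using R(2)[OF elim] by (intro power_mono) auto
   then have "s x \<ge> 1" by (simp add: s_def dot_square_norm)
   then have "1 <= g x" unfolding g_def by (intro one_le_power) simp
   then have "1 powr p <= \<bar>g x\<bar> powr p" using p_pos by (intro powr_mono2) auto
   then have "1 / norm x powr p <= \<bar>g x\<bar> powr p / norm x powr p" by (intro divide_right_mono) auto
   then show ?case by simp
  qed
 qed
qed

lemma Lp_complete':
 assumes "!!n. f n \<in> Lp p \<Omega>"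
  and "!!e. e > 0 ==> \<exists>N. \<forall>m\<ge>N. \<forall>n\<ge>N. nrm (%x. f m x - f n x) < e"
 shows "\<exists>g. g \<in> Lp p \<Omega> \<and> (%n. nrm (%x. f n x - g x)) \<longlonglongrightarrow> 0"
 by (rule Lp_complete[OF assms]) blast+

text \<open>Poincare's inequality turns the Cauchy condition on the gradients alone into one on the
  functions.\<close>

lemma W0_complete:
 assumes W: "!!n. W0 (u n) (D n)"
  and Cau: "!!e. e > 0 ==> \<exists>N. \<forall>m\<ge>N. \<forall>n\<ge>N. nrm (%x. D m x - D n x) < e"
 shows "\<exists>v E. W0 v E \<and> (%n. nrm (%x. u n x - v x)) \<longlonglongrightarrow> 0 \<and> (%n. nrm (%x. D n x - E x)) \<longlonglongrightarrow> 0"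
proof -
 obtain E where E: "E \<in> Lp p \<Omega>" "(%n. nrm (%x. D n x - E x)) \<longlonglongrightarrow> 0"
  using Lp_complete'[OF W0_Lp(2)[OF W] Cau] by blast
 have Cu: "\<exists>N. \<forall>m\<ge>N. \<forall>n\<ge>N. nrm (%x. u m x - u n x) < e" if e: "e > 0" for e
 proof -
  have P: "poincare_const + 1 > 0" using poincare_const_nonneg by simp
  obtain N where N: "!!m n. m \<ge> N ==> n \<ge> N ==> nrm (%x. D m x - D n x) < e / (poincare_const + 1)"
   using Cau[of "e / (poincare_const + 1)"] e P by auto
  have "nrm (%x. u m x - u n x) < e" if "m \<ge> N" "n \<ge> N" for m n
  proof -
   have "nrm (%x. u m x - u n x) <= poincare_const * nrm (%x. D m x - D n x)"
    by (rule W0_Poincare[OF W0_diff[OF W W]])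
   also have "... <= (poincare_const + 1) * nrm (%x. D m x - D n x)"
    using nrm_nonneg by (intro mult_right_mono) auto
   also have "... < (poincare_const + 1) * (e / (poincare_const + 1))"
    using N[OF that] P by (rule mult_strict_left_mono)
   finally show ?thesis using P by simp
  qed
  then show ?thesis by blast
 qed
 obtain v where v: "v \<in> Lp p \<Omega>" "(%n. nrm (%x. u n x - v x)) \<longlonglongrightarrow> 0"
  using Lp_complete'[OF W0_Lp(1)[OF W] Cu] by blast
 show ?thesis
  using W0_limit[OF v(1) E(1) W v(2) E(2)] v(2) E(2) by blast
qed

text \<open>Each \<open>u n\<close> is replaced by a test function at distance below 1/(n+1), to
  which \<open>L1_compactness\<close> applies. For the gradients an approximation within 1 is
  enough, since only a bound on them enters.\<close>

lemma Rellich: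
 assumes W: "!!n. W0 (u n) (D n)" and C: "!!n. nrm (D n) <= C"
 shows "\<exists>(r :: nat => nat) v. strict_mono r \<and> integrable M v \<and>
  (%n. LINT x|M. \<bar>u (r n) x - v x\<bar>) \<longlonglongrightarrow> 0 \<and> (AE x in M. (%n. u (r n) x) \<longlonglongrightarrow> v x)"
proof -
 obtain R where R: "R > 0" "!!x. x \<in> \<Omega> ==> norm x <= R" using domain_radius by blast
 have "\<forall>n. \<exists>\<phi>. \<phi> \<in> test_functions \<Omega> \<and> nrm (%x. \<phi> x - u n x) < inverse (real (Suc n)) \<and> nrm (%x. grad \<phi> x - D n x) < 1"
 proof
  fix n
  have e: "min 1 (inverse (real (Suc n))) > 0" by simp
  obtain \<phi> where "\<phi> \<in> test_functions \<Omega>" "nrm (%x. \<phi> x - u n x) < min 1 (inverse (real (Suc n)))"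
   "nrm (%x. grad \<phi> x - D n x) < min 1 (inverse (real (Suc n)))"
   using W[of n] e unfolding W0_def by blast
  then show "\<exists>\<phi>. \<phi> \<in> test_functions \<Omega> \<and> nrm (%x. \<phi> x - u n x) < inverse (real (Suc n)) \<and> nrm (%x. grad \<phi> x - D n x) < 1"
   by auto
 qed
 then obtain \<phi> where \<phi>: "\<forall>n. \<phi> n \<in> test_functions \<Omega> \<and> nrm (%x. \<phi> n x - u n x) < inverse (real (Suc n)) \<and> nrm (%x. grad (\<phi> n) x - D n x) < 1"
  by (rule choice[THEN exE])
 then have \<phi>t: "\<phi> n \<in> test_functions \<Omega>" for n by blast
 have \<phi>u: "(%n. nrm (%x. \<phi> n x - u n x)) \<longlonglongrightarrow> 0"
 proof -
  have b: "nrm (%x. \<phi> n x - u n x) <= inverse (real (Suc n))" for n using \<phi> less_imp_le by blast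
  show ?thesis
   by (rule tendsto_sandwich[OF _ _ tendsto_const LIMSEQ_inverse_real_of_nat]) (simp_all only: nrm_nonneg b eventually_True)
 qed
 have \<phi>uL: "(%x. \<phi> n x - u n x) \<in> Lp p \<Omega>" for n
  by (rule Lp_diff(1)[OF test_Lp(1)[OF \<phi>t] W0_Lp(1)[OF W]])
 have \<phi>u1: "(%n. LINT x|M. norm (\<phi> n x - u n x)) \<longlonglongrightarrow> 0"
  by (rule L1_tendsto[OF \<phi>uL \<phi>u])
 define B where "B = 2 powr p * (1 + C)"
 have gB: "nrm (grad (\<phi> n)) <= B" for n
 proof -
  have "nrm (grad (\<phi> n)) <= 2 powr p * (nrm (%x. grad (\<phi> n) x - D n x) + nrm (D n))"
   using Lp_add(2)[OF Lp_diff(1)[OF test_Lp(2)[OF \<phi>t[of n]] W0_Lp(2)[OF W[of n]]] W0_Lp(2)[OF W[of n]]] by simp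
  also have "... <= B" unfolding B_def
   using \<phi> C[of n] by (intro mult_left_mono add_mono) (auto simp: less_imp_le)
  finally show ?thesis .
 qed
 define A where "A = 1 * measure M \<Omega> + 1 powr (1 - p) * B"
 define A' where "A' = 1 * measure M \<Omega> + 1 powr (1 - p) * (poincare_const * B)"
 have g1: "(LINT x|M. norm (grad (\<phi> n) x)) <= A" for n
  using L1_le_nrm[OF test_Lp(2)[OF \<phi>t[of n]] zero_less_one] gB[of n] by (simp add: A_def)
 have p1: "(LINT x|M. norm (\<phi> n x)) <= A'" for n
 proof -
  have "nrm (\<phi> n) <= poincare_const * B"
   using W0_Poincare[OF W0_test[OF \<phi>t[of n]]] mult_left_mono[OF gB[of n] poincare_const_nonneg] by linarith
  then show ?thesis using L1_le_nrm[OF test_Lp(1)[OF \<phi>t[of n]] zero_less_one] by (simp add: A'_def)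
 qed
 have "\<forall>n. \<exists>K. C1_compact (\<phi> n) (grad (\<phi> n)) K \<and> K \<subseteq> \<Omega>"
  using test_functions_C1_compact[OF \<phi>t] by blast
 then obtain K where K: "\<forall>n. C1_compact (\<phi> n) (grad (\<phi> n)) (K n) \<and> K n \<subseteq> \<Omega>"
  by (rule choice[THEN exE])
 have supp: "continuous_on UNIV (\<phi> n)" "continuous_on UNIV (grad (\<phi> n))" "compact (K n)" "K n \<subseteq> \<Omega>"
  "!!x. x \<notin> K n ==> \<phi> n x = 0 \<and> grad (\<phi> n) x = 0" for n
 proof -
  have Kn: "C1_compact (\<phi> n) (grad (\<phi> n)) (K n)" "K n \<subseteq> \<Omega>" using K by simp_all
  show "continuous_on UNIV (\<phi> n)" by (rule C1_compact_continuous[OF Kn(1)])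
  show "continuous_on UNIV (grad (\<phi> n))" "compact (K n)" "K n \<subseteq> \<Omega>"
   "!!x. x \<notin> K n ==> \<phi> n x = 0 \<and> grad (\<phi> n) x = 0"
   using Kn by (simp_all add: C1_compact_def)
 qed
 have l1: "(LINT x|lborel. norm (grad (\<phi> n) x)) <= max A A'" for n
 proof -
  have "(LINT x|M. norm (grad (\<phi> n) x)) = (LINT x|lborel. norm (grad (\<phi> n) x))"
   using supp(5)[of _ n] by (intro integral_M_support(1)[OF continuous_on_norm[OF supp(2)] supp(3)[of n] supp(4)]) simp
  then show ?thesis using g1[of n] by simp
 qed
 have l2: "(LINT x|lborel. \<bar>\<phi> n x\<bar>) <= max A A'" for n
 proof -
  have "(LINT x|M. norm (\<phi> n x)) = (LINT x|lborel. norm (\<phi> n x))"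
   using supp(5)[of _ n] by (intro integral_M_support(1)[OF continuous_on_norm[OF supp(1)] supp(3)[of n] supp(4)]) simp
  then show ?thesis using p1[of n] by simp
 qed
 obtain r :: "nat => nat" where r: "strict_mono r"
  and Cau: "!!e. e > 0 ==> \<exists>N. \<forall>m\<ge>N. \<forall>n\<ge>N. (LINT x|lborel. \<bar>\<phi> (r m) x - \<phi> (r n) x\<bar>) < e"
 proof -
  have K1: "C1_compact (\<phi> n) (grad (\<phi> n)) (K n)" for n using K by blast
  have K2: "K n \<subseteq> cball 0 R" for n
  proof
   fix x assume "x \<in> K n"
   then have "x \<in> \<Omega>" using supp(4) by blast
   then show "x \<in> cball 0 R" using R(2) by simp
  qed
  show thesis by (rule L1_compactness[OF K1 K2 l1 l2]) (rule that)
 qed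
 have eqL: "(LINT x|M. norm (\<phi> m x - \<phi> n x)) = (LINT x|lborel. \<bar>\<phi> m x - \<phi> n x\<bar>)" for m n
  unfolding real_norm_def
  by (rule integral_M_support(1)[of _ "K m \<union> K n"])
   (use supp in \<open>auto intro!: continuous_intros compact_Un\<close>)
 have \<phi>i: "integrable M (\<phi> n)" for n by (rule Lp_integrable[OF test_Lp(1)[OF \<phi>t]])
 have Cau': "\<exists>N. \<forall>m\<ge>N. \<forall>n\<ge>N. (LINT x|M. norm (\<phi> (r m) x - \<phi> (r n) x)) < e" if "e > 0" for e
  unfolding eqL by (rule Cau[OF that])
 obtain s v where s: "strict_mono (s :: nat => nat)" and v: "v \<in> borel_measurable M"
  and lim: "AE x in M. (%n. \<phi> (r (s n)) x) \<longlonglongrightarrow> v x"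
  using Cauchy_L1_AE_subseq[of M "%n. \<phi> (r n)", OF \<phi>i Cau'] by blast
 have key: "integrable M (%x. \<bar>\<phi> (r n) x - v x\<bar>) \<and> (LINT x|M. \<bar>\<phi> (r n) x - v x\<bar>) <= e"
  if N: "!!m n. m \<ge> N ==> n \<ge> N ==> (LINT x|M. norm (\<phi> (r m) x - \<phi> (r n) x)) < e" "n \<ge> N" for n N e
 proof -
  have lim': "AE x in M. (%k. \<bar>\<phi> (r n) x - \<phi> (r (s (k + N))) x\<bar>) \<longlonglongrightarrow> \<bar>\<phi> (r n) x - v x\<bar>"
   using lim
  proof eventually_elim
   case (elim x)
   show ?case by (intro tendsto_rabs tendsto_diff tendsto_const LIMSEQ_ignore_initial_segment[OF elim, of N])
  qed
  have m: "(%x. \<bar>\<phi> (r n) x - v x\<bar>) \<in> borel_measurable M"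
   by (intro borel_measurable_abs borel_measurable_diff v borel_measurable_integrable[OF \<phi>i])
  have le: "(LINT x|M. \<bar>\<phi> (r n) x - \<phi> (r (s (k + N))) x\<bar>) <= e" for k
   using N(1)[of n "s (k + N)"] N(2) seq_suble[OF s, of "k + N"] by simp
  have i: "integrable M (%x. \<bar>\<phi> (r n) x - \<phi> (r (s (k + N))) x\<bar>)" for k
   by (intro integrable_abs integrable_diff \<phi>i)
  show ?thesis
   using integrable_Fatou[of M "%k x. \<bar>\<phi> (r n) x - \<phi> (r (s (k + N))) x\<bar>", OF i _ le m lim'] by simp
 qed
 obtain N1 where N1: "!!m n. m \<ge> N1 ==> n \<ge> N1 ==> (LINT x|M. norm (\<phi> (r m) x - \<phi> (r n) x)) < 1"
  using Cau'[of 1] by auto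
 have "integrable M (%x. norm (\<phi> (r N1) x - v x))"
  using key[of N1 1 N1] N1 by simp
 then have "integrable M (%x. \<phi> (r N1) x - v x)"
  by (rule integrable_norm_cancel) (intro borel_measurable_diff v borel_measurable_integrable[OF \<phi>i])
 from integrable_diff[OF \<phi>i[of "r N1"] this] have vi: "integrable M v" by simp
 have \<phi>v: "(%n. LINT x|M. \<bar>\<phi> (r n) x - v x\<bar>) \<longlonglongrightarrow> 0"
 proof (rule LIMSEQ_I)
  fix e :: real assume e: "e > 0"
  obtain N where N: "!!m n. m \<ge> N ==> n \<ge> N ==> (LINT x|M. norm (\<phi> (r m) x - \<phi> (r n) x)) < e / 2"
   using Cau'[of "e / 2"] e by auto
  have "norm ((LINT x|M. \<bar>\<phi> (r n) x - v x\<bar>) - 0) < e" if "n \<ge> N" for n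
  proof -
   have "0 <= (LINT x|M. \<bar>\<phi> (r n) x - v x\<bar>)" by (rule integral_nonneg_AE) simp
   then show ?thesis using key[OF N that] e by simp
  qed
  then show "\<exists>N. \<forall>n\<ge>N. norm ((LINT x|M. \<bar>\<phi> (r n) x - v x\<bar>) - 0) < e" by blast
 qed
 have ui: "integrable M (u n)" for n by (rule Lp_integrable[OF W0_Lp(1)[OF W]])
 have uv: "(%n. LINT x|M. \<bar>u (r n) x - v x\<bar>) \<longlonglongrightarrow> 0"
 proof (rule tendsto_sandwich[OF _ _ tendsto_const])
  have "(%n. (LINT x|M. norm (\<phi> (r n) x - u (r n) x)) + (LINT x|M. \<bar>\<phi> (r n) x - v x\<bar>)) \<longlonglongrightarrow> 0 + 0"
   using LIMSEQ_subseq_LIMSEQ[OF \<phi>u1 r] \<phi>v by (intro tendsto_add) (simp_all add: o_def)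
  then show "(%n. (LINT x|M. norm (\<phi> (r n) x - u (r n) x)) + (LINT x|M. \<bar>\<phi> (r n) x - v x\<bar>)) \<longlonglongrightarrow> 0" by simp
  show "\<forall>\<^sub>F n in sequentially. 0 <= (LINT x|M. \<bar>u (r n) x - v x\<bar>)"
   by (intro always_eventually allI integral_nonneg_AE) simp
  show "\<forall>\<^sub>F n in sequentially. (LINT x|M. \<bar>u (r n) x - v x\<bar>)
    <= (LINT x|M. norm (\<phi> (r n) x - u (r n) x)) + (LINT x|M. \<bar>\<phi> (r n) x - v x\<bar>)"
  proof (intro always_eventually allI)
   fix n
   have "(LINT x|M. \<bar>u (r n) x - v x\<bar>) <= (LINT x|M. \<bar>\<phi> (r n) x - u (r n) x\<bar> + \<bar>\<phi> (r n) x - v x\<bar>)"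
    using ui vi \<phi>i by (intro integral_mono) auto
   also have "... = (LINT x|M. \<bar>\<phi> (r n) x - u (r n) x\<bar>) + (LINT x|M. \<bar>\<phi> (r n) x - v x\<bar>)"
    using ui vi \<phi>i by (intro integral_add) auto
   finally show "(LINT x|M. \<bar>u (r n) x - v x\<bar>)
    <= (LINT x|M. norm (\<phi> (r n) x - u (r n) x)) + (LINT x|M. \<bar>\<phi> (r n) x - v x\<bar>)" by simp
  qed
 qed
 have "integrable M (%x. u (r n) x - v x)" for n using ui vi by (rule integrable_diff)
 moreover have "(%n. LINT x|M. norm (u (r n) x - v x)) \<longlonglongrightarrow> 0" using uv by simp
 ultimately obtain t :: "nat => nat" where t: "strict_mono t" "AE x in M. (%n. u (r (t n)) x - v x) \<longlonglongrightarrow> 0"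
  using tendsto_L1_AE_subseq[of M "%n x. u (r n) x - v x"] by blast
 show ?thesis
 proof (intro exI[of _ "r \<circ> t"] exI[of _ v] conjI)
  show "strict_mono (r \<circ> t)" by (rule strict_mono_o[OF r t(1)])
  show "(%n. LINT x|M. \<bar>u ((r \<circ> t) n) x - v x\<bar>) \<longlonglongrightarrow> 0"
   using LIMSEQ_subseq_LIMSEQ[OF uv t(1)] by (simp add: o_def)
  show "AE x in M. (%n. u ((r \<circ> t) n) x) \<longlonglongrightarrow> v x"
   using t(2) by eventually_elim (simp add: LIM_zero_iff)
 qed (rule vi)
qed

end

section \<open>Chain rule and products\<close>

text \<open>Weierstrass' theorem is applied to g' and the polynomial is then integrated, so function
  and derivative are approximated together. There is no constant term, hence composition with a test
  function keeps the support compact.\<close>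

lemma primitive_polynomial_approx:
 fixes g g' :: "real => real"
 assumes der: "!!s. (g has_real_derivative g' s) (at s)" and cont: "continuous_on UNIV g'"
  and "g 0 = 0" "B \<ge> 0" "e > 0"
 shows "\<exists>a (n::nat) P'. (\<forall>s. ((%s. \<Sum>i\<le>n. a i * s ^ Suc i) has_real_derivative P' s) (at s)) \<and>
  (\<forall>s. \<bar>s\<bar> <= B \<longrightarrow> \<bar>P' s - g' s\<bar> <= e \<and> \<bar>(\<Sum>i\<le>n. a i * s ^ Suc i) - g s\<bar> <= e * B)"
proof -
 have c: "continuous_on {-B..B} g'" using cont continuous_on_subset by blast
 obtain q where q: "real_polynomial_function q" "!!s. s \<in> {-B..B} ==> \<bar>g' s - q s\<bar> < e"
  using Stone_Weierstrass_real_polynomial_function[OF compact_Icc c \<open>e > 0\<close>] by blast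
 obtain b n where bn: "q = (%x. \<Sum>i\<le>n. b i * x ^ i)"
  using q(1) by (auto simp: real_polynomial_function_iff_sum)
 define P where "P s = (\<Sum>i\<le>n. (b i / real (Suc i)) * s ^ Suc i)" for s
 have P: "(P has_real_derivative q s) (at s)" for s
 proof -
  have "(P has_real_derivative (\<Sum>i\<le>n. (b i / real (Suc i)) * (real (Suc i) * s ^ i))) (at s)"
   unfolding P_def
  proof (rule DERIV_sum, rule DERIV_cmult)
   show "((%s. s ^ Suc i) has_real_derivative real (Suc i) * s ^ i) (at s)" for i
    using DERIV_pow[of "Suc i" s] by simp
  qed
  then show ?thesis by (simp add: bn del: of_nat_Suc)
 qed
 have "\<bar>P s - g s\<bar> <= e * B" if s: "\<bar>s\<bar> <= B" for s
 proof -
  have "norm ((P s - g s) - (P 0 - g 0)) <= e * norm (s - 0)"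
  proof (rule field_differentiable_bound[of "{-B..B}" "%s. P s - g s" "%s. q s - g' s"])
   show "((%s. P s - g s) has_field_derivative q z - g' z) (at z within {-B..B})" for z
    by (rule has_field_derivative_at_within[OF DERIV_diff[OF P der]])
   show "norm (q z - g' z) <= e" if "z \<in> {-B..B}" for z
    using q(2)[OF that] by (simp add: abs_minus_commute less_imp_le)
  qed (use s \<open>B \<ge> 0\<close> in auto)
  moreover have "P 0 = 0" by (simp add: P_def)
  ultimately have "\<bar>P s - g s\<bar> <= e * \<bar>s\<bar>" using \<open>g 0 = 0\<close> by simp
  also have "... <= e * B" using s \<open>e > 0\<close> by simp
  finally show ?thesis .
 qed
 moreover have "\<bar>q s - g' s\<bar> <= e" if "\<bar>s\<bar> <= B" for s
  using q(2)[of s] that by (simp add: abs_minus_commute less_imp_le abs_le_iff)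
 ultimately show ?thesis
  using P unfolding P_def by (intro exI[of _ "%i. b i / real (Suc i)"] exI[of _ n] exI[of _ q]) blast
qed

context sobolev_domain
begin

lemma inverse_powr_tendsto_0: "(%k. inverse (real (Suc k)) powr p * C) \<longlonglongrightarrow> 0"
proof -
 have "(%k. inverse (real (Suc k)) powr p) \<longlonglongrightarrow> 0 powr p"
  using p_pos by (intro tendsto_powr' LIMSEQ_inverse_real_of_nat tendsto_const) auto
 from tendsto_mult[OF this tendsto_const[of C]] show ?thesis using p_pos by simp
qed

lemma nrm_sandwich:
 assumes "!!k. nrm (f k) <= a k" "a \<longlonglongrightarrow> 0"
 shows "(%k. nrm (f k)) \<longlonglongrightarrow> 0"
 by (rule tendsto_sandwich[OF _ _ tendsto_const assms(2)]) (simp_all only: nrm_nonneg assms(1) eventually_True)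

lemma continuous_compose_measurable:
 assumes "continuous_on UNIV (g :: real => real)" "u \<in> borel_measurable M"
 shows "(%x. g (u x)) \<in> borel_measurable M"
 by (rule measurable_compose[OF assms(2) borel_measurable_continuous_onI[OF assms(1)]])

text \<open>As \<open>g\<close> is only C^1, the composite need not be a test function. Polynomials
  in \<open>\<phi>\<close> without constant term are test functions, and they approximate it
  together with its gradient.\<close>

lemma W0_chain_test:
 fixes g g' :: "real => real"
 assumes der: "!!s. (g has_real_derivative g' s) (at s)" and cont: "continuous_on UNIV g'"
  and "g 0 = 0" and \<phi>: "\<phi> \<in> test_functions \<Omega>"
 shows "W0 (%x. g (\<phi> x)) (%x. g' (\<phi> x) *\<^sub>R grad \<phi> x)"
proof -
 obtain B where B: "B > 0" "!!x. \<bar>\<phi> x\<bar> <= B" "!!x. norm (grad \<phi> x) <= B"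
  using test_functions_bounded[OF \<phi>] by metis
 obtain K where K: "compact K" "K \<subseteq> \<Omega>" "\<forall>x. x \<notin> K \<longrightarrow> \<phi> x = 0 \<and> grad \<phi> x = 0"
  using test_functions_support[OF \<phi>] by blast
 note sm = test_functions_smooth[OF \<phi>]
 have contg: "continuous_on UNIV g" using der by (intro continuous_at_imp_continuous_on ballI DERIV_isCont)
 have \<phi>m: "\<phi> \<in> borel_measurable M" "grad \<phi> \<in> borel_measurable M"
  using test_Lp[OF \<phi>] by (simp_all add: Lp_iff)
 have um: "(%x. g (\<phi> x)) \<in> borel_measurable M" by (rule continuous_compose_measurable[OF contg \<phi>m(1)])
 have Dm: "(%x. g' (\<phi> x) *\<^sub>R grad \<phi> x) \<in> borel_measurable M"
  by (intro borel_measurable_scaleR continuous_compose_measurable[OF cont \<phi>m(1)] \<phi>m(2))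
 have "\<exists>\<psi>. \<psi> \<in> test_functions \<Omega> \<and> (\<forall>x. \<bar>\<psi> x - g (\<phi> x)\<bar> <= e * B \<and> norm (grad \<psi> x - g' (\<phi> x) *\<^sub>R grad \<phi> x) <= e * norm (grad \<phi> x))"
  if e: "e > 0" for e
 proof -
  obtain a and n :: nat and P' where P: "!!s. ((%s. \<Sum>i\<le>n. a i * s ^ Suc i) has_real_derivative P' s) (at s)"
   "!!s. \<bar>s\<bar> <= B ==> \<bar>P' s - g' s\<bar> <= e \<and> \<bar>(\<Sum>i\<le>n. a i * s ^ Suc i) - g s\<bar> <= e * B"
   using primitive_polynomial_approx[OF der cont \<open>g 0 = 0\<close> less_imp_le[OF B(1)] e] by blast
  define \<psi> where "\<psi> x = (\<Sum>i\<le>n. a i * \<phi> x ^ Suc i)" for x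
  have "smooth \<psi>" unfolding \<psi>_def
   by (rule smooth_sum, simp, rule smooth_mult[OF smooth_const smooth_power[OF sm]])
  then have "\<psi> \<in> test_functions \<Omega>"
   using K by (intro test_functionsI[of _ K]) (simp_all add: \<psi>_def)
  moreover have "norm (grad \<psi> x - g' (\<phi> x) *\<^sub>R grad \<phi> x) <= e * norm (grad \<phi> x)" for x
  proof -
   have "grad \<psi> x = P' (\<phi> x) *\<^sub>R grad \<phi> x"
    unfolding \<psi>_def by (rule grad_compose[OF sm P(1)])
   then have "grad \<psi> x - g' (\<phi> x) *\<^sub>R grad \<phi> x = (P' (\<phi> x) - g' (\<phi> x)) *\<^sub>R grad \<phi> x"
    by (simp add: scaleR_left_diff_distrib)
   then show ?thesis using P(2)[OF B(2)[of x]] by (simp add: mult_right_mono)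
  qed
  moreover have "\<bar>\<psi> x - g (\<phi> x)\<bar> <= e * B" for x
   using P(2)[OF B(2)[of x]] by (simp add: \<psi>_def)
  ultimately show ?thesis by blast
 qed
 then have "\<forall>k. \<exists>\<psi>. \<psi> \<in> test_functions \<Omega> \<and> (\<forall>x. \<bar>\<psi> x - g (\<phi> x)\<bar> <= inverse (real (Suc k)) * B
   \<and> norm (grad \<psi> x - g' (\<phi> x) *\<^sub>R grad \<phi> x) <= inverse (real (Suc k)) * norm (grad \<phi> x))"
  by simp
 then obtain \<psi> where \<psi>: "\<forall>k. \<psi> k \<in> test_functions \<Omega> \<and> (\<forall>x. \<bar>\<psi> k x - g (\<phi> x)\<bar> <= inverse (real (Suc k)) * B
   \<and> norm (grad (\<psi> k) x - g' (\<phi> x) *\<^sub>R grad \<phi> x) <= inverse (real (Suc k)) * norm (grad \<phi> x))"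
  by (rule choice[THEN exE])
 have \<psi>m: "\<psi> k \<in> borel_measurable M" "grad (\<psi> k) \<in> borel_measurable M" for k
  using test_Lp[of "\<psi> k"] \<psi> by (simp_all add: Lp_iff)
 have d1: "(%x. \<psi> k x - g (\<phi> x)) \<in> Lp p \<Omega>"
  "nrm (%x. \<psi> k x - g (\<phi> x)) <= inverse (real (Suc k)) powr p * (B powr p * measure M \<Omega>)" for k
 proof -
  have m: "(%x. \<psi> k x - g (\<phi> x)) \<in> borel_measurable M" by (intro borel_measurable_diff \<psi>m um)
  have le: "AE x in M. norm (\<psi> k x - g (\<phi> x)) <= inverse (real (Suc k)) * B"
   using \<psi> by (intro AE_I2) (simp only: real_norm_def)
  show "(%x. \<psi> k x - g (\<phi> x)) \<in> Lp p \<Omega>" by (rule Lp_bounded(1)[OF m le])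
  have "nrm (%x. \<psi> k x - g (\<phi> x)) <= (inverse (real (Suc k)) * B) powr p * measure M \<Omega>"
   by (rule Lp_bounded(2)[OF m le])
  then show "nrm (%x. \<psi> k x - g (\<phi> x)) <= inverse (real (Suc k)) powr p * (B powr p * measure M \<Omega>)"
   using B(1) by (simp add: powr_mult mult.assoc del: of_nat_Suc)
 qed
 have d2: "(%x. grad (\<psi> k) x - g' (\<phi> x) *\<^sub>R grad \<phi> x) \<in> Lp p \<Omega>"
  "nrm (%x. grad (\<psi> k) x - g' (\<phi> x) *\<^sub>R grad \<phi> x) <= inverse (real (Suc k)) powr p * nrm (grad \<phi>)" for k
  by (rule Lp_dominated[of _ "grad \<phi>" "inverse (real (Suc k))"];
    use \<psi> in \<open>(intro borel_measurable_diff \<psi>m Dm test_Lp \<phi> AE_I2)?; simp\<close>)+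
 show ?thesis
 proof (rule W0_limit[of _ _ \<psi> "%k. grad (\<psi> k)"])
  have t: "\<psi> 0 \<in> test_functions \<Omega>" using \<psi> by blast
  show "(%x. g (\<phi> x)) \<in> Lp p \<Omega>" using Lp_diff(1)[OF test_Lp(1)[OF t] d1(1)[of 0]] by simp
  show "(%x. g' (\<phi> x) *\<^sub>R grad \<phi> x) \<in> Lp p \<Omega>" using Lp_diff(1)[OF test_Lp(2)[OF t] d2(1)[of 0]] by simp
  show "W0 (\<psi> k) (grad (\<psi> k))" for k using \<psi> W0_test by blast
  show "(%k. nrm (%x. \<psi> k x - g (\<phi> x))) \<longlonglongrightarrow> 0"
   by (rule nrm_sandwich[OF d1(2) inverse_powr_tendsto_0])
  show "(%k. nrm (%x. grad (\<psi> k) x - g' (\<phi> x) *\<^sub>R grad \<phi> x)) \<longlonglongrightarrow> 0"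
   by (rule nrm_sandwich[OF d2(2) inverse_powr_tendsto_0])
 qed
qed

text \<open>The gradient error splits into g'(phi k) times the error of the gradients, small because
  g' is bounded, and (g'(phi k) - g'(u)) D, which tends to zero by dominated convergence because phi
  k tends to u almost everywhere.\<close>

lemma W0_chain:
 fixes g g' :: "real => real"
 assumes W: "W0 u D" and der: "!!s. (g has_real_derivative g' s) (at s)" and cont: "continuous_on UNIV g'"
  and L: "!!s. \<bar>g' s\<bar> <= L" and "g 0 = 0"
 shows "W0 (%x. g (u x)) (%x. g' (u x) *\<^sub>R D x)"
proof -
 have L0: "0 <= L" using L[of 0] by (rule order_trans[OF abs_ge_zero])
 have Lip: "\<bar>g s - g t\<bar> <= L * \<bar>s - t\<bar>" for s t
  using field_differentiable_bound[of UNIV g g' L s t] der L by simp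
 obtain \<phi> where \<phi>: "!!k. \<phi> k \<in> test_functions \<Omega>"
  "(%k. nrm (%x. \<phi> k x - u x)) \<longlonglongrightarrow> 0" "(%k. nrm (%x. grad (\<phi> k) x - D x)) \<longlonglongrightarrow> 0"
  "AE x in M. (%k. \<phi> k x) \<longlonglongrightarrow> u x"
  using W0_seq[OF W zero_less_one] by blast
 have contg: "continuous_on UNIV g" using der by (intro continuous_at_imp_continuous_on ballI DERIV_isCont)
 note um = W0_measurable(1)[OF W] and Dm = W0_measurable(2)[OF W]
 have \<phi>m: "\<phi> k \<in> borel_measurable M" "grad (\<phi> k) \<in> borel_measurable M" for k
  using test_Lp[OF \<phi>(1)] by (simp_all add: Lp_iff)
 have c: "(%x. g' (\<phi> k x)) \<in> borel_measurable M" "(%x. g' (u x)) \<in> borel_measurable M" for k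
  by (rule continuous_compose_measurable[OF cont], rule \<phi>m um)+
 have uL: "(%x. g (u x)) \<in> Lp p \<Omega>"
  by (rule Lp_dominated(1)[OF continuous_compose_measurable[OF contg um] W0_Lp(1)[OF W] _ L0])
   (use Lip[of _ 0] \<open>g 0 = 0\<close> in simp)
 have DL: "(%x. g' (u x) *\<^sub>R D x) \<in> Lp p \<Omega>"
  by (rule Lp_dominated(1)[OF borel_measurable_scaleR[OF c(2) Dm] W0_Lp(2)[OF W] _ L0])
   (use L in \<open>simp add: mult_right_mono\<close>)
 note \<phi>u = Lp_diff(1)[OF test_Lp(1)[OF \<phi>(1)] W0_Lp(1)[OF W]]
 note \<phi>D = Lp_diff(1)[OF test_Lp(2)[OF \<phi>(1)] W0_Lp(2)[OF W]]
 have n1: "nrm (%x. g (\<phi> k x) - g (u x)) <= L powr p * nrm (%x. \<phi> k x - u x)" for k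
  by (rule Lp_dominated(2)[OF _ \<phi>u _ L0])
   (simp_all add: Lip borel_measurable_diff continuous_compose_measurable[OF contg] um \<phi>m)
 define c' where "c' k x = g' (\<phi> k x) - g' (u x)" for k x
 have c'm: "c' k \<in> borel_measurable M" for k unfolding c'_def by (intro borel_measurable_diff c)
 have c'L: "\<bar>c' k x\<bar> <= 2 * L" for k x unfolding c'_def using L[of "\<phi> k x"] L[of "u x"] by linarith
 have c'0: "AE x in M. (%k. c' k x) \<longlonglongrightarrow> 0"
  using \<phi>(4)
 proof eventually_elim
  case (elim x)
  have "(%k. g' (\<phi> k x)) \<longlonglongrightarrow> g' (u x)"
   by (rule continuous_on_tendsto_compose[OF cont elim]) simp_all
  then show ?case unfolding c'_def by (rule LIM_zero)
 qed
 have t1: "(%k. nrm (%x. c' k x *\<^sub>R D x)) \<longlonglongrightarrow> 0"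
  by (rule nrm_tendsto_dominated[OF W0_Lp(2)[OF W] c'm _ c'0, of "2 * L"]) (simp add: c'L)
 have n2: "nrm (%x. g' (\<phi> k x) *\<^sub>R grad (\<phi> k) x - g' (u x) *\<^sub>R D x)
   <= 2 powr p * (L powr p * nrm (%x. grad (\<phi> k) x - D x) + nrm (%x. c' k x *\<^sub>R D x))" for k
 proof -
  have m1: "(%x. g' (\<phi> k x) *\<^sub>R (grad (\<phi> k) x - D x)) \<in> borel_measurable M"
   by (intro borel_measurable_scaleR c borel_measurable_diff \<phi>m Dm)
  have le1: "AE x in M. norm (g' (\<phi> k x) *\<^sub>R (grad (\<phi> k) x - D x)) <= L * norm (grad (\<phi> k) x - D x)"
   using L by (simp add: mult_right_mono)
  have m2: "(%x. c' k x *\<^sub>R D x) \<in> borel_measurable M" by (intro borel_measurable_scaleR c'm Dm)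
  have le2: "AE x in M. norm (c' k x *\<^sub>R D x) <= (2 * L) * norm (D x)"
   using c'L by (intro AE_I2) (simp add: mult_right_mono)
  have "nrm (%x. g' (\<phi> k x) *\<^sub>R (grad (\<phi> k) x - D x) + c' k x *\<^sub>R D x)
    <= 2 powr p * (nrm (%x. g' (\<phi> k x) *\<^sub>R (grad (\<phi> k) x - D x)) + nrm (%x. c' k x *\<^sub>R D x))"
   by (rule Lp_add(2)[OF Lp_dominated(1)[OF m1 \<phi>D le1 L0] Lp_dominated(1)[OF m2 W0_Lp(2)[OF W] le2]]) (use L0 in simp)
  also have "... <= 2 powr p * (L powr p * nrm (%x. grad (\<phi> k) x - D x) + nrm (%x. c' k x *\<^sub>R D x))"
   by (intro mult_left_mono add_right_mono Lp_dominated(2)[OF m1 \<phi>D le1 L0]) simp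
  finally show ?thesis unfolding c'_def by (simp add: algebra_simps)
 qed
 have t2: "(%k. L powr p * nrm (%x. \<phi> k x - u x)) \<longlonglongrightarrow> 0"
  using tendsto_mult[OF tendsto_const \<phi>(2), of "L powr p"] by simp
 have t3: "(%k. 2 powr p * (L powr p * nrm (%x. grad (\<phi> k) x - D x) + nrm (%x. c' k x *\<^sub>R D x))) \<longlonglongrightarrow> 0"
  using tendsto_mult[OF tendsto_const tendsto_add[OF tendsto_mult[OF tendsto_const \<phi>(3), of "L powr p"] t1], of "2 powr p"] by simp
 show ?thesis
  by (rule W0_limit[OF uL DL W0_chain_test[OF der cont \<open>g 0 = 0\<close> \<phi>(1)] nrm_sandwich[OF n1 t2] nrm_sandwich[OF n2 t3]])
qed

text \<open>This carries the chain rule beyond C^1 functions. Approximate chain rules all multiply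
  the same field \<open>D\<close>, so bounded pointwise convergence of the coefficients suffices,
  even to a discontinuous limit.\<close>

lemma W0_coefficient_limit:
 assumes W: "!!k. W0 (v k) (%x. c k x *\<^sub>R D x)" and D: "D \<in> Lp p \<Omega>" and v: "w \<in> Lp p \<Omega>"
  and lim: "(%k. nrm (%x. v k x - w x)) \<longlonglongrightarrow> 0"
  and c: "!!k. c k \<in> borel_measurable M" "!!k x. \<bar>c k x\<bar> <= L" "d \<in> borel_measurable M"
  and cd: "AE x in M. (%k. c k x) \<longlonglongrightarrow> d x" and dL: "!!x. \<bar>d x\<bar> <= L"
 shows "W0 w (%x. d x *\<^sub>R D x)"
proof (rule W0_limit[OF v _ W lim])
 have L0: "0 <= L" using dL[of 0] by (rule order_trans[OF abs_ge_zero])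
 show "(%x. d x *\<^sub>R D x) \<in> Lp p \<Omega>"
  by (rule Lp_dominated(1)[OF borel_measurable_scaleR[OF c(3) Lp_measurable[OF D]] D _ L0])
   (use dL in \<open>simp add: mult_right_mono\<close>)
 have "(%k. nrm (%x. (c k x - d x) *\<^sub>R D x)) \<longlonglongrightarrow> 0"
 proof (rule nrm_tendsto_dominated[OF D, of _ "2 * L"])
  show "(%x. c k x - d x) \<in> borel_measurable M" for k by (intro borel_measurable_diff c)
  show "AE x in M. \<bar>c k x - d x\<bar> <= 2 * L" for k
  proof (rule AE_I2)
   show "\<bar>c k x - d x\<bar> <= 2 * L" for x using c(2)[of k x] dL[of x] by linarith
  qed
  show "AE x in M. (%k. c k x - d x) \<longlonglongrightarrow> 0"
   using cd by eventually_elim (rule LIM_zero)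
 qed
 then show "(%k. nrm (%x. c k x *\<^sub>R D x - d x *\<^sub>R D x)) \<longlonglongrightarrow> 0"
  by (simp only: scaleR_left_diff_distrib)
qed

text \<open>The C^1 functions sqrt(s^2 + e^2) - e approximate |s| within e, with derivatives bounded
  by 1 that tend to sgn s, including the value 0 at s = 0.\<close>

lemma W0_abs:
 assumes W: "W0 u D" shows "W0 (%x. \<bar>u x\<bar>) (%x. sgn (u x) *\<^sub>R D x)"
proof -
 define e where "e k = inverse (real (Suc k))" for k
 have e: "e k > 0" for k by (simp add: e_def)
 define g where "g k s = sqrt (s\<^sup>2 + (e k)\<^sup>2) - e k" for k and s :: real
 define g' where "g' k s = s / sqrt (s\<^sup>2 + (e k)\<^sup>2)" for k and s :: real
 have pos: "s\<^sup>2 + (e k)\<^sup>2 > 0" for k s using e[of k] by (simp add: add_nonneg_pos)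
 have der: "(g k has_real_derivative g' k s) (at s)" for k s
  unfolding g_def g'_def using pos[of s k]
  by (auto intro!: derivative_eq_intros simp: divide_simps)
 have cont: "continuous_on UNIV (g' k)" for k
  unfolding g'_def using pos[of _ k] by (intro continuous_intros) (metis less_irrefl real_sqrt_eq_zero_cancel_iff)
 have g'1: "\<bar>g' k s\<bar> <= 1" for k s
 proof -
  have "\<bar>s\<bar> <= sqrt (s\<^sup>2 + (e k)\<^sup>2)" by (rule real_le_rsqrt) simp
  then show ?thesis using pos[of s k] by (simp add: g'_def)
 qed
 have g1: "\<bar>g k s - \<bar>s\<bar>\<bar> <= e k" for k s
 proof -
  have "sqrt (s\<^sup>2 + (e k)\<^sup>2) <= \<bar>s\<bar> + e k" using sqrt_sum_squares_le_sum_abs[of s "e k"] e[of k] by simp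
  moreover have "\<bar>s\<bar> <= sqrt (s\<^sup>2 + (e k)\<^sup>2)" by (rule real_le_rsqrt) simp
  ultimately show ?thesis using e[of k] by (simp add: g_def)
 qed
 note um = W0_measurable(1)[OF W]
 show ?thesis
 proof (rule W0_coefficient_limit[of "%k x. g k (u x)" "%k x. g' k (u x)" D _ 1])
  show "W0 (%x. g k (u x)) (%x. g' k (u x) *\<^sub>R D x)" for k
   by (rule W0_chain[OF W der cont g'1]) (use e[of k] in \<open>simp add: g_def\<close>)
  show "(%x. \<bar>u x\<bar>) \<in> Lp p \<Omega>"
   by (rule Lp_dominated(1)[OF borel_measurable_abs[OF um] W0_Lp(1)[OF W], of 1]) simp_all
  have contg: "continuous_on UNIV (g k)" for k using der by (intro continuous_at_imp_continuous_on ballI DERIV_isCont)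
  have "nrm (%x. g k (u x) - \<bar>u x\<bar>) <= (inverse (real (Suc k))) powr p * measure M \<Omega>" for k
   by (rule Lp_bounded(2)) (use g1 in \<open>simp_all add: e_def borel_measurable_diff borel_measurable_abs um continuous_compose_measurable[OF contg um]\<close>)
  then show "(%k. nrm (%x. g k (u x) - \<bar>u x\<bar>)) \<longlonglongrightarrow> 0"
   by (rule nrm_sandwich[OF _ inverse_powr_tendsto_0])
  show "(%x. g' k (u x)) \<in> borel_measurable M" for k by (rule continuous_compose_measurable[OF cont um])
  show "(%x. sgn (u x)) \<in> borel_measurable M" by (rule measurable_compose[OF um]) simp
  have elim0: "e \<longlonglongrightarrow> 0" unfolding e_def by (rule LIMSEQ_inverse_real_of_nat)
  have "(%k. g' k s) \<longlonglongrightarrow> sgn s" for s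
  proof (cases "s = 0")
   case False
   have "(%k. s / sqrt (s\<^sup>2 + (e k)\<^sup>2)) \<longlonglongrightarrow> s / sqrt (s\<^sup>2 + 0\<^sup>2)"
    using False by (intro tendsto_intros elim0) simp
   moreover have "s / sqrt (s\<^sup>2 + 0\<^sup>2) = sgn s" using False by (simp add: sgn_if)
   ultimately show ?thesis by (simp only: g'_def)
  qed (simp add: g'_def)
  then show "AE x in M. (%k. g' k (u x)) \<longlonglongrightarrow> sgn (u x)" by simp
  show "\<bar>sgn (u x)\<bar> <= 1" for x by (simp add: abs_sgn_eq)
 qed (use g'1 W0_Lp(2)[OF W] in simp_all)
qed

text \<open>As e tends to 0, e arctan(s/e) tends to 0 uniformly while its derivative tends to the
  indicator of s = 0. So the zero function has the gradient D restricted to {u = 0}, and uniqueness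
  of gradients makes this vanish.\<close>

lemma W0_gradient_zero_set:
 assumes W: "W0 u D" shows "AE x in M. u x = 0 \<longrightarrow> D x = 0"
proof -
 define e where "e k = inverse (real (Suc k))" for k
 have e: "e k > 0" for k by (simp add: e_def)
 define g where "g k s = e k * arctan (s / e k)" for k and s :: real
 define g' where "g' k s = 1 / (1 + (s / e k)\<^sup>2)" for k and s :: real
 have pos: "1 + (s / e k)\<^sup>2 > 0" for k s by (simp add: add_pos_nonneg)
 have der: "(g k has_real_derivative g' k s) (at s)" for k s
  unfolding g_def g'_def using e[of k]
  by (auto intro!: derivative_eq_intros simp: divide_inverse)
 have cont: "continuous_on UNIV (g' k)" for k
 proof -
  have "1 + (s / e k)\<^sup>2 \<noteq> 0" for s using pos[of s k] by linarith
  then show ?thesis unfolding g'_def using e[of k] by (intro continuous_intros) auto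
 qed
 have g'1: "\<bar>g' k s\<bar> <= 1" for k s
  using pos[of s k] by (simp add: g'_def)
 have g1: "\<bar>g k s\<bar> <= e k * (pi / 2)" for k s
  using arctan_lbound[of "s / e k"] arctan_ubound[of "s / e k"] e[of k] by (simp add: g_def abs_mult)
 note um = W0_measurable(1)[OF W]
 have "W0 (%x. 0) (%x. (indicator {0} (u x) :: real) *\<^sub>R D x)"
 proof (rule W0_coefficient_limit[of "%k x. g k (u x)" "%k x. g' k (u x)" D _ 1])
  show "W0 (%x. g k (u x)) (%x. g' k (u x) *\<^sub>R D x)" for k
   by (rule W0_chain[OF W der cont g'1]) (simp add: g_def)
  have contg: "continuous_on UNIV (g k)" for k using der by (intro continuous_at_imp_continuous_on ballI DERIV_isCont)
  have "nrm (%x. g k (u x) - 0) <= inverse (real (Suc k)) powr p * ((pi / 2) powr p * measure M \<Omega>)" for k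
  proof -
   have "nrm (%x. g k (u x) - 0) <= (e k * (pi / 2)) powr p * measure M \<Omega>"
    by (rule Lp_bounded(2)) (use g1 in \<open>simp_all add: continuous_compose_measurable[OF contg um]\<close>)
   also have "(e k * (pi / 2)) powr p = e k powr p * (pi / 2) powr p"
    by (subst powr_mult) (use e[of k] in auto)
   finally show ?thesis by (simp only: e_def mult.assoc)
  qed
  then show "(%k. nrm (%x. g k (u x) - 0)) \<longlonglongrightarrow> 0"
   by (rule nrm_sandwich[OF _ inverse_powr_tendsto_0])
  show "(%x. g' k (u x)) \<in> borel_measurable M" for k by (rule continuous_compose_measurable[OF cont um])
  show "(%x. indicator {0} (u x)) \<in> borel_measurable M" by (rule measurable_compose[OF um]) simp
  have "(%k. g' k s) \<longlonglongrightarrow> indicator {0} s" for s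
  proof (cases "s = 0")
   case False
   have "filterlim (%k. 1 + (s * real (Suc k))\<^sup>2) at_top sequentially"
   proof (rule filterlim_at_top_mono)
    show "filterlim (%k. s\<^sup>2 * real (Suc k)) at_top sequentially"
     using False by (intro filterlim_tendsto_pos_mult_at_top[OF tendsto_const] filterlim_compose[OF filterlim_real_sequentially filterlim_Suc]) simp
    show "\<forall>\<^sub>F k in sequentially. s\<^sup>2 * real (Suc k) <= 1 + (s * real (Suc k))\<^sup>2"
    proof (rule always_eventually, rule allI)
     fix k
     have "real (Suc k) <= (real (Suc k))\<^sup>2" by (simp add: power2_eq_square)
     then have "s\<^sup>2 * real (Suc k) <= s\<^sup>2 * (real (Suc k))\<^sup>2" by (intro mult_left_mono) auto
     then show "s\<^sup>2 * real (Suc k) <= 1 + (s * real (Suc k))\<^sup>2" by (simp only: power_mult_distrib)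
    qed
   qed
   from tendsto_divide_0[OF tendsto_const filterlim_at_top_imp_at_infinity[OF this], of 1]
   show ?thesis using False by (simp add: g'_def e_def divide_inverse del: of_nat_Suc)
  qed (simp add: g'_def)
  then show "AE x in M. (%k. g' k (u x)) \<longlonglongrightarrow> indicator {0} (u x)" by simp
  show "(%x. 0 :: real) \<in> Lp p \<Omega>" by (rule W0_Lp(1)[OF W0_zero])
 qed (use g'1 W0_Lp(2)[OF W] in \<open>simp_all add: indicator_def\<close>)
 then have "AE x in M. (indicator {0} (u x) :: real) *\<^sub>R D x = 0" by (rule W0_unique[OF _ W0_zero])
 then show ?thesis
 proof eventually_elim
  case (elim x)
  show ?case
  proof
   assume "u x = 0"
   then have "indicator {0} (u x) = (1 :: real)" by simp
   with elim show "D x = 0" by (simp only: scaleR_one)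
  qed
 qed
qed

text \<open>Polarisation, 4 u v = (u + v)^2 - (u - v)^2. The square is not globally Lipschitz, so
  \<open>q\<close> continues it linearly beyond 2 b, a range that u + v and u - v avoid almost
  everywhere.\<close>

lemma W0_mult_bounded:
 assumes U: "W0 u D" and V: "W0 v E" and B: "AE x in M. \<bar>u x\<bar> <= B" "AE x in M. \<bar>v x\<bar> <= B"
 shows "W0 (%x. u x * v x) (%x. u x *\<^sub>R E x + v x *\<^sub>R D x)"
proof -
 define b where "b = max 0 B"
 define q where "q s = s\<^sup>2 - (max 0 (s - 2 * b))\<^sup>2 - (max 0 (- s - 2 * b))\<^sup>2" for s :: real
 define q' where "q' s = 2 * s - 2 * max 0 (s - 2 * b) + 2 * max 0 (- s - 2 * b)" for s :: real
 have der: "(q has_real_derivative q' s) (at s)" for s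
 proof -
  have "((%s. (max 0 (s - 2 * b))\<^sup>2) has_real_derivative 2 * max 0 (s - 2 * b) * 1) (at s)"
   by (rule DERIV_chain2[OF DERIV_pos_part_square]) (auto intro!: derivative_eq_intros)
  moreover have "((%s. (max 0 (- s - 2 * b))\<^sup>2) has_real_derivative 2 * max 0 (- s - 2 * b) * (- 1)) (at s)"
   by (rule DERIV_chain2[OF DERIV_pos_part_square]) (auto intro!: derivative_eq_intros)
  moreover have "((%s. s\<^sup>2) has_real_derivative 2 * s) (at s)" by (auto intro!: derivative_eq_intros)
  ultimately have "(q has_real_derivative 2 * s - 2 * max 0 (s - 2 * b) * 1 - 2 * max 0 (- s - 2 * b) * (- 1)) (at s)"
   unfolding q_def by (intro DERIV_diff)
  then show ?thesis by (simp add: q'_def)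
 qed
 have cont: "continuous_on UNIV q'" unfolding q'_def by (intro continuous_intros)
 have q'b: "\<bar>q' s\<bar> <= 4 * b" for s by (auto simp: q'_def b_def max_def)
 have q0: "q 0 = 0" by (simp add: q_def b_def)
 have qs: "q s = s\<^sup>2" "q' s = 2 * s" if "\<bar>s\<bar> <= 2 * b" for s
 proof -
  have "max 0 (s - 2 * b) = 0" "max 0 (- s - 2 * b) = 0" using that by (auto simp: max_def)
  then show "q s = s\<^sup>2" "q' s = 2 * s" by (simp_all add: q_def q'_def)
 qed
 have P: "W0 (%x. q (u x + v x)) (%x. q' (u x + v x) *\<^sub>R (D x + E x))"
  by (rule W0_chain[OF W0_add[OF U V] der cont q'b q0])
 have N: "W0 (%x. q (u x - v x)) (%x. q' (u x - v x) *\<^sub>R (D x - E x))"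
  by (rule W0_chain[OF W0_diff[OF U V] der cont q'b q0])
 note W = W0_scale[OF W0_diff[OF P N], of "1 / 4"]
 have ae: "AE x in M. \<bar>u x\<bar> <= b \<and> \<bar>v x\<bar> <= b" using B by eventually_elim (auto simp: b_def)
 show ?thesis
 proof (rule W0_cong_AE[OF W])
  show "(%x. u x * v x) \<in> borel_measurable M"
   by (intro borel_measurable_times W0_measurable(1)[OF U] W0_measurable(1)[OF V])
  show "(%x. u x *\<^sub>R E x + v x *\<^sub>R D x) \<in> borel_measurable M"
   by (intro borel_measurable_add borel_measurable_scaleR W0_measurable[OF U] W0_measurable[OF V])
  show "AE x in M. u x * v x = 1 / 4 * (q (u x + v x) - q (u x - v x))"
   using ae
  proof eventually_elim
   case (elim x)
   have "\<bar>u x + v x\<bar> <= 2 * b" "\<bar>u x - v x\<bar> <= 2 * b" using elim by linarith+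
   then show ?case by (simp add: qs power2_eq_square algebra_simps)
  qed
  show "AE x in M. u x *\<^sub>R E x + v x *\<^sub>R D x
    = (1 / 4) *\<^sub>R (q' (u x + v x) *\<^sub>R (D x + E x) - q' (u x - v x) *\<^sub>R (D x - E x))"
   using ae
  proof eventually_elim
   case (elim x)
   have "\<bar>u x + v x\<bar> <= 2 * b" "\<bar>u x - v x\<bar> <= 2 * b" using elim by linarith+
   then have q2: "q' (u x + v x) = 2 * (u x + v x)" "q' (u x - v x) = 2 * (u x - v x)" by (simp_all only: qs)
   show ?case unfolding q2 by (simp add: vec_eq_iff algebra_simps)
  qed
 qed
qed

end

section \<open>A fixed point theorem on cubes\<close>

text \<open>Brouwer's theorem in a form where the dimension \<open>m\<close> is a number and not a
  type, with coordinatewise convergence. It comes from Kuhn's combinatorial lemma on grids of mesh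
  1/(N+1).\<close>

lemma cube_fixed_point:
 fixes F :: "(nat => real) => nat => real" and m :: nat
 assumes maps: "!!x i. \<forall>j<m. 0 <= x j \<and> x j <= 1 ==> i < m ==> 0 <= F x i \<and> F x i <= 1"
  and cont: "!!X x i. (!!k::nat. \<forall>j<m. 0 <= X k j \<and> X k j <= 1) ==> (\<forall>j<m. 0 <= x j \<and> x j <= 1) ==>
   (!!j. j < m ==> (%k. X k j) \<longlonglongrightarrow> x j) ==> i < m ==> (%k. F (X k) i) \<longlonglongrightarrow> F x i"
 shows "\<exists>x. (\<forall>j<m. 0 <= x j \<and> x j <= 1) \<and> (\<forall>j<m. F x j = x j)"
proof -
 define sc where "sc N y = (%j. real (y j) / real (Suc N))" for N :: nat and y :: "nat => nat"
 have sc01: "\<forall>j<m. 0 <= sc N y j \<and> sc N y j <= 1" if "\<forall>j<m. y j <= Suc N" for N y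
  using that by (auto simp: sc_def divide_le_eq_1 simp del: of_nat_Suc)
 have "\<exists>q. (\<forall>j<m. q j < Suc N) \<and> (\<forall>i<m. \<exists>a b. (\<forall>j<m. q j <= a j \<and> a j <= q j + 1) \<and> (\<forall>j<m. q j <= b j \<and> b j <= q j + 1)
   \<and> sc N a i <= F (sc N a) i \<and> F (sc N b) i <= sc N b i)" for N
 proof -
  \<comment> \<open>The label is 0 where F does not decrease the coordinate. On the upper face it is
    set to 1 outright, as Kuhn's lemma demands; \<open>l1\<close> still holds there because F takes
    values in the cube.\<close>
  define label where "label y i = (if y i = Suc N then 1 else if sc N y i <= F (sc N y) i then 0 else (1::nat))" for y i
  have l0: "sc N y i <= F (sc N y) i" if "label y i = 0" for y i
   using that by (auto simp: label_def split: if_splits)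
  have l1: "F (sc N y) i <= sc N y i" if "label y i = 1" "\<forall>j<m. y j <= Suc N" "i < m" for y i
  proof (cases "y i = Suc N")
   case True
   then have "sc N y i = 1" by (simp add: sc_def)
   then show ?thesis using maps[OF sc01[OF that(2)] that(3)] by simp
  next
   case False
   then show ?thesis using that(1) by (auto simp: label_def split: if_splits)
  qed
  have l01: "label y i = 0 \<or> label y i = 1" for y i by (auto simp: label_def)
  obtain q where q: "\<forall>i<m. q i < Suc N"
   "\<forall>i<m. \<exists>r s. (\<forall>j<m. q j <= r j \<and> r j <= q j + 1) \<and> (\<forall>j<m. q j <= s j \<and> s j <= q j + 1) \<and> label r i \<noteq> label s i"
  proof -
   have k3: "\<forall>x. (\<forall>i<m. x i <= Suc N) \<longrightarrow> (\<forall>i<m. x i = 0 \<longrightarrow> label x i = 0)"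
   proof (intro allI impI)
    fix x i assume x: "\<forall>i<m. x i <= Suc N" "i < m" "x i = 0"
    then have "sc N x i = 0" by (simp add: sc_def)
    then show "label x i = 0" using maps[OF sc01[OF x(1)] x(2)] x(3) by (simp add: label_def)
   qed
   have k2: "\<forall>x. (\<forall>i<m. x i <= Suc N) \<longrightarrow> (\<forall>i<m. label x i = 0 \<or> label x i = 1)" using l01 by blast
   have k4: "\<forall>x. (\<forall>i<m. x i <= Suc N) \<longrightarrow> (\<forall>i<m. x i = Suc N \<longrightarrow> label x i = 1)" by (simp add: label_def)
   show thesis by (rule kuhn_lemma[OF zero_less_Suc k2 k3 k4]) (rule that)
  qed
  show ?thesis
  proof (rule exI[of _ q], rule conjI[OF q(1)], intro allI impI)
   fix i assume i: "i < m"
   obtain r s where rs: "\<forall>j<m. q j <= r j \<and> r j <= q j + 1" "\<forall>j<m. q j <= s j \<and> s j <= q j + 1" "label r i \<noteq> label s i"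
    using q(2) i by blast
   have le: "\<forall>j<m. r j <= Suc N" "\<forall>j<m. s j <= Suc N" using rs q(1) by fastforce+
   show "\<exists>a b. (\<forall>j<m. q j <= a j \<and> a j <= q j + 1) \<and> (\<forall>j<m. q j <= b j \<and> b j <= q j + 1)
     \<and> sc N a i <= F (sc N a) i \<and> F (sc N b) i <= sc N b i"
   proof (cases "label r i = 0")
    case True
    then have "label s i = 1" using l01[of s i] rs(3) by simp
    then show ?thesis using rs l0[OF True] l1[OF _ le(2) i] by blast
   next
    case False
    then have "label r i = 1" "label s i = 0" using l01[of r i] l01[of s i] rs(3) by auto
    then show ?thesis using rs l0[of s i] l1[OF _ le(1) i] by blast
   qed
  qed
 qed
 then have "\<forall>N. \<exists>q. (\<forall>j<m. q j < Suc N) \<and> (\<forall>i<m. \<exists>a b. (\<forall>j<m. q j <= a j \<and> a j <= q j + 1) \<and> (\<forall>j<m. q j <= b j \<and> b j <= q j + 1)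
   \<and> sc N a i <= F (sc N a) i \<and> F (sc N b) i <= sc N b i)" by blast
 then obtain q where q: "\<forall>N. (\<forall>j<m. q N j < Suc N) \<and> (\<forall>i<m. \<exists>a b. (\<forall>j<m. q N j <= a j \<and> a j <= q N j + 1) \<and> (\<forall>j<m. q N j <= b j \<and> b j <= q N j + 1)
   \<and> sc N a i <= F (sc N a) i \<and> F (sc N b) i <= sc N b i)"
  by (rule choice[THEN exE])
 have q01: "\<forall>j<m. 0 <= sc N (q N) j \<and> sc N (q N) j <= 1" for N by (rule sc01) (use q less_imp_le in blast)
 obtain k where k: "strict_mono (k :: nat => nat)" "!!j. j \<in> {..<m} ==> \<exists>l. (%n. sc (k n) (q (k n)) j) \<longlonglongrightarrow> l"
  using function_convergent_subsequence[of "{..<m}" "%N j. sc N (q N) j" 1] q01 by auto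
 define x where "x j = lim (%n. sc (k n) (q (k n)) j)" for j
 have x: "(%n. sc (k n) (q (k n)) j) \<longlonglongrightarrow> x j" if "j < m" for j
  using k(2)[of j] that unfolding x_def by (auto simp: limI)
 have x01: "\<forall>j<m. 0 <= x j \<and> x j <= 1"
 proof (intro allI impI)
  fix j assume j: "j < m"
  have "0 <= x j" by (rule LIMSEQ_le_const[OF x[OF j]]) (use q01 j in auto)
  moreover have "x j <= 1" by (rule LIMSEQ_le_const2[OF x[OF j]]) (use q01 j in auto)
  ultimately show "0 <= x j \<and> x j <= 1" by simp
 qed
 have inv0: "(%n. 1 / real (Suc (k n))) \<longlonglongrightarrow> 0"
  using LIMSEQ_subseq_LIMSEQ[OF LIMSEQ_inverse_real_of_nat k(1)] by (simp add: o_def divide_inverse del: of_nat_Suc)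
 \<comment> \<open>All choices of vertices in the selected cells share one limit, since the cells
   have size 1 / (k n + 1).\<close>
 have near: "(%n. sc (k n) (a n) j) \<longlonglongrightarrow> x j" if a: "!!n. \<forall>j<m. q (k n) j <= a n j \<and> a n j <= q (k n) j + 1" and j: "j < m" for a j
 proof -
  have "(%n. sc (k n) (a n) j - sc (k n) (q (k n)) j) \<longlonglongrightarrow> 0"
  proof (rule Lim_null_comparison[OF _ inv0], rule always_eventually, rule allI)
   fix n
   have "real (q (k n) j) <= real (a n j)" "real (a n j) <= real (q (k n) j) + 1"
    using a[of n] j by (metis of_nat_le_iff, metis of_nat_1 of_nat_add of_nat_le_iff)
   then have "\<bar>real (a n j) - real (q (k n) j)\<bar> <= 1" by linarith
   then have "\<bar>real (a n j) - real (q (k n) j)\<bar> / real (Suc (k n)) <= 1 / real (Suc (k n))"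
    by (intro divide_right_mono) auto
   then show "norm (sc (k n) (a n) j - sc (k n) (q (k n)) j) <= 1 / real (Suc (k n))"
    by (simp add: sc_def diff_divide_distrib[symmetric] del: of_nat_Suc)
  qed
  from tendsto_add[OF this x[OF j]] show ?thesis by simp
 qed
 have fix_i: "F x i = x i" if i: "i < m" for i
 proof -
  have "\<forall>n. \<exists>ab. (\<forall>j<m. q (k n) j <= fst ab j \<and> fst ab j <= q (k n) j + 1) \<and> (\<forall>j<m. q (k n) j <= snd ab j \<and> snd ab j <= q (k n) j + 1)
   \<and> sc (k n) (fst ab) i <= F (sc (k n) (fst ab)) i \<and> F (sc (k n) (snd ab)) i <= sc (k n) (snd ab) i"
   using q i by (metis fst_conv snd_conv)
  then obtain ab where ab: "\<forall>n. (\<forall>j<m. q (k n) j <= fst (ab n) j \<and> fst (ab n) j <= q (k n) j + 1) \<and> (\<forall>j<m. q (k n) j <= snd (ab n) j \<and> snd (ab n) j <= q (k n) j + 1)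
   \<and> sc (k n) (fst (ab n)) i <= F (sc (k n) (fst (ab n))) i \<and> F (sc (k n) (snd (ab n))) i <= sc (k n) (snd (ab n)) i"
   by (rule choice[THEN exE])
  have a: "\<forall>j<m. q (k n) j <= fst (ab n) j \<and> fst (ab n) j <= q (k n) j + 1"
   and b: "\<forall>j<m. q (k n) j <= snd (ab n) j \<and> snd (ab n) j <= q (k n) j + 1" for n using ab by blast+
  have qS: "\<forall>j<m. q (k n) j < Suc (k n)" for n using q by blast
  have "\<forall>j<m. fst (ab n) j <= Suc (k n)" "\<forall>j<m. snd (ab n) j <= Suc (k n)" for n
   using a[of n] b[of n] qS[of n] by fastforce+
  note ab01 = this[THEN sc01]
  have Fa: "(%n. F (sc (k n) (fst (ab n))) i) \<longlonglongrightarrow> F x i"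
   by (rule cont[OF ab01(1) x01 near[OF a] i])
  have Fb: "(%n. F (sc (k n) (snd (ab n))) i) \<longlonglongrightarrow> F x i"
   by (rule cont[OF ab01(2) x01 near[OF b] i])
  have "x i <= F x i" by (rule LIMSEQ_le[OF near[OF a i] Fa]) (use ab in blast)
  moreover have "F x i <= x i" by (rule LIMSEQ_le[OF Fb near[OF b i]]) (use ab in blast)
  ultimately show ?thesis by simp
 qed
 with x01 show ?thesis by blast
qed

section \<open>Strictly monotone vector fields with a potential\<close>

text \<open>The constant \<open>C\<close> may blow up as its \<open>e\<close> decreases, so it is
  fixed first and only then is \<open>Q\<close> made small.\<close>

lemma Cauchy_from_modulus:
 fixes x Q :: "nat => nat => real"
 assumes mod: "!!e. e > 0 ==> \<exists>C\<ge>0. \<forall>m n. x m n <= e * K + C * Q m n" and "K \<ge> 0"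
  and Q: "!!e. e > 0 ==> \<exists>N. \<forall>m\<ge>N. \<forall>n\<ge>N. Q m n < e" and e: "e > 0"
 shows "\<exists>N. \<forall>m\<ge>N. \<forall>n\<ge>N. x m n < e"
proof -
 define e1 where "e1 = e / (2 * (K + 1))"
 have e1: "e1 > 0" using e \<open>K \<ge> 0\<close> by (simp add: e1_def add_nonneg_pos)
 have e1K: "e1 * K < e / 2"
 proof -
  have "e1 * K < e1 * (K + 1)" using e1 by simp
  also have "... = e / 2" using \<open>K \<ge> 0\<close> by (simp add: e1_def field_simps)
  finally show ?thesis .
 qed
 obtain C where C: "C \<ge> 0" "!!m n. x m n <= e1 * K + C * Q m n" using mod[OF e1] by blast
 have "e / (2 * (C + 1)) > 0" using e C(1) by (simp add: add_nonneg_pos)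
 then obtain N where N: "!!m n. m \<ge> N ==> n \<ge> N ==> Q m n < e / (2 * (C + 1))" using Q by blast
 have "x m n < e" if "m \<ge> N" "n \<ge> N" for m n
 proof -
  have "C * Q m n <= C * (e / (2 * (C + 1)))" using N[OF that] C(1) by (intro mult_left_mono) auto
  also have "... <= (C + 1) * (e / (2 * (C + 1)))" using e C(1) by (intro mult_right_mono) auto
  also have "... = e / 2" using C(1) by (simp add: field_simps)
  finally show ?thesis using C(2)[of m n] e1K by linarith
 qed
 then show ?thesis by blast
qed

text \<open>The potential is tied to \<open>a\<close> by the subgradient inequality
  \<open>\<Phi>_sub\<close>, which makes it convex; \<open>a_mono\<close> then makes it uniformly
  convex. The weight (|x| + |y|)^(p-2) covers p < 2 and p >= 2 alike, so no case distinction on p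
  follows.\<close>

locale leray_lions = sobolev_domain \<Omega> p for \<Omega> :: "(real^'n::finite) set" and p +
 fixes a :: "real^'n => real^'n" and \<Phi> :: "real^'n => real" and c2 Ca :: real
 assumes a_cont: "continuous_on UNIV a" and \<Phi>_cont: "continuous_on UNIV \<Phi>"
  and Ca_pos: "Ca > 0" and c2_pos: "c2 > 0"
  and a_growth: "!!x. norm (a x) <= Ca * (1 + norm x powr (p - 1))"
  and a_mono: "!!x y. c2 * (norm x + norm y) powr (p - 2) * (norm (x - y))\<^sup>2 <= (a x - a y) \<bullet> (x - y)"
  and a_zero: "a 0 = 0" and \<Phi>_zero: "\<Phi> 0 = 0"
  and \<Phi>_sub: "!!x y. a x \<bullet> (y - x) <= \<Phi> y - \<Phi> x"
begin

lemma a_mono_nonneg: "0 <= (a x - a y) \<bullet> (x - y)"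
 by (rule order_trans[OF _ a_mono]) (use c2_pos in simp)

lemma a_coercive: "c2 * norm x powr p <= a x \<bullet> x"
proof (cases "x = 0")
 case False
 have "norm x powr (p - 2) * (norm x)\<^sup>2 = norm x powr p"
  using False by (simp add: powr_diff)
 then show ?thesis using a_mono[of x 0] by (simp add: a_zero mult.assoc)
qed (use p_pos in simp)

text \<open>Let S = |x| + |y|. If |x - y| <= d S, the energy term suffices, with d chosen so that
  d^p 2^p = e. Otherwise S^(p-2) |x - y|^2 is at least d^2 S^p, hence at least d^2 |x - y|^p, and
  monotonicity takes over.\<close>

lemma a_modulus:
 assumes "e > 0"
 shows "\<exists>C\<ge>0. \<forall>x y. norm (x - y) powr p <= e * (norm x powr p + norm y powr p) + C * ((a x - a y) \<bullet> (x - y))"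
proof -
 define d where "d = (e / 2 powr p) powr (1 / p)"
 have d: "d > 0" "d powr p * 2 powr p = e" using assms p_pos by (auto simp: d_def powr_powr)
 have c: "1 / (d\<^sup>2 * c2) \<ge> 0" using d c2_pos by simp
 have "norm (x - y) powr p <= e * (norm x powr p + norm y powr p) + 1 / (d\<^sup>2 * c2) * ((a x - a y) \<bullet> (x - y))" for x y
 proof -
  define S where "S = norm x + norm y"
  have S: "S \<ge> 0" "norm (x - y) <= S" by (auto simp: S_def norm_triangle_ineq4)
  show ?thesis
  proof (cases "norm (x - y) <= d * S")
   case True
   have "norm (x - y) powr p <= (d * S) powr p" using True p_pos by (intro powr_mono2) auto
   also have "... = d powr p * S powr p" by (rule powr_mult)
   also have "... <= d powr p * (2 powr p * (norm x powr p + norm y powr p))"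
    unfolding S_def by (intro mult_left_mono powr_add_le) (use p_pos in auto)
   also have "... = e * (norm x powr p + norm y powr p)" using d(2) by (simp add: mult.assoc[symmetric])
   finally show ?thesis
    using mult_nonneg_nonneg[OF c a_mono_nonneg[of x y]] by linarith
  next
   case False
   then have dS: "d * S < norm (x - y)" by simp
   have S0: "S > 0"
   proof (rule ccontr)
    assume "\<not> S > 0"
    then have "S = 0" using S(1) by linarith
    with dS S(2) show False by simp
   qed
   have sq: "S\<^sup>2 * d\<^sup>2 <= (norm (x - y))\<^sup>2"
   proof -
    have "(d * S)\<^sup>2 <= (norm (x - y))\<^sup>2" using dS d S by (intro power_mono) auto
    then show ?thesis by (simp add: power_mult_distrib mult.commute)
   qed
   have "norm (x - y) powr p <= S powr p" using S p_pos by (intro powr_mono2) auto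
   also have "... = S powr (p - 2) * S\<^sup>2" using S0 by (simp add: powr_diff)
   also have "... <= S powr (p - 2) * ((norm (x - y))\<^sup>2 / d\<^sup>2)"
    using sq d by (intro mult_left_mono) (auto simp: field_simps)
   also have "... = 1 / (d\<^sup>2 * c2) * (c2 * S powr (p - 2) * (norm (x - y))\<^sup>2)"
    using c2_pos by (simp add: field_simps)
   also have "... <= 1 / (d\<^sup>2 * c2) * ((a x - a y) \<bullet> (x - y))"
    unfolding S_def by (rule mult_left_mono[OF a_mono c])
   finally show ?thesis
    using assms by (simp add: add_increasing)
  qed
 qed
 then show ?thesis using c by blast
qed

text \<open>Uniform convexity of the potential. It is extracted from the strong monotonicity of
  \<open>a\<close> between the midpoint and a quarter point of the segment, without differentiating
  \<open>\<Phi>\<close>.\<close>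

lemma \<Phi>_modulus:
 assumes "e > 0"
 shows "\<exists>C\<ge>0. \<forall>x y. norm (x - y) powr p <= e * (norm x powr p + norm y powr p)
  + C * (\<Phi> x + \<Phi> y - 2 * \<Phi> ((1 / 2) *\<^sub>R (x + y)))"
proof -
 \<comment> \<open>The factor 4^p comes from x - y = 4 (z - m), and 2 * 2^p from bounding both |z|
   and |m| by |x| + |y|.\<close>
 define e' where "e' = e / (4 powr p * (2 * 2 powr p))"
 have e': "e' > 0" "4 powr p * (e' * (2 * 2 powr p)) = e" using assms by (auto simp: e'_def)
 obtain C where C: "C \<ge> 0" "!!x y. norm (x - y) powr p <= e' * (norm x powr p + norm y powr p) + C * ((a x - a y) \<bullet> (x - y))"
  using a_modulus[OF e'(1)] by blast
 have "norm (x - y) powr p <= e * (norm x powr p + norm y powr p)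
  + 4 powr p * C * (\<Phi> x + \<Phi> y - 2 * \<Phi> ((1 / 2) *\<^sub>R (x + y)))" for x y
 proof -
  \<comment> \<open>\<open>m\<close> is the midpoint and \<open>z\<close> lies halfway from
    \<open>m\<close> to \<open>x\<close>. Add the subgradient inequalities at z towards x, at m
    towards z and at m towards y: since y - m = -2 (z - m), the terms with \<open>a m\<close>
    combine and (a z - a m) . (z - m) remains.\<close>
  define m where "m = (1 / 2) *\<^sub>R (x + y)"
  define z where "z = (1 / 2) *\<^sub>R (x + m)"
  have xz: "x - z = z - m" by (simp add: z_def vec_eq_iff field_simps)
  have xm: "x - m = (x - z) + (z - m)" by simp
  have zm: "z - m = (1 / 4) *\<^sub>R (x - y)" by (simp add: z_def m_def vec_eq_iff field_simps)
  have ym: "y - m = - (x - m)" by (simp add: m_def vec_eq_iff field_simps)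
  have "a m \<bullet> (x - m) + a m \<bullet> (y - m) = 0" unfolding ym inner_minus_right by simp
  moreover have "a m \<bullet> (x - m) = a m \<bullet> (z - m) + a m \<bullet> (z - m)"
   by (subst xm, subst inner_add_right) (simp only: xz)
  moreover have "a z \<bullet> (z - m) <= \<Phi> x - \<Phi> z" using \<Phi>_sub[of z x] unfolding xz .
  ultimately have def1: "(a z - a m) \<bullet> (z - m) <= \<Phi> x + \<Phi> y - 2 * \<Phi> m"
   using \<Phi>_sub[of m z] \<Phi>_sub[of m y] unfolding inner_diff_left by linarith
  have nz: "norm z <= norm x + norm y" "norm m <= norm x + norm y"
  proof -
   have 1: "norm m <= (norm x + norm y) / 2" unfolding m_def using norm_triangle_ineq[of x y] by simp
   have 2: "norm z <= (norm x + norm m) / 2" unfolding z_def using norm_triangle_ineq[of x m] by simp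
   show "norm m <= norm x + norm y" using 1 norm_ge_zero[of x] norm_ge_zero[of y] by argo
   show "norm z <= norm x + norm y" using 1 2 norm_ge_zero[of x] norm_ge_zero[of y] by argo
  qed
  have "norm (x - y) powr p = 4 powr p * norm (z - m) powr p"
   unfolding zm by (simp add: powr_mult powr_divide)
  also have "... <= 4 powr p * (e' * (norm z powr p + norm m powr p) + C * ((a z - a m) \<bullet> (z - m)))"
   by (intro mult_left_mono C(2)) simp
  also have "... <= 4 powr p * (e' * (2 * 2 powr p * (norm x powr p + norm y powr p)) + C * (\<Phi> x + \<Phi> y - 2 * \<Phi> m))"
  proof (intro mult_left_mono add_mono def1 C(1))
   have "norm z powr p <= (norm x + norm y) powr p" "norm m powr p <= (norm x + norm y) powr p"
    using nz p_pos by (intro powr_mono2; simp)+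
   moreover have "(norm x + norm y) powr p <= 2 powr p * (norm x powr p + norm y powr p)"
    by (rule powr_add_le) (use p_pos in auto)
   ultimately show "norm z powr p + norm m powr p <= 2 * 2 powr p * (norm x powr p + norm y powr p)" by linarith
  qed (use e'(1) in auto)
  also have "... = (4 powr p * (e' * (2 * 2 powr p))) * (norm x powr p + norm y powr p) + 4 powr p * C * (\<Phi> x + \<Phi> y - 2 * \<Phi> m)"
   by (simp add: algebra_simps)
  finally show ?thesis unfolding e'(2) m_def .
 qed
 moreover have "4 powr p * C \<ge> 0" using C(1) by simp
 ultimately show ?thesis by blast
qed

text \<open>The subgradient inequality at x/2 gives Phi(x) >= a(x/2) . (x/2), and coercivity there
  accounts for the factor 2^(-p).\<close>

lemma \<Phi>_lower: "c2 * 2 powr (- p) * norm x powr p <= \<Phi> x"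
proof -
 define h where "h = (1 / 2) *\<^sub>R x"
 have xh: "x - h = h" by (simp add: h_def vec_eq_iff)
 have "a h \<bullet> h <= \<Phi> x - \<Phi> h" using \<Phi>_sub[of h x] unfolding xh .
 moreover have "0 <= \<Phi> h" using \<Phi>_sub[of 0 h] by (simp add: a_zero \<Phi>_zero)
 ultimately have "a h \<bullet> h <= \<Phi> x" by linarith
 moreover have "norm h powr p = 2 powr (- p) * norm x powr p"
 proof -
  have "norm h = norm x / 2" by (simp add: h_def)
  then have "norm h powr p = norm x powr p / 2 powr p" by (simp only:) (simp add: powr_divide)
  then show ?thesis by (simp only: powr_minus_divide) simp
 qed
 ultimately show ?thesis using a_coercive[of h] by (simp add: mult.assoc)
qed

lemma \<Phi>_nonneg: "0 <= \<Phi> x"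
 by (rule order_trans[OF _ \<Phi>_lower]) (use c2_pos in simp)

lemma young_p: "d > 0 ==> norm x powr (p - 1) * norm y <= d * norm x powr p + d powr (1 - p) * norm y powr p"
 by (rule young_split[OF p_gt_1]) auto

lemma a_inner_bound:
 assumes "d > 0"
 shows "\<bar>a x \<bullet> y\<bar> <= Ca * (norm y + d * norm x powr p + d powr (1 - p) * norm y powr p)"
proof -
 have "\<bar>a x \<bullet> y\<bar> <= norm (a x) * norm y" by (rule Cauchy_Schwarz_ineq2)
 also have "... <= Ca * (1 + norm x powr (p - 1)) * norm y" by (intro mult_right_mono a_growth) simp
 also have "... = Ca * (norm y + norm x powr (p - 1) * norm y)" by (simp add: algebra_simps)
 also have "... <= Ca * (norm y + (d * norm x powr p + d powr (1 - p) * norm y powr p))"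
  using Ca_pos young_p[OF assms, of x y] by (intro mult_left_mono add_left_mono) auto
 finally show ?thesis by (simp add: add.assoc)
qed

lemma \<Phi>_upper: "\<Phi> x <= Ca * (norm x + 2 * norm x powr p)"
proof -
 have "\<Phi> x <= a x \<bullet> x" using \<Phi>_sub[of x 0] by (simp add: \<Phi>_zero)
 also have "... <= Ca * (norm x + 1 * norm x powr p + 1 powr (1 - p) * norm x powr p)"
  using a_inner_bound[of 1 x x] by simp
 finally show ?thesis by (simp add: add.commute)
qed

lemma measurable_vec: "continuous_on UNIV (h :: real^'n => 'b::euclidean_space) ==> D \<in> borel_measurable M ==> (%x. h (D x)) \<in> borel_measurable M"
 by (rule measurable_compose[OF _ borel_measurable_continuous_onI])

lemma \<Phi>_integrable:
 assumes "D \<in> Lp p \<Omega>" shows "integrable M (%x. \<Phi> (D x))"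
proof (rule integrable_bound)
 show "integrable M (%x. Ca * (norm (D x) + 2 * norm (D x) powr p))"
  using Lp_integrable[OF assms] Lp_integrable_powr[OF assms]
  by (intro integrable_mult_right integrable_add integrable_norm)
 show "(%x. \<Phi> (D x)) \<in> borel_measurable M" by (rule measurable_vec[OF \<Phi>_cont Lp_measurable[OF assms]])
 show "AE x in M. norm (\<Phi> (D x)) <= norm (Ca * (norm (D x) + 2 * norm (D x) powr p))"
  using \<Phi>_upper \<Phi>_nonneg by (intro AE_I2) (auto intro: order_trans[OF _ abs_ge_self])
qed

lemma a_integrable:
 assumes "D \<in> Lp p \<Omega>" "E \<in> Lp p \<Omega>" shows "integrable M (%x. a (D x) \<bullet> E x)"
proof (rule integrable_bound)
 show "integrable M (%x. Ca * (norm (E x) + 1 * norm (D x) powr p + 1 powr (1 - p) * norm (E x) powr p))"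
  using Lp_integrable[OF assms(2)] Lp_integrable_powr[OF assms(1)] Lp_integrable_powr[OF assms(2)]
  by (intro integrable_mult_right integrable_add integrable_norm)
 show "(%x. a (D x) \<bullet> E x) \<in> borel_measurable M"
  by (intro borel_measurable_inner measurable_vec[OF a_cont] Lp_measurable assms)
 show "AE x in M. norm (a (D x) \<bullet> E x) <= norm (Ca * (norm (E x) + 1 * norm (D x) powr p + 1 powr (1 - p) * norm (E x) powr p))"
  using a_inner_bound[of 1] by (intro AE_I2) (auto intro: order_trans[OF _ abs_ge_self])
qed

lemma a_dual_bound:
 assumes "D \<in> Lp p \<Omega>" "E \<in> Lp p \<Omega>" "d > 0"
 shows "\<bar>LINT x|M. a (D x) \<bullet> E x\<bar> <= Ca * ((LINT x|M. norm (E x)) + d * nrm D + d powr (1 - p) * nrm E)"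
proof -
 note i = Lp_integrable[OF assms(2), THEN integrable_norm] Lp_integrable_powr[OF assms(1)] Lp_integrable_powr[OF assms(2)]
 have "norm (LINT x|M. a (D x) \<bullet> E x) <= (LINT x|M. Ca * (norm (E x) + d * norm (D x) powr p + d powr (1 - p) * norm (E x) powr p))"
  by (rule integral_norm_bound_integral[OF a_integrable[OF assms(1,2)]])
   (use i a_inner_bound[OF assms(3)] in \<open>auto intro!: integrable_mult_right integrable_add\<close>)
 also have "... = Ca * ((LINT x|M. norm (E x)) + d * nrm D + d powr (1 - p) * nrm E)"
  unfolding nrm_def using i by simp
 finally show ?thesis by simp
qed

text \<open>Here D is fixed, so \<open>d\<close> first makes the energy term d nrm D small; the
  remaining terms depend on \<open>E n\<close> alone and tend to zero. Thus a(D) acts on L^p as a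
  continuous functional.\<close>

lemma a_dual_tendsto:
 assumes "D \<in> Lp p \<Omega>" "!!n. E n \<in> Lp p \<Omega>" "(%n. nrm (E n)) \<longlonglongrightarrow> 0"
 shows "(%n. LINT x|M. a (D x) \<bullet> E n x) \<longlonglongrightarrow> 0"
proof (rule LIMSEQ_I)
 fix e :: real assume e: "e > 0"
 define t where "t = nrm D + 1"
 have t: "t > 0" "nrm D <= t" using nrm_nonneg[of D] by (auto simp: t_def)
 define d where "d = e / (2 * Ca * t)"
 have d: "d > 0" using e Ca_pos t by (simp add: d_def)
 have "Ca * (d * nrm D) <= Ca * (d * t)" using Ca_pos d t by (intro mult_left_mono) auto
 also have "... = e / 2" using Ca_pos t by (simp add: d_def)
 finally have dD: "Ca * (d * nrm D) <= e / 2" .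
 have "(%n. Ca * ((LINT x|M. norm (E n x)) + d powr (1 - p) * nrm (E n))) \<longlonglongrightarrow> Ca * (0 + d powr (1 - p) * 0)"
  by (intro tendsto_mult tendsto_add tendsto_const L1_tendsto assms)
 then have "\<forall>\<^sub>F n in sequentially. Ca * ((LINT x|M. norm (E n x)) + d powr (1 - p) * nrm (E n)) < e / 2"
  using e by (intro order_tendstoD(2)) auto
 then obtain N where N: "!!n. n \<ge> N ==> Ca * ((LINT x|M. norm (E n x)) + d powr (1 - p) * nrm (E n)) < e / 2"
  by (auto simp: eventually_sequentially)
 have "norm ((LINT x|M. a (D x) \<bullet> E n x) - 0) < e" if "n \<ge> N" for n
 proof -
  have "\<bar>LINT x|M. a (D x) \<bullet> E n x\<bar> <= Ca * (d * nrm D) + Ca * ((LINT x|M. norm (E n x)) + d powr (1 - p) * nrm (E n))"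
   using a_dual_bound[OF assms(1) assms(2) d, of n] by (simp add: algebra_simps)
  then show ?thesis using dD N[OF that] by simp
 qed
 then show "\<exists>N. \<forall>n\<ge>N. norm ((LINT x|M. a (D x) \<bullet> E n x) - 0) < e" by blast
qed

lemma nrm_a_modulus:
 assumes "!!x y. norm (x - y) powr p <= e * (norm x powr p + norm y powr p) + C * ((a x - a y) \<bullet> (x - y))"
  and D: "D \<in> Lp p \<Omega>" and E: "E \<in> Lp p \<Omega>"
 shows "nrm (%x. D x - E x) <= e * (nrm D + nrm E) + C * (LINT x|M. (a (D x) - a (E x)) \<bullet> (D x - E x))"
  and "integrable M (%x. (a (D x) - a (E x)) \<bullet> (D x - E x))"
proof -
 note DE = Lp_diff(1)[OF D E]
 have "integrable M (%x. a (D x) \<bullet> (D x - E x) - a (E x) \<bullet> (D x - E x))"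
  by (intro integrable_diff a_integrable D E DE)
 then show i: "integrable M (%x. (a (D x) - a (E x)) \<bullet> (D x - E x))" by (simp only: inner_diff_left)
 note ip = Lp_integrable_powr[OF D] Lp_integrable_powr[OF E]
 have "nrm (%x. D x - E x) <= (LINT x|M. e * (norm (D x) powr p + norm (E x) powr p) + C * ((a (D x) - a (E x)) \<bullet> (D x - E x)))"
  unfolding nrm_def
  by (intro integral_mono Lp_integrable_powr[OF DE] integrable_add integrable_mult_right ip i assms(1))
 also have "... = e * (nrm D + nrm E) + C * (LINT x|M. (a (D x) - a (E x)) \<bullet> (D x - E x))"
  unfolding nrm_def using ip i by simp
 finally show "nrm (%x. D x - E x) <= e * (nrm D + nrm E) + C * (LINT x|M. (a (D x) - a (E x)) \<bullet> (D x - E x))" .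
qed

subsection \<open>Minimisation\<close>

definition energy :: "(real^'n => real) => (real^'n => real) => (real^'n => real^'n) => real" where
 "energy g u D = (LINT x|M. \<Phi> (D x)) - (LINT x|M. g x * u x)"

lemma bounded_mult_integrable:
 assumes "g \<in> borel_measurable M" "AE x in M. \<bar>g x\<bar> <= (G::real)" "integrable M (u :: _ => real)"
 shows "integrable M (%x. g x * u x)" "\<bar>LINT x|M. g x * u x\<bar> <= G * (LINT x|M. \<bar>u x\<bar>)"
proof -
 have le: "AE x in M. norm (g x * u x) <= G * \<bar>u x\<bar>"
  using assms(2) by eventually_elim (simp add: abs_mult mult_right_mono)
 have Gi: "integrable M (%x. G * \<bar>u x\<bar>)" using assms(3) by simp
 show i: "integrable M (%x. g x * u x)"
 proof (rule integrable_bound[OF Gi])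
  show "(%x. g x * u x) \<in> borel_measurable M" by (intro borel_measurable_times assms(1) borel_measurable_integrable[OF assms(3)])
  show "AE x in M. norm (g x * u x) <= norm (G * \<bar>u x\<bar>)" using le by eventually_elim auto
 qed
 have "\<bar>LINT x|M. g x * u x\<bar> <= (LINT x|M. norm (g x * u x))" using integral_norm_bound[of M "%x. g x * u x"] by simp
 also have "... <= (LINT x|M. G * \<bar>u x\<bar>)" by (rule integral_mono_AE[OF integrable_norm[OF i] Gi le])
 finally show "\<bar>LINT x|M. g x * u x\<bar> <= G * (LINT x|M. \<bar>u x\<bar>)" by simp
qed

text \<open>For p > 1 a linear term is of lower order than the energy: L^1 is bounded by a constant
  plus d^(1-p) nrm u, Poincare's inequality brings in nrm D, and a large \<open>d\<close> makes the
  factor d^(1-p) = 1/t as small as needed.\<close>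

lemma L1_absorb:
 assumes "G \<ge> 0" "c > 0"
 shows "\<exists>K\<ge>0. \<forall>u D. W0 u D \<longrightarrow> G * (LINT x|M. \<bar>u x\<bar>) <= c * nrm D + K"
proof -
 define t where "t = G * poincare_const / c + 1"
 have t: "t > 0" using assms poincare_const_nonneg by (simp add: t_def add_nonneg_pos)
 define d where "d = t powr (1 / (p - 1))"
 have d: "d > 0" using t by (simp add: d_def)
 have "1 / (p - 1) * (1 - p) = - 1" using p_gt_1 by (simp add: field_simps)
 then have dp: "d powr (1 - p) = 1 / t" using t by (simp add: d_def powr_powr powr_minus_divide)
 have key: "G * (d powr (1 - p) * poincare_const) <= c"
 proof -
  have "G * poincare_const <= c * t" using assms by (simp add: t_def field_simps)
  then show ?thesis unfolding dp using t by (simp add: field_simps)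
 qed
 have "G * (LINT x|M. \<bar>u x\<bar>) <= c * nrm D + G * (d * measure M \<Omega>)" if W: "W0 u D" for u D
 proof -
  have "(LINT x|M. \<bar>u x\<bar>) <= d * measure M \<Omega> + d powr (1 - p) * nrm u"
   using L1_le_nrm[OF W0_Lp(1)[OF W] d] by simp
  also have "... <= d * measure M \<Omega> + d powr (1 - p) * (poincare_const * nrm D)"
   using W0_Poincare[OF W] by (intro add_left_mono mult_left_mono) auto
  finally have "G * (LINT x|M. \<bar>u x\<bar>) <= G * (d * measure M \<Omega> + d powr (1 - p) * (poincare_const * nrm D))"
   using assms(1) by (rule mult_left_mono)
  also have "... = G * (d * measure M \<Omega>) + (G * (d powr (1 - p) * poincare_const)) * nrm D" by (simp add: algebra_simps)
  also have "... <= G * (d * measure M \<Omega>) + c * nrm D"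
   by (intro add_left_mono mult_right_mono key nrm_nonneg)
  finally show ?thesis by simp
 qed
 moreover have "0 <= G * (d * measure M \<Omega>)" using assms d by simp
 ultimately show ?thesis by blast
qed

lemma energy_lower:
 assumes "g \<in> borel_measurable M" "AE x in M. \<bar>g x\<bar> <= G"
 shows "\<exists>K. \<forall>u D. W0 u D \<longrightarrow> c2 * 2 powr (- p) / 2 * nrm D - K <= energy g u D"
proof -
 define c where "c = c2 * 2 powr (- p)"
 have c: "c > 0" using c2_pos by (simp add: c_def)
 obtain K where K: "!!u D. W0 u D ==> \<bar>G\<bar> * (LINT x|M. \<bar>u x\<bar>) <= c / 2 * nrm D + K"
  using L1_absorb[of "\<bar>G\<bar>" "c / 2"] c by auto
 have "c / 2 * nrm D - K <= energy g u D" if W: "W0 u D" for u D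
 proof -
  have "c * nrm D = (LINT x|M. c * norm (D x) powr p)" by (simp add: nrm_def)
  also have "... <= (LINT x|M. \<Phi> (D x))"
   unfolding c_def
   by (rule integral_mono[OF integrable_mult_right[OF Lp_integrable_powr[OF W0_Lp(2)[OF W]]] \<Phi>_integrable[OF W0_Lp(2)[OF W]] \<Phi>_lower])
  finally have 1: "c * nrm D <= (LINT x|M. \<Phi> (D x))" .
  have "AE x in M. \<bar>g x\<bar> <= \<bar>G\<bar>" using assms(2) by eventually_elim linarith
  from bounded_mult_integrable(2)[OF assms(1) this Lp_integrable[OF W0_Lp(1)[OF W]]]
  show ?thesis using 1 K[OF W] unfolding energy_def by (simp add: field_simps)
 qed
 then show ?thesis unfolding c_def by (intro exI[of _ K]) simp
qed

lemma energy_midpoint: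
 assumes g: "g \<in> borel_measurable M" "AE x in M. \<bar>g x\<bar> <= G" and U: "W0 u D" and V: "W0 v E"
 shows "(LINT x|M. \<Phi> (D x) + \<Phi> (E x) - 2 * \<Phi> ((1 / 2) *\<^sub>R (D x + E x)))
  = energy g u D + energy g v E - 2 * energy g (%x. 1 / 2 * (u x + v x)) (%x. (1 / 2) *\<^sub>R (D x + E x))"
proof -
 note P = W0_scale[OF W0_add[OF U V], of "1 / 2"]
 note ui = Lp_integrable[OF W0_Lp(1)[OF U]] and vi = Lp_integrable[OF W0_Lp(1)[OF V]]
 note i = \<Phi>_integrable[OF W0_Lp(2)[OF U]] \<Phi>_integrable[OF W0_Lp(2)[OF V]] \<Phi>_integrable[OF W0_Lp(2)[OF P]]
 note gu = bounded_mult_integrable(1)[OF g ui] and gv = bounded_mult_integrable(1)[OF g vi]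
 have "(LINT x|M. g x * (1 / 2 * (u x + v x))) = (LINT x|M. 1 / 2 * (g x * u x + g x * v x))"
  by (intro integral_cong refl) (simp add: algebra_simps)
 also have "... = 1 / 2 * ((LINT x|M. g x * u x) + (LINT x|M. g x * v x))"
  by (subst integral_mult_right_zero, subst integral_add[OF gu gv]) simp
 finally have e1: "(LINT x|M. g x * (1 / 2 * (u x + v x))) = 1 / 2 * ((LINT x|M. g x * u x) + (LINT x|M. g x * v x))" .
 have "(LINT x|M. \<Phi> (D x) + \<Phi> (E x) - 2 * \<Phi> ((1 / 2) *\<^sub>R (D x + E x)))
   = (LINT x|M. \<Phi> (D x)) + (LINT x|M. \<Phi> (E x)) - 2 * (LINT x|M. \<Phi> ((1 / 2) *\<^sub>R (D x + E x)))"
  by (subst integral_diff[OF integrable_add[OF i(1,2)] integrable_mult_right[OF i(3)]],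
    subst integral_add[OF i(1,2)], subst integral_mult_right_zero) simp
 note e2 = this
 show ?thesis unfolding energy_def e1 e2 by (simp add: field_simps)
qed

text \<open>The sets \<open>S n\<close> decrease and are closed under midpoints. The infima of the
  energy increase and stay bounded, hence are Cauchy, and uniform convexity makes near-minimisers
  taken from different sets Cauchy in the gradient. A constant family yields an ordinary minimiser;
  shrinking families replace weak compactness in \<open>weak_limit\<close>.\<close>

lemma nested_minimisation:
 assumes g: "g \<in> borel_measurable M" "AE x in M. \<bar>g x\<bar> <= G"
  and S: "!!n u D. S n u D ==> W0 u D"
  and dec: "!!m n u D. n <= m ==> S m u D ==> S n u D"
  and mid: "!!n u D v E. S n u D ==> S n v E ==> S n (%x. 1 / 2 * (u x + v x)) (%x. (1 / 2) *\<^sub>R (D x + E x))"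
  and ne: "!!n. \<exists>u D. S n u D \<and> energy g u D <= K0"
 shows "\<exists>u D v E. (\<forall>n. S n (u n) (D n)) \<and> W0 v E \<and> (%n. nrm (%x. u n x - v x)) \<longlonglongrightarrow> 0 \<and>
  (%n. nrm (%x. D n x - E x)) \<longlonglongrightarrow> 0 \<and>
  (\<forall>n w F. S n w F \<longrightarrow> energy g (u n) (D n) <= energy g w F + inverse (real (Suc n)))"
proof -
 define c where "c = c2 * 2 powr (- p) / 2"
 have c: "c > 0" using c2_pos by (simp add: c_def)
 obtain K1 where K1: "!!u D. W0 u D ==> c * nrm D - K1 <= energy g u D"
  using energy_lower[OF g] unfolding c_def by blast
 define V where "V n = {energy g u D |u D. S n u D}" for n
 have Vlb: "- K1 <= y" if yV: "y \<in> V n" for y n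
 proof -
  obtain u D where y: "y = energy g u D" "S n u D" using yV unfolding V_def by blast
  have "0 <= c * nrm D" using c nrm_nonneg[of D] by simp
  then show ?thesis using K1[OF S[OF y(2)]] y(1) by linarith
 qed
 then have bdd: "bdd_below (V n)" for n by (rule bdd_belowI)
 have Vne: "V n \<noteq> {}" for n using ne[of n] unfolding V_def by blast
 define I where "I n = Inf (V n)" for n
 have I_le: "I n <= energy g u D" if "S n u D" for n u D
  unfolding I_def by (rule cInf_lower[OF _ bdd]) (use that in \<open>unfold V_def, blast\<close>)
 have I_mono: "I n <= I m" if "n <= m" for m n
  unfolding I_def by (rule cInf_superset_mono[OF Vne bdd]) (use dec[OF that] in \<open>unfold V_def, blast\<close>)
 have I_ub: "I n <= K0" for n
 proof -
  obtain u D where "S n u D" "energy g u D <= K0" using ne[of n] by blast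
  then show ?thesis using I_le[of n u D] by linarith
 qed
 have "Cauchy I"
 proof -
  have "incseq I" unfolding incseq_def using I_mono by blast
  then obtain L where "I \<longlonglongrightarrow> L" by (rule incseq_convergent) (use I_ub in blast)
  then show ?thesis by (rule LIMSEQ_imp_Cauchy)
 qed
 have "\<forall>n. \<exists>uD. S n (fst uD) (snd uD) \<and> energy g (fst uD) (snd uD) < I n + inverse (real (Suc n))"
 proof
  fix n
  have "I n < I n + inverse (real (Suc n))" by simp
  then obtain y where "y \<in> V n" "y < I n + inverse (real (Suc n))"
   unfolding I_def using cInf_lessD[OF Vne] by blast
  then obtain u D where "S n u D" "energy g u D < I n + inverse (real (Suc n))"
   unfolding V_def by blast
  then show "\<exists>uD. S n (fst uD) (snd uD) \<and> energy g (fst uD) (snd uD) < I n + inverse (real (Suc n))"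
   by (intro exI[of _ "(u, D)"]) simp
 qed
 then obtain uD where uD: "\<forall>n. S n (fst (uD n)) (snd (uD n)) \<and> energy g (fst (uD n)) (snd (uD n)) < I n + inverse (real (Suc n))"
  by (rule choice[THEN exE])
 define u where "u n = fst (uD n)" for n
 define D where "D n = snd (uD n)" for n
 have uS: "S n (u n) (D n)" and uI: "energy g (u n) (D n) < I n + inverse (real (Suc n))" for n
  unfolding u_def D_def using uD by blast+
 have inv1: "inverse (real (Suc n)) <= 1" for n by (simp add: field_simps)
 define K where "K = (K0 + 1 + K1) / c"
 have DK: "nrm (D n) <= K" for n
 proof -
  have "c * nrm (D n) <= K0 + 1 + K1" using K1[OF S[OF uS[of n]]] uI[of n] I_ub[of n] inv1[of n] by linarith
  then show ?thesis using c by (simp add: K_def field_simps)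
 qed
 have K0': "0 <= K" using DK[of 0] nrm_nonneg[of "D 0"] by linarith
 define Q where "Q m n = (LINT x|M. \<Phi> (D m x) + \<Phi> (D n x) - 2 * \<Phi> ((1 / 2) *\<^sub>R (D m x + D n x)))" for m n
 have Qle: "Q m n <= \<bar>I m - I n\<bar> + (inverse (real (Suc m)) + inverse (real (Suc n)))" for m n
 proof -
  \<comment> \<open>Both near-minimisers lie in the larger set \<open>S k\<close>, so their midpoint
    has energy at least \<open>I k\<close>. This bounds the convexity defect \<open>Q\<close> by the
    gap between the infima and the two errors.\<close>
  define k where "k = min m n"
  have "S k (u m) (D m)" "S k (u n) (D n)"
   by (rule dec[OF _ uS], simp add: k_def)+
  then have "I k <= energy g (%x. 1 / 2 * (u m x + u n x)) (%x. (1 / 2) *\<^sub>R (D m x + D n x))"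
   by (intro I_le mid)
  moreover have "I m + I n - 2 * I k <= \<bar>I m - I n\<bar>" by (cases "m <= n"; simp add: k_def min_def; linarith)
  ultimately show ?thesis
   unfolding Q_def energy_midpoint[OF g S[OF uS] S[OF uS]] using uI[of m] uI[of n] by linarith
 qed
 have Qsmall: "\<exists>N. \<forall>m\<ge>N. \<forall>n\<ge>N. Q m n < e" if e: "e > 0" for e
 proof -
  obtain N1 where N1: "!!m n. m \<ge> N1 ==> n \<ge> N1 ==> norm (I m - I n) < e / 2"
   using CauchyD[OF \<open>Cauchy I\<close>, of "e / 2"] e by auto
  have "\<forall>\<^sub>F n in sequentially. inverse (real (Suc n)) < e / 4"
   using e by (intro order_tendstoD(2)[OF LIMSEQ_inverse_real_of_nat]) simp
  then obtain N2 where N2: "!!n. n \<ge> N2 ==> inverse (real (Suc n)) < e / 4" by (auto simp: eventually_sequentially)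
  have "Q m n < e" if "m \<ge> max N1 N2" "n \<ge> max N1 N2" for m n
   using Qle[of m n] N1[of m n] N2[of m] N2[of n] that by simp
  then show ?thesis by blast
 qed
 have modl: "\<exists>C\<ge>0. \<forall>m n. nrm (%x. D m x - D n x) <= e * (2 * K) + C * Q m n" if e: "e > 0" for e
 proof -
  obtain C where C: "C \<ge> 0" "!!x y. norm (x - y) powr p <= e * (norm x powr p + norm y powr p)
    + C * (\<Phi> x + \<Phi> y - 2 * \<Phi> ((1 / 2) *\<^sub>R (x + y)))"
   using \<Phi>_modulus[OF e] by blast
  have "nrm (%x. D m x - D n x) <= e * (2 * K) + C * Q m n" for m n
  proof -
   note Wm = S[OF uS[of m]] and Wn = S[OF uS[of n]]
   note ip = Lp_integrable_powr[OF W0_Lp(2)[OF Wm]] Lp_integrable_powr[OF W0_Lp(2)[OF Wn]]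
   have iQ: "integrable M (%x. \<Phi> (D m x) + \<Phi> (D n x) - 2 * \<Phi> ((1 / 2) *\<^sub>R (D m x + D n x)))"
    by (intro integrable_add integrable_diff integrable_mult_right \<Phi>_integrable
      Lp_scaleR(1) Lp_add(1) W0_Lp(2)[OF Wm] W0_Lp(2)[OF Wn])
   have "nrm (%x. D m x - D n x) <= (LINT x|M. e * (norm (D m x) powr p + norm (D n x) powr p)
     + C * (\<Phi> (D m x) + \<Phi> (D n x) - 2 * \<Phi> ((1 / 2) *\<^sub>R (D m x + D n x))))"
    unfolding nrm_def
    by (intro integral_mono Lp_integrable_powr Lp_diff(1) W0_Lp(2)[OF Wm] W0_Lp(2)[OF Wn]
      integrable_add integrable_mult_right ip iQ C(2))
   also have "... = e * (nrm (D m) + nrm (D n)) + C * Q m n"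
    unfolding nrm_def Q_def
    by (subst integral_add[OF integrable_mult_right[OF integrable_add[OF ip]] integrable_mult_right[OF iQ]],
      subst integral_mult_right_zero, subst integral_mult_right_zero, subst integral_add[OF ip]) simp
   also have "... <= e * (2 * K) + C * Q m n"
    using DK[of m] DK[of n] e by (intro add_right_mono mult_left_mono) auto
   finally show ?thesis .
  qed
  then show ?thesis using C(1) by blast
 qed
 have Cau: "\<exists>N. \<forall>m\<ge>N. \<forall>n\<ge>N. nrm (%x. D m x - D n x) < e" if "e > 0" for e
  by (rule Cauchy_from_modulus[OF modl _ Qsmall that]) (use K0' in auto)
 obtain v E where vE: "W0 v E" "(%n. nrm (%x. u n x - v x)) \<longlonglongrightarrow> 0" "(%n. nrm (%x. D n x - E x)) \<longlonglongrightarrow> 0"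
  using W0_complete[OF S[OF uS] Cau] by blast
 have "energy g (u n) (D n) <= energy g w F + inverse (real (Suc n))" if "S n w F" for n w F
  using uI[of n] I_le[OF that] by linarith
 with vE uS show ?thesis by blast
qed

end

lemma half_sum_bounds:
 fixes x y c :: real
 shows "x <= c ==> y <= c ==> 1 / 2 * (x + y) <= c" "c <= x ==> c <= y ==> c <= 1 / 2 * (x + y)"
 by (simp_all add: field_simps)

section \<open>Solutions for bounded right-hand sides, and weak limits by minimisation\<close>

context leray_lions
begin

definition sol :: "(real^'n => real) => (real^'n => real) => (real^'n => real^'n) => bool" where
 "sol g u D \<longleftrightarrow> W0 u D \<and> (\<forall>\<phi> E. W0 \<phi> E \<longrightarrow> (LINT x|M. a (D x) \<bullet> E x) = (LINT x|M. g x * \<phi> x))"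

definition adm :: "real => (real^'n => real) => bool" where
 "adm G g \<longleftrightarrow> g \<in> borel_measurable M \<and> (AE x in M. \<bar>g x\<bar> <= G)"

lemma a_shift_tendsto:
 assumes D: "D \<in> Lp p \<Omega>" and E: "E \<in> Lp p \<Omega>"
 shows "(%k. LINT x|M. a (D x + inverse (real (Suc k)) *\<^sub>R E x) \<bullet> E x) \<longlonglongrightarrow> (LINT x|M. a (D x) \<bullet> E x)"
proof (rule integral_dominated_convergence[where w="%x. Ca * (norm (E x) + 2 powr p * (norm (D x) powr p + norm (E x) powr p) + norm (E x) powr p)"])
 note ip = Lp_integrable_powr[OF D] Lp_integrable_powr[OF E] Lp_integrable[OF E, THEN integrable_norm]
 show "integrable M (%x. Ca * (norm (E x) + 2 powr p * (norm (D x) powr p + norm (E x) powr p) + norm (E x) powr p))"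
  by (intro integrable_mult_right integrable_add ip)
 show "(%x. a (D x) \<bullet> E x) \<in> borel_measurable M" by (rule borel_measurable_integrable[OF a_integrable[OF D E]])
 show "(%x. a (D x + inverse (real (Suc k)) *\<^sub>R E x) \<bullet> E x) \<in> borel_measurable M" for k
  by (rule borel_measurable_integrable[OF a_integrable[OF Lp_add(1)[OF D Lp_scaleR(1)[OF E]] E]])
 show "AE x in M. (%k. a (D x + inverse (real (Suc k)) *\<^sub>R E x) \<bullet> E x) \<longlonglongrightarrow> a (D x) \<bullet> E x"
 proof (rule AE_I2)
  fix x
  have "(%k. D x + inverse (real (Suc k)) *\<^sub>R E x) \<longlonglongrightarrow> D x + 0 *\<^sub>R E x"
   by (intro tendsto_add tendsto_scaleR tendsto_const LIMSEQ_inverse_real_of_nat)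
  then have "(%k. a (D x + inverse (real (Suc k)) *\<^sub>R E x)) \<longlonglongrightarrow> a (D x)"
   by (intro continuous_on_tendsto_compose[OF a_cont]) simp_all
  then show "(%k. a (D x + inverse (real (Suc k)) *\<^sub>R E x) \<bullet> E x) \<longlonglongrightarrow> a (D x) \<bullet> E x"
   by (intro tendsto_inner tendsto_const)
 qed
 fix k
 show "AE x in M. norm (a (D x + inverse (real (Suc k)) *\<^sub>R E x) \<bullet> E x)
   <= Ca * (norm (E x) + 2 powr p * (norm (D x) powr p + norm (E x) powr p) + norm (E x) powr p)"
 proof (rule AE_I2)
  fix x
  define t where "t = inverse (real (Suc k))"
  have t: "0 <= t" "t <= 1" by (auto simp: t_def field_simps)
  have "norm (D x + t *\<^sub>R E x) <= norm (D x) + norm (E x)"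
   using norm_triangle_ineq[of "D x" "t *\<^sub>R E x"] t by (simp add: mult_left_le_one_le) (smt (verit) mult_left_le_one_le norm_ge_zero)
  then have "norm (D x + t *\<^sub>R E x) powr p <= (norm (D x) + norm (E x)) powr p"
   using p_pos by (intro powr_mono2) auto
  also have "... <= 2 powr p * (norm (D x) powr p + norm (E x) powr p)"
   by (rule powr_add_le) (use p_pos in auto)
  finally have 1: "norm (D x + t *\<^sub>R E x) powr p <= 2 powr p * (norm (D x) powr p + norm (E x) powr p)" .
  have "\<bar>a (D x + t *\<^sub>R E x) \<bullet> E x\<bar> <= Ca * (norm (E x) + 1 * norm (D x + t *\<^sub>R E x) powr p + 1 powr (1 - p) * norm (E x) powr p)"
   by (rule a_inner_bound) simp
  also have "... <= Ca * (norm (E x) + 2 powr p * (norm (D x) powr p + norm (E x) powr p) + norm (E x) powr p)"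
   using Ca_pos 1 by (intro mult_left_mono add_mono) auto
  finally show "norm (a (D x + inverse (real (Suc k)) *\<^sub>R E x) \<bullet> E x)
   <= Ca * (norm (E x) + 2 powr p * (norm (D x) powr p + norm (E x) powr p) + norm (E x) powr p)"
   by (simp only: t_def real_norm_def)
 qed
qed

lemma solve_bounded:
 assumes "adm G g" shows "\<exists>u D. sol g u D"
proof -
 have g: "g \<in> borel_measurable M" "AE x in M. \<bar>g x\<bar> <= G" using assms by (simp_all add: adm_def)
 have e0: "energy g (%x. 0) (%x. 0) <= 0" by (simp add: energy_def \<Phi>_zero)
 obtain u D v E where S: "\<forall>n::nat. W0 (u n) (D n)" and v: "W0 v E"
  and lim: "(%n. nrm (%x. u n x - v x)) \<longlonglongrightarrow> 0" "(%n. nrm (%x. D n x - E x)) \<longlonglongrightarrow> 0"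
  and min: "\<forall>(n::nat) w F. W0 w F \<longrightarrow> energy g (u n) (D n) <= energy g w F + inverse (real (Suc n))"
  using nested_minimisation[OF g, of "%n. W0" 0] W0_scale[OF W0_add, of _ _ _ _ "1/2"] W0_zero e0 by blast
 \<comment> \<open>The subgradient inequality at the limit gradient \<open>E\<close> gives lower
   semicontinuity: its linear term tends to zero by \<open>a_dual_tendsto\<close>.\<close>
 have vmin: "energy g v E <= energy g w F" if W: "W0 w F" for w F
 proof -
  note ED = Lp_diff(1)[OF W0_Lp(2)[OF S[rule_format]] W0_Lp(2)[OF v]] and uv = Lp_diff(1)[OF W0_Lp(1)[OF S[rule_format]] W0_Lp(1)[OF v]]
  have "energy g v E <= energy g w F + inverse (real (Suc n)) - (LINT x|M. a (E x) \<bullet> (D n x - E x)) + \<bar>G\<bar> * (LINT x|M. norm (u n x - v x))" for n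
  proof -
   have "(LINT x|M. a (E x) \<bullet> (D n x - E x)) <= (LINT x|M. \<Phi> (D n x) - \<Phi> (E x))"
    by (intro integral_mono a_integrable W0_Lp(2)[OF v] ED integrable_diff \<Phi>_integrable W0_Lp(2)[OF S[rule_format]] \<Phi>_sub)
   also have "... = (LINT x|M. \<Phi> (D n x)) - (LINT x|M. \<Phi> (E x))"
    by (intro integral_diff \<Phi>_integrable W0_Lp(2)[OF S[rule_format]] W0_Lp(2)[OF v])
   finally have 1: "(LINT x|M. a (E x) \<bullet> (D n x - E x)) <= (LINT x|M. \<Phi> (D n x)) - (LINT x|M. \<Phi> (E x))" .
   have gG: "AE x in M. \<bar>g x\<bar> <= \<bar>G\<bar>" using g(2) by eventually_elim linarith
   have "(LINT x|M. g x * (u n x - v x)) = (LINT x|M. g x * u n x) - (LINT x|M. g x * v x)"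
    unfolding right_diff_distrib
    by (intro integral_diff bounded_mult_integrable(1)[OF g(1) gG] Lp_integrable W0_Lp(1)[OF v] W0_Lp(1)[OF S[rule_format]])
   moreover have "\<bar>LINT x|M. g x * (u n x - v x)\<bar> <= \<bar>G\<bar> * (LINT x|M. \<bar>u n x - v x\<bar>)"
    by (rule bounded_mult_integrable(2)[OF g(1) gG Lp_integrable[OF uv]])
   ultimately have 2: "(LINT x|M. g x * u n x) - (LINT x|M. g x * v x) <= \<bar>G\<bar> * (LINT x|M. norm (u n x - v x))"
    unfolding real_norm_def by linarith
   have "energy g (u n) (D n) <= energy g w F + inverse (real (Suc n))" using min W by blast
   then show ?thesis using 1 2 unfolding energy_def by linarith
  qed
  moreover have "(%n. energy g w F + inverse (real (Suc n)) - (LINT x|M. a (E x) \<bullet> (D n x - E x)) + \<bar>G\<bar> * (LINT x|M. norm (u n x - v x)))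
    \<longlonglongrightarrow> energy g w F + 0 - 0 + \<bar>G\<bar> * 0"
   by (intro tendsto_add tendsto_diff tendsto_mult tendsto_const LIMSEQ_inverse_real_of_nat a_dual_tendsto[OF W0_Lp(2)[OF v] ED lim(2)] L1_tendsto[OF uv lim(1)])
  ultimately have "energy g v E <= energy g w F + 0 - 0 + \<bar>G\<bar> * 0"
   by (intro LIMSEQ_le_const) auto
  then show ?thesis by simp
 qed
 \<comment> \<open>Minimality is tested with v + t phi, and the increase of the potential is bounded
   through the subgradient at the shifted point. Only positive t occur; replacing phi by -phi later
   gives equality.\<close>
 have half: "(LINT x|M. g x * \<phi> x) <= (LINT x|M. a (E x) \<bullet> F x)" if W: "W0 \<phi> F" for \<phi> F
 proof (rule LIMSEQ_le_const[OF a_shift_tendsto[OF W0_Lp(2)[OF v] W0_Lp(2)[OF W]]], intro exI[of _ 0] allI impI)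
  fix k :: nat
  define t where "t = inverse (real (Suc k))"
  have t: "t > 0" by (simp add: t_def)
  note Wt = W0_add[OF v W0_scale[OF W, of t]]
  note iphi = bounded_mult_integrable(1)[OF g Lp_integrable[OF W0_Lp(1)[OF W]]] and iv = bounded_mult_integrable(1)[OF g Lp_integrable[OF W0_Lp(1)[OF v]]]
  have "(LINT x|M. g x * (v x + t * \<phi> x)) = (LINT x|M. g x * v x + t * (g x * \<phi> x))"
   by (intro integral_cong refl) (simp add: algebra_simps)
  also have "... = (LINT x|M. g x * v x) + t * (LINT x|M. g x * \<phi> x)"
   by (subst integral_add[OF iv integrable_mult_right[OF iphi]]) simp
  finally have "0 <= (LINT x|M. \<Phi> (E x + t *\<^sub>R F x)) - (LINT x|M. \<Phi> (E x)) - t * (LINT x|M. g x * \<phi> x)"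
   using vmin[OF Wt] unfolding energy_def by linarith
  moreover have "(LINT x|M. \<Phi> (E x + t *\<^sub>R F x)) - (LINT x|M. \<Phi> (E x)) <= t * (LINT x|M. a (E x + t *\<^sub>R F x) \<bullet> F x)"
  proof -
   have "(LINT x|M. \<Phi> (E x + t *\<^sub>R F x)) - (LINT x|M. \<Phi> (E x)) = (LINT x|M. \<Phi> (E x + t *\<^sub>R F x) - \<Phi> (E x))"
    by (intro integral_diff[symmetric] \<Phi>_integrable W0_Lp(2)[OF Wt] W0_Lp(2)[OF v])
   also have "... <= (LINT x|M. t * (a (E x + t *\<^sub>R F x) \<bullet> F x))"
   proof (intro integral_mono integrable_diff \<Phi>_integrable integrable_mult_right a_integrable W0_Lp(2)[OF Wt] W0_Lp(2)[OF v] W0_Lp(2)[OF W])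
    show "\<Phi> (E x + t *\<^sub>R F x) - \<Phi> (E x) <= t * (a (E x + t *\<^sub>R F x) \<bullet> F x)" for x
     using \<Phi>_sub[of "E x + t *\<^sub>R F x" "E x"] by simp
   qed
   finally show ?thesis by simp
  qed
  ultimately have "t * (LINT x|M. g x * \<phi> x) <= t * (LINT x|M. a (E x + t *\<^sub>R F x) \<bullet> F x)" by linarith
  then show "(LINT x|M. g x * \<phi> x) <= (LINT x|M. a (E x + inverse (real (Suc k)) *\<^sub>R F x) \<bullet> F x)"
   using t unfolding t_def[symmetric] by simp
 qed
 have "(LINT x|M. a (E x) \<bullet> F x) = (LINT x|M. g x * \<phi> x)" if W: "W0 \<phi> F" for \<phi> F
  using half[OF W] half[OF W0_scale[OF W, of "-1"]] by simp
 then show ?thesis using v unfolding sol_def by blast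
qed

text \<open>The sets to minimise over consist of functions L^1-close to v whose gradients obey the
  half-space constraint. Both conditions are convex, and suitable \<open>u k\<close> satisfy them
  with bounded energy. Near-minimisers converge strongly, so v has a gradient obeying the same
  constraint.\<close>

lemma weak_limit:
 assumes F: "F \<in> Lp p \<Omega>" and W: "!!n. W0 (u n) (D n)" and C: "!!n. nrm (D n) <= C"
  and u: "integrable M v" and lim: "(%n. LINT x|M. \<bar>u n x - v x\<bar>) \<longlonglongrightarrow> 0"
  and c: "!!n. c <= s * (LINT x|M. a (F x) \<bullet> D n x)"
 shows "\<exists>E. W0 v E \<and> c <= s * (LINT x|M. a (F x) \<bullet> E x)"
proof -
 define S where "S n w E \<longleftrightarrow> W0 w E \<and> (LINT x|M. \<bar>w x - v x\<bar>) <= inverse (real (Suc n)) \<and> c <= s * (LINT x|M. a (F x) \<bullet> E x)" for n w E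
 have ui: "integrable M w" if "W0 w E" for w E by (rule Lp_integrable[OF W0_Lp(1)[OF that]])
 have g0: "(%x. 0 :: real) \<in> borel_measurable M" "AE x in M. \<bar>0 :: real\<bar> <= 0" by simp_all
 have S1: "W0 w E" if "S n w E" for n w E using that by (simp add: S_def)
 have S2: "S n w E" if "n <= m" "S m w E" for m n w E
 proof -
  have "inverse (real (Suc m)) <= inverse (real (Suc n))" using that(1) by (simp add: field_simps)
  then show ?thesis using that(2) unfolding S_def by linarith
 qed
 have S3: "S n (%x. 1 / 2 * (w x + z x)) (%x. (1 / 2) *\<^sub>R (E x + H x))" if A: "S n w E" and B: "S n z H" for n w E z H
 proof -
  have w: "W0 w E" "(LINT x|M. \<bar>w x - v x\<bar>) <= inverse (real (Suc n))" "c <= s * (LINT x|M. a (F x) \<bullet> E x)"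
   and z: "W0 z H" "(LINT x|M. \<bar>z x - v x\<bar>) <= inverse (real (Suc n))" "c <= s * (LINT x|M. a (F x) \<bullet> H x)"
   using A B by (simp_all add: S_def)
  have iw: "integrable M (%x. \<bar>w x - v x\<bar>)" and iz: "integrable M (%x. \<bar>z x - v x\<bar>)"
   by (intro integrable_abs integrable_diff ui[OF w(1)] ui[OF z(1)] u)+
  have "(LINT x|M. \<bar>1 / 2 * (w x + z x) - v x\<bar>) <= (LINT x|M. 1 / 2 * (\<bar>w x - v x\<bar> + \<bar>z x - v x\<bar>))"
  proof (intro integral_mono integrable_mult_right integrable_add iw iz)
   show "integrable M (%x. \<bar>1 / 2 * (w x + z x) - v x\<bar>)"
    by (intro integrable_abs integrable_diff integrable_mult_right integrable_add ui[OF w(1)] ui[OF z(1)] u)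
   show "\<bar>1 / 2 * (w x + z x) - v x\<bar> <= 1 / 2 * (\<bar>w x - v x\<bar> + \<bar>z x - v x\<bar>)" for x
   proof -
    define P where "P = w x - v x"
    define Q where "Q = z x - v x"
    have "1 / 2 * (w x + z x) - v x = P / 2 + Q / 2" by (simp add: P_def Q_def field_simps)
    then show ?thesis unfolding P_def[symmetric] Q_def[symmetric] using abs_triangle_ineq[of "P / 2" "Q / 2"] by simp
   qed
  qed
  also have "... = 1 / 2 * ((LINT x|M. \<bar>w x - v x\<bar>) + (LINT x|M. \<bar>z x - v x\<bar>))"
   by (subst integral_mult_right_zero, subst integral_add[OF iw iz]) simp
  also have "... <= inverse (real (Suc n))" by (rule half_sum_bounds(1)[OF w(2) z(2)])
  finally have 1: "(LINT x|M. \<bar>1 / 2 * (w x + z x) - v x\<bar>) <= inverse (real (Suc n))" .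
  have iE: "integrable M (%x. a (F x) \<bullet> E x)" "integrable M (%x. a (F x) \<bullet> H x)"
   by (intro a_integrable F W0_Lp(2)[OF w(1)] W0_Lp(2)[OF z(1)])+
  have "(LINT x|M. a (F x) \<bullet> ((1 / 2) *\<^sub>R (E x + H x))) = (LINT x|M. 1 / 2 * (a (F x) \<bullet> E x + a (F x) \<bullet> H x))"
   by (intro integral_cong refl) (simp add: inner_add_right)
  also have "... = 1 / 2 * ((LINT x|M. a (F x) \<bullet> E x) + (LINT x|M. a (F x) \<bullet> H x))"
   by (subst integral_mult_right_zero, subst integral_add[OF iE]) simp
  finally have "s * (LINT x|M. a (F x) \<bullet> ((1 / 2) *\<^sub>R (E x + H x))) = 1 / 2 * (s * (LINT x|M. a (F x) \<bullet> E x) + s * (LINT x|M. a (F x) \<bullet> H x))"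
   by (simp add: algebra_simps)
  then have 2: "c <= s * (LINT x|M. a (F x) \<bullet> ((1 / 2) *\<^sub>R (E x + H x)))" using half_sum_bounds(2)[OF w(3) z(3)] by (simp only:)
  show ?thesis unfolding S_def using 1 2 W0_scale[OF W0_add[OF w(1) z(1)], of "1 / 2"] by blast
 qed
 have S4: "\<exists>w E. S n w E \<and> energy (%x. 0) w E <= Ca * (measure M \<Omega> + 3 * C)" for n
 proof -
  have "\<forall>\<^sub>F k in sequentially. (LINT x|M. \<bar>u k x - v x\<bar>) < inverse (real (Suc n))"
   by (intro order_tendstoD(2)[OF lim]) simp
  then obtain k where k: "(LINT x|M. \<bar>u k x - v x\<bar>) < inverse (real (Suc n))" by (auto dest!: eventually_happens)
  note Dk = W0_Lp(2)[OF W[of k]]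
  have "(LINT x|M. \<Phi> (D k x)) <= (LINT x|M. Ca * (norm (D k x) + 2 * norm (D k x) powr p))"
   by (intro integral_mono \<Phi>_integrable Dk integrable_mult_right integrable_add integrable_norm Lp_integrable Lp_integrable_powr \<Phi>_upper)
  also have "... = Ca * ((LINT x|M. norm (D k x)) + 2 * nrm (D k))"
   unfolding nrm_def using Lp_integrable[OF Dk] Lp_integrable_powr[OF Dk] by simp
  also have "... <= Ca * (measure M \<Omega> + 3 * C)"
   using L1_le_nrm[OF Dk zero_less_one] C[of k] Ca_pos by (intro mult_left_mono) auto
  finally have "energy (%x. 0) (u k) (D k) <= Ca * (measure M \<Omega> + 3 * C)" by (simp add: energy_def)
  moreover have "S n (u k) (D k)" using k W[of k] c[of k] by (simp add: S_def less_imp_le)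
  ultimately show ?thesis by blast
 qed
 obtain w E z H where wE: "\<forall>n. S n (w n) (E n)" and z: "W0 z H"
  and l: "(%n. nrm (%x. w n x - z x)) \<longlonglongrightarrow> 0" "(%n. nrm (%x. E n x - H x)) \<longlonglongrightarrow> 0"
 proof -
  have "\<exists>u D v E. (\<forall>n. S n (u n) (D n)) \<and> W0 v E \<and> (%n. nrm (%x. u n x - v x)) \<longlonglongrightarrow> 0 \<and>
   (%n. nrm (%x. D n x - E x)) \<longlonglongrightarrow> 0 \<and>
   (\<forall>n w F. S n w F \<longrightarrow> energy (%x. 0) (u n) (D n) <= energy (%x. 0) w F + inverse (real (Suc n)))"
  proof (rule nested_minimisation[where S=S, OF g0])
   show "W0 w E" if "S n w E" for n w E by (rule S1[OF that])
   show "S n w E" if "n <= m" "S m w E" for m n w E by (rule S2[OF that])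
   show "S n (%x. 1 / 2 * (w x + z x)) (%x. (1 / 2) *\<^sub>R (E x + H x))" if "S n w E" "S n z H" for n w E z H
    by (rule S3[OF that])
   show "\<exists>w E. S n w E \<and> energy (%x. 0) w E <= Ca * (measure M \<Omega> + 3 * C)" for n by (rule S4)
  qed
  then show thesis using that by blast
 qed
 have wE': "W0 (w n) (E n)" "(LINT x|M. \<bar>w n x - v x\<bar>) <= inverse (real (Suc n))" "c <= s * (LINT x|M. a (F x) \<bullet> E n x)" for n
  using wE by (simp_all add: S_def)
 note wz = Lp_diff(1)[OF W0_Lp(1)[OF wE'(1)] W0_Lp(1)[OF z]] and EH = Lp_diff(1)[OF W0_Lp(2)[OF wE'(1)] W0_Lp(2)[OF z]]
 have "(LINT x|M. \<bar>z x - v x\<bar>) <= (LINT x|M. norm (w n x - z x)) + inverse (real (Suc n))" for n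
 proof -
  have "(LINT x|M. \<bar>z x - v x\<bar>) <= (LINT x|M. norm (w n x - z x) + \<bar>w n x - v x\<bar>)"
  proof (intro integral_mono integrable_abs integrable_add integrable_diff integrable_norm ui[OF z] u ui[OF wE'(1)])
   show "\<bar>z x - v x\<bar> <= norm (w n x - z x) + \<bar>w n x - v x\<bar>" for x unfolding real_norm_def by linarith
  qed
  also have "... = (LINT x|M. norm (w n x - z x)) + (LINT x|M. \<bar>w n x - v x\<bar>)"
   by (intro integral_add integrable_abs integrable_diff integrable_norm ui[OF z] u ui[OF wE'(1)])
  finally show ?thesis using wE'(2)[of n] by linarith
 qed
 moreover have "(%n. (LINT x|M. norm (w n x - z x)) + inverse (real (Suc n))) \<longlonglongrightarrow> 0 + 0"
  by (intro tendsto_add L1_tendsto[OF wz l(1)] LIMSEQ_inverse_real_of_nat)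
 ultimately have "(LINT x|M. \<bar>z x - v x\<bar>) <= 0 + 0" by (intro LIMSEQ_le_const) auto
 moreover have izv: "integrable M (%x. \<bar>z x - v x\<bar>)" by (intro integrable_abs integrable_diff ui[OF z] u)
 moreover have "0 <= (LINT x|M. \<bar>z x - v x\<bar>)" by (rule integral_nonneg_AE) simp
 ultimately have "(LINT x|M. \<bar>z x - v x\<bar>) = 0" by linarith
 then have "AE x in M. \<bar>z x - v x\<bar> = 0" using integral_nonneg_eq_0_iff_AE[OF izv] by simp
 then have zv: "AE x in M. v x = z x" by eventually_elim simp
 have vH: "W0 v H"
  by (rule W0_cong_AE[OF z borel_measurable_integrable[OF u] W0_measurable(2)[OF z] zv]) simp
 have "(LINT x|M. a (F x) \<bullet> E n x) = (LINT x|M. a (F x) \<bullet> (E n x - H x)) + (LINT x|M. a (F x) \<bullet> H x)" for n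
  using integral_add[OF a_integrable[OF F EH[of n]] a_integrable[OF F W0_Lp(2)[OF z]]] by (simp add: inner_diff_right)
 moreover have "(%n. s * ((LINT x|M. a (F x) \<bullet> (E n x - H x)) + (LINT x|M. a (F x) \<bullet> H x))) \<longlonglongrightarrow> s * (0 + (LINT x|M. a (F x) \<bullet> H x))"
  by (intro tendsto_mult tendsto_add tendsto_const a_dual_tendsto[OF F EH l(2)])
 ultimately have "c <= s * (0 + (LINT x|M. a (F x) \<bullet> H x))"
  using wE'(3) by (intro LIMSEQ_le_const) auto
 then show ?thesis using vH by auto
qed

text \<open>Only pairings with fields of the form a(F) are needed. If such a pairing failed to
  converge, a subsequence would stay in a half-space that excludes E, and \<open>weak_limit\<close>
  would give v a gradient on the wrong side, against uniqueness.\<close>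

lemma weak_convergence:
 assumes W: "!!n. W0 (u n) (D n)" and C: "!!n. nrm (D n) <= C"
  and v: "integrable M v" and lim: "(%n. LINT x|M. \<bar>u n x - v x\<bar>) \<longlonglongrightarrow> 0"
 shows "\<exists>E. W0 v E \<and> (\<forall>F\<in>Lp p \<Omega>. (%n. LINT x|M. a (F x) \<bullet> D n x) \<longlonglongrightarrow> (LINT x|M. a (F x) \<bullet> E x))"
proof -
 \<comment> \<open>With c = s = 0 the constraint of \<open>weak_limit\<close> is void, and only the
   existence of a gradient of v is extracted.\<close>
 obtain E where E: "W0 v E"
  using weak_limit[OF W0_Lp(2)[OF W0_zero] W C v lim, of 0 0] by auto
 have ev: "\<forall>\<^sub>F n in sequentially. s * (LINT x|M. a (F x) \<bullet> D n x) < s * (LINT x|M. a (F x) \<bullet> E x) + e"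
  if F: "F \<in> Lp p \<Omega>" and e: "e > 0" for F e and s :: real
 proof (rule ccontr)
  assume "\<not> ?thesis"
  then have inf: "\<exists>\<^sub>F n in sequentially. s * (LINT x|M. a (F x) \<bullet> E x) + e <= s * (LINT x|M. a (F x) \<bullet> D n x)"
   by (simp add: frequently_def not_le)
  then have "infinite {n. s * (LINT x|M. a (F x) \<bullet> E x) + e <= s * (LINT x|M. a (F x) \<bullet> D n x)}"
   by (simp add: frequently_cofinite[symmetric] cofinite_eq_sequentially)
  then obtain r :: "nat => nat" where r: "strict_mono r" "!!n. s * (LINT x|M. a (F x) \<bullet> E x) + e <= s * (LINT x|M. a (F x) \<bullet> D (r n) x)"
   using infinite_enumerate by blast
  have l: "(%n. LINT x|M. \<bar>u (r n) x - v x\<bar>) \<longlonglongrightarrow> 0" using LIMSEQ_subseq_LIMSEQ[OF lim r(1)] by (simp add: o_def)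
  obtain H where H: "W0 v H" "s * (LINT x|M. a (F x) \<bullet> E x) + e <= s * (LINT x|M. a (F x) \<bullet> H x)"
   using weak_limit[OF F W C v l r(2)] by blast
  have "(LINT x|M. a (F x) \<bullet> H x) = (LINT x|M. a (F x) \<bullet> E x)"
  proof (rule integral_cong_AE)
   show "AE x in M. a (F x) \<bullet> H x = a (F x) \<bullet> E x" using W0_unique[OF H(1) E] by eventually_elim simp
  qed (intro borel_measurable_integrable a_integrable F W0_Lp(2)[OF H(1)] W0_Lp(2)[OF E])+
  then show False using H(2) e by simp
 qed
 have "(%n. LINT x|M. a (F x) \<bullet> D n x) \<longlonglongrightarrow> (LINT x|M. a (F x) \<bullet> E x)" if F: "F \<in> Lp p \<Omega>" for F
 proof (rule order_tendstoI)
  fix y assume y: "y < (LINT x|M. a (F x) \<bullet> E x)"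
  show "\<forall>\<^sub>F n in sequentially. y < (LINT x|M. a (F x) \<bullet> D n x)"
   using ev[OF F, of "(LINT x|M. a (F x) \<bullet> E x) - y" "-1"] y by simp
 next
  fix y assume y: "(LINT x|M. a (F x) \<bullet> E x) < y"
  show "\<forall>\<^sub>F n in sequentially. (LINT x|M. a (F x) \<bullet> D n x) < y"
   using ev[OF F, of "y - (LINT x|M. a (F x) \<bullet> E x)" 1] y by simp
 qed
 with E show ?thesis by blast
qed

end

context leray_lions
begin

subsection \<open>A fixed point principle\<close>

lemma sol_W0: "sol g u D ==> W0 u D"
 by (simp add: sol_def)

lemma sol_eq: "sol g u D ==> W0 \<phi> E ==> (LINT x|M. a (D x) \<bullet> E x) = (LINT x|M. g x * \<phi> x)"
 by (simp add: sol_def)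

lemma coercive_bound:
 assumes W: "W0 u D" and "(LINT x|M. a (D x) \<bullet> D x) <= G * (LINT x|M. \<bar>u x\<bar>)"
  and K: "!!u D. W0 u D ==> G * (LINT x|M. \<bar>u x\<bar>) <= c2 / 2 * nrm D + K"
 shows "nrm D <= 2 * K / c2"
proof -
 have "c2 * nrm D = (LINT x|M. c2 * norm (D x) powr p)" by (simp add: nrm_def)
 also have "... <= (LINT x|M. a (D x) \<bullet> D x)"
  by (intro integral_mono integrable_mult_right Lp_integrable_powr a_integrable W0_Lp(2)[OF W] a_coercive)
 finally have "c2 * nrm D <= c2 / 2 * nrm D + K" using assms(2) K[OF W] by linarith
 then show ?thesis using c2_pos by (simp add: field_simps)
qed

lemma sol_bound:
 assumes "G \<ge> 0" shows "\<exists>R. \<forall>g u D. adm G g \<longrightarrow> sol g u D \<longrightarrow> nrm D <= R"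
proof -
 obtain K where K: "!!u D. W0 u D ==> G * (LINT x|M. \<bar>u x\<bar>) <= c2 / 2 * nrm D + K"
  using L1_absorb[OF assms, of "c2 / 2"] c2_pos by auto
 have "nrm D <= 2 * K / c2" if g: "adm G g" and s: "sol g u D" for g u D
 proof (rule coercive_bound[OF sol_W0[OF s] _ K])
  note W = sol_W0[OF s]
  have "(LINT x|M. a (D x) \<bullet> D x) = (LINT x|M. g x * u x)" by (rule sol_eq[OF s W])
  also have "... <= \<bar>LINT x|M. g x * u x\<bar>" by simp
  also have "... <= G * (LINT x|M. \<bar>u x\<bar>)"
   by (rule bounded_mult_integrable(2)) (use g Lp_integrable[OF W0_Lp(1)[OF W]] in \<open>simp_all add: adm_def\<close>)
  finally show "(LINT x|M. a (D x) \<bullet> D x) <= G * (LINT x|M. \<bar>u x\<bar>)" .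
 qed
 then show ?thesis by blast
qed

lemma sol_diff:
 assumes g: "adm G g" "adm G h" and s: "sol g u D" "sol h v E"
 shows "(LINT x|M. (a (D x) - a (E x)) \<bullet> (D x - E x)) = (LINT x|M. (g x - h x) * (u x - v x))"
proof -
 note W = sol_W0[OF s(1)] sol_W0[OF s(2)]
 note d = W0_diff[OF W]
 have i: "integrable M (%x. g x * (u x - v x))" "integrable M (%x. h x * (u x - v x))"
  using g Lp_integrable[OF W0_Lp(1)[OF d]] by (auto simp: adm_def intro: bounded_mult_integrable(1))
 have "(LINT x|M. (a (D x) - a (E x)) \<bullet> (D x - E x)) = (LINT x|M. a (D x) \<bullet> (D x - E x)) - (LINT x|M. a (E x) \<bullet> (D x - E x))"
  unfolding inner_diff_left
  by (intro integral_diff a_integrable W0_Lp(2)[OF d] W0_Lp(2)[OF W(1)] W0_Lp(2)[OF W(2)])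
 also have "... = (LINT x|M. g x * (u x - v x)) - (LINT x|M. h x * (u x - v x))"
  by (simp only: sol_eq[OF s(1) d] sol_eq[OF s(2) d])
 also have "... = (LINT x|M. (g x - h x) * (u x - v x))"
  unfolding left_diff_distrib by (rule integral_diff[symmetric, OF i])
 finally show ?thesis .
qed

lemma adm_diff:
 assumes "adm G g" "adm G h"
 shows "(%x. g x - h x) \<in> borel_measurable M" "AE x in M. \<bar>g x - h x\<bar> <= 2 * G"
proof -
 have m: "g \<in> borel_measurable M" "h \<in> borel_measurable M" and b: "AE x in M. \<bar>g x\<bar> <= G" "AE x in M. \<bar>h x\<bar> <= G"
  using assms by (simp_all add: adm_def)
 show "(%x. g x - h x) \<in> borel_measurable M" by (rule borel_measurable_diff[OF m])
 show "AE x in M. \<bar>g x - h x\<bar> <= 2 * G" using b by eventually_elim linarith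
qed

lemma nrm_Cauchy_of_monotone:
 fixes D :: "nat => real^'n => real^'n"
 assumes D: "!!n. D n \<in> Lp p \<Omega>" and R: "!!n. nrm (D n) <= R"
  and Q: "!!e. e > 0 ==> \<exists>N. \<forall>m\<ge>N. \<forall>n\<ge>N. (LINT x|M. (a (D m x) - a (D n x)) \<bullet> (D m x - D n x)) < e" and e: "e > 0"
 shows "\<exists>N. \<forall>m\<ge>N. \<forall>n\<ge>N. nrm (%x. D m x - D n x) < e"
proof (rule Cauchy_from_modulus[where K="2 * R" and Q="%m n. LINT x|M. (a (D m x) - a (D n x)) \<bullet> (D m x - D n x)", OF _ _ Q e])
 show "0 <= 2 * R" using R[of 0] nrm_nonneg[of "D 0"] by linarith
 fix d :: real assume d: "d > 0"
 obtain C where C: "C \<ge> 0" "!!x y. norm (x - y) powr p <= d * (norm x powr p + norm y powr p) + C * ((a x - a y) \<bullet> (x - y))"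
  using a_modulus[OF d] by blast
 have "nrm (%x. D m x - D n x) <= d * (2 * R) + C * (LINT x|M. (a (D m x) - a (D n x)) \<bullet> (D m x - D n x))" for m n
 proof -
  have "d * (nrm (D m) + nrm (D n)) <= d * (2 * R)" using R[of m] R[of n] d by (intro mult_left_mono) auto
  then show ?thesis using nrm_a_modulus(1)[OF C(2) D[of m] D[of n]] by linarith
 qed
 then show "\<exists>C\<ge>0. \<forall>m n. nrm (%x. D m x - D n x) <= d * (2 * R) + C * (LINT x|M. (a (D m x) - a (D n x)) \<bullet> (D m x - D n x))"
  using C(1) by blast
qed

text \<open>Rellich's theorem gives L^1 convergence of a subsequence. As the right-hand sides are
  bounded by G, the monotonicity integral of two solutions is at most 2 G times their L^1 distance,
  which makes the gradients Cauchy in L^p.\<close>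

lemma sol_compact:
 assumes "G \<ge> 0" and g: "!!n. adm G (g n)" and s: "!!n. sol (g n) (u n) (D n)"
 shows "\<exists>(r :: nat => nat) v E. strict_mono r \<and> W0 v E \<and> (%n. nrm (%x. u (r n) x - v x)) \<longlonglongrightarrow> 0 \<and> (%n. nrm (%x. D (r n) x - E x)) \<longlonglongrightarrow> 0"
proof -
 note W = sol_W0[OF s]
 obtain R where R0: "\<forall>g u D. adm G g \<longrightarrow> sol g u D \<longrightarrow> nrm D <= R" using sol_bound[OF assms(1)] by blast
 have R: "nrm (D n) <= R" for n by (rule R0[rule_format, OF g s])
 obtain r :: "nat => nat" and v where r: "strict_mono r" and v: "integrable M v" and l: "(%n. LINT x|M. \<bar>u (r n) x - v x\<bar>) \<longlonglongrightarrow> 0"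
  using Rellich[where u=u and D=D, OF W R] by blast
 note ui = Lp_integrable[OF W0_Lp(1)[OF W]]
 define b where "b n = (LINT x|M. \<bar>u (r n) x - v x\<bar>)" for n
 have Qle: "(LINT x|M. (a (D (r m) x) - a (D (r n) x)) \<bullet> (D (r m) x - D (r n) x)) <= 2 * G * (b m + b n)" for m n
 proof -
  have "(LINT x|M. (g (r m) x - g (r n) x) * (u (r m) x - u (r n) x)) <= 2 * G * (LINT x|M. \<bar>u (r m) x - u (r n) x\<bar>)"
   using bounded_mult_integrable(2)[OF adm_diff[OF g[of "r m"] g[of "r n"]] integrable_diff[OF ui[of "r m"] ui[of "r n"]]]
   by linarith
  also have "... <= 2 * G * (b m + b n)"
  proof (rule mult_left_mono)
   have "(LINT x|M. \<bar>u (r m) x - u (r n) x\<bar>) <= (LINT x|M. \<bar>u (r m) x - v x\<bar> + \<bar>u (r n) x - v x\<bar>)"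
   proof (intro integral_mono integrable_abs integrable_add integrable_diff ui v)
    show "\<bar>u (r m) x - u (r n) x\<bar> <= \<bar>u (r m) x - v x\<bar> + \<bar>u (r n) x - v x\<bar>" for x by linarith
   qed
   also have "... = b m + b n" unfolding b_def
    by (intro integral_add integrable_abs integrable_diff ui v)
   finally show "(LINT x|M. \<bar>u (r m) x - u (r n) x\<bar>) <= b m + b n" .
  qed (use assms(1) in simp)
  finally show ?thesis by (simp only: sol_diff[OF g g s s])
 qed
 have Q: "\<exists>N. \<forall>m\<ge>N. \<forall>n\<ge>N. (LINT x|M. (a (D (r m) x) - a (D (r n) x)) \<bullet> (D (r m) x - D (r n) x)) < e" if e: "e > 0" for e
 proof -
  have "(%n. 2 * G * b n) \<longlonglongrightarrow> 2 * G * 0" unfolding b_def by (intro tendsto_mult tendsto_const l)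
  then have "\<forall>\<^sub>F n in sequentially. 2 * G * b n < e / 2" using e by (intro order_tendstoD(2)) auto
  then obtain N where N: "!!n. n \<ge> N ==> 2 * G * b n < e / 2" by (auto simp: eventually_sequentially)
  have "(LINT x|M. (a (D (r m) x) - a (D (r n) x)) \<bullet> (D (r m) x - D (r n) x)) < e" if "m \<ge> N" "n \<ge> N" for m n
   using Qle[of m n] N[OF that(1)] N[OF that(2)] by (simp add: distrib_left)
  then show ?thesis by blast
 qed
 note DL = W0_Lp(2)[OF W]
 have "\<exists>v E. W0 v E \<and> (%n. nrm (%x. u (r n) x - v x)) \<longlonglongrightarrow> 0 \<and> (%n. nrm (%x. D (r n) x - E x)) \<longlonglongrightarrow> 0"
  by (rule W0_complete[OF W nrm_Cauchy_of_monotone[OF DL R Q]])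
 with r show ?thesis by blast
qed

text \<open>Young's splitting with y = |h|^q and q = 1/(p-1), so that y^(p-1) = |h|. The choice of
  \<open>d\<close> makes the term with z small, and y^p tends to zero by bounded
  convergence.\<close>

lemma mult_tendsto_0:
 assumes h: "!!k. h k \<in> borel_measurable M" "!!k. AE x in M. \<bar>h k x\<bar> <= (H::real)" "AE x in M. (%k. h k x) \<longlonglongrightarrow> 0"
  and z: "!!k. z k \<in> Lp p \<Omega>" "!!k. nrm (z k) <= Z"
 shows "(%k. LINT x|M. h k x * (z k x :: real)) \<longlonglongrightarrow> 0"
proof (rule LIMSEQ_I)
 fix e :: real assume e: "e > 0"
 define q where "q = 1 / (p - 1)"
 have q: "q > 0" "q * (p - 1) = 1" using p_gt_1 by (auto simp: q_def)
 have Z0: "Z \<ge> 0" using z(2)[of 0] nrm_nonneg[of "z 0"] by linarith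
 define d where "d = (2 * (Z + 1) / e) powr q"
 have d: "d > 0" using e Z0 by (simp add: d_def)
 have "d powr (p - 1) = 2 * (Z + 1) / e" unfolding d_def powr_powr q(2) using e Z0 by simp
 moreover have "d powr (1 - p) = inverse (d powr (p - 1))" using powr_minus[of d "p - 1"] by simp
 ultimately have dp: "d powr (1 - p) = e / (2 * (Z + 1))" by simp
 have dZ: "d powr (1 - p) * Z <= e / 2"
 proof -
  have "d powr (1 - p) * Z <= e / (2 * (Z + 1)) * (Z + 1)" unfolding dp using e Z0 by (intro mult_left_mono) auto
  also have "... = e / 2" using Z0 by (simp add: field_simps)
  finally show ?thesis .
 qed
 have pw: "(\<bar>s\<bar> powr q) powr (p - 1) = \<bar>s\<bar>" for s :: real by (cases "s = 0") (simp_all add: powr_powr q(2))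
 have ym: "(%x. (\<bar>h k x\<bar> powr q) powr p) \<in> borel_measurable M" for k
  by (rule measurable_compose[OF h(1)]) measurable
 have yb: "AE x in M. (\<bar>h k x\<bar> powr q) powr p <= (\<bar>H\<bar> powr q) powr p" for k
  using h(2)[of k]
 proof eventually_elim
  case (elim x)
  then have "\<bar>h k x\<bar> <= \<bar>H\<bar>" by linarith
  then show ?case using q p_pos by (intro powr_mono2) auto
 qed
 have yi: "integrable M (%x. (\<bar>h k x\<bar> powr q) powr p)" for k
  by (rule fin.integrable_const_bound[OF _ ym, where B="(\<bar>H\<bar> powr q) powr p"]) (use yb[of k] in simp)
 have "(%k. LINT x|M. (\<bar>h k x\<bar> powr q) powr p) \<longlonglongrightarrow> (LINT x|M. 0)"
 proof (rule integral_dominated_convergence[where w="%x. (\<bar>H\<bar> powr q) powr p"])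
  show "AE x in M. (%k. (\<bar>h k x\<bar> powr q) powr p) \<longlonglongrightarrow> 0"
   using h(3)
  proof eventually_elim
   case (elim x)
   have "(%k. (\<bar>h k x\<bar> powr q) powr p) \<longlonglongrightarrow> (\<bar>0\<bar> powr q) powr p"
    using q p_pos elim by (intro tendsto_powr' tendsto_rabs tendsto_const) auto
   then show ?case using q p_pos by simp
  qed
 qed (use ym yb in simp_all)
 then have "(%k. d * (LINT x|M. (\<bar>h k x\<bar> powr q) powr p)) \<longlonglongrightarrow> d * 0" by (intro tendsto_mult tendsto_const) simp
 then have "\<forall>\<^sub>F k in sequentially. d * (LINT x|M. (\<bar>h k x\<bar> powr q) powr p) < e / 2"
  using e by (intro order_tendstoD(2)) auto
 then obtain N where N: "!!k. k \<ge> N ==> d * (LINT x|M. (\<bar>h k x\<bar> powr q) powr p) < e / 2" by (auto simp: eventually_sequentially)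
 have "norm ((LINT x|M. h k x * z k x) - 0) < e" if k: "k \<ge> N" for k
 proof -
  have "norm (LINT x|M. h k x * z k x) <= (LINT x|M. d * (\<bar>h k x\<bar> powr q) powr p + d powr (1 - p) * norm (z k x) powr p)"
  proof (rule integral_norm_bound_integral)
   have "AE x in M. \<bar>h k x\<bar> <= H" by (rule h(2))
   then show "integrable M (%x. h k x * z k x)" by (rule bounded_mult_integrable(1)[OF h(1) _ Lp_integrable[OF z(1)]])
   show "integrable M (%x. d * (\<bar>h k x\<bar> powr q) powr p + d powr (1 - p) * norm (z k x) powr p)"
    by (intro integrable_add integrable_mult_right yi Lp_integrable_powr z)
   show "norm (h k x * z k x) <= d * (\<bar>h k x\<bar> powr q) powr p + d powr (1 - p) * norm (z k x) powr p" for x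
    using young_split[OF p_gt_1 d, of "\<bar>h k x\<bar> powr q" "\<bar>z k x\<bar>"] by (simp add: pw abs_mult)
  qed
  also have "... = d * (LINT x|M. (\<bar>h k x\<bar> powr q) powr p) + d powr (1 - p) * nrm (z k)"
   unfolding nrm_def using yi[of k] Lp_integrable_powr[OF z(1)[of k]] by simp
  also have "... <= d * (LINT x|M. (\<bar>h k x\<bar> powr q) powr p) + d powr (1 - p) * Z"
   by (intro add_left_mono mult_left_mono z(2)) simp
  finally show ?thesis using N[OF k] dZ by simp
 qed
 then show "\<exists>N. \<forall>k\<ge>N. norm ((LINT x|M. h k x * z k x) - 0) < e" by blast
qed

text \<open>The monotonicity integral of the two solutions equals the pairing of g k - h with u k -
  v. The former is bounded and tends to zero almost everywhere, the latter is bounded in L^p, so the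
  pairing vanishes in the limit.\<close>

lemma sol_continuous:
 assumes "G \<ge> 0" and g: "!!k. adm G (g k)" "adm G h" and s: "!!k. sol (g k) (u k) (D k)" "sol h v E"
  and lim: "AE x in M. (%k. g k x) \<longlonglongrightarrow> h x"
 shows "(%k. nrm (%x. D k x - E x)) \<longlonglongrightarrow> 0" "(%k. nrm (%x. u k x - v x)) \<longlonglongrightarrow> 0"
proof -
 obtain R where R0: "\<forall>g u D. adm G g \<longrightarrow> sol g u D \<longrightarrow> nrm D <= R" using sol_bound[OF assms(1)] by blast
 have R: "nrm (D k) <= R" "nrm E <= R" for k by (rule R0[rule_format, OF g(1) s(1)], rule R0[rule_format, OF g(2) s(2)])
 note W = sol_W0[OF s(1)] and V = sol_W0[OF s(2)]
 note d = W0_diff[OF W V]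
 have z: "nrm (%x. u k x - v x) <= poincare_const * (2 powr p * (R + R))" for k
 proof -
  have "nrm (%x. u k x - v x) <= poincare_const * nrm (%x. D k x - E x)" by (rule W0_Poincare[OF d])
  also have "... <= poincare_const * (2 powr p * (nrm (D k) + nrm E))"
   by (intro mult_left_mono Lp_diff(2) W0_Lp(2)[OF W] W0_Lp(2)[OF V] poincare_const_nonneg)
  also have "... <= poincare_const * (2 powr p * (R + R))"
   using R by (intro mult_left_mono add_mono poincare_const_nonneg) auto
  finally show ?thesis .
 qed
 have "(%k. LINT x|M. (g k x - h x) * (u k x - v x)) \<longlonglongrightarrow> 0"
 proof (rule mult_tendsto_0[of _ "2 * G", OF _ _ _ W0_Lp(1)[OF d] z])
  show "(%x. g k x - h x) \<in> borel_measurable M" "AE x in M. \<bar>g k x - h x\<bar> <= 2 * G" for k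
   by (rule adm_diff[OF g(1) g(2)])+
  show "AE x in M. (%k. g k x - h x) \<longlonglongrightarrow> 0" using lim by eventually_elim (rule LIM_zero)
 qed
 then have Q: "(%k. LINT x|M. (a (D k x) - a (E x)) \<bullet> (D k x - E x)) \<longlonglongrightarrow> 0"
  by (simp only: sol_diff[OF g(1) g(2) s(1) s(2)])
 show D0: "(%k. nrm (%x. D k x - E x)) \<longlonglongrightarrow> 0"
 proof (rule LIMSEQ_I)
  fix e :: real assume e: "e > 0"
  have "\<exists>N. \<forall>m\<ge>N. \<forall>n\<ge>N. nrm (%x. D m x - E x) < e"
  proof (rule Cauchy_from_modulus[where K="2 * R" and x="%m n. nrm (%x. D m x - E x)" and Q="%m n. LINT x|M. (a (D m x) - a (E x)) \<bullet> (D m x - E x)", OF _ _ _ e])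
   show "0 <= 2 * R" using R(2) nrm_nonneg[of E] by linarith
   show "\<exists>N. \<forall>m\<ge>N. \<forall>n\<ge>N. (LINT x|M. (a (D m x) - a (E x)) \<bullet> (D m x - E x)) < b" if "b > 0" for b
    using order_tendstoD(2)[OF Q that] by (auto simp: eventually_sequentially)
   fix b :: real assume b: "b > 0"
   obtain C where C: "C \<ge> 0" "!!x y. norm (x - y) powr p <= b * (norm x powr p + norm y powr p) + C * ((a x - a y) \<bullet> (x - y))"
    using a_modulus[OF b] by blast
   have "nrm (%x. D m x - E x) <= b * (2 * R) + C * (LINT x|M. (a (D m x) - a (E x)) \<bullet> (D m x - E x))" for m
   proof -
    have "b * (nrm (D m) + nrm E) <= b * (2 * R)" using R(1)[of m] R(2) b by (intro mult_left_mono) auto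
    then show ?thesis using nrm_a_modulus(1)[OF C(2) W0_Lp(2)[OF W[of m]] W0_Lp(2)[OF V]] by linarith
   qed
   then show "\<exists>C\<ge>0. \<forall>m n::nat. nrm (%x. D m x - E x) <= b * (2 * R) + C * (LINT x|M. (a (D m x) - a (E x)) \<bullet> (D m x - E x))"
    using C(1) by blast
  qed
  then obtain N where N: "\<forall>m\<ge>N. \<forall>n\<ge>N. nrm (%x. D m x - E x) < e" by blast
  have "norm (nrm (%x. D k x - E x) - 0) < e" if "k \<ge> N" for k
   using N[rule_format, OF that that] nrm_nonneg[of "%x. D k x - E x"] by simp
  then show "\<exists>N. \<forall>k\<ge>N. norm (nrm (%x. D k x - E x) - 0) < e" by blast
 qed
 show "(%k. nrm (%x. u k x - v x)) \<longlonglongrightarrow> 0"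
  by (rule nrm_sandwich[OF W0_Poincare[OF d]]) (use tendsto_mult[OF tendsto_const D0, of poincare_const] in simp)
qed

text \<open>An L^1 distance and not \<open>nrm\<close>: Schauder's argument needs an exact triangle
  inequality for continuity of the weights and convexity for the estimate of convex
  combinations.\<close>

definition rho :: "(real^'n => real) \<times> (real^'n => real^'n) => (real^'n => real) \<times> (real^'n => real^'n) => real" where
 "rho P Q = (LINT x|M. norm (fst P x - fst Q x)) + (LINT x|M. norm (snd P x - snd Q x))"

lemma W0_int: "W0 u D ==> integrable M u" "W0 u D ==> integrable M D"
 by (rule Lp_integrable, rule W0_Lp, assumption)+

lemma L1_triangle:
 fixes f g h :: "real^'n => 'b::euclidean_space"
 assumes "integrable M f" "integrable M g" "integrable M h"
 shows "(LINT x|M. norm (f x - h x)) <= (LINT x|M. norm (f x - g x)) + (LINT x|M. norm (g x - h x))"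
proof -
 have "(LINT x|M. norm (f x - h x)) <= (LINT x|M. norm (f x - g x) + norm (g x - h x))"
 proof (intro integral_mono integrable_add integrable_norm integrable_diff assms)
  show "norm (f x - h x) <= norm (f x - g x) + norm (g x - h x)" for x
   using norm_triangle_ineq[of "f x - g x" "g x - h x"] by simp
 qed
 also have "... = (LINT x|M. norm (f x - g x)) + (LINT x|M. norm (g x - h x))"
  by (intro integral_add integrable_norm integrable_diff assms)
 finally show ?thesis .
qed

lemma rho_triangle:
 assumes "W0 (fst P) (snd P)" "W0 (fst Q) (snd Q)" "W0 (fst S) (snd S)"
 shows "rho P S <= rho P Q + rho Q S"
 unfolding rho_def
 using L1_triangle[OF W0_int(1)[OF assms(1)] W0_int(1)[OF assms(2)] W0_int(1)[OF assms(3)]]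
  L1_triangle[OF W0_int(2)[OF assms(1)] W0_int(2)[OF assms(2)] W0_int(2)[OF assms(3)]] by linarith

lemma rho_commute: "rho P Q = rho Q P"
proof -
 have "norm (fst P x - fst Q x) = norm (fst Q x - fst P x)" "norm (snd P x - snd Q x) = norm (snd Q x - snd P x)" for x
  by (rule norm_minus_commute)+
 then show ?thesis by (simp only: rho_def)
qed

lemma rho_nonneg: "0 <= rho P Q"
 unfolding rho_def by (intro add_nonneg_nonneg integral_nonneg_AE) simp_all

text \<open>Without a finite net, a greedy choice would give an infinite sequence of solutions at
  mutual distance at least e, contradicting \<open>sol_compact\<close>.\<close>

lemma sol_net:
 assumes "G \<ge> 0" "e > 0"
 shows "\<exists>F. finite F \<and> F \<subseteq> {P. \<exists>g. adm G g \<and> sol g (fst P) (snd P)} \<and> (\<forall>g u D. adm G g \<longrightarrow> sol g u D \<longrightarrow> (\<exists>P\<in>F. rho P (u, D) < e))"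
proof (rule ccontr)
 define T where "T = {P. \<exists>g. adm G g \<and> sol g (fst P) (snd P)}"
 assume neg: "\<not> ?thesis"
 have far: "\<exists>P. P \<in> T \<and> (\<forall>Q\<in>F. e <= rho Q P)" if "finite F" "F \<subseteq> T" for F
 proof -
  have "\<not> (\<forall>g u D. adm G g \<longrightarrow> sol g u D \<longrightarrow> (\<exists>P\<in>F. rho P (u, D) < e))"
   using neg that unfolding T_def by simp
  then obtain g u D where *: "adm G g" "sol g u D" "\<forall>P\<in>F. \<not> rho P (u, D) < e" by auto
  have "(u, D) \<in> T" using *(1,2) unfolding T_def by auto
  moreover have "\<forall>Q\<in>F. e <= rho Q (u, D)" using *(3) by (simp only: not_less)
  ultimately show ?thesis by blast
 qed
 define pick where "pick F = (SOME P. P \<in> T \<and> (\<forall>Q\<in>F. e <= rho Q P))" for F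
 have pick: "pick F \<in> T \<and> (\<forall>Q\<in>F. e <= rho Q (pick F))" if "finite F" "F \<subseteq> T" for F
  unfolding pick_def by (rule someI_ex[OF far[OF that]])
 define A where "A = rec_nat {} (%_ F. insert (pick F) F)"
 have A: "finite (A n) \<and> A n \<subseteq> T" for n
 proof (induction n)
  case 0 show ?case by (simp add: A_def)
 next
  case (Suc n)
  have "A (Suc n) = insert (pick (A n)) (A n)" by (simp add: A_def)
  then show ?case using pick[of "A n"] Suc by simp
 qed
 define f where "f n = pick (A n)" for n
 have fT: "f n \<in> T" for n unfolding f_def using pick[of "A n"] A[of n] by simp
 have AS: "A (Suc n) = insert (f n) (A n)" for n by (simp add: A_def f_def)
 have fA: "f m \<in> A n" if "m < n" for m n using that by (induction n) (auto simp: AS less_Suc_eq)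
 have sep: "e <= rho (f m) (f n)" if "m < n" for m n
  using pick[of "A n"] A[of n] fA[OF that] unfolding f_def[of n] by simp
 have "\<forall>n. \<exists>g. adm G g \<and> sol g (fst (f n)) (snd (f n))" using fT by (simp add: T_def)
 then obtain g where g: "\<forall>n. adm G (g n) \<and> sol (g n) (fst (f n)) (snd (f n))" by (rule choice[THEN exE])
 have g1: "adm G (g n)" "sol (g n) (fst (f n)) (snd (f n))" for n using g by simp_all
 obtain r :: "nat => nat" and v E where r: "strict_mono r" and v: "W0 v E"
  and l: "(%n. nrm (%x. fst (f (r n)) x - v x)) \<longlonglongrightarrow> 0" "(%n. nrm (%x. snd (f (r n)) x - E x)) \<longlonglongrightarrow> 0"
  using sol_compact[where g=g and u="%n. fst (f n)" and D="%n. snd (f n)", OF assms(1) g1] by blast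
 note W = sol_W0[OF g1(2)]
 have "(%n. rho (f (r n)) (v, E)) \<longlonglongrightarrow> 0 + 0"
  unfolding rho_def fst_conv snd_conv
  by (intro tendsto_add L1_tendsto Lp_diff(1) W0_Lp[OF W] W0_Lp[OF v] l)
 then have "\<forall>\<^sub>F n in sequentially. rho (f (r n)) (v, E) < e / 2" using assms(2) by (intro order_tendstoD(2)) auto
 then obtain N where N: "!!n. n \<ge> N ==> rho (f (r n)) (v, E) < e / 2" by (auto simp: eventually_sequentially)
 have "rho (f (r N)) (f (r (Suc N))) <= rho (f (r N)) (v, E) + rho (v, E) (f (r (Suc N)))"
  by (rule rho_triangle) (simp_all add: W v)
 also have "... < e" using N[of N] N[of "Suc N"] by (simp add: rho_commute[of "(v, E)"])
 finally show False using sep[OF strict_monoD[OF r, of N "Suc N"]] by simp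
qed

lemma W0_sum:
 assumes "finite I" "!!i. i \<in> I ==> W0 (U i) (V i)"
 shows "W0 (%x. \<Sum>i\<in>I. c i * U i x) (%x. \<Sum>i\<in>I. c i *\<^sub>R V i x)"
 using assms
proof (induction I rule: finite_induct)
 case empty then show ?case by (simp add: W0_zero)
next
 case (insert i I)
 have "W0 (%x. c i * U i x + (\<Sum>i\<in>I. c i * U i x)) (%x. c i *\<^sub>R V i x + (\<Sum>i\<in>I. c i *\<^sub>R V i x))"
  by (intro W0_add W0_scale insert.IH) (simp_all add: insert.prems)
 then show ?case using insert.hyps by simp
qed

lemma L1_convex_combination:
 fixes U :: "'i => real^'n => 'b::euclidean_space"
 assumes "finite I" "!!i. i \<in> I ==> integrable M (U i)" "integrable M u" "!!i. i \<in> I ==> 0 <= c i" "(\<Sum>i\<in>I. c i) = 1"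
 shows "(LINT x|M. norm ((\<Sum>i\<in>I. c i *\<^sub>R U i x) - u x)) <= (\<Sum>i\<in>I. c i * (LINT x|M. norm (U i x - u x)))"
proof -
 have i1: "integrable M (%x. norm (U i x - u x))" if "i \<in> I" for i
  by (intro integrable_norm integrable_diff assms(2)[OF that] assms(3))
 have "(LINT x|M. norm ((\<Sum>i\<in>I. c i *\<^sub>R U i x) - u x)) <= (LINT x|M. (\<Sum>i\<in>I. c i * norm (U i x - u x)))"
 proof (rule integral_mono)
  show "integrable M (%x. norm ((\<Sum>i\<in>I. c i *\<^sub>R U i x) - u x))"
   by (intro integrable_norm integrable_diff integrable_sum integrable_scaleR_right assms(2,3))
  show "integrable M (%x. \<Sum>i\<in>I. c i * norm (U i x - u x))"
   by (intro integrable_sum integrable_mult_right i1)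
  fix x
  have eq: "(\<Sum>i\<in>I. c i *\<^sub>R U i x) - u x = (\<Sum>i\<in>I. c i *\<^sub>R (U i x - u x))"
   using assms(5) by (simp add: scaleR_diff_right sum_subtractf scaleR_sum_left[symmetric])
  have "norm ((\<Sum>i\<in>I. c i *\<^sub>R U i x) - u x) <= (\<Sum>i\<in>I. norm (c i *\<^sub>R (U i x - u x)))"
   unfolding eq by (rule norm_sum)
  also have "... = (\<Sum>i\<in>I. c i * norm (U i x - u x))" using assms(4) by (intro sum.cong) auto
  finally show "norm ((\<Sum>i\<in>I. c i *\<^sub>R U i x) - u x) <= (\<Sum>i\<in>I. c i * norm (U i x - u x))" .
 qed
 also have "... = (\<Sum>i\<in>I. c i * (LINT x|M. norm (U i x - u x)))"
  by (subst integral_sum) (auto intro: i1)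
 finally show ?thesis .
qed

text \<open>Schauder's argument: the image of the solution map is precompact, so the map is almost fixed on
 the convex hull of a finite net, where the cube fixed point theorem applies.\<close>

lemma almost_fixed_point:
 fixes N :: "(real^'n => real) => (real^'n => real^'n) => real^'n => real"
 assumes G: "G \<ge> 0" and adm: "!!w E. W0 w E ==> adm G (N w E)"
  and cont: "!!w E w' E'. (!!k::nat. W0 (w k) (E k)) ==> W0 w' E' ==> (AE x in M. (%k. w k x) \<longlonglongrightarrow> w' x) ==>
   (AE x in M. (%k. E k x) \<longlonglongrightarrow> E' x) ==> AE x in M. (%k. N (w k) (E k) x) \<longlonglongrightarrow> N w' E' x"
  and e: "e > 0"
 shows "\<exists>w E u D. W0 w E \<and> sol (N w E) u D \<and> rho (w, E) (u, D) <= e"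
proof -
 obtain F where F: "finite F" "F \<subseteq> {P. \<exists>g. adm G g \<and> sol g (fst P) (snd P)}"
  "!!g u D. adm G g ==> sol g u D ==> \<exists>P\<in>F. rho P (u, D) < e"
  using sol_net[OF G e] by blast
 obtain h :: "nat => _" and m :: nat where hm: "F = h ` {i. i < m}"
  using finite_imp_nat_seg_image_inj_on[OF F(1)] by blast
 have hW: "W0 (fst (h i)) (snd (h i))" if "i < m" for i using F(2) that unfolding hm by (auto dest: sol_W0)
 \<comment> \<open>Dividing by max 1 (sum) keeps the coefficients continuous on the whole cube, the
   origin included. At the fixed point the coordinates sum to 1 and the division changes
   nothing.\<close>
 define sm where "sm x = max 1 (\<Sum>i<m. x i)" for x :: "nat => real"
 define c where "c x i = x i / sm x" for x i
 define w where "w x = (%y. \<Sum>i<m. c x i * fst (h i) y)" for x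
 define E where "E x = (%y. \<Sum>i<m. c x i *\<^sub>R snd (h i) y)" for x
 have sm1: "sm x \<ge> 1" for x by (simp add: sm_def)
 have W: "W0 (w x) (E x)" for x unfolding w_def E_def by (rule W0_sum) (simp_all add: hW)
 define P where "P x = (SOME P. sol (N (w x) (E x)) (fst P) (snd P))" for x
 have P: "sol (N (w x) (E x)) (fst (P x)) (snd (P x))" for x
 proof -
  obtain u D where "sol (N (w x) (E x)) u D" using solve_bounded[OF adm[OF W[of x]]] by blast
  then have "\<exists>P. sol (N (w x) (E x)) (fst P) (snd P)" by (intro exI[of _ "(u, D)"]) simp
  then show ?thesis unfolding P_def by (rule someI_ex)
 qed
 note PW = sol_W0[OF P]
 \<comment> \<open>Schauder's weights: a net element counts only if it is closer than
   \<open>e\<close> to the solution \<open>P x\<close>. The net property makes at least one weight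
   positive, so \<open>tot\<close> never vanishes.\<close>
 define mu where "mu x i = max 0 (e - rho (h i) (P x))" for x i
 define tot where "tot x = (\<Sum>i<m. mu x i)" for x
 have mu0: "mu x i \<ge> 0" for x i by (simp add: mu_def)
 have totpos: "tot x > 0" for x
 proof -
  obtain i where i: "i < m" "rho (h i) (P x) < e" using F(3)[OF adm[OF W] P] unfolding hm by auto
  have "0 < mu x i" using i by (simp add: mu_def)
  also have "... <= tot x" unfolding tot_def by (rule member_le_sum) (use i mu0 in auto)
  finally show ?thesis .
 qed
 have mu_le: "mu x i <= tot x" if "i < m" for x i
  unfolding tot_def by (rule member_le_sum) (use that mu0 in auto)
 have mucont: "(%k. mu (X k) i) \<longlonglongrightarrow> mu x i" if X: "!!j. j < m ==> (%k. X k j) \<longlonglongrightarrow> x j" and i: "i < m" for X x i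
 proof -
  have "(%k. sm (X k)) \<longlonglongrightarrow> sm x" unfolding sm_def by (intro tendsto_max tendsto_const tendsto_sum X) simp
  then have cl: "(%k. c (X k) j) \<longlonglongrightarrow> c x j" if "j < m" for j
   unfolding c_def using sm1[of x] by (intro tendsto_divide X that) auto
  have "AE y in M. (%k. N (w (X k)) (E (X k)) y) \<longlonglongrightarrow> N (w x) (E x) y"
  proof (rule cont[OF W W])
   show "AE y in M. (%k. w (X k) y) \<longlonglongrightarrow> w x y" unfolding w_def
    by (intro AE_I2 tendsto_sum tendsto_mult tendsto_const cl) simp
   show "AE y in M. (%k. E (X k) y) \<longlonglongrightarrow> E x y" unfolding E_def
    by (intro AE_I2 tendsto_sum tendsto_scaleR tendsto_const cl) simp
  qed
  note sc = sol_continuous[OF G adm[OF W] adm[OF W] P P this]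
  have r0: "(%k. rho (P (X k)) (P x)) \<longlonglongrightarrow> 0"
  proof -
   have "(%k. rho (P (X k)) (P x)) \<longlonglongrightarrow> 0 + 0" unfolding rho_def
    by (intro tendsto_add L1_tendsto Lp_diff(1) W0_Lp[OF PW] sc)
   then show ?thesis by simp
  qed
  have "(%k. rho (h i) (P (X k)) - rho (h i) (P x)) \<longlonglongrightarrow> 0"
  proof (rule Lim_null_comparison[OF _ r0], rule always_eventually, rule allI)
   fix k
   show "norm (rho (h i) (P (X k)) - rho (h i) (P x)) <= rho (P (X k)) (P x)"
    using rho_triangle[OF hW[OF i] PW[of "X k"] PW[of x]] rho_triangle[OF hW[OF i] PW[of x] PW[of "X k"]]
     rho_commute[of "P x" "P (X k)"] unfolding real_norm_def by linarith
  qed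
  then have "(%k. rho (h i) (P (X k))) \<longlonglongrightarrow> rho (h i) (P x)" by (rule LIM_zero_cancel)
  then show ?thesis unfolding mu_def by (intro tendsto_max tendsto_diff tendsto_const)
 qed
 obtain x where x: "\<forall>j<m. 0 <= x j \<and> x j <= 1" "\<forall>j<m. mu x j / tot x = x j"
 proof -
  have "\<exists>x. (\<forall>j<m. 0 <= x j \<and> x j <= 1) \<and> (\<forall>j<m. mu x j / tot x = x j)"
  proof (rule cube_fixed_point[of m "%x i. mu x i / tot x"])
   show "0 <= mu x i / tot x \<and> mu x i / tot x <= 1" if "i < m" for x i
    using mu0[of x i] totpos[of x] mu_le[OF that, of x] by simp
   fix X :: "nat => nat => real" and x :: "nat => real" and i
   assume X: "!!j. j < m ==> (%k. X k j) \<longlonglongrightarrow> x j" and i: "i < m"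
   have "(%k. tot (X k)) \<longlonglongrightarrow> tot x" unfolding tot_def by (intro tendsto_sum mucont[OF X]) simp_all
   then show "(%k. mu (X k) i / tot (X k)) \<longlonglongrightarrow> mu x i / tot x"
    using totpos[of x] by (intro tendsto_divide mucont[OF X] i) auto
  qed
  then show thesis using that by blast
 qed
 have "(\<Sum>i<m. x i) = (\<Sum>i<m. mu x i / tot x)" using x(2) by (intro sum.cong) auto
 also have "... = 1" using totpos[of x] by (simp add: sum_divide_distrib[symmetric] tot_def[symmetric])
 finally have sx: "(\<Sum>i<m. x i) = 1" .
 then have cx: "c x i = x i" for i by (simp add: c_def sm_def)
 \<comment> \<open>Net elements at distance at least e carry weight zero, so the convex combination
   itself is within e of \<open>P x\<close>.\<close>
 have tm: "x i * rho (h i) (P x) <= x i * e" if "i < m" for i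
 proof (cases "rho (h i) (P x) < e")
  case True then show ?thesis using x(1) that by (intro mult_left_mono) auto
 next
  case False
  then have "mu x i = 0" by (simp add: mu_def)
  then have "x i = 0" using x(2) that by force
  then show ?thesis by simp
 qed
 have "rho (w x, E x) (P x) <= (\<Sum>i<m. x i * rho (h i) (P x))"
 proof -
  have "(LINT y|M. norm (w x y - fst (P x) y)) <= (\<Sum>i<m. x i * (LINT y|M. norm (fst (h i) y - fst (P x) y)))"
   using L1_convex_combination[of "{..<m}" "%i. fst (h i)" "fst (P x)" x] x(1) sx W0_int(1)[OF hW] W0_int(1)[OF PW[of x]]
   by (simp add: w_def cx)
  moreover have "(LINT y|M. norm (E x y - snd (P x) y)) <= (\<Sum>i<m. x i * (LINT y|M. norm (snd (h i) y - snd (P x) y)))"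
   using L1_convex_combination[of "{..<m}" "%i. snd (h i)" "snd (P x)" x] x(1) sx W0_int(2)[OF hW] W0_int(2)[OF PW[of x]]
   by (simp add: E_def cx)
  ultimately show ?thesis by (simp add: rho_def distrib_left sum.distrib)
 qed
 also have "... <= (\<Sum>i<m. x i * e)" by (intro sum_mono tm) simp
 also have "... = e" using sx by (simp add: sum_distrib_right[symmetric])
 finally have "rho (w x, E x) (fst (P x), snd (P x)) <= e" by simp
 then show ?thesis using W[of x] P[of x] by blast
qed

text \<open>Inputs and outputs of the almost fixed points approach each other in L^1. The outputs
  converge strongly along a subsequence, so the inputs converge almost everywhere to the same limit
  along a further one, and continuity of the solution map shows that this limit is fixed.\<close>

lemma fixed_point:
 fixes N :: "(real^'n => real) => (real^'n => real^'n) => real^'n => real"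
 assumes G: "G \<ge> 0" and adm: "!!w E. W0 w E ==> adm G (N w E)"
  and cont: "!!w E w' E'. (!!k::nat. W0 (w k) (E k)) ==> W0 w' E' ==> (AE x in M. (%k. w k x) \<longlonglongrightarrow> w' x) ==>
   (AE x in M. (%k. E k x) \<longlonglongrightarrow> E' x) ==> AE x in M. (%k. N (w k) (E k) x) \<longlonglongrightarrow> N w' E' x"
 shows "\<exists>u D. sol (N u D) u D"
proof -
 have "\<forall>j. \<exists>q. W0 (fst (fst q)) (snd (fst q)) \<and> sol (N (fst (fst q)) (snd (fst q))) (fst (snd q)) (snd (snd q)) \<and> rho (fst q) (snd q) <= inverse (real (Suc j))"
 proof
  fix j :: nat
  have "inverse (real (Suc j)) > 0" by simp
  have "\<exists>w E u D. W0 w E \<and> sol (N w E) u D \<and> rho (w, E) (u, D) <= inverse (real (Suc j))"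
  proof (rule almost_fixed_point[where N=N and G=G])
   show "adm G (N w E)" if "W0 w E" for w E by (rule adm[OF that])
   show "AE x in M. (%k. N (w k) (E k) x) \<longlonglongrightarrow> N w' E' x" if "!!k::nat. W0 (w k) (E k)" "W0 w' E'"
    "AE x in M. (%k. w k x) \<longlonglongrightarrow> w' x" "AE x in M. (%k. E k x) \<longlonglongrightarrow> E' x" for w E w' E'
    by (rule cont[OF that])
  qed (use G in simp_all)
  then obtain w E u D where "W0 w E" "sol (N w E) u D" "rho (w, E) (u, D) <= inverse (real (Suc j))" by blast
  then show "\<exists>q. W0 (fst (fst q)) (snd (fst q)) \<and> sol (N (fst (fst q)) (snd (fst q))) (fst (snd q)) (snd (snd q)) \<and> rho (fst q) (snd q) <= inverse (real (Suc j))"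
   by (intro exI[of _ "((w, E), (u, D))"]) simp
 qed
 then obtain q where q: "\<forall>j. W0 (fst (fst (q j))) (snd (fst (q j))) \<and> sol (N (fst (fst (q j))) (snd (fst (q j)))) (fst (snd (q j))) (snd (snd (q j))) \<and> rho (fst (q j)) (snd (q j)) <= inverse (real (Suc j))"
  by (rule choice[THEN exE])
 define w E u D where "w j = fst (fst (q j))" and "E j = snd (fst (q j))" and "u j = fst (snd (q j))" and "D j = snd (snd (q j))" for j
 have W: "W0 (w j) (E j)" and s: "sol (N (w j) (E j)) (u j) (D j)" and rh: "rho (w j, E j) (u j, D j) <= inverse (real (Suc j))" for j
  using q unfolding w_def E_def u_def D_def by simp_all
 obtain r :: "nat => nat" and v H where r: "strict_mono r" and v: "W0 v H"
  and l: "(%n. nrm (%x. u (r n) x - v x)) \<longlonglongrightarrow> 0" "(%n. nrm (%x. D (r n) x - H x)) \<longlonglongrightarrow> 0"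
  using sol_compact[where g="%j. N (w j) (E j)" and u=u and D=D, OF G adm[OF W] s] by blast
 note UW = sol_W0[OF s]
 have rh0: "(%n. rho (w (r n), E (r n)) (v, H)) \<longlonglongrightarrow> 0"
 proof (rule tendsto_sandwich[OF _ _ tendsto_const])
  have "(%n. inverse (real (Suc (r n))) + ((LINT x|M. norm (u (r n) x - v x)) + (LINT x|M. norm (D (r n) x - H x)))) \<longlonglongrightarrow> 0 + (0 + 0)"
   using LIMSEQ_subseq_LIMSEQ[OF LIMSEQ_inverse_real_of_nat r]
   by (intro tendsto_add L1_tendsto Lp_diff(1) W0_Lp[OF UW] W0_Lp[OF v] l) (simp add: o_def)
  then show "(%n. inverse (real (Suc (r n))) + ((LINT x|M. norm (u (r n) x - v x)) + (LINT x|M. norm (D (r n) x - H x)))) \<longlonglongrightarrow> 0" by simp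
  show "\<forall>\<^sub>F n in sequentially. 0 <= rho (w (r n), E (r n)) (v, H)" by (simp only: rho_nonneg eventually_True)
  have "rho (w (r n), E (r n)) (v, H) <= inverse (real (Suc (r n))) + ((LINT x|M. norm (u (r n) x - v x)) + (LINT x|M. norm (D (r n) x - H x)))" for n
   using rho_triangle[of "(w (r n), E (r n))" "(u (r n), D (r n))" "(v, H)"] W[of "r n"] UW[of "r n"] v rh[of "r n"]
   by (simp add: rho_def)
  then show "\<forall>\<^sub>F n in sequentially. rho (w (r n), E (r n)) (v, H) <= inverse (real (Suc (r n))) + ((LINT x|M. norm (u (r n) x - v x)) + (LINT x|M. norm (D (r n) x - H x)))"
   by (simp only: eventually_True)
 qed
 have nn: "0 <= (LINT x|M. norm (f x))" for f :: "real^'n => 'c::real_normed_vector" by (rule integral_nonneg_AE) simp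
 have w0: "(%n. LINT x|M. norm (w (r n) x - v x)) \<longlonglongrightarrow> 0" and E0: "(%n. LINT x|M. norm (E (r n) x - H x)) \<longlonglongrightarrow> 0"
  by (rule tendsto_sandwich[OF _ _ tendsto_const rh0]; intro always_eventually allI; simp add: rho_def nn)+
 have wi: "integrable M (%x. w (r n) x - v x)" and Ei: "integrable M (%x. E (r n) x - H x)" for n
  by (intro integrable_diff W0_int[OF W] W0_int[OF v])+
 obtain t1 :: "nat => nat" where t1: "strict_mono t1" "AE x in M. (%n. w (r (t1 n)) x - v x) \<longlonglongrightarrow> 0"
  using tendsto_L1_AE_subseq[of M "%n x. w (r n) x - v x", OF wi w0] by blast
 have E1: "(%n. LINT x|M. norm (E (r (t1 n)) x - H x)) \<longlonglongrightarrow> 0" using LIMSEQ_subseq_LIMSEQ[OF E0 t1(1)] by (simp add: o_def)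
 obtain t2 :: "nat => nat" where t2: "strict_mono t2" "AE x in M. (%n. E (r (t1 (t2 n))) x - H x) \<longlonglongrightarrow> 0"
  using tendsto_L1_AE_subseq[of M "%n x. E (r (t1 n)) x - H x", OF Ei E1] by blast
 define k where "k n = r (t1 (t2 n))" for n
 have aw: "AE x in M. (%n. w (k n) x) \<longlonglongrightarrow> v x"
  using t1(2)
 proof eventually_elim
  case (elim x)
  from LIMSEQ_subseq_LIMSEQ[OF elim t2(1)] show ?case unfolding k_def o_def by (rule LIM_zero_cancel)
 qed
 have aE: "AE x in M. (%n. E (k n) x) \<longlonglongrightarrow> H x"
  using t2(2) by eventually_elim (unfold k_def, rule LIM_zero_cancel)
 have gl: "AE x in M. (%n. N (w (k n)) (E (k n)) x) \<longlonglongrightarrow> N v H x" by (rule cont[OF W v aw aE])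
 obtain v' H' where s': "sol (N v H) v' H'" using solve_bounded[OF adm[OF v]] by blast
 note V' = sol_W0[OF s']
 have "(%n. nrm (%x. D (k n) x - H' x)) \<longlonglongrightarrow> 0" by (rule sol_continuous(1)[OF G adm[OF W] adm[OF v] s s' gl])
 moreover have "(%n. nrm (%x. D (k n) x - H x)) \<longlonglongrightarrow> 0"
  using LIMSEQ_subseq_LIMSEQ[OF LIMSEQ_subseq_LIMSEQ[OF l(2) t1(1)] t2(1)] by (simp add: k_def o_def)
 ultimately have hl: "(%n. 2 powr p * (nrm (%x. D (k n) x - H x) + nrm (%x. D (k n) x - H' x))) \<longlonglongrightarrow> 2 powr p * (0 + 0)"
  by (intro tendsto_mult tendsto_add tendsto_const)
 have "nrm (%x. H x - H' x) <= 2 powr p * (nrm (%x. D (k n) x - H x) + nrm (%x. D (k n) x - H' x))" for n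
  using nrm_triangle[OF W0_Lp(2)[OF v] W0_Lp(2)[OF UW[of "k n"]] W0_Lp(2)[OF V']] by (simp add: nrm_commute[of H])
 then have "nrm (%x. H x - H' x) <= 2 powr p * (0 + 0)" by (intro LIMSEQ_le_const[OF hl]) blast
 then have "nrm (%x. H x - H' x) <= 0" by simp
 then have "nrm (%x. H x - H' x) = 0" using nrm_nonneg[of "%x. H x - H' x"] by (rule antisym)
 then have "AE x in M. norm (H x - H' x) powr p = 0"
  using integral_nonneg_eq_0_iff_AE[OF Lp_integrable_powr[OF Lp_diff(1)[OF W0_Lp(2)[OF v] W0_Lp(2)[OF V']]]] by (simp add: nrm_def)
 then have HH: "AE x in M. H x = H' x" by eventually_elim simp
 \<comment> \<open>In the weak equation the solution appears on the left only through its gradient,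
   so the agreement of H and H' almost everywhere is enough.\<close>
 have "sol (N v H) v H"
  unfolding sol_def
 proof (intro conjI v allI impI)
  fix \<phi> F assume \<phi>: "W0 \<phi> F"
  have "(LINT x|M. a (H x) \<bullet> F x) = (LINT x|M. a (H' x) \<bullet> F x)"
  proof (rule integral_cong_AE)
   show "AE x in M. a (H x) \<bullet> F x = a (H' x) \<bullet> F x" using HH by eventually_elim simp
  qed (intro borel_measurable_integrable a_integrable W0_Lp(2)[OF v] W0_Lp(2)[OF V'] W0_Lp(2)[OF \<phi>])+
  also have "... = (LINT x|M. N v H x * \<phi> x)" by (rule sol_eq[OF s' \<phi>])
  finally show "(LINT x|M. a (H x) \<bullet> F x) = (LINT x|M. N v H x * \<phi> x)" .
 qed
 then show ?thesis by blast
qed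

end

section \<open>Passage to the limit\<close>

lemma subseq_of_eventually:
 assumes "!!j. \<forall>\<^sub>F n in sequentially. P j (n::nat)"
 shows "\<exists>r :: nat => nat. strict_mono r \<and> (\<forall>j. P j (r j))"
proof -
 have "\<forall>j. \<exists>N. \<forall>n\<ge>N. P j n" using assms by (simp add: eventually_sequentially)
 then obtain N where N: "\<forall>j. \<forall>n\<ge>N j. P j n" by (rule choice[THEN exE])
 define r where "r = rec_nat (N 0) (%k m. max (Suc m) (N (Suc k)))"
 have "r n < r (Suc n)" for n by (simp add: r_def less_max_iff_disj)
 then have "strict_mono r" by (simp add: strict_mono_Suc_iff)
 moreover have "N j <= r j" for j by (cases j) (simp_all add: r_def)
 ultimately show ?thesis using N by blast
qed

lemma integral_Fatou_limit:
 fixes f :: "'a => real"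
 assumes X: "!!n. integrable M (X n)" "!!n. AE x in M. 0 <= X n x"
  and L: "(%n. integral\<^sup>L M (X n)) \<longlonglongrightarrow> L" and f: "f \<in> borel_measurable M"
  and lim: "AE x in M. (%n. X n x) \<longlonglongrightarrow> f x"
 shows "integral\<^sup>L M f <= L"
proof (rule field_le_epsilon)
 fix e :: real assume "e > 0"
 then have "\<forall>\<^sub>F n in sequentially. integral\<^sup>L M (X n) < L + e" by (intro order_tendstoD(2)[OF L]) simp
 then obtain N where N: "!!n. n \<ge> N ==> integral\<^sup>L M (X n) < L + e" by (auto simp: eventually_sequentially)
 have le: "integral\<^sup>L M (X (n + N)) <= L + e" for n using N[of "n + N"] by simp
 have lim': "AE x in M. (%n. X (n + N) x) \<longlonglongrightarrow> f x"
  using lim by eventually_elim (rule LIMSEQ_ignore_initial_segment)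
 show "integral\<^sup>L M f <= L + e"
  by (rule integrable_Fatou(2)[of M "%n. X (n + N)", OF X(1) X(2) le f lim'])
qed

text \<open>This is (1 + exp s)^(-l), a smooth stand-in for exp(-l max(0, s)) that is bounded with
  bounded derivative on the whole line. For s >= 0 the ratio exp s / (1 + exp s) is at least 1/2,
  which is the source of the factor l/2 in \<open>bump_exp'_bounds\<close>.\<close>

definition bump_exp :: "real => real => real" where
 "bump_exp l s = exp (- l * ln (1 + exp s))"

definition bump_exp' :: "real => real => real" where
 "bump_exp' l s = - l * (exp s / (1 + exp s)) * bump_exp l s"

lemma one_plus_exp_pos: "0 < 1 + exp (s::real)" by (simp add: add_pos_pos)

lemma softplus_nonneg: "0 <= ln (1 + exp (s::real))" by simp

lemma exp_ratio: "0 <= exp s / (1 + exp s)" "exp s / (1 + exp (s::real)) <= 1" "0 <= s ==> 1 / 2 <= exp s / (1 + exp s)"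
 using one_plus_exp_pos[of s] by (simp_all add: field_simps)

lemma bump_exp_bounds: "l \<ge> 0 ==> 0 < bump_exp l s" "l \<ge> 0 ==> bump_exp l s <= 1"
 using softplus_nonneg[of s] by (simp_all add: bump_exp_def)

lemma bump_exp'_bounds:
 assumes "l \<ge> 0"
 shows "\<bar>bump_exp' l s\<bar> <= l" "0 <= s ==> l / 2 * bump_exp l s <= - bump_exp' l s"
proof -
 have "exp s / (1 + exp s) * bump_exp l s <= 1 * 1"
  by (intro mult_mono exp_ratio) (use bump_exp_bounds[OF assms, of s] in auto)
 then have "l * (exp s / (1 + exp s) * bump_exp l s) <= l * 1" using assms by (intro mult_left_mono) auto
 moreover have "\<bar>bump_exp' l s\<bar> = l * (exp s / (1 + exp s) * bump_exp l s)"
  using assms exp_ratio(1)[of s] bump_exp_bounds(1)[OF assms, of s] by (simp add: bump_exp'_def abs_mult mult.assoc)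
 ultimately show "\<bar>bump_exp' l s\<bar> <= l" by linarith
 assume "0 <= s"
 then have "1 / 2 * (l * bump_exp l s) <= exp s / (1 + exp s) * (l * bump_exp l s)"
  using assms bump_exp_bounds(1)[OF assms, of s] by (intro mult_right_mono exp_ratio(3)) auto
 then show "l / 2 * bump_exp l s <= - bump_exp' l s" by (simp add: bump_exp'_def mult_ac)
qed

lemma softplus_deriv: "((%s. ln (1 + exp s)) has_real_derivative exp s / (1 + exp s)) (at s)"
 using one_plus_exp_pos[of s] by (auto intro!: derivative_eq_intros)

lemma bump_exp_deriv: "(bump_exp l has_real_derivative bump_exp' l s) (at s)"
proof -
 have "((%s. exp (- l * ln (1 + exp s))) has_real_derivative exp (- l * ln (1 + exp s)) * (- l * (exp s / (1 + exp s)))) (at s)"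
  by (rule DERIV_chain2[OF DERIV_exp DERIV_cmult[OF softplus_deriv]])
 then show ?thesis unfolding bump_exp_def[abs_def] bump_exp'_def by (simp only: mult.commute)
qed

lemma softplus_continuous: "continuous_on UNIV (%s::real. ln (1 + exp s))"
 by (rule continuous_at_imp_continuous_on) (blast intro: DERIV_isCont[OF softplus_deriv])

lemma exp_ratio_continuous: "continuous_on UNIV (%s::real. exp s / (1 + exp s))"
 by (intro continuous_intros) (metis one_plus_exp_pos less_irrefl)

lemma bump_exp_continuous: "continuous_on UNIV (bump_exp l)" "continuous_on UNIV (bump_exp' l)"
proof -
 show c: "continuous_on UNIV (bump_exp l)"
  by (rule continuous_at_imp_continuous_on) (blast intro: DERIV_isCont[OF bump_exp_deriv])
 show "continuous_on UNIV (bump_exp' l)"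
  unfolding bump_exp'_def by (intro continuous_on_mult continuous_on_const exp_ratio_continuous c)
qed

text \<open>The reciprocal of \<open>bump_exp l\<close> is unbounded and cannot multiply test
  functions. Here its exponent t = ln (1 + exp s) is replaced by (k+1) arctan(t/(k+1)), which is
  bounded for each k and tends to t.\<close>

definition lift_exp :: "real => nat => real => real" where
 "lift_exp l k s = exp (l * (real (Suc k) * arctan (ln (1 + exp s) / real (Suc k))))"

definition lift_exp' :: "real => nat => real => real" where
 "lift_exp' l k s = l * (1 / (1 + (ln (1 + exp s) / real (Suc k))\<^sup>2)) * (exp s / (1 + exp s)) * lift_exp l k s"

lemma one_plus_square_pos: "0 < 1 + (t::real)\<^sup>2" by (simp add: add_pos_nonneg)

lemma lift_exp_deriv: "(lift_exp l k has_real_derivative lift_exp' l k s) (at s)"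
proof -
 define m where "m = real (Suc k)"
 have m: "m > 0" by (simp add: m_def)
 define t where "t = ln (1 + exp s) / m"
 have "((%s. ln (1 + exp s) / m) has_real_derivative exp s / (1 + exp s) / m) (at s)"
  by (rule DERIV_cdivide[OF softplus_deriv])
 then have "((%s. arctan (ln (1 + exp s) / m)) has_real_derivative inverse (1 + t\<^sup>2) * (exp s / (1 + exp s) / m)) (at s)"
  unfolding t_def by (rule DERIV_chain2[OF DERIV_arctan])
 then have "((%s. l * (m * arctan (ln (1 + exp s) / m))) has_real_derivative l * (m * (inverse (1 + t\<^sup>2) * (exp s / (1 + exp s) / m)))) (at s)"
  by (intro DERIV_cmult)
 then have "((%s. exp (l * (m * arctan (ln (1 + exp s) / m)))) has_real_derivative
   exp (l * (m * arctan (ln (1 + exp s) / m))) * (l * (m * (inverse (1 + t\<^sup>2) * (exp s / (1 + exp s) / m))))) (at s)"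
  by (rule DERIV_chain2[OF DERIV_exp])
 moreover have "m * (inverse (1 + t\<^sup>2) * (exp s / (1 + exp s) / m)) = 1 / (1 + t\<^sup>2) * (exp s / (1 + exp s))"
  using m by (simp add: divide_inverse)
 ultimately show ?thesis
  unfolding lift_exp_def[abs_def] lift_exp'_def m_def[symmetric] t_def[symmetric] by (simp add: mult_ac)
qed

lemma lift_exp_pos: "0 < lift_exp l k s" by (simp add: lift_exp_def)

lemma lift_exp_le:
 assumes "l \<ge> 0" shows "lift_exp l k s <= exp (l * (real (Suc k) * (pi / 2)))"
 unfolding lift_exp_def exp_le_cancel_iff
 by (intro mult_left_mono less_imp_le[OF arctan_ubound] assms) simp

lemma inverse_one_plus_square: "0 <= 1 / (1 + (t::real)\<^sup>2)" "1 / (1 + t\<^sup>2) <= 1"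
 using one_plus_square_pos[of t] by simp_all

lemma lift_exp'_bound:
 assumes "l \<ge> 0" shows "\<bar>lift_exp' l k s\<bar> <= l * exp (l * (real (Suc k) * (pi / 2)))"
proof -
 let ?a = "1 / (1 + (ln (1 + exp s) / real (Suc k))\<^sup>2)"
 have "?a * (exp s / (1 + exp s)) <= 1 * 1"
  by (intro mult_mono exp_ratio inverse_one_plus_square) simp
 moreover have "0 <= ?a * (exp s / (1 + exp s))" by (intro mult_nonneg_nonneg exp_ratio inverse_one_plus_square)
 ultimately have "l * (?a * (exp s / (1 + exp s)) * lift_exp l k s) <= l * (1 * exp (l * (real (Suc k) * (pi / 2))))"
  using assms lift_exp_le[OF assms, of k s] lift_exp_pos[of l k s] by (intro mult_left_mono mult_mono) auto
 moreover have "\<bar>lift_exp' l k s\<bar> = l * (?a * (exp s / (1 + exp s)) * lift_exp l k s)"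
  unfolding lift_exp'_def using assms lift_exp_pos[of l k s] exp_ratio(1)[of s] inverse_one_plus_square(1)[of "ln (1 + exp s) / real (Suc k)"]
  by (simp add: abs_mult mult.assoc)
 ultimately show ?thesis by simp
qed

lemma lift_exp_continuous: "continuous_on UNIV (lift_exp l k)" "continuous_on UNIV (lift_exp' l k)"
proof -
 show c: "continuous_on UNIV (lift_exp l k)"
  by (rule continuous_at_imp_continuous_on) (blast intro: DERIV_isCont[OF lift_exp_deriv])
 have d: "continuous_on UNIV (%s. 1 / (1 + (ln (1 + exp s) / real (Suc k))\<^sup>2))"
 proof (intro continuous_on_divide continuous_on_add continuous_on_const continuous_on_power softplus_continuous ballI)
  show "1 + (ln (1 + exp s) / real (Suc k))\<^sup>2 \<noteq> 0" for s :: real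
   using one_plus_square_pos[of "ln (1 + exp s) / real (Suc k)"] by linarith
 qed simp
 show "continuous_on UNIV (lift_exp' l k)"
  unfolding lift_exp'_def by (intro continuous_on_mult continuous_on_const exp_ratio_continuous c d)
qed

lemma arctan_scaled_le: "0 <= t ==> m > 0 ==> m * arctan (t / m) <= (t::real)"
 using arctan_le_self[of "t / m"] by (simp add: field_simps)

lemma arctan_scaled_tendsto: "(%k. real (Suc k) * arctan (t / real (Suc k))) \<longlonglongrightarrow> t"
proof (cases "t = 0")
 case False
 have "((%x. arctan x / x) \<longlongrightarrow> 1) (at 0)"
  using DERIV_arctan[of 0] by (simp add: has_field_derivative_iff)
 moreover have "(%k. t * inverse (real (Suc k))) \<longlonglongrightarrow> 0"
  using tendsto_mult[OF tendsto_const[of t] LIMSEQ_inverse_real_of_nat] by simp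
 ultimately have "(%k. arctan (t * inverse (real (Suc k))) / (t * inverse (real (Suc k)))) \<longlonglongrightarrow> 1"
  using False unfolding tendsto_at_iff_sequentially o_def by (auto simp del: of_nat_Suc)
 from tendsto_mult[OF tendsto_const[of t] this]
 have "(%k. t * (arctan (t * inverse (real (Suc k))) / (t * inverse (real (Suc k))))) \<longlonglongrightarrow> t * 1" .
 moreover have "t * (arctan (t * inverse (real (Suc k))) / (t * inverse (real (Suc k)))) = real (Suc k) * arctan (t / real (Suc k))" for k
  using False by (simp add: divide_inverse del: of_nat_Suc)
 ultimately show ?thesis by (simp only: mult_1_right)
qed simp

lemma bump_lift_le: "l \<ge> 0 ==> bump_exp l s * lift_exp l k s <= 1"
proof -
 assume l: "l \<ge> 0"
 have "l * (real (Suc k) * arctan (ln (1 + exp s) / real (Suc k))) <= l * ln (1 + exp s)"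
  by (intro mult_left_mono arctan_scaled_le softplus_nonneg l) simp
 then show ?thesis unfolding bump_exp_def lift_exp_def exp_add[symmetric] by simp
qed

lemma bump_lift_tendsto: "(%k. bump_exp l s * lift_exp l k s) \<longlonglongrightarrow> 1"
proof -
 have "(%k. exp (- l * ln (1 + exp s) + l * (real (Suc k) * arctan (ln (1 + exp s) / real (Suc k))))) \<longlonglongrightarrow> exp (- l * ln (1 + exp s) + l * ln (1 + exp s))"
  by (intro tendsto_exp tendsto_add tendsto_mult tendsto_const arctan_scaled_tendsto)
 then show ?thesis unfolding bump_exp_def lift_exp_def exp_add by (simp only: exp_add[symmetric]) simp
qed

text \<open>The expression is the derivative of the product of \<open>bump_exp l\<close> and
  \<open>lift_exp l k\<close>, which tends to 1. It equals the product times l z (t k - 1), where t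
  k tends to 1, so the energy term created by the weights disappears in the limit.\<close>

lemma bump_lift_cross:
 assumes "l \<ge> 0"
 shows "\<bar>bump_exp l s * lift_exp' l k s + bump_exp' l s * lift_exp l k s\<bar> <= l"
  "(%k. bump_exp l s * lift_exp' l k s + bump_exp' l s * lift_exp l k s) \<longlonglongrightarrow> 0"
proof -
 define t where "t k = 1 / (1 + (ln (1 + exp s) / real (Suc k))\<^sup>2)" for k
 define y where "y k = bump_exp l s * lift_exp l k s" for k
 define z where "z = exp s / (1 + exp s)"
 have eq: "bump_exp l s * lift_exp' l k s + bump_exp' l s * lift_exp l k s = l * z * (t k - 1) * y k" for k
  by (simp add: lift_exp'_def bump_exp'_def t_def y_def z_def algebra_simps)
 have "\<bar>t k - 1\<bar> <= 1" for k using inverse_one_plus_square[of "ln (1 + exp s) / real (Suc k)"] unfolding t_def by linarith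
 moreover have y: "\<bar>y k\<bar> <= 1" for k
  using bump_lift_le[OF assms, of s k] bump_exp_bounds(1)[OF assms, of s] lift_exp_pos[of l k s] by (simp add: y_def)
 ultimately have "\<bar>z\<bar> * (\<bar>t k - 1\<bar> * \<bar>y k\<bar>) <= 1 * (1 * 1)" for k
  using exp_ratio[of s] by (intro mult_mono) (auto simp: z_def)
 from mult_left_mono[OF this, of l] show "\<bar>bump_exp l s * lift_exp' l k s + bump_exp' l s * lift_exp l k s\<bar> <= l"
  unfolding eq using assms by (simp add: abs_mult mult.assoc)
 have "(%k. ln (1 + exp s) * inverse (real (Suc k))) \<longlonglongrightarrow> ln (1 + exp s) * 0"
  by (intro tendsto_mult tendsto_const LIMSEQ_inverse_real_of_nat)
 then have "(%k. 1 / (1 + (ln (1 + exp s) * inverse (real (Suc k)))\<^sup>2)) \<longlonglongrightarrow> 1 / (1 + (ln (1 + exp s) * 0)\<^sup>2)"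
  by (intro tendsto_divide tendsto_add tendsto_const tendsto_power) simp_all
 then have "t \<longlonglongrightarrow> 1" by (simp add: t_def[abs_def] divide_inverse del: of_nat_Suc)
 then have "(%k. l * z * (t k - 1) * y k) \<longlonglongrightarrow> l * z * (1 - 1) * 1"
  unfolding y_def by (intro tendsto_mult tendsto_diff tendsto_const bump_lift_tendsto)
 then show "(%k. bump_exp l s * lift_exp' l k s + bump_exp' l s * lift_exp l k s) \<longlonglongrightarrow> 0"
  unfolding eq by simp
qed

section \<open>Almost everywhere convergence of gradients\<close>

context leray_lions
begin

text \<open>No bound on X n is given in advance. In \<open>a_modulus\<close> the term e |X n|^p is
  absorbed through |X n|^p <= 2^p (|X n - y|^p + |y|^p).\<close>

lemma a_pointwise:
 fixes X :: "nat => real^'n"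
 assumes "(%n. (a (X n) - a y) \<bullet> (X n - y)) \<longlonglongrightarrow> 0"
 shows "X \<longlonglongrightarrow> y"
proof -
 define Y where "Y = norm y powr p"
 have Y0: "Y \<ge> 0" by (simp add: Y_def)
 have "(%n. norm (X n - y) powr p) \<longlonglongrightarrow> 0"
 proof (rule LIMSEQ_I)
  fix h :: real assume h: "h > 0"
  define b where "b = (2::real) powr p"
  have b: "b > 0" by (simp add: b_def)
  \<comment> \<open>The first bound makes e 2^p at most 1/2, so that term is absorbed on the left;
    the second keeps the contribution of |y|^p at most h/4.\<close>
  define e where "e = min (1 / (2 * b)) (h / (4 * ((b + 1) * (Y + 1))))"
  have e: "e > 0" using b h Y0 by (simp add: e_def)
  have e1: "e * b <= 1 / 2"
  proof -
   have "e * b <= 1 / (2 * b) * b" using b by (intro mult_right_mono) (auto simp: e_def)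
   then show ?thesis using b by simp
  qed
  have e2: "e * ((b + 1) * Y) <= h / 4"
  proof -
   have "e * ((b + 1) * Y) <= e * ((b + 1) * (Y + 1))" using e b by (intro mult_left_mono) auto
   also have "... <= h / (4 * ((b + 1) * (Y + 1))) * ((b + 1) * (Y + 1))"
    using b Y0 by (intro mult_right_mono) (auto simp: e_def)
   also have "... = h / 4" using b Y0 by simp
   finally show ?thesis .
  qed
  obtain C where C: "C \<ge> 0" "!!x y. norm (x - y) powr p <= e * (norm x powr p + norm y powr p) + C * ((a x - a y) \<bullet> (x - y))"
   using a_modulus[OF e] by blast
  have "(%n. C * ((a (X n) - a y) \<bullet> (X n - y))) \<longlonglongrightarrow> C * 0" by (intro tendsto_mult tendsto_const assms)
  then have "\<forall>\<^sub>F n in sequentially. C * ((a (X n) - a y) \<bullet> (X n - y)) < h / 4" using h by (intro order_tendstoD(2)) auto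
  then obtain N where N: "!!n. n \<ge> N ==> C * ((a (X n) - a y) \<bullet> (X n - y)) < h / 4" by (auto simp: eventually_sequentially)
  have "norm (norm (X n - y) powr p - 0) < h" if "n \<ge> N" for n
  proof -
   define d where "d = norm (X n - y) powr p"
   have "norm (X n) powr p <= (norm (X n - y) + norm y) powr p"
    using norm_triangle_ineq[of "X n - y" y] p_pos by (intro powr_mono2) auto
   also have "... <= b * (d + Y)" unfolding b_def d_def Y_def by (rule powr_add_le) (use p_pos in auto)
   finally have "e * (norm (X n) powr p + Y) <= e * (b * (d + Y) + Y)" using e by (intro mult_left_mono add_right_mono) auto
   also have "... = (e * b) * d + e * ((b + 1) * Y)" by (simp add: algebra_simps)
   also have "... <= 1 / 2 * d + h / 4" using e1 e2 by (intro add_mono mult_right_mono) (auto simp: d_def)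
   finally have "d <= 1 / 2 * d + h / 4 + C * ((a (X n) - a y) \<bullet> (X n - y))" using C(2)[of "X n" y] unfolding d_def Y_def by linarith
   then have "d < h" using N[OF that] by (simp add: field_simps)
   then show ?thesis by (simp add: d_def)
  qed
  then show "\<exists>N. \<forall>n\<ge>N. norm (norm (X n - y) powr p - 0) < h" by blast
 qed
 then have "(%n. (norm (X n - y) powr p) powr (1 / p)) \<longlonglongrightarrow> 0 powr (1 / p)"
  using p_pos by (intro tendsto_powr' tendsto_const) auto
 moreover have "(norm (X n - y) powr p) powr (1 / p) = norm (X n - y)" for n using p_pos by (simp add: powr_powr)
 ultimately have "(%n. norm (X n - y)) \<longlonglongrightarrow> 0" using p_pos by simp
 then have "(%n. X n - y) \<longlonglongrightarrow> 0" by (rule tendsto_norm_zero_cancel)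
 then show ?thesis by (rule LIM_zero_cancel)
qed

definition bdd_fun :: "(real^'n => real) => bool" where
 "bdd_fun \<phi> \<longleftrightarrow> (\<exists>B. AE x in M. \<bar>\<phi> x\<bar> <= B)"

text \<open>Boccardo--Murat: testing with a multiple of \<open>arctan\<close> of the difference of height \<open>e\<close>
 only uses an \<open>L\<^sup>1\<close> bound of the right-hand sides.\<close>

lemma gradients_converge:
 assumes W: "!!n. W0 (u n) (D n)" and R: "!!n. nrm (D n) <= R"
  and v: "integrable M v" and l: "(%n. LINT x|M. \<bar>u n x - v x\<bar>) \<longlonglongrightarrow> 0"
  and h: "!!n. integrable M (h n)" "!!n. (LINT x|M. \<bar>h n x\<bar>) <= H"
  and eq: "!!n \<phi> F. W0 \<phi> F ==> bdd_fun \<phi> ==> (LINT x|M. a (D n x) \<bullet> F x) = (LINT x|M. h n x * \<phi> x)"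
 shows "\<exists>(r :: nat => nat) E. strict_mono r \<and> W0 v E \<and> (AE x in M. (%n. D (r n) x) \<longlonglongrightarrow> E x)"
proof -
 obtain E where E: "W0 v E" using weak_convergence[where u=u and D=D, OF W R v l] by blast
 define g where "g e s = e * arctan (s / e)" for e s :: real
 define g' where "g' e s = 1 / (1 + (s / e)\<^sup>2)" for e s :: real
 have der: "(g e has_real_derivative g' e s) (at s)" if "e > 0" for e s
  unfolding g_def g'_def using that by (auto intro!: derivative_eq_intros simp: divide_inverse)
 have cont: "continuous_on UNIV (g' e)" if "e > 0" for e
 proof -
  have "1 + (s / e)\<^sup>2 \<noteq> 0" for s using one_plus_square_pos[of "s / e"] by linarith
  then show ?thesis unfolding g'_def using that by (intro continuous_intros) auto
 qed
 have g'1: "\<bar>g' e s\<bar> <= 1" "0 <= g' e s" for e s using inverse_one_plus_square[of "s / e"] by (simp_all add: g'_def)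
 have g0: "g e 0 = 0" for e by (simp add: g_def)
 have gpi: "\<bar>g e s\<bar> <= e * (pi / 2)" if "e > 0" for e s
  using arctan_lbound[of "s / e"] arctan_ubound[of "s / e"] that by (simp add: g_def abs_mult)
 have gs: "\<bar>g e s\<bar> <= \<bar>s\<bar>" if "e > 0" for e s
  using field_differentiable_bound[of UNIV "g e" "g' e" 1 s 0] der[OF that] g'1(1)[of e] g0 by simp
 have um: "(%x. u n x - v x) \<in> borel_measurable M" for n
  by (intro borel_measurable_diff W0_measurable(1)[OF W] borel_measurable_integrable[OF v])
 define Dl where "Dl n x = (a (D n x) - a (E x)) \<bullet> (D n x - E x)" for n x
 have Dl0: "0 <= Dl n x" for n x unfolding Dl_def by (rule a_mono_nonneg)
 define q where "q e n = (LINT x|M. g' e (u n x - v x) * Dl n x)" for e n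
 have qint: "integrable M (%x. g' e (u n x - v x) * Dl n x)" if "e > 0" for e n
 proof -
  have i: "integrable M (%x. Dl n x)"
  proof -
   have "integrable M (%x. a (D n x) \<bullet> (D n x - E x) - a (E x) \<bullet> (D n x - E x))"
    by (intro integrable_diff a_integrable Lp_diff(1) W0_Lp(2)[OF W] W0_Lp(2)[OF E])
   then show ?thesis by (simp only: Dl_def inner_diff_left)
  qed
  have "AE x in M. \<bar>g' e (u n x - v x)\<bar> <= 1" using g'1 by simp
  then show ?thesis
   by (rule bounded_mult_integrable(1)[OF continuous_compose_measurable[OF cont[OF that] um] _ i])
 qed
 \<comment> \<open>The part paired with a(E) tends to zero because the truncated differences
   converge weakly to zero. The part paired with a(D n) is at most e (pi/2) H by the equation, since
   arctan is bounded by pi/2.\<close>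
 have evq: "\<forall>\<^sub>F n in sequentially. q e n < e * (pi / 2) * H + e" if e: "e > 0" for e
 proof -
  have Z: "W0 (%x. g e (u n x - v x)) (%x. g' e (u n x - v x) *\<^sub>R (D n x - E x))" for n
   by (rule W0_chain[OF W0_diff[OF W E] der[OF e] cont[OF e] g'1(1) g0])
  have ZR: "nrm (%x. g' e (u n x - v x) *\<^sub>R (D n x - E x)) <= 1 powr p * (2 powr p * (R + nrm E))" for n
  proof -
   have m: "(%x. g' e (u n x - v x) *\<^sub>R (D n x - E x)) \<in> borel_measurable M" by (rule W0_measurable(2)[OF Z])
   have le: "AE x in M. norm (g' e (u n x - v x) *\<^sub>R (D n x - E x)) <= 1 * norm (D n x - E x)"
    using g'1(1) by (intro AE_I2) (simp add: mult_left_le_one_le)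
   have "nrm (%x. g' e (u n x - v x) *\<^sub>R (D n x - E x)) <= 1 powr p * nrm (%x. D n x - E x)"
    by (rule Lp_dominated(2)[OF m Lp_diff(1)[OF W0_Lp(2)[OF W] W0_Lp(2)[OF E]] le]) simp
   also have "... <= 1 powr p * (2 powr p * (nrm (D n) + nrm E))"
    by (intro mult_left_mono Lp_diff(2) W0_Lp(2)[OF W] W0_Lp(2)[OF E]) simp
   also have "... <= 1 powr p * (2 powr p * (R + nrm E))"
    using R[of n] by (intro mult_left_mono add_right_mono) auto
   finally show ?thesis .
  qed
  have Zl: "(%n. LINT x|M. \<bar>g e (u n x - v x) - 0\<bar>) \<longlonglongrightarrow> 0"
  proof (rule tendsto_sandwich[OF _ _ tendsto_const l]; rule always_eventually; rule allI)
   fix n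
   show "0 <= (LINT x|M. \<bar>g e (u n x - v x) - 0\<bar>)" by (rule integral_nonneg_AE) simp
   show "(LINT x|M. \<bar>g e (u n x - v x) - 0\<bar>) <= (LINT x|M. \<bar>u n x - v x\<bar>)"
    using W0_int(1)[OF Z[of n]] W0_int(1)[OF W[of n]] v gs[OF e] by (intro integral_mono) auto
  qed
  obtain Z0 where Z0: "W0 (%x. 0) Z0"
   "\<forall>F\<in>Lp p \<Omega>. (%n. LINT x|M. a (F x) \<bullet> (g' e (u n x - v x) *\<^sub>R (D n x - E x))) \<longlonglongrightarrow> (LINT x|M. a (F x) \<bullet> Z0 x)"
   using weak_convergence[where u="%n x. g e (u n x - v x)" and v="%x. 0", OF Z ZR _ Zl] by auto
  have "(LINT x|M. a (E x) \<bullet> Z0 x) = (LINT x|M. 0)"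
  proof (rule integral_cong_AE)
   show "AE x in M. a (E x) \<bullet> Z0 x = 0" using W0_unique[OF Z0(1) W0_zero] by eventually_elim simp
  qed (simp_all add: borel_measurable_integrable[OF a_integrable[OF W0_Lp(2)[OF E] W0_Lp(2)[OF Z0(1)]]])
  then have "(%n. LINT x|M. a (E x) \<bullet> (g' e (u n x - v x) *\<^sub>R (D n x - E x))) \<longlonglongrightarrow> 0"
   using bspec[OF Z0(2) W0_Lp(2)[OF E]] by simp
  then have "\<forall>\<^sub>F n in sequentially. - e < (LINT x|M. a (E x) \<bullet> (g' e (u n x - v x) *\<^sub>R (D n x - E x)))"
   using e by (intro order_tendstoD(1)) auto
  then show ?thesis
  proof (rule eventually_mono)
   fix n assume n: "- e < (LINT x|M. a (E x) \<bullet> (g' e (u n x - v x) *\<^sub>R (D n x - E x)))"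
   have zb: "AE x in M. \<bar>g e (u n x - v x)\<bar> <= e * (pi / 2)" using gpi[OF e] by simp
   then have bd: "bdd_fun (%x. g e (u n x - v x))" unfolding bdd_fun_def by blast
   have "q e n = (LINT x|M. a (D n x) \<bullet> (g' e (u n x - v x) *\<^sub>R (D n x - E x)) - a (E x) \<bullet> (g' e (u n x - v x) *\<^sub>R (D n x - E x)))"
    unfolding q_def Dl_def by (intro integral_cong refl) (simp add: inner_diff_left algebra_simps)
   also have "... = (LINT x|M. a (D n x) \<bullet> (g' e (u n x - v x) *\<^sub>R (D n x - E x))) - (LINT x|M. a (E x) \<bullet> (g' e (u n x - v x) *\<^sub>R (D n x - E x)))"
    by (intro integral_diff a_integrable W0_Lp(2)[OF W] W0_Lp(2)[OF E] W0_Lp(2)[OF Z])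
   also have "(LINT x|M. a (D n x) \<bullet> (g' e (u n x - v x) *\<^sub>R (D n x - E x))) = (LINT x|M. g e (u n x - v x) * h n x)"
    unfolding eq[OF Z bd] by (intro integral_cong refl) simp
   also have "... <= e * (pi / 2) * (LINT x|M. \<bar>h n x\<bar>)"
    using bounded_mult_integrable(2)[OF W0_measurable(1)[OF Z] zb h(1)[of n]] by linarith
   also have "... <= e * (pi / 2) * H" using h(2)[of n] e by (intro mult_left_mono) auto
   finally show "q e n < e * (pi / 2) * H + e" using n by linarith
  qed
 qed
 \<comment> \<open>The height e tends to zero along the subsequence while the L^1 distance is kept
   below e^2. Then (u - v)/e tends to zero in L^1, and the weight 1 / (1 + ((u - v)/e)^2) no longer
   hides the monotonicity term.\<close>
 define ee where "ee j = inverse (real (Suc j))" for j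
 have ee: "ee j > 0" for j by (simp add: ee_def)
 have "\<forall>\<^sub>F n in sequentially. q (ee j) n < ee j * (pi / 2) * H + ee j \<and> (LINT x|M. \<bar>u n x - v x\<bar>) < ee j * ee j" for j
  by (rule eventually_conj[OF evq[OF ee] order_tendstoD(2)[OF l]]) (use ee[of j] in simp)
 then obtain r :: "nat => nat" where r: "strict_mono r"
  and r1: "\<forall>j. q (ee j) (r j) < ee j * (pi / 2) * H + ee j \<and> (LINT x|M. \<bar>u (r j) x - v x\<bar>) < ee j * ee j"
  using subseq_of_eventually[of "%j n. q (ee j) n < ee j * (pi / 2) * H + ee j \<and> (LINT x|M. \<bar>u n x - v x\<bar>) < ee j * ee j"] by blast
 define Y where "Y j x = g' (ee j) (u (r j) x - v x) * Dl (r j) x" for j x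
 define V where "V j x = (u (r j) x - v x) / ee j" for j x
 have ee0: "ee \<longlonglongrightarrow> 0" unfolding ee_def by (rule LIMSEQ_inverse_real_of_nat)
 have Yi: "integrable M (Y j)" for j unfolding Y_def by (rule qint[OF ee])
 have Vi: "integrable M (V j)" for j unfolding V_def using W0_int(1)[OF W[of "r j"]] v by auto
 have Y0: "(%j. LINT x|M. norm (Y j x)) \<longlonglongrightarrow> 0"
 proof (rule tendsto_sandwich[OF _ _ tendsto_const])
  have "(%j. ee j * (pi / 2) * H + ee j) \<longlonglongrightarrow> 0 * (pi / 2) * H + 0"
   by (intro tendsto_add tendsto_mult tendsto_const ee0)
  then show "(%j. ee j * (pi / 2) * H + ee j) \<longlonglongrightarrow> 0" by simp
  have "norm (Y j x) = g' (ee j) (u (r j) x - v x) * Dl (r j) x" for j x unfolding Y_def using g'1(2) Dl0 by simp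
  then have "(LINT x|M. norm (Y j x)) = q (ee j) (r j)" for j unfolding q_def by simp
  then have "(LINT x|M. norm (Y j x)) <= ee j * (pi / 2) * H + ee j" for j using r1 by (simp add: less_imp_le)
  then show "\<forall>\<^sub>F j in sequentially. (LINT x|M. norm (Y j x)) <= ee j * (pi / 2) * H + ee j" by (simp only: eventually_True)
  show "\<forall>\<^sub>F j in sequentially. 0 <= (LINT x|M. norm (Y j x))" by (intro always_eventually allI integral_nonneg_AE) simp
 qed
 have V0: "(%j. LINT x|M. norm (V j x)) \<longlonglongrightarrow> 0"
 proof (rule tendsto_sandwich[OF _ _ tendsto_const ee0])
  have "(LINT x|M. norm (V j x)) <= ee j" for j
  proof -
   have "(LINT x|M. norm (V j x)) = (LINT x|M. \<bar>u (r j) x - v x\<bar>) / ee j"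
    unfolding V_def using ee[of j] by simp
   also have "... <= ee j * ee j / ee j" using r1 ee[of j] by (intro divide_right_mono) (auto simp: less_imp_le)
   finally show ?thesis using ee[of j] by simp
  qed
  then show "\<forall>\<^sub>F j in sequentially. (LINT x|M. norm (V j x)) <= ee j" by (simp only: eventually_True)
  show "\<forall>\<^sub>F j in sequentially. 0 <= (LINT x|M. norm (V j x))" by (intro always_eventually allI integral_nonneg_AE) simp
 qed
 obtain t1 :: "nat => nat" where t1: "strict_mono t1" "AE x in M. (%n. Y (t1 n) x) \<longlonglongrightarrow> 0"
  using tendsto_L1_AE_subseq[of M Y, OF Yi Y0] by blast
 have V1: "(%n. LINT x|M. norm (V (t1 n) x)) \<longlonglongrightarrow> 0" using LIMSEQ_subseq_LIMSEQ[OF V0 t1(1)] by (simp add: o_def)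
 obtain t2 :: "nat => nat" where t2: "strict_mono t2" "AE x in M. (%n. V (t1 (t2 n)) x) \<longlonglongrightarrow> 0"
  using tendsto_L1_AE_subseq[of M "%n. V (t1 n)", OF Vi V1] by blast
 have "AE x in M. (%n. D (r (t1 (t2 n))) x) \<longlonglongrightarrow> E x"
  using t1(2) t2(2)
 proof eventually_elim
  case (elim x)
  have y: "(%n. Y (t1 (t2 n)) x) \<longlonglongrightarrow> 0" using LIMSEQ_subseq_LIMSEQ[OF elim(1) t2(1)] by (simp add: o_def)
  have "(%n. Y (t1 (t2 n)) x * (1 + (V (t1 (t2 n)) x)\<^sup>2)) \<longlonglongrightarrow> 0 * (1 + 0\<^sup>2)"
   by (intro tendsto_mult tendsto_add tendsto_power tendsto_const y elim(2))
  moreover have "Y j x * (1 + (V j x)\<^sup>2) = Dl (r j) x" for j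
   using one_plus_square_pos[of "V j x"] unfolding Y_def g'_def V_def by (simp add: field_simps)
  ultimately have "(%n. Dl (r (t1 (t2 n))) x) \<longlonglongrightarrow> 0" by simp
  then show ?case unfolding Dl_def by (rule a_pointwise)
 qed
 moreover have "strict_mono (%n. r (t1 (t2 n)))" using r t1(1) t2(1) by (simp add: strict_mono_def)
 ultimately show ?thesis using E by blast
qed

end

section \<open>Exponentially weighted test functions and the limit equation\<close>

context leray_lions
begin

text \<open>The chain rule wants a function vanishing at 0, so \<open>g\<close> is split into g - g
  0 and the constant g 0. The factor \<open>\<phi>\<close> supplies the zero boundary values for the
  constant part.\<close>

lemma W0_mult_compose:
 fixes g g' :: "real => real"
 assumes \<phi>: "W0 \<phi> F" and B: "AE x in M. \<bar>\<phi> x\<bar> <= B" and w: "W0 w D"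
  and der: "!!s. (g has_real_derivative g' s) (at s)" and cont: "continuous_on UNIV g'"
  and L: "!!s. \<bar>g' s\<bar> <= L" and N: "!!s. \<bar>g s\<bar> <= N"
 shows "W0 (%x. \<phi> x * g (w x)) (%x. g (w x) *\<^sub>R F x + (\<phi> x * g' (w x)) *\<^sub>R D x)"
  "AE x in M. \<bar>\<phi> x * g (w x)\<bar> <= B * N"
proof -
 have d: "((%s. g s - g 0) has_real_derivative g' s) (at s)" for s
  using DERIV_diff[OF der[of s] DERIV_const[of "g 0"]] by simp
 have w': "W0 (%x. g (w x) - g 0) (%x. g' (w x) *\<^sub>R D x)"
  by (rule W0_chain[OF w d cont L]) simp
 have b1: "AE x in M. \<bar>\<phi> x\<bar> <= max B (2 * N)" using B by eventually_elim simp
 have "\<bar>g (w x) - g 0\<bar> <= max B (2 * N)" for x using N[of "w x"] N[of 0] by linarith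
 then have b2: "AE x in M. \<bar>g (w x) - g 0\<bar> <= max B (2 * N)" by simp
 have "W0 (%x. \<phi> x * (g (w x) - g 0) + g 0 * \<phi> x)
   (%x. (\<phi> x *\<^sub>R (g' (w x) *\<^sub>R D x) + (g (w x) - g 0) *\<^sub>R F x) + g 0 *\<^sub>R F x)"
  by (rule W0_add[OF W0_mult_bounded[OF \<phi> w' b1 b2] W0_scale[OF \<phi>]])
 moreover have "(%x. \<phi> x * (g (w x) - g 0) + g 0 * \<phi> x) = (%x. \<phi> x * g (w x))"
  by (simp add: algebra_simps)
 moreover have "(%x. (\<phi> x *\<^sub>R (g' (w x) *\<^sub>R D x) + (g (w x) - g 0) *\<^sub>R F x) + g 0 *\<^sub>R F x)
   = (%x. g (w x) *\<^sub>R F x + (\<phi> x * g' (w x)) *\<^sub>R D x)"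
  by (simp add: scaleR_diff_left fun_eq_iff)
 ultimately show "W0 (%x. \<phi> x * g (w x)) (%x. g (w x) *\<^sub>R F x + (\<phi> x * g' (w x)) *\<^sub>R D x)" by simp
 show "AE x in M. \<bar>\<phi> x * g (w x)\<bar> <= B * N"
  using B
 proof eventually_elim
  case (elim x)
  then have "\<bar>\<phi> x\<bar> * \<bar>g (w x)\<bar> <= B * N" using N[of "w x"] by (intro mult_mono) auto
  then show ?case by (simp add: abs_mult)
 qed
qed

text \<open>Paired with a fixed F, the flux is at most an arbitrarily small multiple of |D n|^p,
  whose integrals are bounded, plus a fixed integrable function. This is the equi-integrability
  asked for by \<open>tendsto_integral_Vitali\<close>.\<close>

lemma flux_tendsto:
 assumes D: "!!n. D n \<in> Lp p \<Omega>" "!!n. nrm (D n) <= R" and E: "E \<in> Lp p \<Omega>" and F: "F \<in> Lp p \<Omega>"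
  and DE: "AE x in M. (%n. D n x) \<longlonglongrightarrow> E x"
  and G: "!!n. G n \<in> borel_measurable M" "G0 \<in> borel_measurable M" "!!n x. \<bar>G n x\<bar> <= L" "!!x. \<bar>G0 x\<bar> <= L" "L > 0"
  and GG: "AE x in M. (%n. G n x) \<longlonglongrightarrow> G0 x"
 shows "(%n. LINT x|M. G n x * (a (D n x) \<bullet> F x)) \<longlonglongrightarrow> (LINT x|M. G0 x * (a (E x) \<bullet> F x))"
proof -
 note iD = a_integrable[OF D(1) F] and iE = a_integrable[OF E F]
 have i1: "integrable M (%x. G n x * (a (D n x) \<bullet> F x))" for n
  by (rule bounded_mult_integrable(1)[OF G(1) _ iD, where G=L]) (use G(3) in simp)
 have i2: "integrable M (%x. G0 x * (a (E x) \<bullet> F x))"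
  by (rule bounded_mult_integrable(1)[OF G(2) _ iE, where G=L]) (use G(4) in simp)
 define X where "X n x = \<bar>G n x * (a (D n x) \<bullet> F x) - G0 x * (a (E x) \<bullet> F x)\<bar>" for n x
 have Xi: "integrable M (X n)" for n unfolding X_def by (intro integrable_abs integrable_diff i1 i2)
 have Xl: "AE x in M. (%n. X n x) \<longlonglongrightarrow> 0"
  using DE GG
 proof eventually_elim
  case (elim x)
  have "(%n. a (D n x)) \<longlonglongrightarrow> a (E x)"
   using continuous_on_tendsto_compose[OF a_cont elim(1)] by simp
  then have "(%n. \<bar>G n x * (a (D n x) \<bullet> F x) - G0 x * (a (E x) \<bullet> F x)\<bar>) \<longlonglongrightarrow> \<bar>G0 x * (a (E x) \<bullet> F x) - G0 x * (a (E x) \<bullet> F x)\<bar>"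
   by (intro tendsto_rabs tendsto_diff tendsto_mult tendsto_inner tendsto_const elim(2))
  then show ?case by (simp add: X_def)
 qed
 have "(%n. integral\<^sup>L M (X n)) \<longlonglongrightarrow> 0"
 proof (rule tendsto_integral_Vitali(2)[where Y="%n x. norm (D n x) powr p" and C=R])
  show "X n \<in> borel_measurable M" for n by (rule borel_measurable_integrable[OF Xi])
  show "0 <= X n x" for n x by (simp add: X_def)
  show "integrable M (%x. norm (D n x) powr p)" for n by (rule Lp_integrable_powr[OF D(1)])
  show "0 <= norm (D n x) powr p" for n x by simp
  show "(LINT x|M. norm (D n x) powr p) <= R" for n using D(2)[of n] by (simp add: nrm_def)
  show "AE x in M. (%n. X n x) \<longlonglongrightarrow> 0" by (rule Xl)
  fix d :: real assume d: "d > 0"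
  define d' where "d' = d / (L * Ca)"
  have d': "d' > 0" using d G(5) Ca_pos by (simp add: d'_def)
  have dd: "L * (Ca * d') = d" using d G(5) Ca_pos by (simp add: d'_def)
  define H where "H x = L * (Ca * (norm (F x) + d' powr (1 - p) * norm (F x) powr p)) + L * \<bar>a (E x) \<bullet> F x\<bar>" for x
  have "integrable M H" unfolding H_def
   by (intro integrable_add integrable_mult_right integrable_norm integrable_abs Lp_integrable[OF F] Lp_integrable_powr[OF F] iE)
  moreover have "0 <= H x" for x unfolding H_def using G(5) Ca_pos by (intro add_nonneg_nonneg mult_nonneg_nonneg) auto
  moreover have "X n x <= d * norm (D n x) powr p + H x" for n x
  proof -
   have "X n x <= \<bar>G n x\<bar> * \<bar>a (D n x) \<bullet> F x\<bar> + \<bar>G0 x\<bar> * \<bar>a (E x) \<bullet> F x\<bar>"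
    unfolding X_def abs_mult[symmetric] by (rule abs_triangle_ineq4)
   also have "... <= L * (Ca * (norm (F x) + d' * norm (D n x) powr p + d' powr (1 - p) * norm (F x) powr p)) + L * \<bar>a (E x) \<bullet> F x\<bar>"
    using G(3)[of n x] G(4)[of x] G(5) a_inner_bound[OF d', of "D n x" "F x"] by (intro add_mono mult_mono) auto
   also have "... = (L * (Ca * d')) * norm (D n x) powr p + H x" by (simp add: H_def algebra_simps)
   finally show ?thesis by (simp only: dd)
  qed
  ultimately show "\<exists>G. integrable M G \<and> (\<forall>x. 0 <= G x) \<and> (\<forall>n. AE x in M. X n x <= d * norm (D n x) powr p + G x)"
   by (intro exI[of _ H]) simp
 qed
 moreover have "norm ((LINT x|M. G n x * (a (D n x) \<bullet> F x)) - (LINT x|M. G0 x * (a (E x) \<bullet> F x))) <= integral\<^sup>L M (X n)" for n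
 proof -
  have "\<bar>LINT x|M. G n x * (a (D n x) \<bullet> F x) - G0 x * (a (E x) \<bullet> F x)\<bar> <= integral\<^sup>L M (X n)"
   unfolding X_def[abs_def] by (rule integral_abs_bound)
  then show ?thesis using integral_diff[OF i1[of n] i2] by simp
 qed
 ultimately have "(%n. (LINT x|M. G n x * (a (D n x) \<bullet> F x)) - (LINT x|M. G0 x * (a (E x) \<bullet> F x))) \<longlonglongrightarrow> 0"
  by (rule Lim_null_comparison[OF always_eventually[OF allI], rotated])
 then show ?thesis by (rule LIM_zero_cancel)
qed

lemma product_tendsto:
 fixes g :: "nat => real^'n => real"
 assumes g: "!!n. integrable M (g n)" "integrable M g0" "(%n. LINT x|M. \<bar>g n x - g0 x\<bar>) \<longlonglongrightarrow> 0"
  and \<psi>: "!!n. \<psi> n \<in> borel_measurable M" "\<psi>0 \<in> borel_measurable M" "!!n. AE x in M. \<bar>\<psi> n x\<bar> <= B"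
  and l: "AE x in M. (%n. \<psi> n x) \<longlonglongrightarrow> \<psi>0 x"
 shows "(%n. LINT x|M. g n x * \<psi> n x) \<longlonglongrightarrow> (LINT x|M. g0 x * \<psi>0 x)"
proof -
 note m = borel_measurable_integrable[OF g(1)] borel_measurable_integrable[OF g(2)]
 have "(%n. LINT x|M. g0 x * \<psi> n x) \<longlonglongrightarrow> (LINT x|M. g0 x * \<psi>0 x)"
 proof (rule integral_dominated_convergence[where w="%x. B * \<bar>g0 x\<bar>"])
  show "integrable M (%x. B * \<bar>g0 x\<bar>)" by (intro integrable_mult_right integrable_abs g)
  show "AE x in M. (%n. g0 x * \<psi> n x) \<longlonglongrightarrow> g0 x * \<psi>0 x"
   using l by eventually_elim (intro tendsto_mult tendsto_const)
  show "AE x in M. norm (g0 x * \<psi> n x) <= B * \<bar>g0 x\<bar>" for n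
   using \<psi>(3)[of n]
  proof eventually_elim
   case (elim x)
   from mult_right_mono[OF elim abs_ge_zero[of "g0 x"]] show ?case by (simp add: abs_mult mult.commute)
  qed
 qed (intro borel_measurable_times m \<psi>)+
 moreover have "(%n. (LINT x|M. \<psi> n x * (g n x - g0 x))) \<longlonglongrightarrow> 0"
 proof (rule Lim_null_comparison[OF always_eventually])
  show "\<forall>n. norm (LINT x|M. \<psi> n x * (g n x - g0 x)) <= B * (LINT x|M. \<bar>g n x - g0 x\<bar>)"
   using bounded_mult_integrable(2)[OF \<psi>(1) \<psi>(3) integrable_diff[OF g(1,2)]] by simp
  show "(%n. B * (LINT x|M. \<bar>g n x - g0 x\<bar>)) \<longlonglongrightarrow> 0" using tendsto_mult[OF tendsto_const[of B] g(3)] by simp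
 qed
 ultimately have "(%n. (LINT x|M. g0 x * \<psi> n x) + (LINT x|M. \<psi> n x * (g n x - g0 x))) \<longlonglongrightarrow> (LINT x|M. g0 x * \<psi>0 x) + 0"
  by (rule tendsto_add)
 moreover have "(LINT x|M. g0 x * \<psi> n x) + (LINT x|M. \<psi> n x * (g n x - g0 x)) = (LINT x|M. g n x * \<psi> n x)" for n
 proof -
  have "integrable M (%x. g0 x * \<psi> n x)"
   using bounded_mult_integrable(1)[OF \<psi>(1) \<psi>(3) g(2), of n] by (simp add: mult.commute)
  moreover have "integrable M (%x. \<psi> n x * (g n x - g0 x))"
   by (rule bounded_mult_integrable(1)[OF \<psi>(1) \<psi>(3) integrable_diff[OF g(1,2)]])
  ultimately have "(LINT x|M. g0 x * \<psi> n x) + (LINT x|M. \<psi> n x * (g n x - g0 x)) = (LINT x|M. g0 x * \<psi> n x + \<psi> n x * (g n x - g0 x))"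
   by (rule integral_add[symmetric])
  also have "... = (LINT x|M. g n x * \<psi> n x)"
   by (intro integral_cong refl) (simp add: algebra_simps)
  finally show ?thesis .
 qed
 ultimately show ?thesis by simp
qed

lemma a_inner_self_integral:
 assumes "D \<in> Lp p \<Omega>" "nrm D <= R"
 shows "(LINT x|M. a (D x) \<bullet> D x) <= Ca * (measure M (space M) + 3 * R)"
proof -
 have le: "a y \<bullet> y <= Ca * (1 + 3 * norm y powr p)" for y :: "real^'n"
 proof -
  have "norm y <= 1 + norm y powr p"
  proof (cases "norm y <= 1")
   case False
   then have "norm y powr 1 <= norm y powr p" using p_gt_1 by (intro powr_mono) auto
   then show ?thesis using False by simp
  qed (simp add: add_increasing2)
  then have "Ca * (norm y + 1 * norm y powr p + 1 powr (1 - p) * norm y powr p) <= Ca * (1 + 3 * norm y powr p)"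
   using Ca_pos by (intro mult_left_mono) auto
  then show ?thesis using a_inner_bound[of 1 y y] by simp
 qed
 have i: "integrable M (%x. norm (D x) powr p)" by (rule Lp_integrable_powr[OF assms(1)])
 have c: "integrable M (%x. 1::real)" by (rule fin.integrable_const)
 have "(LINT x|M. a (D x) \<bullet> D x) <= (LINT x|M. Ca * (1 + 3 * norm (D x) powr p))"
  using le by (intro integral_mono a_integrable assms integrable_add integrable_mult_right i c) auto
 also have "... = Ca * (measure M (space M) + 3 * nrm D)"
  using integral_add[OF c integrable_mult_right[OF i, of 3]] by (simp add: nrm_def)
 also have "... <= Ca * (measure M (space M) + 3 * R)" using assms(2) Ca_pos by (intro mult_left_mono) auto
 finally show ?thesis .
qed

text \<open>The lower-order term is only controlled by the energy density, which need not converge in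
 \<open>L\<^sup>1\<close>. One inequality is Fatou's lemma; for the other, the test function is multiplied by
 \<open>bump_exp (2 * C) (u n)\<close>, whose derivative makes the sum of both nonlinear terms nonpositive,
 and afterwards by \<open>lift_exp (2 * C) k v\<close> to remove the weight again.\<close>

lemma limit_equation:
 assumes W: "!!n. W0 (u n) (D n)" and R: "!!n. nrm (D n) <= R" and E: "W0 v E"
  and DE: "AE x in M. (%n. D n x) \<longlonglongrightarrow> E x" and uv: "AE x in M. (%n. u n x) \<longlonglongrightarrow> v x"
  and u0: "!!n. AE x in M. 0 <= u n x"
  and bm: "!!n. b n \<in> borel_measurable M" and b0m: "b0 \<in> borel_measurable M"
  and C: "C \<ge> 0" and bb: "!!n. AE x in M. 0 <= b n x \<and> b n x <= C * (a (D n x) \<bullet> D n x)"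
  and bl: "AE x in M. (%n. b n x) \<longlonglongrightarrow> b0 x"
  and g: "!!n. integrable M (g n)" "integrable M g0" "(%n. LINT x|M. \<bar>g n x - g0 x\<bar>) \<longlonglongrightarrow> 0"
  and eq: "!!n \<phi> F. W0 \<phi> F ==> bdd_fun \<phi> ==> (LINT x|M. a (D n x) \<bullet> F x) + (LINT x|M. b n x * \<phi> x) = (LINT x|M. g n x * \<phi> x)"
 shows "integrable M b0"
  and "W0 \<phi> F ==> bdd_fun \<phi> ==> (LINT x|M. a (E x) \<bullet> F x) + (LINT x|M. b0 x * \<phi> x) = (LINT x|M. g0 x * \<phi> x)"
proof -
 note DL = W0_Lp(2)[OF W] and EL = W0_Lp(2)[OF E]
 note DD = a_integrable[OF DL DL] and EE = a_integrable[OF EL EL]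
 have bi: "integrable M (b n)" for n
 proof (rule integrable_bound[OF integrable_mult_right[OF DD, of C] bm])
  show "AE x in M. norm (b n x) <= norm (C * (a (D n x) \<bullet> D n x))" using bb[of n] by eventually_elim simp
 qed
 have b0: "AE x in M. 0 <= b n x" for n using bb[of n] by eventually_elim simp
 have bI: "(LINT x|M. b n x) <= C * (Ca * (measure M (space M) + 3 * R))" for n
 proof -
  have "(LINT x|M. b n x) <= (LINT x|M. C * (a (D n x) \<bullet> D n x))"
   using bb[of n] by (intro integral_mono_AE bi integrable_mult_right DD) auto
  also have "... <= C * (Ca * (measure M (space M) + 3 * R))"
   using a_inner_self_integral[OF DL R] C by (simp add: mult_left_mono)
  finally show ?thesis .
 qed
 show b0i: "integrable M b0" by (rule integrable_Fatou(1)[of M b, OF bi b0 bI b0m bl])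
 \<comment> \<open>For nonnegative phi the products b n phi are nonnegative and their integrals
   converge by the equation, so Fatou bounds the integral of the limit from above.\<close>
 have upper: "(LINT x|M. b0 x * \<phi> x) <= (LINT x|M. g0 x * \<phi> x) - (LINT x|M. a (E x) \<bullet> F x)"
  if \<phi>: "W0 \<phi> F" and B: "AE x in M. \<bar>\<phi> x\<bar> <= B" and p0: "AE x in M. 0 <= \<phi> x" for \<phi> F B
 proof (rule integral_Fatou_limit[where X="%n x. b n x * \<phi> x"])
  note \<phi>m = W0_measurable(1)[OF \<phi>]
  have bd: "bdd_fun \<phi>" using B unfolding bdd_fun_def by blast
  show "integrable M (%x. b n x * \<phi> x)" for n
   using bounded_mult_integrable(1)[OF \<phi>m B bi] by (simp add: mult.commute)
  show "AE x in M. 0 <= b n x * \<phi> x" for n using b0[of n] p0 by eventually_elim simp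
  show "(%x. b0 x * \<phi> x) \<in> borel_measurable M" by (intro borel_measurable_times b0m \<phi>m)
  show "AE x in M. (%n. b n x * \<phi> x) \<longlonglongrightarrow> b0 x * \<phi> x" using bl by eventually_elim (intro tendsto_mult tendsto_const)
  have "(%n. LINT x|M. 1 * (a (D n x) \<bullet> F x)) \<longlonglongrightarrow> (LINT x|M. 1 * (a (E x) \<bullet> F x))"
   by (rule flux_tendsto[OF DL R EL W0_Lp(2)[OF \<phi>] DE, where L=1]) simp_all
  moreover have "(%n. LINT x|M. g n x * \<phi> x) \<longlonglongrightarrow> (LINT x|M. g0 x * \<phi> x)"
   by (rule product_tendsto[OF g \<phi>m \<phi>m B]) simp
  ultimately have "(%n. (LINT x|M. g n x * \<phi> x) - (LINT x|M. a (D n x) \<bullet> F x)) \<longlonglongrightarrow> (LINT x|M. g0 x * \<phi> x) - (LINT x|M. a (E x) \<bullet> F x)"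
   by (simp add: tendsto_diff)
  moreover have "(LINT x|M. b n x * \<phi> x) = (LINT x|M. g n x * \<phi> x) - (LINT x|M. a (D n x) \<bullet> F x)" for n
   using eq[OF \<phi> bd, of n] by linarith
  ultimately show "(%n. LINT x|M. b n x * \<phi> x) \<longlonglongrightarrow> (LINT x|M. g0 x * \<phi> x) - (LINT x|M. a (E x) \<bullet> F x)" by simp
 qed
 \<comment> \<open>For s >= 0 this makes -bump_exp' at least (l/2) bump_exp = C bump_exp, exactly
   what is needed to dominate b n <= C a(D n) . D n.\<close>
 define l where "l = 2 * C"
 have l: "l \<ge> 0" using C by (simp add: l_def)
 let ?G = "bump_exp l" and ?G' = "bump_exp' l"
 have G1: "\<bar>?G s\<bar> <= 1" for s using bump_exp_bounds[OF l, of s] by simp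
 note G'1 = bump_exp'_bounds(1)[OF l]
 \<comment> \<open>The weight puts both terms of energy growth into one nonnegative integrand, so
   Fatou applies to it and no L^1 convergence of either term has to be known.\<close>
 have weighted: "(LINT x|M. - (b0 x * ?G (v x) + ?G' (v x) * (a (E x) \<bullet> E x)) * \<psi> x) <=
   (LINT x|M. ?G (v x) * (a (E x) \<bullet> P x)) - (LINT x|M. g0 x * (\<psi> x * ?G (v x)))"
  if \<psi>: "W0 \<psi> P" and B: "AE x in M. \<bar>\<psi> x\<bar> <= B" and p0: "AE x in M. 0 <= \<psi> x" for \<psi> P B
 proof (rule integral_Fatou_limit[where X="%n x. - (b n x * ?G (u n x) + ?G' (u n x) * (a (D n x) \<bullet> D n x)) * \<psi> x"])
  note \<psi>m = W0_measurable(1)[OF \<psi>]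
  note um = W0_measurable(1)[OF W] and vm = W0_measurable(1)[OF E]
  note Gm = continuous_compose_measurable[OF bump_exp_continuous(1)] and G'm = continuous_compose_measurable[OF bump_exp_continuous(2)]
  note T = W0_mult_compose[OF \<psi> B W bump_exp_deriv bump_exp_continuous(2) G'1 G1]
  have bd: "bdd_fun (%x. \<psi> x * ?G (u n x))" for n using T(2)[of n] unfolding bdd_fun_def by blast
  have i1: "integrable M (%x. (\<psi> x * ?G (u n x)) * b n x)" for n
   by (rule bounded_mult_integrable(1)[OF W0_measurable(1)[OF T(1)] T(2) bi])
  have i2: "integrable M (%x. \<psi> x * (?G' (u n x) * (a (D n x) \<bullet> D n x)))" for n
   by (rule bounded_mult_integrable(1)[OF \<psi>m B], rule bounded_mult_integrable(1)[OF G'm[OF um] _ DD, where G=l]) (use G'1 in simp)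
  have i3: "integrable M (%x. ?G (u n x) * (a (D n x) \<bullet> P x))" for n
   by (rule bounded_mult_integrable(1)[OF Gm[OF um] _ a_integrable[OF DL W0_Lp(2)[OF \<psi>]], where G=1]) (use G1 in simp)
  have split: "- (b n x * ?G (u n x) + ?G' (u n x) * (a (D n x) \<bullet> D n x)) * \<psi> x
    = - ((\<psi> x * ?G (u n x)) * b n x) - \<psi> x * (?G' (u n x) * (a (D n x) \<bullet> D n x))" for n x
   by (simp add: algebra_simps)
  show "integrable M (%x. - (b n x * ?G (u n x) + ?G' (u n x) * (a (D n x) \<bullet> D n x)) * \<psi> x)" for n
   unfolding split by (intro integrable_diff integrable_minus i1 i2)
  show "AE x in M. 0 <= - (b n x * ?G (u n x) + ?G' (u n x) * (a (D n x) \<bullet> D n x)) * \<psi> x" for n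
   using bb[of n] u0[of n] p0
  proof eventually_elim
   case (elim x)
   have e0: "0 <= a (D n x) \<bullet> D n x" using a_mono_nonneg[of "D n x" 0] by (simp add: a_zero)
   have "b n x * ?G (u n x) <= C * (a (D n x) \<bullet> D n x) * ?G (u n x)"
    using elim(1) bump_exp_bounds(1)[OF l, of "u n x"] by (intro mult_right_mono) auto
   also have "... = (l / 2 * ?G (u n x)) * (a (D n x) \<bullet> D n x)" by (simp add: l_def)
   also have "... <= - ?G' (u n x) * (a (D n x) \<bullet> D n x)"
    using bump_exp'_bounds(2)[OF l elim(2)] e0 by (intro mult_right_mono) auto
   finally have "0 <= - (b n x * ?G (u n x) + ?G' (u n x) * (a (D n x) \<bullet> D n x))" by simp
   then show ?case using elim(3) by (rule mult_nonneg_nonneg)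
  qed
  show "(%x. - (b0 x * ?G (v x) + ?G' (v x) * (a (E x) \<bullet> E x)) * \<psi> x) \<in> borel_measurable M"
   by (intro borel_measurable_times borel_measurable_uminus borel_measurable_add b0m \<psi>m Gm[OF vm] G'm[OF vm] borel_measurable_integrable[OF EE])
  show "AE x in M. (%n. - (b n x * ?G (u n x) + ?G' (u n x) * (a (D n x) \<bullet> D n x)) * \<psi> x) \<longlonglongrightarrow> - (b0 x * ?G (v x) + ?G' (v x) * (a (E x) \<bullet> E x)) * \<psi> x"
   using bl DE uv
  proof eventually_elim
   case (elim x)
   have "(%n. a (D n x)) \<longlonglongrightarrow> a (E x)" using continuous_on_tendsto_compose[OF a_cont elim(2)] by simp
   moreover have "(%n. ?G (u n x)) \<longlonglongrightarrow> ?G (v x)" using continuous_on_tendsto_compose[OF bump_exp_continuous(1) elim(3)] by simp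
   moreover have "(%n. ?G' (u n x)) \<longlonglongrightarrow> ?G' (v x)" using continuous_on_tendsto_compose[OF bump_exp_continuous(2) elim(3)] by simp
   ultimately show ?case by (intro tendsto_mult tendsto_minus tendsto_add tendsto_inner tendsto_const elim)
  qed
  have I: "(LINT x|M. - (b n x * ?G (u n x) + ?G' (u n x) * (a (D n x) \<bullet> D n x)) * \<psi> x)
    = (LINT x|M. ?G (u n x) * (a (D n x) \<bullet> P x)) - (LINT x|M. g n x * (\<psi> x * ?G (u n x)))" for n
  proof -
   have "(LINT x|M. a (D n x) \<bullet> (?G (u n x) *\<^sub>R P x + (\<psi> x * ?G' (u n x)) *\<^sub>R D n x))
     = (LINT x|M. ?G (u n x) * (a (D n x) \<bullet> P x) + \<psi> x * (?G' (u n x) * (a (D n x) \<bullet> D n x)))"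
    by (intro integral_cong refl) (simp add: inner_add_right mult.assoc)
   also have "... = (LINT x|M. ?G (u n x) * (a (D n x) \<bullet> P x)) + (LINT x|M. \<psi> x * (?G' (u n x) * (a (D n x) \<bullet> D n x)))"
    by (rule integral_add[OF i3 i2])
   finally have 1: "(LINT x|M. ?G (u n x) * (a (D n x) \<bullet> P x)) + (LINT x|M. \<psi> x * (?G' (u n x) * (a (D n x) \<bullet> D n x)))
     + (LINT x|M. b n x * (\<psi> x * ?G (u n x))) = (LINT x|M. g n x * (\<psi> x * ?G (u n x)))"
    using eq[OF T(1) bd, of n n] by simp
   have 2: "(LINT x|M. - (b n x * ?G (u n x) + ?G' (u n x) * (a (D n x) \<bullet> D n x)) * \<psi> x)
     = - (LINT x|M. (\<psi> x * ?G (u n x)) * b n x) - (LINT x|M. \<psi> x * (?G' (u n x) * (a (D n x) \<bullet> D n x)))"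
    unfolding split using integral_diff[OF integrable_minus[OF i1[of n]] i2[of n]] by simp
   have 3: "(LINT x|M. (\<psi> x * ?G (u n x)) * b n x) = (LINT x|M. b n x * (\<psi> x * ?G (u n x)))"
    by (intro integral_cong refl) simp
   show ?thesis using 1 2 3 by linarith
  qed
  have "(%n. LINT x|M. ?G (u n x) * (a (D n x) \<bullet> P x)) \<longlonglongrightarrow> (LINT x|M. ?G (v x) * (a (E x) \<bullet> P x))"
  proof (rule flux_tendsto[OF DL R EL W0_Lp(2)[OF \<psi>] DE Gm[OF um] Gm[OF vm] G1 G1])
   show "AE x in M. (%n. ?G (u n x)) \<longlonglongrightarrow> ?G (v x)"
    using uv
   proof eventually_elim
    case (elim x) show ?case using continuous_on_tendsto_compose[OF bump_exp_continuous(1) elim] by simp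
   qed
  qed simp
  moreover have "(%n. LINT x|M. g n x * (\<psi> x * ?G (u n x))) \<longlonglongrightarrow> (LINT x|M. g0 x * (\<psi> x * ?G (v x)))"
  proof (rule product_tendsto[OF g W0_measurable(1)[OF T(1)] borel_measurable_times[OF \<psi>m Gm[OF vm]] T(2)])
   show "AE x in M. (%n. \<psi> x * ?G (u n x)) \<longlonglongrightarrow> \<psi> x * ?G (v x)"
    using uv
   proof eventually_elim
    case (elim x)
    have "(%n. ?G (u n x)) \<longlonglongrightarrow> ?G (v x)" using continuous_on_tendsto_compose[OF bump_exp_continuous(1) elim] by simp
    then show ?case by (intro tendsto_mult tendsto_const)
   qed
  qed
  ultimately show "(%n. LINT x|M. - (b n x * ?G (u n x) + ?G' (u n x) * (a (D n x) \<bullet> D n x)) * \<psi> x) \<longlonglongrightarrow>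
    (LINT x|M. ?G (v x) * (a (E x) \<bullet> P x)) - (LINT x|M. g0 x * (\<psi> x * ?G (v x)))"
   unfolding I by (rule tendsto_diff)
 qed
 \<comment> \<open>With psi = phi * lift_exp l k v in \<open>weighted\<close>, the total weight is
   the product of \<open>bump_exp\<close> and \<open>lift_exp\<close>. It tends to 1, and the limit
   energy is multiplied by its derivative, which tends to 0.\<close>
 have lower: "(LINT x|M. g0 x * \<phi> x) <= (LINT x|M. a (E x) \<bullet> F x + b0 x * \<phi> x)"
  if \<phi>: "W0 \<phi> F" and B: "AE x in M. \<bar>\<phi> x\<bar> <= B" and p0: "AE x in M. 0 <= \<phi> x" for \<phi> F B
 proof -
  let ?H = "lift_exp l" and ?H' = "lift_exp' l"
  have H1: "\<bar>?H k s\<bar> <= exp (l * (real (Suc k) * (pi / 2)))" for k s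
   using lift_exp_le[OF l, of k s] lift_exp_pos[of l k s] by simp
  note T = W0_mult_compose[OF \<phi> B E lift_exp_deriv lift_exp_continuous(2) lift_exp'_bound[OF l] H1]
  note \<phi>m = W0_measurable(1)[OF \<phi>] and vm = W0_measurable(1)[OF E]
  note FF = a_integrable[OF EL W0_Lp(2)[OF \<phi>]]
  note Gm = continuous_compose_measurable[OF bump_exp_continuous(1) vm] and G'm = continuous_compose_measurable[OF bump_exp_continuous(2) vm]
  note Hm = continuous_compose_measurable[OF lift_exp_continuous(1) vm] and H'm = continuous_compose_measurable[OF lift_exp_continuous(2) vm]
  define S where "S k x = (?G (v x) * ?H k (v x)) * (a (E x) \<bullet> F x) +
    (?G (v x) * ?H' k (v x) + ?G' (v x) * ?H k (v x)) * (\<phi> x * (a (E x) \<bullet> E x)) + (?G (v x) * ?H k (v x)) * (b0 x * \<phi> x)" for k x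
  define w where "w x = \<bar>a (E x) \<bullet> F x\<bar> + l * \<bar>\<phi> x * (a (E x) \<bullet> E x)\<bar> + \<bar>b0 x * \<phi> x\<bar>" for x
  have bi0: "integrable M (%x. b0 x * \<phi> x)" using bounded_mult_integrable(1)[OF \<phi>m B b0i] by (simp add: mult.commute)
  have gi0: "integrable M (%x. g0 x * \<phi> x)" using bounded_mult_integrable(1)[OF \<phi>m B g(2)] by (simp add: mult.commute)
  have ei0: "integrable M (%x. \<phi> x * (a (E x) \<bullet> E x))" by (rule bounded_mult_integrable(1)[OF \<phi>m B EE])
  have GH: "\<bar>?G s * ?H k s\<bar> <= 1" for k s
   using bump_lift_le[OF l, of s k] bump_exp_bounds(1)[OF l, of s] lift_exp_pos[of l k s] by simp
  have wi: "integrable M w" unfolding w_def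
   by (intro integrable_add integrable_abs integrable_mult_right FF ei0 bi0)
  have Sm: "S k \<in> borel_measurable M" for k unfolding S_def
   by (intro borel_measurable_times borel_measurable_add Gm G'm Hm H'm borel_measurable_integrable[OF FF] borel_measurable_integrable[OF EE] b0m \<phi>m)
  have Sw: "norm (S k x) <= w x" for k x
  proof -
   have "norm (S k x) <= \<bar>?G (v x) * ?H k (v x)\<bar> * \<bar>a (E x) \<bullet> F x\<bar> +
    \<bar>?G (v x) * ?H' k (v x) + ?G' (v x) * ?H k (v x)\<bar> * \<bar>\<phi> x * (a (E x) \<bullet> E x)\<bar> + \<bar>?G (v x) * ?H k (v x)\<bar> * \<bar>b0 x * \<phi> x\<bar>"
    unfolding S_def real_norm_def abs_mult[symmetric] by linarith
   also have "... <= 1 * \<bar>a (E x) \<bullet> F x\<bar> + l * \<bar>\<phi> x * (a (E x) \<bullet> E x)\<bar> + 1 * \<bar>b0 x * \<phi> x\<bar>"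
    by (intro add_mono mult_right_mono GH bump_lift_cross(1)[OF l] abs_ge_zero)
   finally show ?thesis by (simp add: w_def)
  qed
  have Si: "integrable M (S k)" for k
   by (rule integrable_bound[OF wi Sm]) (intro AE_I2 order_trans[OF Sw], simp)
  have "(%k. LINT x|M. S k x) \<longlonglongrightarrow> (LINT x|M. a (E x) \<bullet> F x + b0 x * \<phi> x)"
  proof (rule integral_dominated_convergence[OF _ Sm wi])
   show "(%x. a (E x) \<bullet> F x + b0 x * \<phi> x) \<in> borel_measurable M"
    by (intro borel_measurable_add borel_measurable_integrable[OF FF] borel_measurable_integrable[OF bi0])
   have "(%k. S k x) \<longlonglongrightarrow> 1 * (a (E x) \<bullet> F x) + 0 * (\<phi> x * (a (E x) \<bullet> E x)) + 1 * (b0 x * \<phi> x)" for x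
    unfolding S_def by (intro tendsto_add tendsto_mult[OF _ tendsto_const] bump_lift_tendsto bump_lift_cross(2)[OF l])
   then show "AE x in M. (%k. S k x) \<longlonglongrightarrow> a (E x) \<bullet> F x + b0 x * \<phi> x" by simp
   show "AE x in M. norm (S k x) <= w x" for k by (intro AE_I2 Sw)
  qed
  moreover have "(%k. LINT x|M. (?G (v x) * ?H k (v x)) * (g0 x * \<phi> x)) \<longlonglongrightarrow> (LINT x|M. g0 x * \<phi> x)"
  proof (rule integral_dominated_convergence[OF _ _ integrable_abs[OF gi0]])
   show "(%x. g0 x * \<phi> x) \<in> borel_measurable M" by (rule borel_measurable_integrable[OF gi0])
   show "(%x. (?G (v x) * ?H k (v x)) * (g0 x * \<phi> x)) \<in> borel_measurable M" for k
    by (intro borel_measurable_times[OF _ borel_measurable_integrable[OF gi0]] borel_measurable_times Gm Hm)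
   have "(%k. (?G (v x) * ?H k (v x)) * (g0 x * \<phi> x)) \<longlonglongrightarrow> 1 * (g0 x * \<phi> x)" for x
    by (intro tendsto_mult[OF _ tendsto_const] bump_lift_tendsto)
   then show "AE x in M. (%k. (?G (v x) * ?H k (v x)) * (g0 x * \<phi> x)) \<longlonglongrightarrow> g0 x * \<phi> x" by simp
   have "norm ((?G (v x) * ?H k (v x)) * (g0 x * \<phi> x)) <= 1 * \<bar>g0 x * \<phi> x\<bar>" for k x
    unfolding real_norm_def abs_mult[of "?G (v x) * ?H k (v x)"] by (rule mult_right_mono[OF GH]) simp
   then show "AE x in M. norm ((?G (v x) * ?H k (v x)) * (g0 x * \<phi> x)) <= \<bar>g0 x * \<phi> x\<bar>" for k by simp
  qed
  moreover have "(LINT x|M. (?G (v x) * ?H k (v x)) * (g0 x * \<phi> x)) <= (LINT x|M. S k x)" for k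
  proof -
   let ?\<psi> = "%x. \<phi> x * ?H k (v x)" and ?P = "%x. ?H k (v x) *\<^sub>R F x + (\<phi> x * ?H' k (v x)) *\<^sub>R E x"
   have "AE x in M. 0 <= ?\<psi> x" using p0 by eventually_elim (use lift_exp_pos[of l k] in \<open>simp add: less_imp_le\<close>)
   note wt = weighted[OF T(1) T(2) this]
   have iP: "integrable M (%x. ?G (v x) * (a (E x) \<bullet> ?P x))"
    by (rule bounded_mult_integrable(1)[OF Gm _ a_integrable[OF EL W0_Lp(2)[OF T(1)]], where G=1]) (use G1 in simp)
   have iG: "integrable M (%x. (?G (v x) * ?H k (v x)) * (g0 x * \<phi> x))"
    by (rule bounded_mult_integrable(1)[OF borel_measurable_times[OF Gm Hm] _ gi0, where G=1]) (use GH in simp)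
   have "(LINT x|M. - (b0 x * ?G (v x) + ?G' (v x) * (a (E x) \<bullet> E x)) * ?\<psi> x) = (LINT x|M. ?G (v x) * (a (E x) \<bullet> ?P x) - S k x)"
    by (intro integral_cong refl) (simp add: S_def inner_add_right algebra_simps)
   also have "... = (LINT x|M. ?G (v x) * (a (E x) \<bullet> ?P x)) - (LINT x|M. S k x)"
    by (rule integral_diff[OF iP Si])
   finally have "(LINT x|M. ?G (v x) * (a (E x) \<bullet> ?P x)) - (LINT x|M. S k x) <=
     (LINT x|M. ?G (v x) * (a (E x) \<bullet> ?P x)) - (LINT x|M. g0 x * (?\<psi> x * ?G (v x)))" using wt by linarith
   moreover have "(LINT x|M. g0 x * (?\<psi> x * ?G (v x))) = (LINT x|M. (?G (v x) * ?H k (v x)) * (g0 x * \<phi> x))"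
    by (intro integral_cong refl) (simp add: mult_ac)
   ultimately show ?thesis by linarith
  qed
  ultimately show ?thesis by (intro LIMSEQ_le) auto
 qed
 have pos: "(LINT x|M. a (E x) \<bullet> F x) + (LINT x|M. b0 x * \<phi> x) = (LINT x|M. g0 x * \<phi> x)"
  if \<phi>: "W0 \<phi> F" and B: "AE x in M. \<bar>\<phi> x\<bar> <= B" and p0: "AE x in M. 0 <= \<phi> x" for \<phi> F B
 proof -
  have "integrable M (%x. b0 x * \<phi> x)"
   using bounded_mult_integrable(1)[OF W0_measurable(1)[OF \<phi>] B b0i] by (simp add: mult.commute)
  from integral_add[OF a_integrable[OF EL W0_Lp(2)[OF \<phi>]] this]
  show ?thesis using upper[OF \<phi> B p0] lower[OF \<phi> B p0] by linarith
 qed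
 show "(LINT x|M. a (E x) \<bullet> F x) + (LINT x|M. b0 x * \<phi> x) = (LINT x|M. g0 x * \<phi> x)" if \<phi>: "W0 \<phi> F" and bd: "bdd_fun \<phi>" for \<phi> F
 proof -
  obtain B where B: "AE x in M. \<bar>\<phi> x\<bar> <= B" using bd unfolding bdd_fun_def by blast
  \<comment> \<open>A signed phi is the difference of the nonnegative bounded functions |phi| + phi
    and |phi|, so the gradient of |phi| is all that linearity requires.\<close>
  note A = W0_abs[OF \<phi>]
  have B2: "AE x in M. \<bar>\<bar>\<phi> x\<bar> + \<phi> x\<bar> <= 2 * B" using B by eventually_elim linarith
  have B1: "AE x in M. \<bar>\<bar>\<phi> x\<bar>\<bar> <= B" using B by simp
  have 1: "(LINT x|M. a (E x) \<bullet> (sgn (\<phi> x) *\<^sub>R F x + F x)) + (LINT x|M. b0 x * (\<bar>\<phi> x\<bar> + \<phi> x)) = (LINT x|M. g0 x * (\<bar>\<phi> x\<bar> + \<phi> x))"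
   by (rule pos[OF W0_add[OF A \<phi>] B2]) simp
  have 2: "(LINT x|M. a (E x) \<bullet> (sgn (\<phi> x) *\<^sub>R F x)) + (LINT x|M. b0 x * \<bar>\<phi> x\<bar>) = (LINT x|M. g0 x * \<bar>\<phi> x\<bar>)"
   by (rule pos[OF A B1]) simp
  have f: "integrable M (%x. f x * \<phi> x)" "integrable M (%x. f x * \<bar>\<phi> x\<bar>)" if "integrable M f" for f :: "_ => real"
   using bounded_mult_integrable(1)[OF W0_measurable(1)[OF \<phi>] B that] bounded_mult_integrable(1)[OF W0_measurable(1)[OF A] B1 that]
   by (simp_all add: mult.commute)
  show ?thesis
   using 1 2 integral_add[OF a_integrable[OF EL W0_Lp(2)[OF A]] a_integrable[OF EL W0_Lp(2)[OF \<phi>]]]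
    integral_add[OF f(2)[OF b0i] f(1)[OF b0i]] integral_add[OF f(2)[OF g(2)] f(1)[OF g(2)]]
   unfolding inner_add_right distrib_left by linarith
 qed
qed

end

section \<open>The quasilinear problem\<close>

text \<open>\<open>T\<close> is the point where s^q = d s^p. Up to \<open>T\<close> the power s^q is
  at most T^q; beyond it s^(q-p) is at most d.\<close>

lemma powr_absorb:
 fixes p q d :: real
 assumes "0 < q" "q < p" "d > 0"
 shows "\<exists>K\<ge>0. \<forall>s\<ge>0. s powr q <= d * s powr p + K"
proof -
 define T where "T = d powr (- 1 / (p - q))"
 have T: "T > 0" using assms by (simp add: T_def)
 have Td: "T powr (q - p) = d"
 proof -
  have "- 1 / (p - q) * (q - p) = 1" using assms by (simp add: field_simps)
  then show ?thesis using assms by (simp add: T_def powr_powr)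
 qed
 have "s powr q <= d * s powr p + T powr q" if s: "s \<ge> 0" for s
 proof (cases "s <= T")
  case True
  then have "s powr q <= T powr q" using s assms by (intro powr_mono2) auto
  moreover have "0 <= d * s powr p" using assms by simp
  ultimately show ?thesis by linarith
 next
  case False
  then have s: "s > T" "s > 0" using T by auto
  have "s powr q = s powr (q - p) * s powr p" by (simp add: powr_add[symmetric])
  also have "... <= T powr (q - p) * s powr p"
   using s T assms by (intro mult_right_mono powr_mono2') auto
  finally show ?thesis unfolding Td by (simp add: add_increasing2)
 qed
 then show ?thesis by (intro exI[of _ "T powr q"]) simp
qed

lemma min_index_tendsto:
 fixes y :: "nat => real"
 assumes "y \<longlonglongrightarrow> c" "strict_mono (r :: nat => nat)"
 shows "(%n. min (real (r n)) (y n)) \<longlonglongrightarrow> c"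
proof (rule Lim_transform_eventually[OF assms(1)])
 have "\<forall>\<^sub>F n in sequentially. y n < c + 1" by (rule order_tendstoD(2)[OF assms(1)]) simp
 moreover have "\<forall>\<^sub>F n in sequentially. c + 1 <= real n"
  using filterlim_real_sequentially by (simp add: filterlim_at_top)
 ultimately show "\<forall>\<^sub>F n in sequentially. y n = min (real (r n)) (y n)"
 proof eventually_elim
  case (elim n)
  have "real n <= real (r n)" using seq_suble[OF assms(2), of n] by simp
  then show ?case using elim by simp
 qed
qed

text \<open>\<open>\<beta>\<close> stands for B(|y|). Its two bounds play opposite parts:
  \<open>\<beta>_le\<close> allows the exponential weights to dominate the gradient term by the
  energy density, while \<open>\<beta>_ge\<close> yields the a priori estimate.\<close>

locale gradient_problem = leray_lions \<Omega> p a \<Phi> c2 Ca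
 for \<Omega> :: "(real^'n::finite) set" and p a \<Phi> c2 Ca +
 fixes \<beta> :: "real^'n => real" and \<sigma> C \<theta> q :: real and f :: "real^'n => real"
 assumes \<beta>_cont: "continuous_on UNIV \<beta>" and \<beta>_nonneg: "!!y. 0 <= \<beta> y" and \<beta>_zero: "\<beta> 0 = 0"
  and \<beta>_le: "!!y. \<beta> y <= C * (a y \<bullet> y)" and C_nonneg: "C \<ge> 0"
  and \<sigma>_pos: "\<sigma> > 0" and \<beta>_ge: "!!y. \<sigma> * norm y powr p <= \<beta> y"
  and \<theta>_pos: "\<theta> > 0" and q_pos: "0 < q" and q_less: "q < p"
  and f_int: "integrable M f" and f_nonneg: "!!x. 0 <= f x"
begin

text \<open>The positive part makes the source continuous in s on the whole line, as the fixed point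
  principle requires; it drops out once solutions are known to be nonnegative.\<close>

definition rhs :: "real => real^'n => real" where
 "rhs s x = \<theta> * ((max 0 s) powr q / norm x powr p) + f x"

definition trunc :: "nat => real => real^'n => real" where
 "trunc n s x = min (real n) (rhs s x)"

text \<open>The last factor switches the gradient term off where \<open>s <= 0\<close>, so that solutions of the
 regularised problem are nonnegative.\<close>

definition damp :: "nat => real => real^'n => real" where
 "damp m s y = min (real m) (\<beta> y) * min 1 (real m * max 0 s)"

lemma rhs_nonneg: "0 <= rhs s x"
 using \<theta>_pos f_nonneg by (simp add: rhs_def)

lemma trunc_bounds: "0 <= trunc n s x" "trunc n s x <= real n" "trunc n s x <= rhs s x" "\<bar>trunc n s x\<bar> <= real n"
 using rhs_nonneg[of s x] by (auto simp: trunc_def)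

lemma damp_bounds: "0 <= damp m s y" "damp m s y <= \<beta> y" "damp m s y <= real m" "s <= 0 ==> damp m s y = 0"
proof -
 have m: "0 <= min 1 (real m * max 0 s)" "min 1 (real m * max 0 s) <= 1" by auto
 have b: "0 <= min (real m) (\<beta> y)" using \<beta>_nonneg by simp
 show "0 <= damp m s y" unfolding damp_def by (rule mult_nonneg_nonneg[OF b m(1)])
 have "damp m s y <= min (real m) (\<beta> y)" unfolding damp_def by (rule mult_left_le[OF m(2) b])
 then show "damp m s y <= \<beta> y" "damp m s y <= real m" by auto
 show "damp m s y = 0" if "s <= 0" using that by (simp add: damp_def)
qed

lemma pos_powr_continuous: "continuous_on UNIV (%s::real. (max 0 s) powr q)"
 using q_pos by (intro continuous_on_powr' continuous_intros) auto

lemma rhs_measurable: "w \<in> borel_measurable M ==> (%x. rhs (w x) x) \<in> borel_measurable M"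
proof -
 assume w: "w \<in> borel_measurable M"
 have "(%x. norm x powr p) \<in> borel_measurable M" by (rule borel_M) simp
 then show ?thesis unfolding rhs_def
  by (intro borel_measurable_add borel_measurable_times borel_measurable_divide borel_measurable_const
    continuous_compose_measurable[OF pos_powr_continuous w] borel_measurable_integrable[OF f_int])
qed

lemma trunc_measurable: "w \<in> borel_measurable M ==> (%x. trunc n (w x) x) \<in> borel_measurable M"
 unfolding trunc_def by (intro borel_measurable_min borel_measurable_const rhs_measurable)

lemma \<beta>_measurable: "E \<in> borel_measurable M ==> (%x. \<beta> (E x)) \<in> borel_measurable M"
 by (rule measurable_compose[OF _ borel_measurable_continuous_onI[OF \<beta>_cont]])

lemma damp_measurable: "w \<in> borel_measurable M ==> E \<in> borel_measurable M ==> (%x. damp m (w x) (E x)) \<in> borel_measurable M"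
 unfolding damp_def by (intro borel_measurable_times borel_measurable_min borel_measurable_max borel_measurable_const \<beta>_measurable)

lemma rhs_tendsto: "s \<longlonglongrightarrow> t ==> (%k. rhs (s k) x) \<longlonglongrightarrow> rhs t x"
proof -
 assume "s \<longlonglongrightarrow> t"
 then have "(%k. (max 0 (s k)) powr q) \<longlonglongrightarrow> (max 0 t) powr q"
  using continuous_on_tendsto_compose[OF pos_powr_continuous] by simp
 then show ?thesis unfolding rhs_def divide_inverse by (intro tendsto_add tendsto_mult tendsto_const)
qed

lemma trunc_tendsto: "s \<longlonglongrightarrow> t ==> (%k. trunc n (s k) x) \<longlonglongrightarrow> trunc n t x"
 unfolding trunc_def by (intro tendsto_min tendsto_const rhs_tendsto)

lemma \<beta>_tendsto: "Y \<longlonglongrightarrow> y ==> (%k. \<beta> (Y k)) \<longlonglongrightarrow> \<beta> y"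
 using continuous_on_tendsto_compose[OF \<beta>_cont] by simp

lemma trunc_integrable: "w \<in> borel_measurable M ==> integrable M (%x. trunc n (w x) x)"
 by (rule fin.integrable_const_bound[where B="real n"]) (use trunc_bounds(4) in \<open>auto intro: trunc_measurable\<close>)

lemma \<beta>_integrable:
 assumes "D \<in> Lp p \<Omega>"
 shows "integrable M (%x. \<beta> (D x))" "nrm D <= R ==> (LINT x|M. \<beta> (D x)) <= C * (Ca * (measure M (space M) + 3 * R))"
proof -
 have "norm (\<beta> y) <= norm (C * (a y \<bullet> y))" for y using \<beta>_le[of y] \<beta>_nonneg[of y] by simp
 then show i: "integrable M (%x. \<beta> (D x))"
  by (intro integrable_bound[OF integrable_mult_right[OF a_integrable[OF assms assms], of C]] \<beta>_measurable Lp_measurable[OF assms] AE_I2)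
 assume R: "nrm D <= R"
 have "(LINT x|M. \<beta> (D x)) <= (LINT x|M. C * (a (D x) \<bullet> D x))"
  by (intro integral_mono i integrable_mult_right a_integrable assms \<beta>_le)
 also have "... <= C * (Ca * (measure M (space M) + 3 * R))"
  using a_inner_self_integral[OF assms R] C_nonneg by (simp add: mult_left_mono)
 finally show "(LINT x|M. \<beta> (D x)) <= C * (Ca * (measure M (space M) + 3 * R))" .
qed

lemma compact_sequence:
 assumes W: "!!n. W0 (u n) (D n)" and R: "!!n. nrm (D n) <= R"
  and h: "!!n. integrable M (h n)" "!!n. (LINT x|M. \<bar>h n x\<bar>) <= H"
  and eq: "!!n \<phi> F. W0 \<phi> F ==> bdd_fun \<phi> ==> (LINT x|M. a (D n x) \<bullet> F x) = (LINT x|M. h n x * \<phi> x)"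
 shows "\<exists>(r :: nat => nat) v E. strict_mono r \<and> W0 v E \<and> (AE x in M. (%n. u (r n) x) \<longlonglongrightarrow> v x) \<and> (AE x in M. (%n. D (r n) x) \<longlonglongrightarrow> E x)"
proof -
 obtain r1 :: "nat => nat" and v where r1: "strict_mono r1" and v: "integrable M v"
  and l: "(%n. LINT x|M. \<bar>u (r1 n) x - v x\<bar>) \<longlonglongrightarrow> 0" and ae: "AE x in M. (%n. u (r1 n) x) \<longlonglongrightarrow> v x"
  using Rellich[where u=u and D=D, OF W R] by blast
 have "\<exists>(r :: nat => nat) E. strict_mono r \<and> W0 v E \<and> (AE x in M. (%n. D (r1 (r n)) x) \<longlonglongrightarrow> E x)"
 proof (rule gradients_converge[where u="%n. u (r1 n)" and D="%n. D (r1 n)" and h="%n. h (r1 n)"])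
  show "W0 (u (r1 n)) (D (r1 n))" for n by (rule W)
  show "nrm (D (r1 n)) <= R" for n by (rule R)
  show "integrable M v" by (rule v)
  show "(%n. LINT x|M. \<bar>u (r1 n) x - v x\<bar>) \<longlonglongrightarrow> 0" by (rule l)
  show "integrable M (h (r1 n))" for n by (rule h(1))
  show "(LINT x|M. \<bar>h (r1 n) x\<bar>) <= H" for n by (rule h(2))
  show "(LINT x|M. a (D (r1 n) x) \<bullet> F x) = (LINT x|M. h (r1 n) x * \<phi> x)" if "W0 \<phi> F" "bdd_fun \<phi>" for n \<phi> F
   by (rule eq[OF that])
 qed
 then obtain r2 :: "nat => nat" and E where r2: "strict_mono r2" and E: "W0 v E" "AE x in M. (%n. D (r1 (r2 n)) x) \<longlonglongrightarrow> E x" by blast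
 have "AE x in M. (%n. u (r1 (r2 n)) x) \<longlonglongrightarrow> v x"
  using ae
 proof eventually_elim
  case (elim x) show ?case using LIMSEQ_subseq_LIMSEQ[OF elim r2] by (simp add: o_def)
 qed
 moreover have "strict_mono (%n. r1 (r2 n))" using r1 r2 by (simp add: strict_mono_def)
 ultimately show ?thesis using E by (intro exI[of _ "%n. r1 (r2 n)"] exI[of _ v] exI[of _ E]) simp
qed

lemma L1_diff_bound:
 fixes g b :: "real^'n => real"
 assumes "integrable M g" "integrable M b" "!!x. 0 <= g x" "!!x. 0 <= b x" "(LINT x|M. g x) <= G" "(LINT x|M. b x) <= B"
 shows "(LINT x|M. \<bar>g x - b x\<bar>) <= G + B"
proof -
 have "\<bar>g x - b x\<bar> <= g x + b x" for x using assms(3,4)[of x] by linarith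
 then have "(LINT x|M. \<bar>g x - b x\<bar>) <= (LINT x|M. g x + b x)"
  by (intro integral_mono integrable_abs integrable_diff integrable_add assms(1,2)) auto
 also have "... = (LINT x|M. g x) + (LINT x|M. b x)" by (rule integral_add[OF assms(1,2)])
 finally show ?thesis using assms(5,6) by linarith
qed

lemma integral_diff_mult:
 fixes g b :: "real^'n => real"
 assumes "integrable M g" "integrable M b" "\<phi> \<in> borel_measurable M" "bdd_fun \<phi>"
 shows "(LINT x|M. (g x - b x) * \<phi> x) = (LINT x|M. g x * \<phi> x) - (LINT x|M. b x * \<phi> x)"
proof -
 obtain B where B: "AE x in M. \<bar>\<phi> x\<bar> <= B" using assms(4) unfolding bdd_fun_def by blast
 have "integrable M (%x. g x * \<phi> x)" "integrable M (%x. b x * \<phi> x)"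
  using bounded_mult_integrable(1)[OF assms(3) B assms(1)] bounded_mult_integrable(1)[OF assms(3) B assms(2)] by (simp_all add: mult.commute)
 from integral_diff[OF this] show ?thesis by (simp add: left_diff_distrib)
qed

lemma AE_nonneg_limit:
 assumes "!!n. AE x in M. 0 <= u n x" "AE x in M. (%n. u n x) \<longlonglongrightarrow> (v x :: real)"
 shows "AE x in M. 0 <= v x"
proof -
 have "AE x in M. \<forall>n. 0 <= u n x" using assms(1) by (simp add: AE_all_countable)
 then show ?thesis using assms(2)
 proof eventually_elim
  case (elim x) show ?case by (rule LIMSEQ_le_const[OF elim(2)]) (use elim(1) in simp)
 qed
qed

text \<open>For fixed n and m the right-hand side is bounded and continuous, so the fixed point
  principle applies. Nonnegativity follows by testing with |u| - u: where this is nonzero the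
  damping vanishes and the source is nonnegative.\<close>

lemma regularised_solution:
 "\<exists>u D. W0 u D \<and> (AE x in M. 0 <= u x) \<and>
  (\<forall>\<phi> F. W0 \<phi> F \<longrightarrow> (LINT x|M. a (D x) \<bullet> F x) = (LINT x|M. (trunc n (u x) x - damp m (u x) (D x)) * \<phi> x))"
proof -
 let ?N = "%w E x. trunc n (w x) x - damp m (w x) (E x)"
 have "\<exists>u D. sol (?N u D) u D"
 proof (rule fixed_point[where N="?N" and G="real n + real m"])
  show "0 <= real n + real m" by simp
  show "adm (real n + real m) (?N w E)" if "W0 w E" for w E
   unfolding adm_def
  proof
   show "?N w E \<in> borel_measurable M"
    by (intro borel_measurable_diff trunc_measurable damp_measurable W0_measurable[OF that])
   have "\<bar>?N w E x\<bar> <= real n + real m" for x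
    using trunc_bounds[of n "w x" x] damp_bounds(1,3)[of m "w x" "E x"] by linarith
   then show "AE x in M. \<bar>?N w E x\<bar> <= real n + real m" by simp
  qed
  show "AE x in M. (%k. ?N (w k) (E k) x) \<longlonglongrightarrow> ?N w' E' x"
   if "AE x in M. (%k. w k x) \<longlonglongrightarrow> w' x" "AE x in M. (%k. E k x) \<longlonglongrightarrow> E' x" for w E w' E'
   using that
  proof eventually_elim
   case (elim x)
   show ?case unfolding damp_def
    by (intro tendsto_diff trunc_tendsto tendsto_mult tendsto_min tendsto_max tendsto_const \<beta>_tendsto elim)
  qed
 qed
 then obtain u D where s: "sol (?N u D) u D" by blast
 note W = sol_W0[OF s]
 note Z = W0_diff[OF W0_abs[OF W] W]
 \<comment> \<open>The gradient of |u| - u is -t D, and \<open>t\<close> is 2, 1 or 0 where u is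
   negative, zero or positive. Testing shows that t times the energy density has integral at most
   0.\<close>
 define t where "t x = 1 - sgn (u x)" for x
 have t: "t x \<in> {0, 1, 2}" for x by (auto simp: t_def sgn_real_def)
 have ai: "integrable M (%x. t x * (a (D x) \<bullet> D x))"
 proof -
  have "(%x. sgn (u x)) \<in> borel_measurable M"
   by (rule measurable_compose[OF W0_measurable(1)[OF W] borel_measurable_sgn]) 
  then have "t \<in> borel_measurable M" unfolding t_def by (intro borel_measurable_diff borel_measurable_const)
  moreover have "\<bar>t x\<bar> <= 2" for x using t[of x] by auto
  ultimately show ?thesis by (intro bounded_mult_integrable(1)[OF _ AE_I2 a_integrable[OF W0_Lp(2)[OF W] W0_Lp(2)[OF W]], where G=2])
 qed
 have "(LINT x|M. a (D x) \<bullet> (sgn (u x) *\<^sub>R D x - D x)) = (LINT x|M. - (t x * (a (D x) \<bullet> D x)))"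
  by (intro integral_cong refl) (simp add: t_def inner_diff_right algebra_simps)
 also have "... = - (LINT x|M. t x * (a (D x) \<bullet> D x))" by simp
 finally have "- (LINT x|M. t x * (a (D x) \<bullet> D x)) = (LINT x|M. ?N u D x * (\<bar>u x\<bar> - u x))"
  using sol_eq[OF s Z] by simp
 moreover have "0 <= (LINT x|M. ?N u D x * (\<bar>u x\<bar> - u x))"
 proof (intro integral_nonneg_AE AE_I2)
  fix x show "0 <= ?N u D x * (\<bar>u x\<bar> - u x)"
  proof (cases "u x <= 0")
   case True
   then show ?thesis using damp_bounds(4)[of "u x" m "D x"] trunc_bounds(1)[of n "u x" x] by (simp add: mult_nonpos_nonneg)
  qed simp
 qed
 ultimately have le: "(LINT x|M. t x * (a (D x) \<bullet> D x)) <= 0" by linarith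
 have "nrm (%x. sgn (u x) *\<^sub>R D x - D x) <= (LINT x|M. 2 powr p / c2 * (t x * (a (D x) \<bullet> D x)))"
  unfolding nrm_def
 proof (intro integral_mono Lp_integrable_powr[OF W0_Lp(2)[OF Z]] integrable_mult_right ai)
  fix x
  have "sgn (u x) *\<^sub>R D x - D x = (- t x) *\<^sub>R D x" by (simp add: t_def algebra_simps)
  then have "norm (sgn (u x) *\<^sub>R D x - D x) powr p = (t x) powr p * norm (D x) powr p"
   using t[of x] by (auto simp: powr_mult)
  \<comment> \<open>As t is 0, 1 or 2, its power t^p is at most 2^p t.\<close>
  also have "... <= (2 powr p * t x) * norm (D x) powr p"
   using t[of x] p_gt_1 by (intro mult_right_mono) (auto simp: ge_one_powr_ge_zero)
  also have "... = 2 powr p / c2 * t x * (c2 * norm (D x) powr p)" using c2_pos by simp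
  also have "... <= 2 powr p / c2 * t x * (a (D x) \<bullet> D x)"
   using t[of x] c2_pos by (intro mult_left_mono a_coercive) auto
  finally show "norm (sgn (u x) *\<^sub>R D x - D x) powr p <= 2 powr p / c2 * (t x * (a (D x) \<bullet> D x))" by (simp add: mult.assoc)
 qed
 also have "... = 2 powr p / c2 * (LINT x|M. t x * (a (D x) \<bullet> D x))" by simp
 also have "... <= 0" using le c2_pos by (intro mult_nonneg_nonpos) auto
 finally have "nrm (%x. \<bar>u x\<bar> - u x) <= 0"
  using W0_Poincare[OF Z] mult_nonneg_nonpos[OF poincare_const_nonneg] by (meson order_trans)
 moreover have "0 <= (LINT x|M. norm (\<bar>u x\<bar> - u x) powr p)" by (rule integral_nonneg_AE) simp
 ultimately have "(LINT x|M. norm (\<bar>u x\<bar> - u x) powr p) = 0" unfolding nrm_def by linarith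
 then have "AE x in M. norm (\<bar>u x\<bar> - u x) powr p = 0"
  using integral_nonneg_eq_0_iff_AE[OF Lp_integrable_powr[OF W0_Lp(1)[OF Z]]] by simp
 then have "AE x in M. 0 <= u x" by eventually_elim (simp add: abs_if split: if_splits)
 then show ?thesis using W sol_eq[OF s] by (intro exI[of _ u] exI[of _ D]) simp
qed

text \<open>Where t > 0 the cutoff factor is eventually 1. Where t = 0 it is only known to lie in
  [0, 1], but there the gradient y vanishes, so the gradient term tends to zero anyway. In the
  application \<open>W0_gradient_zero_set\<close> supplies this condition.\<close>

lemma damp_tendsto:
 assumes s: "s \<longlonglongrightarrow> t" and Y: "Y \<longlonglongrightarrow> y" and r: "strict_mono (r :: nat => nat)" and 0: "0 <= t" "t = 0 \<longrightarrow> y = 0"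
 shows "(%k. damp (r k) (s k) (Y k)) \<longlonglongrightarrow> \<beta> y"
proof (cases "t = 0")
 case True
 then have "(%k. \<beta> (Y k)) \<longlonglongrightarrow> 0" using \<beta>_tendsto[OF Y] 0 \<beta>_zero by simp
 then have "(%k. damp (r k) (s k) (Y k)) \<longlonglongrightarrow> 0"
  by (rule Lim_null_comparison[OF always_eventually, rotated]) (use damp_bounds(1,2) in auto)
 then show ?thesis using True 0 \<beta>_zero by simp
next
 case False
 then have t: "t > 0" using 0 by simp
 show ?thesis
 proof (rule Lim_transform_eventually[OF min_index_tendsto[OF \<beta>_tendsto[OF Y] r]])
  have "\<forall>\<^sub>F k in sequentially. t / 2 < s k" by (rule order_tendstoD(1)[OF s]) (use t in simp)
  moreover have "\<forall>\<^sub>F k in sequentially. 2 / t <= real k"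
   using filterlim_real_sequentially by (simp add: filterlim_at_top)
  ultimately show "\<forall>\<^sub>F k in sequentially. min (real (r k)) (\<beta> (Y k)) = damp (r k) (s k) (Y k)"
  proof eventually_elim
   case (elim k)
   have "real k <= real (r k)" using seq_suble[OF r, of k] by simp
   then have "2 / t * (t / 2) <= real (r k) * max 0 (s k)" using elim t by (intro mult_mono) auto
   then show ?case using t by (simp add: damp_def min_absorb1)
  qed
 qed
qed

lemma truncated_solution:
 "\<exists>u D. W0 u D \<and> (AE x in M. 0 <= u x) \<and>
  (\<forall>\<phi> F. W0 \<phi> F \<longrightarrow> bdd_fun \<phi> \<longrightarrow> (LINT x|M. a (D x) \<bullet> F x) + (LINT x|M. \<beta> (D x) * \<phi> x) = (LINT x|M. trunc n (u x) x * \<phi> x))"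
proof -
 have "\<forall>m. \<exists>P. W0 (fst P) (snd P) \<and> (AE x in M. 0 <= fst P x) \<and>
  (\<forall>\<phi> F. W0 \<phi> F \<longrightarrow> (LINT x|M. a (snd P x) \<bullet> F x) = (LINT x|M. (trunc n (fst P x) x - damp m (fst P x) (snd P x)) * \<phi> x))"
  using regularised_solution[of n] by auto
 then obtain P where P: "\<forall>m. W0 (fst (P m)) (snd (P m)) \<and> (AE x in M. 0 <= fst (P m) x) \<and>
  (\<forall>\<phi> F. W0 \<phi> F \<longrightarrow> (LINT x|M. a (snd (P m) x) \<bullet> F x) = (LINT x|M. (trunc n (fst (P m) x) x - damp m (fst (P m) x) (snd (P m) x)) * \<phi> x))"
  by (rule choice[THEN exE])
 define u where "u m = fst (P m)" for m
 define D where "D m = snd (P m)" for m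
 have W: "W0 (u m) (D m)" and u0: "AE x in M. 0 <= u m x" for m using P by (simp_all add: u_def D_def)
 have eq: "(LINT x|M. a (D m x) \<bullet> F x) = (LINT x|M. (trunc n (u m x) x - damp m (u m x) (D m x)) * \<phi> x)" if "W0 \<phi> F" for m \<phi> F
  using P that by (simp add: u_def D_def)
 note um = W0_measurable(1)[OF W] and Dm = W0_measurable(2)[OF W]
 obtain K where K: "!!u D. W0 u D ==> real n * (LINT x|M. \<bar>u x\<bar>) <= c2 / 2 * nrm D + K"
  using L1_absorb[of "real n" "c2 / 2"] c2_pos by auto
 define R where "R = 2 * K / c2"
 have ti: "integrable M (%x. trunc n (u m x) x)" for m by (rule trunc_integrable[OF um])
 have di: "integrable M (%x. damp m (u m x) (D m x))" for m
  by (rule integrable_bound[OF \<beta>_integrable(1)[OF W0_Lp(2)[OF W[of m]]] damp_measurable[OF um Dm]])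
   (use damp_bounds(1,2) \<beta>_nonneg in \<open>auto intro!: AE_I2\<close>)
 have R: "nrm (D m) <= R" for m
  unfolding R_def
 proof (rule coercive_bound[OF W _ K])
  have "AE x in M. \<bar>trunc n (u m x) x - damp m (u m x) (D m x)\<bar> <= real n + real m"
   using trunc_bounds damp_bounds(1,3) by (intro AE_I2) (smt (verit))
  from bounded_mult_integrable(1)[OF borel_measurable_diff[OF trunc_measurable[OF um] damp_measurable[OF um Dm]] this W0_int(1)[OF W]]
  have i: "integrable M (%x. (trunc n (u m x) x - damp m (u m x) (D m x)) * u m x)" .
  have "(LINT x|M. a (D m x) \<bullet> D m x) = (LINT x|M. (trunc n (u m x) x - damp m (u m x) (D m x)) * u m x)" by (rule eq[OF W])
  also have "... <= (LINT x|M. real n * \<bar>u m x\<bar>)"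
  proof (rule integral_mono_AE[OF i integrable_mult_right[OF integrable_abs[OF W0_int(1)[OF W]]]])
   show "AE x in M. (trunc n (u m x) x - damp m (u m x) (D m x)) * u m x <= real n * \<bar>u m x\<bar>"
    using u0[of m]
   proof eventually_elim
    case (elim x)
    then show ?case using trunc_bounds(2)[of n "u m x" x] damp_bounds(1)[of m "u m x" "D m x"] by (simp add: mult_right_mono)
   qed
  qed
  finally show "(LINT x|M. a (D m x) \<bullet> D m x) <= real n * (LINT x|M. \<bar>u m x\<bar>)" by simp
 qed
 have h2: "(LINT x|M. \<bar>trunc n (u m x) x - damp m (u m x) (D m x)\<bar>) <= real n * measure M (space M) + C * (Ca * (measure M (space M) + 3 * R))" for m
 proof (rule L1_diff_bound[OF ti di trunc_bounds(1) damp_bounds(1)])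
  have "(LINT x|M. trunc n (u m x) x) <= (LINT x|M. real n)"
   by (intro integral_mono ti fin.integrable_const trunc_bounds(2))
  then show "(LINT x|M. trunc n (u m x) x) <= real n * measure M (space M)" by (simp add: mult.commute)
  have "(LINT x|M. damp m (u m x) (D m x)) <= (LINT x|M. \<beta> (D m x))"
   by (intro integral_mono di \<beta>_integrable(1) W0_Lp(2)[OF W] damp_bounds(2))
  then show "(LINT x|M. damp m (u m x) (D m x)) <= C * (Ca * (measure M (space M) + 3 * R))"
   using \<beta>_integrable(2)[OF W0_Lp(2)[OF W] R, of m] by linarith
 qed
 have "\<exists>(r :: nat => nat) v E. strict_mono r \<and> W0 v E \<and> (AE x in M. (%m. u (r m) x) \<longlonglongrightarrow> v x) \<and> (AE x in M. (%m. D (r m) x) \<longlonglongrightarrow> E x)"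
  by (rule compact_sequence[where u=u and D=D and h="%m x. trunc n (u m x) x - damp m (u m x) (D m x)",
     OF W R integrable_diff[OF ti di] h2 eq])
 then obtain r :: "nat => nat" and v E where r: "strict_mono r" and E: "W0 v E"
  and uv: "AE x in M. (%m. u (r m) x) \<longlonglongrightarrow> v x" and DE: "AE x in M. (%m. D (r m) x) \<longlonglongrightarrow> E x" by blast
 have v0: "AE x in M. 0 <= v x" by (rule AE_nonneg_limit[OF u0 uv])
 have "(LINT x|M. a (E x) \<bullet> F x) + (LINT x|M. \<beta> (E x) * \<phi> x) = (LINT x|M. trunc n (v x) x * \<phi> x)" if \<phi>: "W0 \<phi> F" "bdd_fun \<phi>" for \<phi> F
 proof (rule limit_equation(2)[where u="%m. u (r m)" and D="%m. D (r m)" and b="%m x. damp (r m) (u (r m) x) (D (r m) x)"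
    and ?b0.0="%x. \<beta> (E x)" and g="%m x. trunc n (u (r m) x) x" and C=C and R=R and v=v])
  show "W0 (u (r m)) (D (r m))" "nrm (D (r m)) <= R" for m by (rule W, rule R)
  show "AE x in M. (%m. damp (r m) (u (r m) x) (D (r m) x)) \<longlonglongrightarrow> \<beta> (E x)"
   using uv DE v0 W0_gradient_zero_set[OF E] by eventually_elim (rule damp_tendsto[OF _ _ r])
  show "AE x in M. 0 <= damp (r m) (u (r m) x) (D (r m) x) \<and> damp (r m) (u (r m) x) (D (r m) x) <= C * (a (D (r m) x) \<bullet> D (r m) x)" for m
   using damp_bounds(1) order_trans[OF damp_bounds(2) \<beta>_le] by simp
  show "(%m. LINT x|M. \<bar>trunc n (u (r m) x) x - trunc n (v x) x\<bar>) \<longlonglongrightarrow> 0"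
  proof -
   have "(%m. LINT x|M. \<bar>trunc n (u (r m) x) x - trunc n (v x) x\<bar>) \<longlonglongrightarrow> (LINT x|M. 0)"
   proof (rule integral_dominated_convergence[where w="%x. real n"])
    show "AE x in M. (%m. \<bar>trunc n (u (r m) x) x - trunc n (v x) x\<bar>) \<longlonglongrightarrow> 0"
     using uv
    proof eventually_elim
     case (elim x)
     have "(%m. \<bar>trunc n (u (r m) x) x - trunc n (v x) x\<bar>) \<longlonglongrightarrow> \<bar>trunc n (v x) x - trunc n (v x) x\<bar>"
      by (intro tendsto_rabs tendsto_diff tendsto_const trunc_tendsto elim)
     then show ?case by simp
    qed
    have "norm \<bar>trunc n (u (r m) x) x - trunc n (v x) x\<bar> <= real n" for m x
     using trunc_bounds(1,2)[of n "u (r m) x" x] trunc_bounds(1,2)[of n "v x" x] by simp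
    then show "AE x in M. norm \<bar>trunc n (u (r m) x) x - trunc n (v x) x\<bar> <= real n" for m by simp
    show "(%x. \<bar>trunc n (u (r m) x) x - trunc n (v x) x\<bar>) \<in> borel_measurable M" for m
     by (intro borel_measurable_abs borel_measurable_diff trunc_measurable um W0_measurable(1)[OF E])
   qed simp_all
   then show ?thesis by simp
  qed
  show "(LINT x|M. a (D (r m) x) \<bullet> F x) + (LINT x|M. damp (r m) (u (r m) x) (D (r m) x) * \<phi> x) = (LINT x|M. trunc n (u (r m) x) x * \<phi> x)"
   if "W0 \<phi> F" "bdd_fun \<phi>" for m \<phi> F
   using eq[OF that(1), of "r m"] integral_diff_mult[OF ti di W0_measurable(1)[OF that(1)] that(2), of "r m" "r m"] by linarith
 qed (fact E DE uv u0 C_nonneg \<phi> ti \<open>W0 \<phi> F\<close> | intro damp_measurable um Dm \<beta>_measurable W0_measurable[OF E] trunc_integrable)+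
 then show ?thesis using E v0 by (intro exI[of _ v] exI[of _ E]) simp
qed

text \<open>Because q < p, the singular source is at most any chosen multiple of the Hardy density
  |s|^p / |x|^p plus a fixed integrable function. The size of theta affects only that
  function.\<close>

lemma singular_term:
 assumes "d > 0"
 shows "\<exists>K\<ge>0. \<forall>s x. rhs s x <= d * (\<bar>s\<bar> powr p / norm x powr p) + (K * (1 / norm x powr p) + f x)"
proof -
 obtain K where K: "K \<ge> 0" "!!s. s \<ge> 0 ==> s powr q <= d / \<theta> * s powr p + K"
  using powr_absorb[OF q_pos q_less, of "d / \<theta>"] assms \<theta>_pos by auto
 have "rhs s x <= d * (\<bar>s\<bar> powr p / norm x powr p) + (\<theta> * K * (1 / norm x powr p) + f x)" for s x
 proof -
  have "(max 0 s) powr p <= \<bar>s\<bar> powr p" using p_pos by (intro powr_mono2) auto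
  then have "d / \<theta> * (max 0 s) powr p <= d / \<theta> * \<bar>s\<bar> powr p" using assms \<theta>_pos by (intro mult_left_mono) auto
  then have "\<theta> * ((max 0 s) powr q / norm x powr p) <= \<theta> * ((d / \<theta> * \<bar>s\<bar> powr p + K) / norm x powr p)"
   using K(2)[of "max 0 s"] \<theta>_pos by (intro mult_left_mono divide_right_mono) auto
  also have "... = d * (\<bar>s\<bar> powr p / norm x powr p) + \<theta> * K * (1 / norm x powr p)"
   using \<theta>_pos by (simp add: add_divide_distrib distrib_left)
  finally show ?thesis by (simp add: rhs_def)
 qed
 then show ?thesis using K(1) \<theta>_pos by (intro exI[of _ "\<theta> * K"]) simp
qed

lemma rhs_integrable:
 assumes W: "W0 u D" shows "integrable M (%x. rhs (u x) x)"
proof -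
 obtain K where K: "!!s x. rhs s x <= 1 * (\<bar>s\<bar> powr p / norm x powr p) + (K * (1 / norm x powr p) + f x)"
  using singular_term[of 1] by auto
 show ?thesis
 proof (rule integrable_bound)
  show "integrable M (%x. 1 * (\<bar>u x\<bar> powr p / norm x powr p) + (K * (1 / norm x powr p) + f x))"
   by (intro integrable_add integrable_mult_right W0_Hardy(1)[OF W] integrable_inverse_norm_powr f_int)
  show "AE x in M. norm (rhs (u x) x) <= norm (1 * (\<bar>u x\<bar> powr p / norm x powr p) + (K * (1 / norm x powr p) + f x))"
   using K rhs_nonneg by (intro AE_I2) (smt (verit) real_norm_def)
 qed (rule rhs_measurable[OF W0_measurable(1)[OF W]])
qed

text \<open>Hardy's inequality turns the Hardy density into energy. Its coefficient remains
  arbitrary, so it can be absorbed by the left-hand side in \<open>solution_exists\<close>.\<close>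

lemma rhs_integral_bound:
 assumes "d > 0"
 shows "\<exists>K\<ge>0. \<forall>u D. W0 u D \<longrightarrow> (LINT x|M. rhs (u x) x) <= d * nrm D + K"
proof -
 define d' where "d' = d / (hardy_const + 1)"
 have d': "d' > 0" using assms hardy_const_nonneg by (simp add: d'_def)
 obtain K where K: "K \<ge> 0" "!!s x. rhs s x <= d' * (\<bar>s\<bar> powr p / norm x powr p) + (K * (1 / norm x powr p) + f x)"
  using singular_term[OF d'] by auto
 define J where "J = (LINT x|M. K * (1 / norm x powr p) + f x)"
 have J0: "0 <= J" unfolding J_def using K(1) f_nonneg by (intro integral_nonneg_AE AE_I2) simp
 have Ji: "integrable M (%x. K * (1 / norm x powr p) + f x)"
  by (intro integrable_add integrable_mult_right integrable_inverse_norm_powr f_int)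
 have "(LINT x|M. rhs (u x) x) <= d * nrm D + J" if W: "W0 u D" for u D
 proof -
  note H = W0_Hardy[OF W]
  have "(LINT x|M. rhs (u x) x) <= (LINT x|M. d' * (\<bar>u x\<bar> powr p / norm x powr p) + (K * (1 / norm x powr p) + f x))"
   by (intro integral_mono rhs_integrable[OF W] integrable_add[OF integrable_mult_right[OF H(1)] Ji] K(2))
  also have "... = d' * (LINT x|M. \<bar>u x\<bar> powr p / norm x powr p) + J"
   unfolding J_def integral_add[OF integrable_mult_right[OF H(1)] Ji] by (simp only: integral_mult_right_zero)
  also have "d' * (LINT x|M. \<bar>u x\<bar> powr p / norm x powr p) <= d' * (hardy_const * nrm D)"
   using H(2) d' by (intro mult_left_mono) auto
  also have "... <= d * nrm D"
  proof -
   have "d' * hardy_const <= d" using assms hardy_const_nonneg by (simp add: d'_def field_simps)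
   moreover have "0 <= nrm D" unfolding nrm_def by (rule integral_nonneg_AE) simp
   ultimately show ?thesis by (simp add: mult.assoc[symmetric] mult_right_mono)
  qed
  finally show ?thesis by simp
 qed
 then show ?thesis using J0 by blast
qed

text \<open>For s <= 1 the weight 1/(1 + s^2) is at least 1/2 and the principal term is coercive.
  For s > 1 that weight degenerates, but arctan s is at least pi/4 and the gradient term, bounded
  below by sigma |y|^p, takes over.\<close>

lemma arctan_energy:
 assumes "0 <= s" shows "min (c2 / 2) (\<sigma> * (pi / 4)) * norm y powr p <= 1 / (1 + s\<^sup>2) * (a y \<bullet> y) + \<beta> y * arctan s"
proof -
 define Y where "Y = norm y powr p"
 have Y: "Y \<ge> 0" by (simp add: Y_def)
 have e: "c2 * Y <= a y \<bullet> y" "\<sigma> * Y <= \<beta> y" unfolding Y_def by (rule a_coercive, rule \<beta>_ge)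
 have e0: "0 <= c2 * Y" "0 <= \<sigma> * Y" using Y c2_pos \<sigma>_pos by auto
 show ?thesis
 proof (cases "s <= 1")
  case True
  then have "s\<^sup>2 <= 1" using assms by (simp add: power_le_one)
  then have "1 / 2 <= 1 / (1 + s\<^sup>2)" by (intro divide_left_mono) (auto intro: add_pos_nonneg)
  then have "1 / 2 * (c2 * Y) <= 1 / (1 + s\<^sup>2) * (a y \<bullet> y)" using e e0 by (intro mult_mono) auto
  moreover have "0 <= \<beta> y * arctan s" using assms \<beta>_nonneg by (intro mult_nonneg_nonneg) auto
  moreover have "min (c2 / 2) (\<sigma> * (pi / 4)) * Y <= c2 / 2 * Y" using Y by (intro mult_right_mono) auto
  ultimately show ?thesis unfolding Y_def[symmetric] by linarith
 next
  case False
  then have "pi / 4 <= arctan s" using arctan_monotone'[of 1 s] by (simp add: arctan_one)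
  then have "\<sigma> * Y * (pi / 4) <= \<beta> y * arctan s" using e e0 \<beta>_nonneg by (intro mult_mono) auto
  moreover have "0 <= 1 / (1 + s\<^sup>2) * (a y \<bullet> y)" using e e0 by (intro mult_nonneg_nonneg) auto
  moreover have "min (c2 / 2) (\<sigma> * (pi / 4)) * Y <= \<sigma> * (pi / 4) * Y" using Y by (intro mult_right_mono) auto
  ultimately show ?thesis unfolding Y_def[symmetric] by (simp add: mult_ac)
 qed
qed

theorem solution_exists:
 "\<exists>u D. W0 u D \<and> (AE x in M. 0 <= u x) \<and> integrable M (%x. \<beta> (D x)) \<and>
  (\<forall>\<phi> F. W0 \<phi> F \<longrightarrow> bdd_fun \<phi> \<longrightarrow> (LINT x|M. a (D x) \<bullet> F x) + (LINT x|M. \<beta> (D x) * \<phi> x) = (LINT x|M. rhs (u x) x * \<phi> x))"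
proof -
 have "\<forall>n. \<exists>P. W0 (fst P) (snd P) \<and> (AE x in M. 0 <= fst P x) \<and>
  (\<forall>\<phi> F. W0 \<phi> F \<longrightarrow> bdd_fun \<phi> \<longrightarrow> (LINT x|M. a (snd P x) \<bullet> F x) + (LINT x|M. \<beta> (snd P x) * \<phi> x) = (LINT x|M. trunc n (fst P x) x * \<phi> x))"
  using truncated_solution by auto
 then obtain P where P: "\<forall>n. W0 (fst (P n)) (snd (P n)) \<and> (AE x in M. 0 <= fst (P n) x) \<and>
  (\<forall>\<phi> F. W0 \<phi> F \<longrightarrow> bdd_fun \<phi> \<longrightarrow> (LINT x|M. a (snd (P n) x) \<bullet> F x) + (LINT x|M. \<beta> (snd (P n) x) * \<phi> x) = (LINT x|M. trunc n (fst (P n) x) x * \<phi> x))"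
  by (rule choice[THEN exE])
 define u where "u n = fst (P n)" for n
 define D where "D n = snd (P n)" for n
 have W: "W0 (u n) (D n)" and u0: "AE x in M. 0 <= u n x" for n using P by (simp_all add: u_def D_def)
 have eq: "(LINT x|M. a (D n x) \<bullet> F x) + (LINT x|M. \<beta> (D n x) * \<phi> x) = (LINT x|M. trunc n (u n x) x * \<phi> x)"
  if "W0 \<phi> F" "bdd_fun \<phi>" for n \<phi> F using P that by (simp add: u_def D_def)
 note um = W0_measurable(1)[OF W] and DL = W0_Lp(2)[OF W]
 have ti: "integrable M (%x. trunc n (u n x) x)" for n by (rule trunc_integrable[OF um])
 note bi = \<beta>_integrable(1)[OF DL]
 define c0 where "c0 = min (c2 / 2) (\<sigma> * (pi / 4))"
 have c0: "c0 > 0" using c2_pos \<sigma>_pos by (simp add: c0_def)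
 \<comment> \<open>The coefficient c0/pi is chosen against the bound pi/2 of arctan: the product is
   c0/2, so half of the energy on the left survives.\<close>
 obtain K where K: "!!u D. W0 u D ==> (LINT x|M. rhs (u x) x) <= c0 / pi * nrm D + K"
  using rhs_integral_bound[of "c0 / pi"] c0 by auto
 define R where "R = pi * K / c0"
 have tr: "(LINT x|M. trunc n (u n x) x) <= (LINT x|M. rhs (u n x) x)" for n
  by (intro integral_mono ti rhs_integrable[OF W] trunc_bounds(3))
 have R: "nrm (D n) <= R" for n
 proof -
  define g' where "g' s = 1 / (1 + s\<^sup>2)" for s :: real
  have der: "(arctan has_real_derivative g' s) (at s)" for s using DERIV_arctan[of s] by (simp add: g'_def inverse_eq_divide)
  have cont: "continuous_on UNIV g'"
  proof -
   have "1 + s\<^sup>2 \<noteq> 0" for s :: real using one_plus_square_pos[of s] by linarith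
   then show ?thesis unfolding g'_def by (intro continuous_intros) auto
  qed
  have g'1: "\<bar>g' s\<bar> <= 1" for s using inverse_one_plus_square[of s] by (simp add: g'_def)
  have T: "W0 (%x. arctan (u n x)) (%x. g' (u n x) *\<^sub>R D n x)"
   by (rule W0_chain[OF W der cont g'1]) simp
  have ab: "\<bar>arctan s\<bar> <= pi / 2" for s using arctan_lbound[of s] arctan_ubound[of s] by (simp add: abs_if)
  have B: "AE x in M. \<bar>arctan (u n x)\<bar> <= pi / 2" using ab by simp
  then have bd: "bdd_fun (%x. arctan (u n x))" unfolding bdd_fun_def by blast
  note i1 = a_integrable[OF DL W0_Lp(2)[OF T], of n]
  have i2: "integrable M (%x. \<beta> (D n x) * arctan (u n x))"
   using bounded_mult_integrable(1)[OF W0_measurable(1)[OF T] B bi] by (simp add: mult.commute)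
  have "c0 * nrm (D n) = (LINT x|M. c0 * norm (D n x) powr p)" by (simp add: nrm_def)
  also have "... <= (LINT x|M. a (D n x) \<bullet> (g' (u n x) *\<^sub>R D n x) + \<beta> (D n x) * arctan (u n x))"
  proof (rule integral_mono_AE[OF integrable_mult_right[OF Lp_integrable_powr[OF DL]] integrable_add[OF i1 i2]])
   show "AE x in M. c0 * norm (D n x) powr p <= a (D n x) \<bullet> (g' (u n x) *\<^sub>R D n x) + \<beta> (D n x) * arctan (u n x)"
    using u0[of n]
   proof eventually_elim
    case (elim x) show ?case using arctan_energy[OF elim, of "D n x"] by (simp add: c0_def g'_def)
   qed
  qed
  also have "... = (LINT x|M. trunc n (u n x) x * arctan (u n x))"
   using integral_add[OF i1 i2] eq[OF T bd, of n] by simp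
  also have "... = (LINT x|M. arctan (u n x) * trunc n (u n x) x)" by (simp only: mult.commute)
  also have "... <= pi / 2 * (LINT x|M. \<bar>trunc n (u n x) x\<bar>)"
   using bounded_mult_integrable(2)[OF W0_measurable(1)[OF T] B ti, of n] by linarith
  also have "(LINT x|M. \<bar>trunc n (u n x) x\<bar>) = (LINT x|M. trunc n (u n x) x)" using trunc_bounds(1) by simp
  also have "pi / 2 * ... <= pi / 2 * (c0 / pi * nrm (D n) + K)"
   using tr[of n] K[OF W[of n]] by (intro mult_left_mono) auto
  also have "... = c0 * nrm (D n) / 2 + pi * K / 2" by (simp add: field_simps)
  finally have "c0 * nrm (D n) <= pi * K" by (simp add: field_simps)
  then show ?thesis using c0 by (simp add: R_def field_simps)
 qed
 have tR: "(LINT x|M. trunc n (u n x) x) <= c0 / pi * R + K" for n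
 proof -
  have "c0 / pi * nrm (D n) <= c0 / pi * R" using R[of n] c0 by (intro mult_left_mono) auto
  then show ?thesis using tr[of n] K[OF W[of n]] by linarith
 qed
 note h2 = L1_diff_bound[OF ti bi trunc_bounds(1) \<beta>_nonneg tR \<beta>_integrable(2)[OF DL R]]
 have h3: "(LINT x|M. a (D n x) \<bullet> F x) = (LINT x|M. (trunc n (u n x) x - \<beta> (D n x)) * \<phi> x)" if "W0 \<phi> F" "bdd_fun \<phi>" for n \<phi> F
  using eq[OF that, of n] integral_diff_mult[OF ti bi W0_measurable(1)[OF that(1)] that(2), of n n] by linarith
 have "\<exists>(r :: nat => nat) v E. strict_mono r \<and> W0 v E \<and> (AE x in M. (%n. u (r n) x) \<longlonglongrightarrow> v x) \<and> (AE x in M. (%n. D (r n) x) \<longlonglongrightarrow> E x)"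
  by (rule compact_sequence[where u=u and D=D and h="%n x. trunc n (u n x) x - \<beta> (D n x)",
     OF W R integrable_diff[OF ti bi] h2 h3])
 then obtain r :: "nat => nat" and v E where r: "strict_mono r" and E: "W0 v E"
  and uv: "AE x in M. (%n. u (r n) x) \<longlonglongrightarrow> v x" and DE: "AE x in M. (%n. D (r n) x) \<longlonglongrightarrow> E x" by blast
 have v0: "AE x in M. 0 <= v x" by (rule AE_nonneg_limit[OF u0 uv])
 note ri = rhs_integrable[OF E]
 \<comment> \<open>The sources converge in L^1. By \<open>singular_term\<close> they are at most a
   small multiple of the Hardy densities of \<open>u (r n)\<close>, whose integrals are bounded,
   plus a fixed integrable function.\<close>
 have gl: "(%n. LINT x|M. \<bar>trunc (r n) (u (r n) x) x - rhs (v x) x\<bar>) \<longlonglongrightarrow> 0"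
 proof (rule tendsto_integral_Vitali(2)[where Y="%n x. \<bar>u (r n) x\<bar> powr p / norm x powr p" and C="hardy_const * R"])
  show "(%x. \<bar>trunc (r n) (u (r n) x) x - rhs (v x) x\<bar>) \<in> borel_measurable M" for n
   by (intro borel_measurable_abs borel_measurable_diff trunc_measurable um borel_measurable_integrable[OF ri])
  show "integrable M (%x. \<bar>u (r n) x\<bar> powr p / norm x powr p)" for n by (rule W0_Hardy(1)[OF W])
  show "(LINT x|M. \<bar>u (r n) x\<bar> powr p / norm x powr p) <= hardy_const * R" for n
   by (rule order_trans[OF W0_Hardy(2)[OF W] mult_left_mono[OF R hardy_const_nonneg]])
  show "AE x in M. (%n. \<bar>trunc (r n) (u (r n) x) x - rhs (v x) x\<bar>) \<longlonglongrightarrow> 0"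
   using uv
  proof eventually_elim
   case (elim x)
   have "(%n. trunc (r n) (u (r n) x) x) \<longlonglongrightarrow> rhs (v x) x"
    unfolding trunc_def by (rule min_index_tendsto[OF rhs_tendsto[OF elim] r])
   then have "(%n. \<bar>trunc (r n) (u (r n) x) x - rhs (v x) x\<bar>) \<longlonglongrightarrow> \<bar>rhs (v x) x - rhs (v x) x\<bar>"
    by (intro tendsto_rabs tendsto_diff tendsto_const)
   then show ?case by simp
  qed
  fix d :: real assume "d > 0"
  then obtain K where K: "K \<ge> 0" "!!s x. rhs s x <= d * (\<bar>s\<bar> powr p / norm x powr p) + (K * (1 / norm x powr p) + f x)"
   using singular_term by blast
  let ?H = "%x. (K * (1 / norm x powr p) + f x) + rhs (v x) x"
  have "integrable M ?H"
   by (intro integrable_add integrable_mult_right integrable_inverse_norm_powr f_int ri)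
  moreover have "0 <= ?H x" for x using K(1) f_nonneg rhs_nonneg by simp
  moreover have "\<bar>trunc (r n) (u (r n) x) x - rhs (v x) x\<bar> <= d * (\<bar>u (r n) x\<bar> powr p / norm x powr p) + ?H x" for n x
   using K(2)[of "u (r n) x" x] trunc_bounds(1,3)[of "r n" "u (r n) x" x] rhs_nonneg[of "v x" x] by linarith
  ultimately show "\<exists>G. integrable M G \<and> (\<forall>x. 0 <= G x) \<and>
    (\<forall>n. AE x in M. \<bar>trunc (r n) (u (r n) x) x - rhs (v x) x\<bar> <= d * (\<bar>u (r n) x\<bar> powr p / norm x powr p) + G x)"
   by (intro exI[of _ ?H]) simp
 qed simp_all
 have "(LINT x|M. a (E x) \<bullet> F x) + (LINT x|M. \<beta> (E x) * \<phi> x) = (LINT x|M. rhs (v x) x * \<phi> x)" if \<phi>: "W0 \<phi> F" "bdd_fun \<phi>" for \<phi> F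
 proof (rule limit_equation(2)[where u="%n. u (r n)" and D="%n. D (r n)" and b="%n x. \<beta> (D (r n) x)"
    and ?b0.0="%x. \<beta> (E x)" and g="%n x. trunc (r n) (u (r n) x) x" and C=C and R=R and v=v])
  show "W0 (u (r n)) (D (r n))" "nrm (D (r n)) <= R" for n by (rule W, rule R)
  show "AE x in M. (%n. \<beta> (D (r n) x)) \<longlonglongrightarrow> \<beta> (E x)"
   using DE by eventually_elim (rule \<beta>_tendsto)
  show "AE x in M. 0 <= \<beta> (D (r n) x) \<and> \<beta> (D (r n) x) <= C * (a (D (r n) x) \<bullet> D (r n) x)" for n
   using \<beta>_nonneg \<beta>_le by simp
  show "(LINT x|M. a (D (r n) x) \<bullet> F x) + (LINT x|M. \<beta> (D (r n) x) * \<phi> x) = (LINT x|M. trunc (r n) (u (r n) x) x * \<phi> x)"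
   if "W0 \<phi> F" "bdd_fun \<phi>" for n \<phi> F by (rule eq[OF that])
 qed (fact E DE uv u0 C_nonneg \<phi> ti ri gl | intro \<beta>_measurable W0_measurable[OF E] W0_measurable[OF W])+
 then show ?thesis using E v0 \<beta>_integrable(1)[OF W0_Lp(2)[OF E]] by (intro exI[of _ v] exI[of _ E]) simp
qed

end

section \<open>Verification of the structural assumptions and the concluding argument\<close>

lemma lebesgue_on_AE_measurable:
 fixes g :: "real^'n::finite => 'b::euclidean_space"
 assumes "open \<Omega>" "h \<in> borel_measurable (lebesgue_on \<Omega>)" "AE x in lebesgue_on \<Omega>. h x = g x"
 shows "g \<in> borel_measurable (lebesgue_on \<Omega>)"
proof -
 have S: "\<Omega> \<in> sets lebesgue" using assms(1) by simp
 have "(%x. if x \<in> \<Omega> then h x else 0) \<in> borel_measurable lebesgue"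
  using assms(2) by (simp add: borel_measurable_if[OF S])
 moreover have "AE x in lebesgue. (if x \<in> \<Omega> then h x else 0) = (if x \<in> \<Omega> then g x else 0)"
  using assms(3) S by (auto simp: AE_restrict_space_iff elim: eventually_mono)
 ultimately have "(%x. if x \<in> \<Omega> then g x else 0) \<in> borel_measurable lebesgue" by (rule borel_measurable_AE)
 then show ?thesis by (simp add: borel_measurable_if[OF S])
qed

text \<open>Convexity of the primitive of an increasing function: between c and d the integrand lies
  on one side of S c, whichever of the two points is larger.\<close>

lemma monotone_primitive:
 fixes S :: "real => real"
 assumes "continuous_on UNIV S" "mono_on {0..} S" "0 <= c" "0 <= d"
 shows "S c * (d - c) <= integral {0..d} S - integral {0..c} S"
proof -
 have int: "S integrable_on {s..t}" for s t
  by (rule integrable_continuous_real) (rule continuous_on_subset[OF assms(1)], simp)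
 have c: "(%_. S c) integrable_on {s..t}" for s t :: real by (rule integrable_continuous_real) simp
 show ?thesis
 proof (cases "c <= d")
  case True
  have "integral {c..d} (%_. S c) <= integral {c..d} S"
   by (rule integral_le[OF c int]) (use assms in \<open>auto intro!: mono_onD[OF assms(2)]\<close>)
  moreover have "integral {0..c} S + integral {c..d} S = integral {0..d} S"
   by (rule Henstock_Kurzweil_Integration.integral_combine[OF assms(3) True int])
  ultimately show ?thesis using True by (simp add: mult.commute)
 next
  case False
  then have dc: "d <= c" by simp
  have "integral {d..c} S <= integral {d..c} (%_. S c)"
   by (rule integral_le[OF int c]) (use assms in \<open>auto intro!: mono_onD[OF assms(2)]\<close>)
  moreover have "integral {0..d} S + integral {d..c} S = integral {0..c} S"
   by (rule Henstock_Kurzweil_Integration.integral_combine[OF assms(4) dc int])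
  ultimately show ?thesis using dc by (simp add: algebra_simps)
 qed
qed

lemma primitive_norm_continuous:
 fixes S :: "real => real"
 assumes "continuous_on UNIV S"
 shows "continuous_on UNIV (%y :: real^'n::finite. integral {0..norm y} S)"
proof (rule continuous_at_imp_continuous_on, rule ballI)
 fix x :: "real^'n"
 have "continuous_on {0..norm x + 1} (%t. integral {0..t} S)"
  by (rule DERIV_continuous_on, rule integral_has_real_derivative[OF continuous_on_subset[OF assms]]) auto
 then have "continuous_on (ball 0 (norm x + 1)) (%y :: real^'n. integral {0..norm y} S)"
  by (rule continuous_on_compose2) (auto intro!: continuous_intros)
 then show "isCont (%y :: real^'n. integral {0..norm y} S) x"
  by (simp add: continuous_on_eq_continuous_at)
qed

lemma flux_continuous:
 assumes "A C1_differentiable_on {0<..}" "isCont (flux A :: real^'n::finite => real^'n) 0"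
 shows "continuous_on UNIV (flux A :: real^'n => real^'n)"
proof (rule continuous_at_imp_continuous_on, rule ballI)
 fix x :: "real^'n"
 show "isCont (flux A) x"
 proof (cases "x = 0")
  case False
  have "continuous_on (- {0}) (%y :: real^'n. A (norm y) *\<^sub>R y)"
   by (intro continuous_on_scaleR continuous_on_id continuous_on_compose2[OF C1_differentiable_imp_continuous_on[OF assms(1)]] continuous_on_norm) auto
  then have "continuous_on (- {0}) (flux A :: real^'n => real^'n)"
   by (subst continuous_on_cong[OF refl, of _ _ "%y. A (norm y) *\<^sub>R y"]) (auto simp: flux_def)
  then show ?thesis using False by (simp add: continuous_on_eq_continuous_at open_Compl)
 qed (use assms(2) in simp)
qed

theorem theorem1p2:
  fixes \<Omega> :: "(real^'n::finite) set"
    and p q K c1 c2 \<sigma> Chat :: real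
    and A B B' :: "real \<Rightarrow> real"
    and f :: "real^'n \<Rightarrow> real"
  assumes \<Omega>: "smooth_bounded_domain \<Omega>" "0 \<in> \<Omega>"
    and p: "1 < p" "p < real CARD('n)"
    and q: "p - 1 < q" "q < p"
    and A_pos: "\<And>t. t > 0 \<Longrightarrow> A t > 0"
    and A_C1: "A C1_differentiable_on {0<..}"
    and A_convention: "isCont (flux A :: real^'n \<Rightarrow> real^'n) 0"
    and A_consts: "K \<ge> 1" "c1 > 0" "c2 > 0"
    and A_mono: "mono_on {0<..} (\<lambda>t. t * A t)"
    and A_growth: "\<And>\<eta> :: real^'n. norm \<eta> \<ge> K \<Longrightarrow>
      norm (flux A \<eta>) \<le> c1 * norm \<eta> powr (p - 1)"
    and A_elliptic: "\<And>\<eta> \<eta>' :: real^'n. \<not> (\<eta> = 0 \<and> \<eta>' = 0) \<Longrightarrow>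
      (flux A \<eta> - flux A \<eta>') \<bullet> (\<eta> - \<eta>')
        \<ge> c2 * (norm \<eta> + norm \<eta>') powr (p - 2) * (norm (\<eta> - \<eta>'))\<^sup>2"
    and B_nonneg: "\<And>t. t \<ge> 0 \<Longrightarrow> B t \<ge> 0"
    and B_C1: "\<And>t. t \<ge> 0 \<Longrightarrow> (B has_real_derivative B' t) (at t within {0..})"
      "continuous_on {0..} B'"
    and B_0: "B 0 = 0"
    and B_consts: "\<sigma> > 0" "Chat > 0"
    and B_lower: "\<And>t. t \<ge> 0 \<Longrightarrow> B t \<ge> \<sigma> * t powr p"
    and B_deriv: "\<And>t. t > 0 \<Longrightarrow> B' t \<le> Chat * (t * A t)"
    and f: "f \<in> Lp 1 \<Omega>" "AE x in lebesgue_on \<Omega>. f x \<ge> 0"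
  shows "\<forall>\<theta>>0. \<exists>u. weak_solution p q \<theta> \<Omega> A B f u"
proof (intro allI impI)
 fix \<theta> :: real assume \<theta>: "\<theta> > 0"
 define e :: "real^'n" where "e = axis undefined 1"
 have e: "norm e = 1" by (simp add: e_def)
 \<comment> \<open>\<open>S t\<close> is t A(t), extended by 0 to t <= 0. Reading it off the flux
   along a unit vector transfers continuity of the flux at the origin to S.\<close>
 define S where "S t = norm (flux A (max 0 t *\<^sub>R e))" for t
 have fc: "continuous_on UNIV (flux A :: real^'n => real^'n)" by (rule flux_continuous[OF A_C1 A_convention])
 have Sc: "continuous_on UNIV S"
  unfolding S_def by (intro continuous_on_norm continuous_on_compose2[OF fc] continuous_intros) auto
 have Spos: "S t = t * A t" if "t > 0" for t
 proof -
  have "max 0 t *\<^sub>R e \<noteq> 0" using that e by auto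
  then show ?thesis using that e A_pos[OF that] by (simp add: S_def flux_def)
 qed
 have S0: "S 0 = 0" by (simp add: S_def flux_def)
 have Snn: "0 <= S t" for t by (simp add: S_def)
 have Sm: "mono_on {0..} S"
 proof (rule mono_onI)
  fix s t :: real assume st: "s \<in> {0..}" "t \<in> {0..}" "s <= t"
  show "S s <= S t"
  proof (cases "s = 0")
   case True then show ?thesis using S0 Snn by simp
  next
   case False
   then show ?thesis using st mono_onD[OF A_mono, of s t] by (simp add: Spos)
  qed
 qed
 have fS: "norm (flux A x) = S (norm x)" for x :: "real^'n"
  by (cases "x = 0") (use A_pos[of "norm x"] in \<open>auto simp: S0 Spos flux_def\<close>)
 have fx: "flux A x \<bullet> x = norm x * S (norm x)" for x :: "real^'n"
  by (cases "x = 0") (auto simp: Spos flux_def power2_norm_eq_inner[symmetric] power2_eq_square)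
 \<comment> \<open>The potential of the radial field \<open>flux A\<close>. It is convex because S
   is nonnegative and increasing.\<close>
 define \<Phi> where "\<Phi> y = integral {0..norm y} S" for y :: "real^'n"
 \<comment> \<open>For |x| >= K the growth condition supplies c1; for |x| < K monotonicity bounds
   the flux by S K.\<close>
 define Ca where "Ca = c1 + S K + 1"
 have Ca: "Ca > 0" using Snn[of K] A_consts by (simp add: Ca_def)
 have Bc: "continuous_on {0..} B" by (rule DERIV_continuous_on) (use B_C1 in auto)
 define \<beta> where "\<beta> y = B (norm y)" for y :: "real^'n"
 \<comment> \<open>f is nonnegative only almost everywhere, whereas the locale asks for
   nonnegativity at every point.\<close>
 define f' where "f' x = max 0 (f x)" for x
 have fM: "f \<in> borel_measurable (lebesgue_on \<Omega>)" "integrable (lebesgue_on \<Omega>) f"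
 proof -
  show m: "f \<in> borel_measurable (lebesgue_on \<Omega>)" using f(1) by (simp add: Lp_def)
  have "integrable (lebesgue_on \<Omega>) (%x. norm (f x))" using f(1) by (simp add: Lp_def)
  then show "integrable (lebesgue_on \<Omega>) f" by (rule integrable_norm_cancel[OF _ m])
 qed
 interpret gradient_problem \<Omega> p "flux A" \<Phi> c2 Ca \<beta> \<sigma> Chat \<theta> q f'
 proof
  show "open \<Omega>" "bounded \<Omega>" using \<Omega>(1) by (simp_all add: smooth_bounded_domain_def)
  show "1 < p" "p < real CARD('n)" by (fact p)+
  show "continuous_on UNIV (flux A :: real^'n => real^'n)" by (rule fc)
  show "continuous_on UNIV \<Phi>" unfolding \<Phi>_def by (rule primitive_norm_continuous[OF Sc])
  show "Ca > 0" "c2 > 0" by (fact Ca, fact A_consts(3))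
  show "norm (flux A x) <= Ca * (1 + norm x powr (p - 1))" for x :: "real^'n"
  proof (cases "norm x \<ge> K")
   case True
   have "norm (flux A x) <= c1 * norm x powr (p - 1)" by (rule A_growth[OF True])
   also have "... <= Ca * (1 + norm x powr (p - 1))"
    using Snn[of K] A_consts by (intro mult_mono) (auto simp: Ca_def)
   finally show ?thesis .
  next
   case False
   then have "S (norm x) <= S K" using A_consts by (intro mono_onD[OF Sm]) auto
   also have "... = S K * 1" by simp
   also have "... <= Ca * (1 + norm x powr (p - 1))"
    using Snn[of K] A_consts by (intro mult_mono) (auto simp: Ca_def)
   finally show ?thesis by (simp add: fS)
  qed
  show "c2 * (norm x + norm y) powr (p - 2) * (norm (x - y))\<^sup>2 <= (flux A x - flux A y) \<bullet> (x - y)" for x y :: "real^'n"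
  proof (cases "x = 0 \<and> y = 0")
   case False
   from A_elliptic[OF this] show ?thesis .
  qed simp
  show "flux A (0::real^'n) = 0" by (simp add: flux_def)
  show "\<Phi> 0 = 0" by (simp add: \<Phi>_def)
  show "flux A x \<bullet> (y - x) <= \<Phi> y - \<Phi> x" for x y :: "real^'n"
  proof -
   \<comment> \<open>By Cauchy-Schwarz, with equality for y = x, the subgradient inequality reduces
     to the one-dimensional one for the primitive of S.\<close>
   have "flux A x \<bullet> y <= S (norm x) * norm y" using norm_cauchy_schwarz[of "flux A x" y] by (simp add: fS)
   then have "flux A x \<bullet> (y - x) <= S (norm x) * (norm y - norm x)"
    by (simp add: inner_diff_right fx algebra_simps)
   also have "... <= \<Phi> y - \<Phi> x" unfolding \<Phi>_def by (rule monotone_primitive[OF Sc Sm]) auto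
   finally show ?thesis .
  qed
  show "continuous_on UNIV \<beta>" unfolding \<beta>_def by (intro continuous_on_compose2[OF Bc] continuous_intros) auto
  show "0 <= \<beta> y" for y unfolding \<beta>_def by (rule B_nonneg) simp
  show "\<beta> 0 = 0" by (simp add: \<beta>_def B_0)
  show "\<beta> y <= Chat * (flux A y \<bullet> y)" for y
  proof (cases "y = 0")
   case False
   \<comment> \<open>The mean value theorem gives B(|y|) = B'(t) |y| with t < |y|, and B'(t) <= Chat
     t A(t) <= Chat S(|y|) by monotonicity. Since |y| S(|y|) is the energy density, this is the
     required bound.\<close>
   have "\<exists>t\<in>{0<..<norm y}. B (norm y) - B 0 = (%h. B' t * h) (norm y - 0)"
   proof (rule mvt_simple)
    show "(B has_derivative (%h. B' t * h)) (at t within {0..norm y})" if "0 <= t" "t <= norm y" for t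
     by (rule has_derivative_subset[OF B_C1(1)[OF that(1), unfolded has_field_derivative_def]]) auto
   qed (use False in simp)
   then obtain t where t: "0 < t" "t < norm y" "B (norm y) = B' t * norm y" using B_0 by auto
   have "B' t <= Chat * S t" using B_deriv[OF t(1)] Spos[OF t(1)] by simp
   also have "... <= Chat * S (norm y)" using t B_consts by (intro mult_left_mono mono_onD[OF Sm]) auto
   finally have "B' t * norm y <= Chat * S (norm y) * norm y" by (intro mult_right_mono) auto
   then show ?thesis by (simp add: \<beta>_def t(3) fx mult_ac)
  qed (simp add: \<beta>_def B_0)
  show "0 <= Chat" "\<sigma> > 0" using B_consts by auto
  show "\<sigma> * norm y powr p <= \<beta> y" for y unfolding \<beta>_def by (rule B_lower) simp
  show "\<theta> > 0" "0 < q" "q < p" using \<theta> p q by auto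
  show "integrable (lebesgue_on \<Omega>) f'" unfolding f'_def using fM(2) by (intro integrable_max) auto
  show "0 <= f' x" for x by (simp add: f'_def)
 qed
 obtain u D where W: "W0 u D" and u0: "AE x in M. 0 <= u x" and bi: "integrable M (%x. \<beta> (D x))"
  and eq: "\<forall>\<phi> F. W0 \<phi> F \<longrightarrow> bdd_fun \<phi> \<longrightarrow>
   (LINT x|M. flux A (D x) \<bullet> F x) + (LINT x|M. \<beta> (D x) * \<phi> x) = (LINT x|M. rhs (u x) x * \<phi> x)"
  using solution_exists by blast
 have rf: "AE x in M. rhs (u x) x = \<theta> * (u x powr q / norm x powr p) + f x"
  using u0 f(2) by eventually_elim (simp add: rhs_def f'_def)
 have "norm \<in> borel_measurable M" by (rule borel_M) simp
 then have um: "(%x. u x powr q / norm x powr p) \<in> borel_measurable M"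
  using W0_measurable(1)[OF W] by (intro borel_measurable_divide powr_real_measurable borel_measurable_const)
 \<comment> \<open>Since f >= 0, the singular term is at most the integrable source divided by
   theta.\<close>
 have ui: "integrable M (%x. u x powr q / norm x powr p)"
 proof (rule integrable_bound[OF integrable_mult_right[OF rhs_integrable[OF W], of "1 / \<theta>"] um])
  show "AE x in M. norm (u x powr q / norm x powr p) <= norm (1 / \<theta> * rhs (u x) x)"
   using rf f(2)
  proof eventually_elim
   case (elim x)
   have "u x powr q / norm x powr p <= 1 / \<theta> * rhs (u x) x"
    using \<theta> elim by (simp add: field_simps)
   then show ?case using \<theta> rhs_nonneg[of "u x" x] by simp
  qed
 qed
 have "weak_solution p q \<theta> \<Omega> A B f u"
  unfolding weak_solution_def
 proof (intro conjI exI[of _ D] ballI allI impI)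
  show "u \<in> W01p p \<Omega>" using W W01p_iff by blast
  show "AE x in lebesgue_on \<Omega>. 0 <= u x" by (rule u0)
  show "has_weak_gradient \<Omega> u D" by (rule W0_has_weak_gradient[OF W])
  fix \<phi> D\<phi> assume \<phi>: "\<phi> \<in> W01p p \<Omega> \<inter> Linfty \<Omega>" and D\<phi>: "has_weak_gradient \<Omega> \<phi> D\<phi>"
  obtain F where F: "W0 \<phi> F" using \<phi> W01p_iff by blast
  have bd: "bdd_fun \<phi>" using \<phi> by (simp add: Linfty_def bdd_fun_def)
  then obtain G where G: "AE x in M. \<bar>\<phi> x\<bar> <= G" unfolding bdd_fun_def by blast
  \<comment> \<open>The weak gradient of phi in the definition of a solution is arbitrary;
    uniqueness identifies it with the L^p gradient F.\<close>
  have FD: "AE x in M. F x = D\<phi> x" by (rule weak_gradient_unique[OF W0_has_weak_gradient[OF F] D\<phi>])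
  note ai = a_integrable[OF W0_Lp(2)[OF W] W0_Lp(2)[OF F]]
  have ae: "AE x in M. flux A (D x) \<bullet> F x = flux A (D x) \<bullet> D\<phi> x" using FD by eventually_elim simp
  \<comment> \<open>An arbitrary weak gradient is by definition only locally integrable, so
    measurability on the whole domain is inherited from F through completeness of Lebesgue
    measure.\<close>
  have am: "(%x. flux A (D x) \<bullet> D\<phi> x) \<in> borel_measurable M"
   by (rule lebesgue_on_AE_measurable[OF open_domain borel_measurable_integrable[OF ai] ae])
  show "integrable M (%x. flux A (D x) \<bullet> D\<phi> x)"
   by (rule integrable_cong_AE_imp[OF ai am]) (use ae in \<open>auto elim: eventually_mono\<close>)
  have mult: "integrable M (%x. g x * \<phi> x)" if "integrable M g" for g :: "_ => real"
   using bounded_mult_integrable(1)[OF W0_measurable(1)[OF F] G that] by (simp add: mult.commute)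
  show "integrable M (%x. B (norm (D x)) * \<phi> x)" using mult[OF bi] by (simp add: \<beta>_def)
  show i1: "integrable M (%x. u x powr q / norm x powr p * \<phi> x)" by (rule mult[OF ui])
  show i2: "integrable M (%x. f x * \<phi> x)" by (rule mult[OF fM(2)])
  have "(LINT x|M. flux A (D x) \<bullet> F x) = (LINT x|M. flux A (D x) \<bullet> D\<phi> x)"
   by (rule integral_cong_AE[OF borel_measurable_integrable[OF ai] am ae])
  moreover have "(LINT x|M. rhs (u x) x * \<phi> x) = (LINT x|M. \<theta> * (u x powr q / norm x powr p * \<phi> x) + f x * \<phi> x)"
  proof (rule integral_cong_AE)
   show "AE x in M. rhs (u x) x * \<phi> x = \<theta> * (u x powr q / norm x powr p * \<phi> x) + f x * \<phi> x"
    using rf by eventually_elim (simp add: algebra_simps)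
   show "(%x. rhs (u x) x * \<phi> x) \<in> borel_measurable M" by (rule borel_measurable_integrable[OF mult[OF rhs_integrable[OF W]]])
   show "(%x. \<theta> * (u x powr q / norm x powr p * \<phi> x) + f x * \<phi> x) \<in> borel_measurable M"
    by (rule borel_measurable_integrable[OF integrable_add[OF integrable_mult_right[OF i1] i2]])
  qed
  moreover have "(LINT x|M. \<theta> * (u x powr q / norm x powr p * \<phi> x) + f x * \<phi> x) = \<theta> * (LINT x|M. u x powr q / norm x powr p * \<phi> x) + (LINT x|M. f x * \<phi> x)"
   unfolding integral_add[OF integrable_mult_right[OF i1] i2] by (simp only: integral_mult_right_zero)
  ultimately show "(LINT x|M. flux A (D x) \<bullet> D\<phi> x) + (LINT x|M. B (norm (D x)) * \<phi> x) =
    \<theta> * (LINT x|M. u x powr q / norm x powr p * \<phi> x) + (LINT x|M. f x * \<phi> x)"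
   using eq[rule_format, OF F bd] unfolding \<beta>_def by simp
 qed
 then show "\<exists>u. weak_solution p q \<theta> \<Omega> A B f u" by blast
qed

end
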